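(* Let $k$ be a commutative ring. Let $\mathrm{Sh}: k\text{-CAlg}\to \mathrm{Set}$ be a sheaf of sets, and let $s$ be a functorial simplicial frame preserving finite limits, given both on $k\text{-CAlg}$ ($s: k\text{-CAlg}\to \mathrm{s}k\text{-CAlg}$) and on $\mathrm{Set}$ ($s:\mathrm{Set}\to\mathrm{Set}_\Delta$). Let $\mathrm{dSt}:\mathrm{s}k\text{-CAlg}\to\mathrm{Set}_\Delta$ be a functor making the square commute, i.e. $\mathrm{dSt}\circ s = s\circ \mathrm{Sh}$ as functors $k\text{-CAlg}\to\mathrm{Set}_\Delta$. Then $\mathrm{dSt}$ is a derived stack, in the following sense: (1) for all $A,B\in k\text{-CAlg}$ and any equivalence $s(A)\to s(B)$ in $\mathrm{s}k\text{-CAlg}$, the induced morphism $\mathrm{dSt}(sA)\to\mathrm{dSt}(sB)$ is an equivalence in $\mathrm{Set}_\Delta$; (2) for any coaugmented cosimplicial object $s(A)\to s(B_* )$ in $\mathrm{s}k\text{-CAlg}$ (with $A\in k\text{-CAlg}$ and $B_*$ a cosimplicial object of $k\text{-CAlg}$) corresponding to an étale hypercovering $\mathrm{Spec}\,s(B_* )\to\mathrm{Spec}\,s(A)$ in $\mathrm{d}k\text{-Aff}=\mathrm{s}k\text{-CAlg}^{\mathrm{op}}$, the induced morphism $\mathrm{dSt}(sA)\to\mathrm{holim}_{n\in\Delta}\mathrm{dSt}(sB_n)$ is an equivalence in $\mathrm{Set}_\Delta$; (3) for any finite family $\{A_i\}$ in $k\text{-CAlg}$, the natural morphism $\mathrm{dSt}(\prod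 sA_i)\to\prod\mathrm{dSt}(sA_i)$ is an equivalence in $\mathrm{Set}_\Delta$.
   Context: Categories. $k\text{-CAlg}$ is the category of commutative $k$-algebras, $\mathrm{s}k\text{-CAlg}=(k\text{-CAlg})^{\Delta^{\mathrm{op}}}$ the category of simplicial commutative $k$-algebras, $\mathrm{Set}_\Delta$ the category of simplicial sets, $k\text{-Aff}=k\text{-CAlg}^{\mathrm{op}}$, $\mathrm{d}k\text{-Aff}=\mathrm{s}k\text{-CAlg}^{\mathrm{op}}$, and $\mathrm{Spec}\,A$ denotes the object of the opposite category corresponding to an algebra $A$. $\mathrm{s}k\text{-Aff}$ and $\mathrm{sd}k\text{-Aff}$ are the categories of simplicial objects in $k\text{-Aff}$ and $\mathrm{d}k\text{-Aff}$. $k\text{-CAlg}$ and $\mathrm{Set}$ carry the trivial model structure (equivalences are isomorphisms). Equivalences in $\mathrm{Set}_\Delta$ are weak homotopy equivalences; equivalences in $\mathrm{s}k\text{-CAlg}$ are the maps that are weak equivalences of underlying simplicial sets (its standard model structure, giving the opposite one on $\mathrm{d}k\text{-Aff}$), and $\mathrm{sd}k\text{-Aff}$, $\mathrm{s}k\text{-Aff}$ carry the Reedy (levelwise equivalence) structures. Sets are regarded as constant simplicial sets. Functorial simplicial frames. $cs_*$ is the constant simplicial object functor. For $\mathcal{C}=k\text{-CAlg}$ or $\mathrm{Set}$, a simplicial frame on $A\in\mathcal{C}$ is a simplicial object $\hat A\in\mathcal{C}^{\Delta^{\mathrm{op}}}$ with an equivalence $cs_*A\to\hat A$ in the Reedy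 model structure on $\mathcal{C}^{\Delta^{\mathrm{op}}}$ (a levelwise equivalence in $\mathcal{C}$) such that $A\to\hat A_0$ is an isomorphism and, if $A$ is fibrant, $\hat A$ is Reedy fibrant. A functorial simplicial frame on $\mathcal{C}$ is a pair $(G,j)$ of a functor $G:\mathcal{C}\to\mathcal{C}^{\Delta^{\mathrm{op}}}$ and a natural transformation $j: cs_*\Rightarrow G$ such that each $j_A:cs_*A\to G(A)$ is a simplicial frame on $A$; one refers to $G$ itself as the frame. For a cosimplicial object $B_*$ of $k\text{-CAlg}$, $s(B_* )$ is the cosimplicial object $[n]\mapsto s(B_n)$ of $\mathrm{s}k\text{-CAlg}$. (The paper calls $\mathrm{Sh}$, $s$, $\mathrm{dSt}$ "motifs", i.e. variables ranging over all such sheaves, frames and functors; the theorem is thus asserted for every choice.) Étale coverings. A finite family $\{A\to B_i\}_{i\in I}$ in $\mathrm{s}k\text{-CAlg}$ is an étale covering (of $\mathrm{Spec}\,A$ in $\mathrm{d}k\text{-Aff}$) if there is a finite subset $J\subset I$ with $\coprod_{j\in J}\mathrm{Spec}\,\pi_0(B_j)\to\mathrm{Spec}\,\pi_0(A)$ étale and surjective, and for all $i\in I$ the map $\pi_*(A)\otimes_{\pi_0(A)}\pi_0(B_i)\to\pi_*(B_i)$ is an isomorphism. A family $\{\mathrm{Spec}\,A_i\to\mathrm{Spec}\,A\}_{i\in I}$ in $k\text{-Aff}$ is an étale covering if there is a finite $J\subset I$ with $\coprod_{j\in J}\mathrm{Spec}\,A_j\to\mathrm{Spec}\,A$ faithfully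 flat and étale. Hypercoverings. For a simplicial set $K$ and $X_*\in\mathrm{sd}k\text{-Aff}$ (resp. $\mathrm{s}k\text{-Aff}$), $X_*^{\mathbb{R}K}=\big((RX_* )^{\underline{K}}\big)_0$, where $R$ is Reedy fibrant replacement, $(-)^{\underline{K}}$ is the cotensor by $K$ of the simplicial category of simplicial objects, and $(-)_0$ is the degree zero component. An object $Y$ of $\mathrm{d}k\text{-Aff}$ (resp. $k\text{-Aff}$) is regarded as a constant simplicial object. An étale hypercovering of $Y$ is a morphism $X_*\to Y$ of simplicial objects (in the homotopy category) such that for all $n\ge0$ the map $X_*^{\mathbb{R}\Delta^n}\to X_*^{\mathbb{R}\partial\Delta^n}\times^h_{Y^{\mathbb{R}\partial\Delta^n}}Y^{\mathbb{R}\Delta^n}$ is an étale covering in $\mathrm{Ho}(\mathrm{d}k\text{-Aff})$ (resp. $\mathrm{Ho}(k\text{-Aff})$), where $\times^h$ is the homotopy fiber product. A coaugmented cosimplicial object $A\to B_*$ of algebras corresponds to the augmented simplicial object $\mathrm{Spec}\,B_*\to\mathrm{Spec}\,A$. Sheaves. A functor $F:k\text{-CAlg}\to\mathrm{Set}$ is a sheaf if, regarding sets as constant simplicial sets: (i) $F$ sends equivalences in $k\text{-CAlg}$ to equivalences in $\mathrm{Set}_\Delta$; (ii) for any finite family $\{A_i\}$ in $k\text{-CAlg}$, $F(\prod A_i)\to\prod F(A_i)$ is an equivalence; (iii) for any coaugmented cosimplicial object $A\to B_*$ in $k\text{-CAlg}$ corresponding to an étale hypercovering $\mathrm{Spec}\,B_*\to\mathrm{Spec}\,A$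 in $k\text{-Aff}$, $F(A)\to\mathrm{holim}_{n\in\Delta}F(B_n)$ is an equivalence in $\mathrm{Set}_\Delta$. *)

theory Defs
  imports
    "HOL-Homology.Simplices"
    "HOL-Algebra.Module"
    "HOL-Algebra.QuotRing"
    "HOL-Algebra.Generated_Groups"
    "HOL-Library.Infinite_Typeclass"
begin

section \<open>Categories, functors, limits\<close>

record ('o, 'm) category =
  Ob :: "'o set"
  Arr :: "'m set"
  Dom :: "'m \<Rightarrow> 'o"
  Cod :: "'m \<Rightarrow> 'o"
  Ident :: "'o \<Rightarrow> 'm"
  Comp :: "'m \<Rightarrow> 'm \<Rightarrow> 'm"  (infixl \<open>\<cdot>\<index>\<close> 70)

definition Hom :: "('o, 'm, 'z) category_scheme \<Rightarrow> 'o \<Rightarrow> 'o \<Rightarrow> 'm set" where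
  "Hom C a b = {f \<in> Arr C. Dom C f = a \<and> Cod C f = b}"

definition is_category :: "('o, 'm, 'z) category_scheme \<Rightarrow> bool" where
  "is_category C \<longleftrightarrow>
     (\<forall>f\<in>Arr C. Dom C f \<in> Ob C \<and> Cod C f \<in> Ob C) \<and>
     (\<forall>a\<in>Ob C. Ident C a \<in> Hom C a a) \<and>
     (\<forall>a b c f g. f \<in> Hom C a b \<and> g \<in> Hom C b c \<longrightarrow> g \<cdot>\<^bsub>C\<^esub> f \<in> Hom C a c) \<and>
     (\<forall>a b. \<forall>f\<in>Hom C a b. f \<cdot>\<^bsub>C\<^esub> Ident C a = f \<and> Ident C b \<cdot>\<^bsub>C\<^esub> f = f) \<and>
     (\<forall>a b c d f g h. f \<in> Hom C a b \<and> g \<in> Hom C b c \<and> h \<in> Hom C c d \<longrightarrow>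
        h \<cdot>\<^bsub>C\<^esub> (g \<cdot>\<^bsub>C\<^esub> f) = h \<cdot>\<^bsub>C\<^esub> g \<cdot>\<^bsub>C\<^esub> f)"

definition is_iso :: "('o, 'm, 'z) category_scheme \<Rightarrow> 'm \<Rightarrow> bool" where
  "is_iso C f \<longleftrightarrow> f \<in> Arr C \<and>
     (\<exists>g\<in>Hom C (Cod C f) (Dom C f). g \<cdot>\<^bsub>C\<^esub> f = Ident C (Dom C f) \<and> f \<cdot>\<^bsub>C\<^esub> g = Ident C (Cod C f))"

text \<open>A functor carries only its values (it does not record source and target) and is undefined
  outside its source; in particular a functor \<open>J \<rightarrow> C\<close> and the corresponding functor between the
  opposite categories are the same datum.\<close>

record ('j, 'n, 'o, 'm) fctr =
  omap :: "'j \<Rightarrow> 'o"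
  amap :: "'n \<Rightarrow> 'm"

definition is_functor ::
  "('j, 'n, 'y) category_scheme \<Rightarrow> ('o, 'm, 'z) category_scheme \<Rightarrow> ('j, 'n, 'o, 'm) fctr \<Rightarrow> bool" where
  "is_functor J C F \<longleftrightarrow>
     omap F \<in> extensional (Ob J) \<and> amap F \<in> extensional (Arr J) \<and>
     (\<forall>j\<in>Ob J. omap F j \<in> Ob C) \<and>
     (\<forall>a b. \<forall>f\<in>Hom J a b. amap F f \<in> Hom C (omap F a) (omap F b)) \<and>
     (\<forall>j\<in>Ob J. amap F (Ident J j) = Ident C (omap F j)) \<and>
     (\<forall>a b c f g. f \<in> Hom J a b \<and> g \<in> Hom J b c \<longrightarrow>
        amap F (g \<cdot>\<^bsub>J\<^esub> f) = amap F g \<cdot>\<^bsub>C\<^esub> amap F f)"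

definition fctr_comp ::
  "('j, 'n, 'y) category_scheme \<Rightarrow> ('o, 'm, 'p, 'q) fctr \<Rightarrow> ('j, 'n, 'o, 'm) fctr \<Rightarrow> ('j, 'n, 'p, 'q) fctr"
  where "fctr_comp J G F = \<lparr>omap = (\<lambda>j\<in>Ob J. omap G (omap F j)), amap = (\<lambda>f\<in>Arr J. amap G (amap F f))\<rparr>"

definition const_fctr ::
  "('j, 'n, 'y) category_scheme \<Rightarrow> ('o, 'm, 'z) category_scheme \<Rightarrow> 'o \<Rightarrow> ('j, 'n, 'o, 'm) fctr" where
  "const_fctr J C c = \<lparr>omap = (\<lambda>j\<in>Ob J. c), amap = (\<lambda>f\<in>Arr J. Ident C c)\<rparr>"

definition nat_trans ::
  "('j, 'n, 'y) category_scheme \<Rightarrow> ('o, 'm, 'z) category_scheme \<Rightarrow>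
   ('j, 'n, 'o, 'm) fctr \<Rightarrow> ('j, 'n, 'o, 'm) fctr \<Rightarrow> ('j \<Rightarrow> 'm) \<Rightarrow> bool" where
  "nat_trans J C F G \<eta> \<longleftrightarrow>
     (\<forall>j\<in>Ob J. \<eta> j \<in> Hom C (omap F j) (omap G j)) \<and>
     (\<forall>a b. \<forall>f\<in>Hom J a b. \<eta> b \<cdot>\<^bsub>C\<^esub> amap F f = amap G f \<cdot>\<^bsub>C\<^esub> \<eta> a)"

text \<open>Morphisms in all concrete categories below are triples (source, underlying data, target).\<close>

abbreviation mid :: "'a \<times> 'b \<times> 'c \<Rightarrow> 'b" where
  "mid t \<equiv> fst (snd t)"

definition fun_cat ::
  "('j, 'n, 'y) category_scheme \<Rightarrow> ('o, 'm, 'z) category_scheme \<Rightarrow>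
   (('j, 'n, 'o, 'm) fctr, ('j, 'n, 'o, 'm) fctr \<times> ('j \<Rightarrow> 'm) \<times> ('j, 'n, 'o, 'm) fctr) category" where
  "fun_cat J C =
    \<lparr>Ob = {F. is_functor J C F},
     Arr = {(F, \<eta>, G). is_functor J C F \<and> is_functor J C G \<and> nat_trans J C F G \<eta> \<and> \<eta> \<in> extensional (Ob J)},
     Dom = fst,
     Cod = (\<lambda>t. snd (snd t)),
     Ident = (\<lambda>F. (F, \<lambda>j\<in>Ob J. Ident C (omap F j), F)),
     Comp = (\<lambda>s t. (fst t, \<lambda>j\<in>Ob J. mid s j \<cdot>\<^bsub>C\<^esub> mid t j, snd (snd s)))\<rparr>"

definition op_cat :: "('o, 'm, 'z) category_scheme \<Rightarrow> ('o, 'm) category" where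
  "op_cat C = \<lparr>Ob = Ob C, Arr = Arr C, Dom = Cod C, Cod = Dom C, Ident = Ident C, Comp = (\<lambda>g f. f \<cdot>\<^bsub>C\<^esub> g)\<rparr>"

definition is_cone ::
  "('j, 'n, 'y) category_scheme \<Rightarrow> ('o, 'm, 'z) category_scheme \<Rightarrow> ('j, 'n, 'o, 'm) fctr \<Rightarrow>
   'o \<Rightarrow> ('j \<Rightarrow> 'm) \<Rightarrow> bool" where
  "is_cone J C D L l \<longleftrightarrow> L \<in> Ob C \<and> nat_trans J C (const_fctr J C L) D l"

definition is_limit ::
  "('j, 'n, 'y) category_scheme \<Rightarrow> ('o, 'm, 'z) category_scheme \<Rightarrow> ('j, 'n, 'o, 'm) fctr \<Rightarrow>
   'o \<Rightarrow> ('j \<Rightarrow> 'm) \<Rightarrow> bool" where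
  "is_limit J C D L l \<longleftrightarrow> is_cone J C D L l \<and>
     (\<forall>L' l'. is_cone J C D L' l' \<longrightarrow> (\<exists>!h. h \<in> Hom C L' L \<and> (\<forall>j\<in>Ob J. l j \<cdot>\<^bsub>C\<^esub> h = l' j)))"

text \<open>Every finite category is isomorphic to one whose objects and arrows are natural numbers.\<close>

definition preserves_finite_limits ::
  "('o, 'm, 'y) category_scheme \<Rightarrow> ('p, 'q, 'z) category_scheme \<Rightarrow> ('o, 'm, 'p, 'q) fctr \<Rightarrow> bool" where
  "preserves_finite_limits C D G \<longleftrightarrow>
     (\<forall>(J :: (nat, nat) category) F L l.
        is_category J \<and> finite (Ob J) \<and> finite (Arr J) \<and> is_functor J C F \<and> is_limit J C F L l \<longrightarrow>
        is_limit J D (fctr_comp J G F) (omap G L) (\<lambda>j. amap G (l j)))"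

definition is_terminal :: "('o, 'm, 'z) category_scheme \<Rightarrow> 'o \<Rightarrow> bool" where
  "is_terminal C T \<longleftrightarrow> T \<in> Ob C \<and> (\<forall>X\<in>Ob C. \<exists>!h. h \<in> Hom C X T)"

definition is_product ::
  "('o, 'm, 'z) category_scheme \<Rightarrow> 'i set \<Rightarrow> ('i \<Rightarrow> 'o) \<Rightarrow> 'o \<Rightarrow> ('i \<Rightarrow> 'm) \<Rightarrow> bool" where
  "is_product C I A P p \<longleftrightarrow> P \<in> Ob C \<and> (\<forall>i\<in>I. p i \<in> Hom C P (A i)) \<and>
     (\<forall>X\<in>Ob C. \<forall>f. (\<forall>i\<in>I. f i \<in> Hom C X (A i)) \<longrightarrow>
        (\<exists>!h. h \<in> Hom C X P \<and> (\<forall>i\<in>I. p i \<cdot>\<^bsub>C\<^esub> h = f i)))"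

definition is_pullback ::
  "('o, 'm, 'z) category_scheme \<Rightarrow> 'm \<Rightarrow> 'm \<Rightarrow> 'o \<Rightarrow> 'm \<Rightarrow> 'm \<Rightarrow> bool" where
  "is_pullback C f g P p q \<longleftrightarrow>
     p \<in> Hom C P (Dom C f) \<and> q \<in> Hom C P (Dom C g) \<and> f \<cdot>\<^bsub>C\<^esub> p = g \<cdot>\<^bsub>C\<^esub> q \<and>
     (\<forall>X\<in>Ob C. \<forall>a\<in>Hom C X (Dom C f). \<forall>b\<in>Hom C X (Dom C g). f \<cdot>\<^bsub>C\<^esub> a = g \<cdot>\<^bsub>C\<^esub> b \<longrightarrow>
        (\<exists>!h. h \<in> Hom C X P \<and> p \<cdot>\<^bsub>C\<^esub> h = a \<and> q \<cdot>\<^bsub>C\<^esub> h = b))"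


section \<open>Simplicial objects and simplicial sets\<close>

type_synonym darr = "nat \<times> (nat \<Rightarrow> nat) \<times> nat"

text \<open>The object \<open>n\<close> of the simplex category is the ordered set \<open>{0, \<dots>, n}\<close>.\<close>

definition delta :: "(nat, darr) category" where
  "delta =
    \<lparr>Ob = UNIV,
     Arr = {(m, f, n). f \<in> {..m} \<rightarrow>\<^sub>E {..n} \<and> mono_on {..m} f},
     Dom = fst,
     Cod = (\<lambda>t. snd (snd t)),
     Ident = (\<lambda>n. (n, \<lambda>i\<in>{..n}. i, n)),
     Comp = (\<lambda>s t. (fst t, compose {..fst t} (mid s) (mid t), snd (snd s)))\<rparr>"

type_synonym ('o, 'm) sobj = "(nat, darr, 'o, 'm) fctr"
type_synonym ('o, 'm) sarr = "('o, 'm) sobj \<times> (nat \<Rightarrow> 'm) \<times> ('o, 'm) sobj"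

abbreviation simp_cat ::
  "('o, 'm, 'z) category_scheme \<Rightarrow> (('o, 'm) sobj, ('o, 'm) sarr) category" where
  "simp_cat C \<equiv> fun_cat (op_cat delta) C"

definition cs :: "('o, 'm, 'z) category_scheme \<Rightarrow> ('o, 'm, ('o, 'm) sobj, ('o, 'm) sarr) fctr" where
  "cs C =
    \<lparr>omap = (\<lambda>c\<in>Ob C. const_fctr (op_cat delta) C c),
     amap = (\<lambda>f\<in>Arr C. (const_fctr (op_cat delta) C (Dom C f), \<lambda>n\<in>UNIV. f,
                          const_fctr (op_cat delta) C (Cod C f)))\<rparr>"

type_synonym 'a set_arr = "'a set \<times> ('a \<Rightarrow> 'a) \<times> 'a set"
type_synonym 'a sset = "('a set, 'a set_arr) sobj"
type_synonym 'a sset_arr = "('a set, 'a set_arr) sarr"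

text \<open>As with algebras below, the sets and simplicial sets of a fixed universe are those with
  elements in a fixed type.\<close>

definition set_cat :: "('a set, 'a set_arr) category" where
  "set_cat =
    \<lparr>Ob = UNIV,
     Arr = {(A, f, B). f \<in> A \<rightarrow>\<^sub>E B},
     Dom = fst,
     Cod = (\<lambda>t. snd (snd t)),
     Ident = (\<lambda>A. (A, \<lambda>x\<in>A. x, A)),
     Comp = (\<lambda>s t. (fst t, compose (fst t) (mid s) (mid t), snd (snd s)))\<rparr>"

abbreviation sset_cat :: "('a sset, 'a sset_arr) category" where
  "sset_cat \<equiv> simp_cat set_cat"

abbreviation act :: "'a sset \<Rightarrow> darr \<Rightarrow> 'a \<Rightarrow> 'a" where
  "act X \<theta> \<equiv> mid (amap X \<theta>)"

text \<open>The simplicial set with given simplices and given action of the arrows of \<^const>\<open>delta\<close>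
  (an arrow \<open>m \<rightarrow> n\<close> maps \<open>n\<close>-simplices to \<open>m\<close>-simplices).\<close>

definition mk_sset :: "(nat \<Rightarrow> 'a set) \<Rightarrow> (darr \<Rightarrow> 'a \<Rightarrow> 'a) \<Rightarrow> 'a sset" where
  "mk_sset S r =
    \<lparr>omap = S,
     amap = (\<lambda>\<theta>\<in>Arr delta. (S (Cod delta \<theta>), \<lambda>x\<in>S (Cod delta \<theta>). r \<theta> x, S (Dom delta \<theta>)))\<rparr>"

text \<open>Maps of simplicial sets whose simplices may live in different types.\<close>

definition sset_map :: "'a sset \<Rightarrow> 'b sset \<Rightarrow> (nat \<Rightarrow> 'a \<Rightarrow> 'b) \<Rightarrow> bool" where
  "sset_map X Y f \<longleftrightarrow>
     (\<forall>n. \<forall>x\<in>omap X n. f n x \<in> omap Y n) \<and>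
     (\<forall>m n. \<forall>\<theta>\<in>Hom delta m n. \<forall>x\<in>omap X n. f m (act X \<theta> x) = act Y \<theta> (f n x))"

definition std :: "nat \<Rightarrow> darr sset" where
  "std n = mk_sset (\<lambda>m. Hom delta m n) (\<lambda>\<theta> \<tau>. \<tau> \<cdot>\<^bsub>delta\<^esub> \<theta>)"

definition bdry :: "nat \<Rightarrow> darr sset" where
  "bdry n = mk_sset (\<lambda>m. {\<tau> \<in> Hom delta m n. mid \<tau> ` {..m} \<noteq> {..n}}) (\<lambda>\<theta> \<tau>. \<tau> \<cdot>\<^bsub>delta\<^esub> \<theta>)"

definition horn :: "nat \<Rightarrow> nat \<Rightarrow> darr sset" where
  "horn n k = mk_sset (\<lambda>m. {\<tau> \<in> Hom delta m n. \<exists>i\<le>n. i \<noteq> k \<and> i \<notin> mid \<tau> ` {..m}}) (\<lambda>\<theta> \<tau>. \<tau> \<cdot>\<^bsub>delta\<^esub> \<theta>)"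

definition sset_times :: "'a sset \<Rightarrow> 'b sset \<Rightarrow> ('a \<times> 'b) sset" where
  "sset_times X Y = mk_sset (\<lambda>n. omap X n \<times> omap Y n) (\<lambda>\<theta> (x, y). (act X \<theta> x, act Y \<theta> y))"

definition sset_prod :: "'i set \<Rightarrow> ('i \<Rightarrow> 'a sset) \<Rightarrow> ('i \<Rightarrow> 'a) sset" where
  "sset_prod I Y = mk_sset (\<lambda>n. \<Pi>\<^sub>E i\<in>I. omap (Y i) n) (\<lambda>\<theta> x. \<lambda>i\<in>I. act (Y i) \<theta> (x i))"

definition kan_fib :: "'a sset \<Rightarrow> 'b sset \<Rightarrow> (nat \<Rightarrow> 'a \<Rightarrow> 'b) \<Rightarrow> bool" where
  "kan_fib X Y p \<longleftrightarrow> sset_map X Y p \<and>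
     (\<forall>n\<ge>1. \<forall>k\<le>n. \<forall>u v.
        sset_map (horn n k) X u \<and> sset_map (std n) Y v \<and>
        (\<forall>m. \<forall>\<tau>\<in>omap (horn n k) m. p m (u m \<tau>) = v m \<tau>) \<longrightarrow>
        (\<exists>w. sset_map (std n) X w \<and>
             (\<forall>m. \<forall>\<tau>\<in>omap (horn n k) m. w m \<tau> = u m \<tau>) \<and>
             (\<forall>m. \<forall>\<tau>\<in>omap (std n) m. p m (w m \<tau>) = v m \<tau>)))"

definition kan_complex :: "'a sset \<Rightarrow> bool" where
  "kan_complex X \<longleftrightarrow> kan_fib X (mk_sset (\<lambda>_. {()}) (\<lambda>_ x. x)) (\<lambda>_ _. ())"


section \<open>Weak homotopy equivalences\<close>

definition cube :: "nat \<Rightarrow> (nat \<Rightarrow> real) topology" where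
  "cube n = product_topology (\<lambda>_. top_of_set {0..1}) {..<n}"

definition cube_bdry :: "nat \<Rightarrow> (nat \<Rightarrow> real) set" where
  "cube_bdry n = {t \<in> topspace (cube n). \<exists>i<n. t i = 0 \<or> t i = 1}"

definition spheroids :: "nat \<Rightarrow> 'a topology \<Rightarrow> 'a \<Rightarrow> ((nat \<Rightarrow> real) \<Rightarrow> 'a) set" where
  "spheroids n X x = {g. continuous_map (cube n) X g \<and> g ` cube_bdry n \<subseteq> {x}}"

definition homotopic_rel :: "nat \<Rightarrow> 'a topology \<Rightarrow> 'a \<Rightarrow> ((nat \<Rightarrow> real) \<Rightarrow> 'a) \<Rightarrow> ((nat \<Rightarrow> real) \<Rightarrow> 'a) \<Rightarrow> bool" where
  "homotopic_rel n X x g h \<longleftrightarrow> homotopic_with (\<lambda>e. e ` cube_bdry n \<subseteq> {x}) (cube n) X g h"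

text \<open>Bijectivity on path components and on all homotopy groups \<open>\<pi>\<^sub>n(X, x)\<close>, whose elements are
  the homotopy classes of maps of pairs from the \<open>n\<close>-cube and its boundary to \<open>(X, x)\<close>.\<close>

definition weak_homotopy_equiv :: "'a topology \<Rightarrow> 'b topology \<Rightarrow> ('a \<Rightarrow> 'b) \<Rightarrow> bool" where
  "weak_homotopy_equiv X Y f \<longleftrightarrow> continuous_map X Y f \<and>
     (\<forall>y\<in>topspace Y. \<exists>x\<in>topspace X. path_component_of Y (f x) y) \<and>
     (\<forall>x\<in>topspace X. \<forall>x'\<in>topspace X. path_component_of Y (f x) (f x') \<longrightarrow> path_component_of X x x') \<and>
     (\<forall>n\<ge>1. \<forall>x\<in>topspace X.
        (\<forall>h\<in>spheroids n Y (f x). \<exists>g\<in>spheroids n X x. homotopic_rel n Y (f x) (f \<circ> g) h) \<and>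
        (\<forall>g\<in>spheroids n X x. \<forall>g'\<in>spheroids n X x.
           homotopic_rel n Y (f x) (f \<circ> g) (f \<circ> g') \<longrightarrow> homotopic_rel n X x g g'))"

text \<open>The geometric realization is the quotient of the disjoint union of the \<open>{x} \<times> \<Delta>\<^sup>n\<close>,
  \<open>x\<close> an \<open>n\<close>-simplex, by the equivalence relation generated by \<open>(x, \<theta>\<^sub>* t) \<sim> (\<theta>\<^sup>* x, t)\<close>; its points
  are equivalence classes, with the quotient topology.\<close>

definition push :: "darr \<Rightarrow> (nat \<Rightarrow> real) \<Rightarrow> nat \<Rightarrow> real" where
  "push \<theta> t = (\<lambda>i. \<Sum>j | j \<le> Dom delta \<theta> \<and> mid \<theta> j = i. t j)"

definition glue :: "'a sset \<Rightarrow> ((nat \<times> 'a \<times> (nat \<Rightarrow> real)) \<times> (nat \<times> 'a \<times> (nat \<Rightarrow> real))) set" where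
  "glue X = {((n, x, push \<theta> t), (m, act X \<theta> x, t)) | m n \<theta> x t.
      \<theta> \<in> Hom delta m n \<and> x \<in> omap X n \<and> t \<in> standard_simplex m}"

definition rcls :: "'a sset \<Rightarrow> nat \<times> 'a \<times> (nat \<Rightarrow> real) \<Rightarrow> (nat \<times> 'a \<times> (nat \<Rightarrow> real)) set" where
  "rcls X p = (glue X \<union> (glue X)\<inverse>)\<^sup>* `` {p}"

definition realization :: "'a sset \<Rightarrow> (nat \<times> 'a \<times> (nat \<Rightarrow> real)) set topology" where
  "realization X = topology (\<lambda>U.
     U \<subseteq> rcls X ` {(n, x, t). x \<in> omap X n \<and> t \<in> standard_simplex n} \<and>
     (\<forall>n. \<forall>x\<in>omap X n. openin (subtopology (powertop_real UNIV) (standard_simplex n))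
        {t \<in> standard_simplex n. rcls X (n, x, t) \<in> U}))"

definition realization_map ::
  "'b sset \<Rightarrow> (nat \<Rightarrow> 'a \<Rightarrow> 'b) \<Rightarrow> (nat \<times> 'a \<times> (nat \<Rightarrow> real)) set \<Rightarrow> (nat \<times> 'b \<times> (nat \<Rightarrow> real)) set" where
  "realization_map Y f c = (\<Union>(n, x, t)\<in>c. rcls Y (n, f n x, t))"

definition sset_weq :: "'a sset \<Rightarrow> 'b sset \<Rightarrow> (nat \<Rightarrow> 'a \<Rightarrow> 'b) \<Rightarrow> bool" where
  "sset_weq X Y f \<longleftrightarrow> sset_map X Y f \<and>
     weak_homotopy_equiv (realization X) (realization Y) (realization_map Y f)"

definition sset_equivs :: "'a sset_arr set" where
  "sset_equivs = {e \<in> Arr sset_cat. sset_weq (fst e) (snd (snd e)) (\<lambda>n. mid (mid e n))}"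


section \<open>Homotopy limits of simplicial sets\<close>

definition over_cat :: "('j, 'n, 'z) category_scheme \<Rightarrow> 'j \<Rightarrow> ('n, 'n \<times> 'n \<times> 'n) category" where
  "over_cat J j =
    \<lparr>Ob = {a \<in> Arr J. Cod J a = j},
     Arr = {(a, u, b). a \<in> Arr J \<and> Cod J a = j \<and> b \<in> Arr J \<and> Cod J b = j \<and>
              u \<in> Hom J (Dom J a) (Dom J b) \<and> b \<cdot>\<^bsub>J\<^esub> u = a},
     Dom = fst,
     Cod = (\<lambda>t. snd (snd t)),
     Ident = (\<lambda>a. (a, Ident J (Dom J a), a)),
     Comp = (\<lambda>s t. (fst t, mid s \<cdot>\<^bsub>J\<^esub> mid t, snd (snd s)))\<rparr>"

definition ordinal_cat :: "nat \<Rightarrow> (nat, nat \<times> nat) category" where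
  "ordinal_cat p =
    \<lparr>Ob = {..p}, Arr = {(i, j). i \<le> j \<and> j \<le> p}, Dom = fst, Cod = snd,
     Ident = (\<lambda>i. (i, i)), Comp = (\<lambda>s t. (fst t, snd s))\<rparr>"

definition nerve :: "('o, 'm, 'z) category_scheme \<Rightarrow> (nat, nat \<times> nat, 'o, 'm) fctr sset" where
  "nerve C = mk_sset (\<lambda>p. {\<sigma>. is_functor (ordinal_cat p) C \<sigma>})
     (\<lambda>\<theta> \<sigma>. fctr_comp (ordinal_cat (Dom delta \<theta>)) \<sigma>
        \<lparr>omap = mid \<theta>, amap = (\<lambda>(i, j). (mid \<theta> i, mid \<theta> j))\<rparr>)"

definition over_push ::
  "('j, 'n, 'z) category_scheme \<Rightarrow> 'n \<Rightarrow> ('n, 'n \<times> 'n \<times> 'n, 'n, 'n \<times> 'n \<times> 'n) fctr" where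
  "over_push J u = \<lparr>omap = (\<lambda>a. u \<cdot>\<^bsub>J\<^esub> a), amap = (\<lambda>(a, v, b). (u \<cdot>\<^bsub>J\<^esub> a, v, u \<cdot>\<^bsub>J\<^esub> b))\<rparr>"

type_synonym ('j, 'n, 'a) holim_simplex =
  "'j \<Rightarrow> nat \<Rightarrow> (nat, nat \<times> nat, 'n, 'n \<times> 'n \<times> 'n) fctr \<times> darr \<Rightarrow> 'a"

text \<open>The Bousfield--Kan formula: the \<open>m\<close>-simplices of the homotopy limit of an objectwise Kan
  diagram \<open>Y\<close> are the natural transformations \<open>N(J/-) \<times> \<Delta>\<^sup>m \<rightarrow> Y\<close> of diagrams of simplicial sets.\<close>

definition bk_holim ::
  "('j, 'n, 'z) category_scheme \<Rightarrow> ('j, 'n, 'a sset, 'a sset_arr) fctr \<Rightarrow> ('j, 'n, 'a) holim_simplex sset" where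
  "bk_holim J Y = mk_sset
     (\<lambda>m. {\<phi> \<in> extensional (Ob J).
        (\<forall>j\<in>Ob J.
           (\<forall>p. \<phi> j p \<in> extensional (omap (sset_times (nerve (over_cat J j)) (std m)) p)) \<and>
           sset_map (sset_times (nerve (over_cat J j)) (std m)) (omap Y j) (\<phi> j)) \<and>
        (\<forall>i j. \<forall>u\<in>Hom J i j. \<forall>p. \<forall>\<sigma>\<in>omap (nerve (over_cat J i)) p. \<forall>\<tau>\<in>omap (std m) p.
           \<phi> j p (fctr_comp (ordinal_cat p) (over_push J u) \<sigma>, \<tau>) = mid (mid (amap Y u) p) (\<phi> i p (\<sigma>, \<tau>)))})
     (\<lambda>\<theta> \<phi>. \<lambda>j\<in>Ob J. \<lambda>p. \<lambda>(\<sigma>, \<tau>)\<in>omap (sset_times (nerve (over_cat J j)) (std (Dom delta \<theta>))) p.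
        \<phi> j p (\<sigma>, \<theta> \<cdot>\<^bsub>delta\<^esub> \<tau>))"

definition bk_coaug ::
  "('j, 'n, 'z) category_scheme \<Rightarrow> 'a sset \<Rightarrow> ('j \<Rightarrow> 'a sset_arr) \<Rightarrow> nat \<Rightarrow> 'a \<Rightarrow> ('j, 'n, 'a) holim_simplex" where
  "bk_coaug J X c m x = (\<lambda>j\<in>Ob J. \<lambda>p. \<lambda>(\<sigma>, \<tau>)\<in>omap (sset_times (nerve (over_cat J j)) (std m)) p.
     mid (mid (c j) p) (act X \<tau> x))"

text \<open>The canonical map \<open>X \<rightarrow> holim Y\<close> induced by a cone \<open>c\<close> is an equivalence. The homotopy limit is
  computed on an objectwise fibrant replacement of \<open>Y\<close>.\<close>

definition holim_equiv ::
  "('j, 'n, 'z) category_scheme \<Rightarrow> 'a sset \<Rightarrow> ('j, 'n, 'a sset, 'a sset_arr) fctr \<Rightarrow> ('j \<Rightarrow> 'a sset_arr) \<Rightarrow> bool" where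
  "holim_equiv J X Y c \<longleftrightarrow> is_cone J sset_cat Y X c \<and>
     (\<exists>Y' q. is_functor J sset_cat Y' \<and> nat_trans J sset_cat Y Y' q \<and>
        (\<forall>j\<in>Ob J. q j \<in> sset_equivs \<and> kan_complex (omap Y' j)) \<and>
        sset_weq X (bk_holim J Y') (bk_coaug J X (\<lambda>j. q j \<cdot>\<^bsub>sset_cat\<^esub> c j)))"


section \<open>Model structures and Reedy structures on simplicial objects\<close>

record ('o, 'm) model = "('o, 'm) category" +
  Weq :: "'m set"
  Fib :: "'m set"
  Cof :: "'m set"

definition trivial_model :: "('o, 'm) category \<Rightarrow> ('o, 'm) model" where
  "trivial_model C = category.extend C
    (model.fields ({f. is_iso C f}) (Arr C) (Arr C))"

definition op_model :: "('o, 'm) model \<Rightarrow> ('o, 'm) model" where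
  "op_model M = category.extend (op_cat M)
    (model.fields (Weq M) (Cof M) (Fib M))"

definition has_llp :: "('o, 'm, 'z) category_scheme \<Rightarrow> 'm set \<Rightarrow> 'm \<Rightarrow> bool" where
  "has_llp C S i \<longleftrightarrow> i \<in> Arr C \<and>
     (\<forall>p\<in>S. \<forall>u\<in>Hom C (Dom C i) (Dom C p). \<forall>v\<in>Hom C (Cod C i) (Cod C p).
        p \<cdot>\<^bsub>C\<^esub> u = v \<cdot>\<^bsub>C\<^esub> i \<longrightarrow>
        (\<exists>w\<in>Hom C (Cod C i) (Dom C p). w \<cdot>\<^bsub>C\<^esub> i = u \<and> p \<cdot>\<^bsub>C\<^esub> w = v))"

definition fibrant :: "('o, 'm) model \<Rightarrow> 'o \<Rightarrow> bool" where
  "fibrant M X \<longleftrightarrow> X \<in> Ob M \<and> (\<exists>T. is_terminal M T \<and> (\<exists>f\<in>Hom M X T. f \<in> Fib M))"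

text \<open>Maps \<open>K \<otimes> W \<rightarrow> X\<close> of simplicial objects, where \<open>(K \<otimes> W)\<^sub>n\<close> is the coproduct of copies
  of \<open>W\<^sub>n\<close> indexed by the \<open>n\<close>-simplices of \<open>K\<close>. For \<open>K = \<Delta>\<^sup>m\<close> these are the \<open>m\<close>-simplices of
  the simplicial mapping space from \<open>W\<close> to \<open>X\<close>.\<close>

definition tensor_map ::
  "('o, 'm, 'z) category_scheme \<Rightarrow> 'x sset \<Rightarrow> ('o, 'm) sobj \<Rightarrow> ('o, 'm) sobj \<Rightarrow> (nat \<Rightarrow> 'x \<Rightarrow> 'm) \<Rightarrow> bool" where
  "tensor_map C K W X f \<longleftrightarrow>
     (\<forall>n. \<forall>x\<in>omap K n. f n x \<in> Hom C (omap W n) (omap X n)) \<and>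
     (\<forall>m n. \<forall>\<theta>\<in>Hom delta m n. \<forall>x\<in>omap K n.
        amap X \<theta> \<cdot>\<^bsub>C\<^esub> f n x = f m (act K \<theta> x) \<cdot>\<^bsub>C\<^esub> amap W \<theta>)"

text \<open>\<open>Z\<close> with evaluation \<open>ev : K \<otimes> Z \<rightarrow> X\<close> is the cotensor \<open>X\<^sup>K\<close> of the simplicial category of
  simplicial objects: for all \<open>W\<close>, \<open>Map(W, Z)\<close> is the simplicial set of maps \<open>K \<rightarrow> Map(W, X)\<close>,
  whose \<open>m\<close>-simplices are the maps \<open>(K \<times> \<Delta>\<^sup>m) \<otimes> W \<rightarrow> X\<close>.\<close>

definition is_cotensor ::
  "('o, 'm, 'z) category_scheme \<Rightarrow> 'x sset \<Rightarrow> ('o, 'm) sobj \<Rightarrow> ('o, 'm) sobj \<Rightarrow> (nat \<Rightarrow> 'x \<Rightarrow> 'm) \<Rightarrow> bool" where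
  "is_cotensor C K X Z ev \<longleftrightarrow> Z \<in> Ob (simp_cat C) \<and> tensor_map C K Z X ev \<and>
     (\<forall>W\<in>Ob (simp_cat C). \<forall>m f. tensor_map C (sset_times K (std m)) W X f \<longrightarrow>
        (\<exists>g. tensor_map C (std m) W Z g \<and>
           (\<forall>n. \<forall>x\<in>omap K n. \<forall>\<tau>\<in>omap (std m) n. ev n x \<cdot>\<^bsub>C\<^esub> g n \<tau> = f n (x, \<tau>)) \<and>
           (\<forall>g'. tensor_map C (std m) W Z g' \<and>
              (\<forall>n. \<forall>x\<in>omap K n. \<forall>\<tau>\<in>omap (std m) n. ev n x \<cdot>\<^bsub>C\<^esub> g' n \<tau> = f n (x, \<tau>)) \<longrightarrow>
              (\<forall>n. \<forall>\<tau>\<in>omap (std m) n. g' n \<tau> = g n \<tau>))))"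

text \<open>The matching object \<open>M\<^sub>nX\<close>: the limit of the \<open>X\<^sub>m\<close> over the simplices \<open>m \<rightarrow> n\<close> of the boundary
  of \<open>\<Delta>\<^sup>n\<close>, with its projections.\<close>

definition is_matching ::
  "('o, 'm, 'z) category_scheme \<Rightarrow> ('o, 'm) sobj \<Rightarrow> nat \<Rightarrow> 'o \<Rightarrow> (nat \<Rightarrow> darr \<Rightarrow> 'm) \<Rightarrow> bool" where
  "is_matching C X n N ev \<longleftrightarrow> N \<in> Ob C \<and>
     tensor_map C (bdry n) (const_fctr (op_cat delta) C N) X ev \<and>
     (\<forall>c\<in>Ob C. \<forall>f. tensor_map C (bdry n) (const_fctr (op_cat delta) C c) X f \<longrightarrow>
        (\<exists>!h. h \<in> Hom C c N \<and> (\<forall>m. \<forall>\<tau>\<in>omap (bdry n) m. ev m \<tau> \<cdot>\<^bsub>C\<^esub> h = f m \<tau>)))"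

definition reedy_fibrant :: "('o, 'm) model \<Rightarrow> ('o, 'm) sobj \<Rightarrow> bool" where
  "reedy_fibrant M X \<longleftrightarrow> X \<in> Ob (simp_cat M) \<and>
     (\<forall>n. \<exists>N ev. is_matching M X n N ev \<and>
        (\<exists>h\<in>Hom M (omap X n) N. h \<in> Fib M \<and> (\<forall>m. \<forall>\<tau>\<in>omap (bdry n) m. ev m \<tau> \<cdot>\<^bsub>M\<^esub> h = amap X \<tau>)))"

definition reedy_weq :: "('o, 'm) model \<Rightarrow> ('o, 'm) sobj \<Rightarrow> ('o, 'm) sobj \<Rightarrow> (nat \<Rightarrow> 'm) \<Rightarrow> bool" where
  "reedy_weq M X Y e \<longleftrightarrow> X \<in> Ob (simp_cat M) \<and> Y \<in> Ob (simp_cat M) \<and>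
     nat_trans (op_cat delta) M X Y e \<and> (\<forall>n. e n \<in> Weq M)"

definition functorial_simplicial_frame ::
  "('o, 'm) model \<Rightarrow> ('o, 'm, ('o, 'm) sobj, ('o, 'm) sarr) fctr \<Rightarrow> ('o \<Rightarrow> ('o, 'm) sarr) \<Rightarrow> bool" where
  "functorial_simplicial_frame M G j \<longleftrightarrow>
     is_functor M (simp_cat M) G \<and> nat_trans M (simp_cat M) (cs M) G j \<and>
     (\<forall>A\<in>Ob M.
        reedy_weq M (omap (cs M) A) (omap G A) (mid (j A)) \<and>
        is_iso M (mid (j A) 0) \<and>
        (fibrant M A \<longrightarrow> reedy_fibrant M (omap G A)))"

text \<open>Given a square \<open>c \<circ> a = d \<circ> b\<close>, the canonical map from the source of \<open>a\<close> and \<open>b\<close> to the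
  homotopy fibre product of \<open>c\<close> and \<open>d\<close> lies in \<open>S\<close>. The homotopy fibre product is the fibre
  product of a fibrant replacement of the cospan \<open>c\<close>, \<open>d\<close>.\<close>

definition hpullback_map_in ::
  "('o, 'm) model \<Rightarrow> 'm set \<Rightarrow> 'm \<Rightarrow> 'm \<Rightarrow> 'm \<Rightarrow> 'm \<Rightarrow> bool" where
  "hpullback_map_in M S a b c d \<longleftrightarrow> c \<cdot>\<^bsub>M\<^esub> a = d \<cdot>\<^bsub>M\<^esub> b \<and>
     (\<exists>c' d' x y z P p q h.
        c' \<in> Fib M \<and> d' \<in> Fib M \<and> Cod M c' = Cod M d' \<and> fibrant M (Cod M c') \<and>
        x \<in> Hom M (Dom M c) (Dom M c') \<and> y \<in> Hom M (Dom M d) (Dom M d') \<and>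
        z \<in> Hom M (Cod M c) (Cod M c') \<and> x \<in> Weq M \<and> y \<in> Weq M \<and> z \<in> Weq M \<and>
        c' \<cdot>\<^bsub>M\<^esub> x = z \<cdot>\<^bsub>M\<^esub> c \<and> d' \<cdot>\<^bsub>M\<^esub> y = z \<cdot>\<^bsub>M\<^esub> d \<and>
        is_pullback M c' d' P p q \<and>
        h \<in> Hom M (Dom M a) P \<and> p \<cdot>\<^bsub>M\<^esub> h = x \<cdot>\<^bsub>M\<^esub> a \<and> q \<cdot>\<^bsub>M\<^esub> h = y \<cdot>\<^bsub>M\<^esub> b \<and>
        h \<in> S)"

text \<open>The comparison map \<open>X\<^bsup>\<Delta>\<^sup>n\<^esup> \<rightarrow> X\<^bsup>\<partial>\<Delta>\<^sup>n\<^esup> \<times>\<^sup>h Y\<^bsup>\<Delta>\<^sup>n\<^esup>\<close> (over \<open>Y\<^bsup>\<partial>\<Delta>\<^sup>n\<^esup>\<close>, in degree zero) of a map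
  \<open>e : X \<rightarrow> Y\<close> of Reedy fibrant objects belongs to \<open>S\<close>. Here \<open>XD\<close>, \<open>XB\<close>, \<open>YD\<close>, \<open>YB\<close> are the cotensors
  of \<open>X\<close> and \<open>Y\<close> by \<open>\<Delta>\<^sup>n\<close> and by its boundary, \<open>rX\<close>, \<open>rY\<close> the restrictions along the inclusion of
  the boundary, and \<open>eD\<close>, \<open>eB\<close> are induced by \<open>e\<close>.\<close>

definition comparison_map_in ::
  "('o, 'm) model \<Rightarrow> 'm set \<Rightarrow> ('o, 'm) sobj \<Rightarrow> ('o, 'm) sobj \<Rightarrow> (nat \<Rightarrow> 'm) \<Rightarrow> nat \<Rightarrow> bool" where
  "comparison_map_in M S X Y e n \<longleftrightarrow>
     (\<exists>XD xD XB xB YD yD YB yB rX rY eD eB.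
        is_cotensor M (std n) X XD xD \<and> is_cotensor M (bdry n) X XB xB \<and>
        is_cotensor M (std n) Y YD yD \<and> is_cotensor M (bdry n) Y YB yB \<and>
        nat_trans (op_cat delta) M XD XB rX \<and>
        (\<forall>m. \<forall>\<tau>\<in>omap (bdry n) m. xB m \<tau> \<cdot>\<^bsub>M\<^esub> rX m = xD m \<tau>) \<and>
        nat_trans (op_cat delta) M YD YB rY \<and>
        (\<forall>m. \<forall>\<tau>\<in>omap (bdry n) m. yB m \<tau> \<cdot>\<^bsub>M\<^esub> rY m = yD m \<tau>) \<and>
        nat_trans (op_cat delta) M XD YD eD \<and>
        (\<forall>m. \<forall>\<tau>\<in>omap (std n) m. yD m \<tau> \<cdot>\<^bsub>M\<^esub> eD m = e m \<cdot>\<^bsub>M\<^esub> xD m \<tau>) \<and>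
        nat_trans (op_cat delta) M XB YB eB \<and>
        (\<forall>m. \<forall>\<tau>\<in>omap (bdry n) m. yB m \<tau> \<cdot>\<^bsub>M\<^esub> eB m = e m \<cdot>\<^bsub>M\<^esub> xB m \<tau>) \<and>
        hpullback_map_in M S (rX 0) (eD 0) (eB 0) (rY 0))"

text \<open>\<open>S\<close> is the class of one-element coverings. The Reedy fibrant replacement \<open>R\<close> is some choice of
  \<open>e' : X' \<rightarrow> Y'\<close> replacing \<open>e\<close>.\<close>

definition hypercovering ::
  "('o, 'm) model \<Rightarrow> 'm set \<Rightarrow> ('o, 'm) sobj \<Rightarrow> 'o \<Rightarrow> (nat \<Rightarrow> 'm) \<Rightarrow> bool" where
  "hypercovering M S X Y e \<longleftrightarrow>
     Y \<in> Ob M \<and> X \<in> Ob (simp_cat M) \<and> nat_trans (op_cat delta) M X (const_fctr (op_cat delta) M Y) e \<and>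
     (\<exists>X' Y' i j e'.
        reedy_weq M X X' i \<and> reedy_fibrant M X' \<and>
        reedy_weq M (const_fctr (op_cat delta) M Y) Y' j \<and> reedy_fibrant M Y' \<and>
        nat_trans (op_cat delta) M X' Y' e' \<and> (\<forall>n. e' n \<cdot>\<^bsub>M\<^esub> i n = j n \<cdot>\<^bsub>M\<^esub> e n) \<and>
        (\<forall>n. comparison_map_in M S X' Y' e' n))"


section \<open>Etale ring maps\<close>

text \<open>Relations presenting \<open>M \<otimes>\<^sub>R S\<close> as a quotient of the free abelian group on \<open>M \<times> S\<close>, for \<open>S\<close>
  an \<open>R\<close>-algebra via \<open>f\<close>.\<close>

definition tensor_relations ::
  "('a, 'b) ring_scheme \<Rightarrow> ('a, 'm) module \<Rightarrow> ('s, 'c) ring_scheme \<Rightarrow> ('a \<Rightarrow> 's) \<Rightarrow> (('m \<times> 's) \<Rightarrow>\<^sub>0 int) set" where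
  "tensor_relations R M S f = generate (free_Abelian_group (carrier M \<times> carrier S))
     ({frag_of (x \<oplus>\<^bsub>M\<^esub> y, s) - frag_of (x, s) - frag_of (y, s) | x y s.
         x \<in> carrier M \<and> y \<in> carrier M \<and> s \<in> carrier S} \<union>
      {frag_of (x, s \<oplus>\<^bsub>S\<^esub> t) - frag_of (x, s) - frag_of (x, t) | x s t.
         x \<in> carrier M \<and> s \<in> carrier S \<and> t \<in> carrier S} \<union>
      {frag_of (r \<odot>\<^bsub>M\<^esub> x, s) - frag_of (x, f r \<otimes>\<^bsub>S\<^esub> s) | r x s.
         r \<in> carrier R \<and> x \<in> carrier M \<and> s \<in> carrier S})"

text \<open>Tensoring with \<open>S\<close> preserves injectivity of maps of modules in the universe \<open>'u\<close>; all
  finitely generated modules occur there if \<open>'u\<close> is infinite and at least as large as \<open>R\<close>.\<close>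

definition flat :: "'u itself \<Rightarrow> ('a, 'b) ring_scheme \<Rightarrow> ('s, 'c) ring_scheme \<Rightarrow> ('a \<Rightarrow> 's) \<Rightarrow> bool" where
  "flat U R S f \<longleftrightarrow>
     (\<forall>(M :: ('a, 'u) module) (M' :: ('a, 'u) module) g.
        Module.module R M \<and> Module.module R M' \<and> g \<in> carrier M \<rightarrow> carrier M' \<and> inj_on g (carrier M) \<and>
        (\<forall>x\<in>carrier M. \<forall>y\<in>carrier M. g (x \<oplus>\<^bsub>M\<^esub> y) = g x \<oplus>\<^bsub>M'\<^esub> g y) \<and>
        (\<forall>r\<in>carrier R. \<forall>x\<in>carrier M. g (r \<odot>\<^bsub>M\<^esub> x) = r \<odot>\<^bsub>M'\<^esub> g x) \<longrightarrow>
        (\<forall>t\<in>carrier (free_Abelian_group (carrier M \<times> carrier S)).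
           frag_extend (\<lambda>(x, s). frag_of (g x, s)) t \<in> tensor_relations R M' S f \<longrightarrow>
           t \<in> tensor_relations R M S f))"

text \<open>The polynomial ring \<open>R[X\<^sub>0, \<dots>, X\<^bsub>n-1\<^esub>]\<close>; a polynomial is the function sending a multi-exponent
  to its coefficient.\<close>

definition mpoly :: "('a, 'b) ring_scheme \<Rightarrow> nat \<Rightarrow> ((nat \<Rightarrow> nat) \<Rightarrow> 'a) ring" where
  "mpoly R n =
    \<lparr>carrier = {p. (\<forall>e. p e \<in> carrier R) \<and> finite {e. p e \<noteq> \<zero>\<^bsub>R\<^esub>} \<and>
                 (\<forall>e. p e \<noteq> \<zero>\<^bsub>R\<^esub> \<longrightarrow> (\<forall>i\<ge>n. e i = 0))},
     mult = (\<lambda>p q e. finsum R (\<lambda>(a, b). p a \<otimes>\<^bsub>R\<^esub> q b) {(a, b). \<forall>i. a i + b i = e i}),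
     one = (\<lambda>e. if \<forall>i. e i = 0 then \<one>\<^bsub>R\<^esub> else \<zero>\<^bsub>R\<^esub>),
     zero = (\<lambda>_. \<zero>\<^bsub>R\<^esub>),
     add = (\<lambda>p q e. p e \<oplus>\<^bsub>R\<^esub> q e)\<rparr>"

definition mpoly_eval ::
  "('a, 'b) ring_scheme \<Rightarrow> ('s, 'c) ring_scheme \<Rightarrow> ('a \<Rightarrow> 's) \<Rightarrow> nat \<Rightarrow> (nat \<Rightarrow> 's) \<Rightarrow> ((nat \<Rightarrow> nat) \<Rightarrow> 'a) \<Rightarrow> 's" where
  "mpoly_eval R S f n x p =
     (\<Oplus>\<^bsub>S\<^esub>e\<in>{e. p e \<noteq> \<zero>\<^bsub>R\<^esub>}. f (p e) \<otimes>\<^bsub>S\<^esub> (\<Otimes>\<^bsub>S\<^esub>i\<in>{..<n}. x i [^]\<^bsub>S\<^esub> e i))"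

definition finitely_presented ::
  "('a, 'b) ring_scheme \<Rightarrow> ('s, 'c) ring_scheme \<Rightarrow> ('a \<Rightarrow> 's) \<Rightarrow> bool" where
  "finitely_presented R S f \<longleftrightarrow>
     (\<exists>n x F. x \<in> {..<n} \<rightarrow> carrier S \<and>
        mpoly_eval R S f n x ` carrier (mpoly R n) = carrier S \<and>
        finite F \<and> F \<subseteq> carrier (mpoly R n) \<and>
        {p \<in> carrier (mpoly R n). mpoly_eval R S f n x p = \<zero>\<^bsub>S\<^esub>} = Idl\<^bsub>mpoly R n\<^esub> F)"

text \<open>Relations presenting the module of Kaehler differentials of \<open>S\<close> over \<open>R\<close> as a quotient of the
  free abelian group on symbols \<open>(s, t)\<close>, standing for \<open>s dt\<close>.\<close>

definition kaehler_relations ::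
  "('a, 'b) ring_scheme \<Rightarrow> ('s, 'c) ring_scheme \<Rightarrow> ('a \<Rightarrow> 's) \<Rightarrow> (('s \<times> 's) \<Rightarrow>\<^sub>0 int) set" where
  "kaehler_relations R S f = generate (free_Abelian_group (carrier S \<times> carrier S))
     ({frag_of (s \<oplus>\<^bsub>S\<^esub> s', t) - frag_of (s, t) - frag_of (s', t) | s s' t.
         s \<in> carrier S \<and> s' \<in> carrier S \<and> t \<in> carrier S} \<union>
      {frag_of (s, t \<oplus>\<^bsub>S\<^esub> t') - frag_of (s, t) - frag_of (s, t') | s t t'.
         s \<in> carrier S \<and> t \<in> carrier S \<and> t' \<in> carrier S} \<union>
      {frag_of (s, t \<otimes>\<^bsub>S\<^esub> t') - frag_of (s \<otimes>\<^bsub>S\<^esub> t, t') - frag_of (s \<otimes>\<^bsub>S\<^esub> t', t) | s t t'.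
         s \<in> carrier S \<and> t \<in> carrier S \<and> t' \<in> carrier S} \<union>
      {frag_of (s, f r) | s r. s \<in> carrier S \<and> r \<in> carrier R})"

definition unramified :: "('a, 'b) ring_scheme \<Rightarrow> ('s, 'c) ring_scheme \<Rightarrow> ('a \<Rightarrow> 's) \<Rightarrow> bool" where
  "unramified R S f \<longleftrightarrow>
     kaehler_relations R S f = carrier (free_Abelian_group (carrier S \<times> carrier S))"

definition etale :: "'u itself \<Rightarrow> ('a, 'b) ring_scheme \<Rightarrow> ('s, 'c) ring_scheme \<Rightarrow> ('a \<Rightarrow> 's) \<Rightarrow> bool" where
  "etale U R S f \<longleftrightarrow>
     f \<in> ring_hom R S \<and> finitely_presented R S f \<and> flat U R S f \<and> unramified R S f"

text \<open>Surjectivity of the map from the disjoint union of the \<open>Spec (S j)\<close> to \<open>Spec R\<close>.\<close>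

definition spec_surjective ::
  "('a, 'b) ring_scheme \<Rightarrow> 'i set \<Rightarrow> ('i \<Rightarrow> ('s, 'c) ring_scheme) \<Rightarrow> ('i \<Rightarrow> 'a \<Rightarrow> 's) \<Rightarrow> bool" where
  "spec_surjective R J S f \<longleftrightarrow>
     (\<forall>P. primeideal P R \<longrightarrow> (\<exists>j\<in>J. \<exists>Q. primeideal Q (S j) \<and> {a \<in> carrier R. f j a \<in> Q} = P))"


section \<open>Commutative algebras and simplicial commutative algebras\<close>

text \<open>The type \<open>'u\<close> of elements of \<open>k\<close> plays the role of the universe: the \<open>k\<close>-algebras under
  consideration are all commutative \<open>k\<close>-algebras with elements in \<open>'u\<close>. If \<open>'u\<close> is infinite, this
  category is closed under finite limits, countable colimits, etale extensions and the factorizations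
  needed for the model structure on simplicial algebras. The Cof and Fib classes below are those of the
  standard model structure: Kan fibrations, and the left lifting property.\<close>

type_synonym 'u calg = "('u, 'u) module"
type_synonym 'u calg_arr = "'u calg \<times> ('u \<Rightarrow> 'u) \<times> 'u calg"
type_synonym 'u scalg = "('u calg, 'u calg_arr) sobj"
type_synonym 'u scalg_arr = "('u calg, 'u calg_arr) sarr"

definition calg_cat :: "'u ring \<Rightarrow> ('u calg, 'u calg_arr) category" where
  "calg_cat k =
    \<lparr>Ob = {A. Module.algebra k A},
     Arr = {(A, f, B). Module.algebra k A \<and> Module.algebra k B \<and> f \<in> ring_hom A B \<and> f \<in> extensional (carrier A) \<and>
              (\<forall>c\<in>carrier k. \<forall>x\<in>carrier A. f (c \<odot>\<^bsub>A\<^esub> x) = c \<odot>\<^bsub>B\<^esub> f x)},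
     Dom = fst,
     Cod = (\<lambda>t. snd (snd t)),
     Ident = (\<lambda>A. (A, \<lambda>x\<in>carrier A. x, A)),
     Comp = (\<lambda>s t. (fst t, compose (carrier (fst t)) (mid s) (mid t), snd (snd s)))\<rparr>"

abbreviation kCAlg :: "'u ring \<Rightarrow> ('u calg, 'u calg_arr) model" where
  "kCAlg k \<equiv> trivial_model (calg_cat k)"

abbreviation kAff :: "'u ring \<Rightarrow> ('u calg, 'u calg_arr) model" where
  "kAff k \<equiv> op_model (kCAlg k)"

definition underlying :: "'u scalg \<Rightarrow> 'u sset" where
  "underlying A = mk_sset (\<lambda>n. carrier (omap A n)) (\<lambda>\<theta>. mid (amap A \<theta>))"

definition scalg_equivs :: "'u ring \<Rightarrow> 'u scalg_arr set" where
  "scalg_equivs k = {e \<in> Arr (simp_cat (calg_cat k)).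
     sset_weq (underlying (fst e)) (underlying (snd (snd e))) (\<lambda>n. mid (mid e n))}"

definition scalg_fibs :: "'u ring \<Rightarrow> 'u scalg_arr set" where
  "scalg_fibs k = {e \<in> Arr (simp_cat (calg_cat k)).
     kan_fib (underlying (fst e)) (underlying (snd (snd e))) (\<lambda>n. mid (mid e n))}"

definition skCAlg :: "'u ring \<Rightarrow> ('u scalg, 'u scalg_arr) model" where
  "skCAlg k = category.extend (simp_cat (calg_cat k))
    (model.fields (scalg_equivs k) (scalg_fibs k) ({i. has_llp (simp_cat (calg_cat k)) (scalg_fibs k \<inter> scalg_equivs k) i}))"

abbreviation dkAff :: "'u ring \<Rightarrow> ('u scalg, 'u scalg_arr) model" where
  "dkAff k \<equiv> op_model (skCAlg k)"


section \<open>Homotopy groups of simplicial algebras\<close>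

text \<open>Homotopy groups are computed by the normalized chain complex: cycles are killed by all faces,
  boundaries are the zeroth faces of elements all of whose other faces vanish.\<close>

definition face :: "'u scalg \<Rightarrow> nat \<Rightarrow> nat \<Rightarrow> 'u \<Rightarrow> 'u" where
  "face A n i = mid (amap A (n, \<lambda>j\<in>{..n}. if j < i then j else Suc j, Suc n))"

definition cycles :: "'u scalg \<Rightarrow> nat \<Rightarrow> 'u set" where
  "cycles A n = {x \<in> carrier (omap A n).
     \<forall>m i. n = Suc m \<and> i \<le> n \<longrightarrow> face A m i x = \<zero>\<^bsub>omap A m\<^esub>}"

definition boundaries :: "'u scalg \<Rightarrow> nat \<Rightarrow> 'u set" where
  "boundaries A n = face A n 0 ` {y \<in> carrier (omap A (Suc n)).
     \<forall>i\<in>{1..Suc n}. face A n i y = \<zero>\<^bsub>omap A n\<^esub>}"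

definition pi_class :: "'u scalg \<Rightarrow> nat \<Rightarrow> 'u \<Rightarrow> 'u set" where
  "pi_class A n x = boundaries A n +>\<^bsub>omap A n\<^esub> x"

definition pi0 :: "'u scalg \<Rightarrow> 'u set ring" where
  "pi0 A = omap A 0 Quot boundaries A 0"

text \<open>\<open>\<pi>\<^sub>n(A)\<close> as a module over \<open>\<pi>\<^sub>0(A)\<close>, which acts through the degeneracy \<open>A\<^sub>0 \<rightarrow> A\<^sub>n\<close>. The ring fields
  of the record are irrelevant.\<close>

definition pi_mod :: "'u scalg \<Rightarrow> nat \<Rightarrow> ('u set, 'u set) module" where
  "pi_mod A n =
    \<lparr>carrier = pi_class A n ` cycles A n,
     mult = undefined,
     one = undefined,
     zero = boundaries A n,
     add = set_add (omap A n),
     smult = (\<lambda>c z. \<Union>x\<in>c. \<Union>y\<in>z.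
       pi_class A n (mid (amap A (n, \<lambda>j\<in>{..n}. 0, 0)) x \<otimes>\<^bsub>omap A n\<^esub> y))\<rparr>"

definition pi_map :: "'u scalg_arr \<Rightarrow> nat \<Rightarrow> 'u set \<Rightarrow> 'u set" where
  "pi_map e n z = (\<Union>x\<in>z. pi_class (snd (snd e)) n (mid (mid e n) x))"

text \<open>For \<open>e : A \<rightarrow> B\<close>, the map \<open>\<pi>\<^sub>n(A) \<otimes> \<pi>\<^sub>0(B) \<rightarrow> \<pi>\<^sub>n(B)\<close>, lifted to the free abelian group
  on \<open>\<pi>\<^sub>n(A) \<times> \<pi>\<^sub>0(B)\<close>.\<close>

definition pi_base_change :: "'u scalg_arr \<Rightarrow> nat \<Rightarrow> (('u set \<times> 'u set) \<Rightarrow>\<^sub>0 int) \<Rightarrow> 'u set" where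
  "pi_base_change e n t = (let N = pi_mod (snd (snd e)) n in
     finsum N (\<lambda>(z, s). [Poly_Mapping.lookup t (z, s)] \<cdot>\<^bsub>N\<^esub> (s \<odot>\<^bsub>N\<^esub> pi_map e n z)) (Poly_Mapping.keys t))"

definition pi_base_change_iso :: "'u scalg_arr \<Rightarrow> nat \<Rightarrow> bool" where
  "pi_base_change_iso e n \<longleftrightarrow> (let A = fst e; B = snd (snd e);
       F = carrier (free_Abelian_group (carrier (pi_mod A n) \<times> carrier (pi0 B))) in
     pi_base_change e n ` F = carrier (pi_mod B n) \<and>
     {t \<in> F. pi_base_change e n t = \<zero>\<^bsub>pi_mod B n\<^esub>} = tensor_relations (pi0 A) (pi_mod A n) (pi0 B) (pi_map e 0))"


section \<open>Etale coverings and sheaves\<close>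

text \<open>A family of schemes maps flatly (or by an etale map) from its disjoint union iff each member does.\<close>

definition etale_covering_aff :: "'u ring \<Rightarrow> 'u calg \<Rightarrow> 'i set \<Rightarrow> ('i \<Rightarrow> 'u calg_arr) \<Rightarrow> bool" where
  "etale_covering_aff k A I e \<longleftrightarrow> finite I \<and>
     (\<forall>i\<in>I. e i \<in> Arr (calg_cat k) \<and> fst (e i) = A) \<and>
     (\<exists>J\<subseteq>I. finite J \<and>
        (\<forall>j\<in>J. flat TYPE('u) A (snd (snd (e j))) (mid (e j)) \<and>
               etale TYPE('u) A (snd (snd (e j))) (mid (e j))) \<and>
        spec_surjective A J (\<lambda>j. snd (snd (e j))) (\<lambda>j. mid (e j)))"

definition etale_covering_daff :: "'u ring \<Rightarrow> 'u scalg \<Rightarrow> 'i set \<Rightarrow> ('i \<Rightarrow> 'u scalg_arr) \<Rightarrow> bool" where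
  "etale_covering_daff k A I e \<longleftrightarrow> finite I \<and>
     (\<forall>i\<in>I. e i \<in> Arr (skCAlg k) \<and> fst (e i) = A) \<and>
     (\<exists>J\<subseteq>I. finite J \<and>
        (\<forall>j\<in>J. etale TYPE('u) (pi0 A) (pi0 (snd (snd (e j)))) (pi_map (e j) 0)) \<and>
        spec_surjective (pi0 A) J (\<lambda>j. pi0 (snd (snd (e j)))) (\<lambda>j. pi_map (e j) 0)) \<and>
     (\<forall>i\<in>I. \<forall>n. pi_base_change_iso (e i) n)"

text \<open>A coaugmented cosimplicial algebra \<open>u : A \<rightarrow> B\<close> is the same datum as the corresponding augmented
  simplicial object of the opposite category.\<close>

definition etale_hypercovering_aff ::
  "'u ring \<Rightarrow> 'u calg \<Rightarrow> (nat, darr, 'u calg, 'u calg_arr) fctr \<Rightarrow> (nat \<Rightarrow> 'u calg_arr) \<Rightarrow> bool" where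
  "etale_hypercovering_aff k A B u \<longleftrightarrow>
     hypercovering (kAff k) {e. etale_covering_aff k (fst e) {()} (\<lambda>_. e)} B A u"

definition etale_hypercovering_daff ::
  "'u ring \<Rightarrow> 'u scalg \<Rightarrow> (nat, darr, 'u scalg, 'u scalg_arr) fctr \<Rightarrow> (nat \<Rightarrow> 'u scalg_arr) \<Rightarrow> bool" where
  "etale_hypercovering_daff k A B u \<longleftrightarrow>
     hypercovering (dkAff k) {e. etale_covering_daff k (fst e) {()} (\<lambda>_. e)} B A u"

definition set_model :: "('a set, 'a set_arr) model" where
  "set_model = trivial_model set_cat"

text \<open>The canonical map \<open>X \<rightarrow> \<Prod>\<^sub>i Y\<^sub>i\<close> with components \<open>c i : X \<rightarrow> Y\<^sub>i\<close> is an equivalence.\<close>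

definition prod_equiv :: "'i set \<Rightarrow> 'a sset \<Rightarrow> ('i \<Rightarrow> 'a sset) \<Rightarrow> ('i \<Rightarrow> 'a sset_arr) \<Rightarrow> bool" where
  "prod_equiv I X Y c \<longleftrightarrow> sset_weq X (sset_prod I Y) (\<lambda>n x. \<lambda>i\<in>I. mid (mid (c i) n) x)"

definition is_sheaf :: "'u ring \<Rightarrow> ('u calg, 'u calg_arr, 'v set, 'v set_arr) fctr \<Rightarrow> bool" where
  "is_sheaf k F \<longleftrightarrow> is_functor (kCAlg k) set_cat F \<and>
     (let F' = fctr_comp (kCAlg k) (cs set_cat) F in
       (\<forall>f\<in>Weq (kCAlg k). amap F' f \<in> sset_equivs) \<and>
       (\<forall>(I :: nat set) A P p. finite I \<and> (\<forall>i\<in>I. A i \<in> Ob (kCAlg k)) \<and> is_product (kCAlg k) I A P p \<longrightarrow>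
          prod_equiv I (omap F' P) (\<lambda>i. omap F' (A i)) (\<lambda>i. amap F' (p i))) \<and>
       (\<forall>A B u. A \<in> Ob (kCAlg k) \<and> is_functor delta (kCAlg k) B \<and>
          nat_trans delta (kCAlg k) (const_fctr delta (kCAlg k) A) B u \<and>
          etale_hypercovering_aff k A B u \<longrightarrow>
          holim_equiv delta (omap F' A) (fctr_comp delta F' B) (\<lambda>n. amap F' (u n))))"

end

(* Over a trivial model structure a simplicial frame is levelwise isomorphic to a constant simplicial
   object, so both functors called s are naturally isomorphic to cs. Hence every map s A -> s B is s f
   for a unique f : A -> B, and on the image of s the functor dSt agrees with Sh up to isomorphism.

   (1) A weak equivalence of discrete simplicial sets is bijective, since locally constant functions on
   the realization separate its points; so an equivalence s A -> s B is an isomorphism.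

   (2) The functor pi_0 from simplicial algebras to algebras is left adjoint to cs. In the opposite
   categories it is a right adjoint, so it preserves cotensors, matching objects and fibre products; it
   turns weak equivalences into isomorphisms and derived etale coverings into etale coverings. Applied
   to the data witnessing that Spec s(B) -> Spec s(A) is a hypercovering, it produces the data for
   Spec B -> Spec A; no limit has to be constructed. Descent for dSt is then descent for Sh.

   (3) If P is a product of the s A_i, then P_0 is a product of the A_i, because maps from a constant
   object to P are maps to P_0, and P is isomorphic to s P_0. So the claim reduces to that for Sh. *)
theory Submission
  imports Defs
begin

section \<open>Functors and isomorphisms\<close>

text \<open>Etaleness of \<open>pi0 A\<close> is stated for a ring of cosets, whose elements are
  sets over \<open>'u\<close>, while an object of \<open>calg_cat k\<close> has its elements in
  \<open>'u\<close> itself. Hence pi_0 as a functor to algebras is built on coset representatives,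
  and every ingredient of etaleness has to be carried along a ring isomorphism between two different
  types.

  Both uses of path components rest on one observation: a function on 0-simplices that agrees at the
  two ends of every edge is constant along paths in the realization. For a discrete simplicial set
  the identity is such a function, for a simplicial algebra the projection to pi_0 is. In a
  simplicial algebra equality of classes is witnessed by a single edge, because edges can be added.

  Hypercoverings, homotopy fibre products and homotopy limits are all phrased by the existence of
  auxiliary data: replacements, cotensors, comparison maps. An isomorphism is therefore absorbed by
  composing it into the replacement maps, and the other data are kept as they are or moved by a
  functor.\<close>

lemma HomD: assumes "f \<in> Hom C a b" shows "f \<in> Arr C" "Dom C f = a" "Cod C f = b"
  using assms by (auto simp: Hom_def)

lemma Arr_Hom: "f \<in> Arr C \<Longrightarrow> f \<in> Hom C (Dom C f) (Cod C f)"
  by (simp add: Hom_def)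

lemma Hom_Ob: "is_category C \<Longrightarrow> f \<in> Hom C a b \<Longrightarrow> a \<in> Ob C \<and> b \<in> Ob C"
  by (auto simp: Hom_def is_category_def)

lemma Ident_Hom: "is_category C \<Longrightarrow> a \<in> Ob C \<Longrightarrow> Ident C a \<in> Hom C a a"
  by (simp add: is_category_def)

lemma Comp_Hom:
  "is_category C \<Longrightarrow> f \<in> Hom C a b \<Longrightarrow> g \<in> Hom C b c \<Longrightarrow> g \<cdot>\<^bsub>C\<^esub> f \<in> Hom C a c"
  unfolding is_category_def by blast

lemma Comp_Ident:
  assumes "is_category C" "f \<in> Hom C a b"
  shows "f \<cdot>\<^bsub>C\<^esub> Ident C a = f" "Ident C b \<cdot>\<^bsub>C\<^esub> f = f"
  using assms unfolding is_category_def by blast+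

lemma Comp_assoc:
  "is_category C \<Longrightarrow> f \<in> Hom C a b \<Longrightarrow> g \<in> Hom C b c \<Longrightarrow> h \<in> Hom C c d \<Longrightarrow>
    h \<cdot>\<^bsub>C\<^esub> (g \<cdot>\<^bsub>C\<^esub> f) = h \<cdot>\<^bsub>C\<^esub> g \<cdot>\<^bsub>C\<^esub> f"
  unfolding is_category_def by blast

lemma functor_Ob: "is_functor J C F \<Longrightarrow> a \<in> Ob J \<Longrightarrow> omap F a \<in> Ob C"
  by (simp add: is_functor_def)

lemma functor_Hom: "is_functor J C F \<Longrightarrow> f \<in> Hom J a b \<Longrightarrow> amap F f \<in> Hom C (omap F a) (omap F b)"
  unfolding is_functor_def by blast

lemma functor_Ident: "is_functor J C F \<Longrightarrow> a \<in> Ob J \<Longrightarrow> amap F (Ident J a) = Ident C (omap F a)"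
  unfolding is_functor_def by blast

lemma functor_comp:
  "is_functor J C F \<Longrightarrow> f \<in> Hom J a b \<Longrightarrow> g \<in> Hom J b c \<Longrightarrow>
    amap F (g \<cdot>\<^bsub>J\<^esub> f) = amap F g \<cdot>\<^bsub>C\<^esub> amap F f"
  unfolding is_functor_def by blast

lemma nat_trans_Hom: "nat_trans J C F G \<eta> \<Longrightarrow> j \<in> Ob J \<Longrightarrow> \<eta> j \<in> Hom C (omap F j) (omap G j)"
  by (simp add: nat_trans_def)

lemma nat_trans_eq:
  "nat_trans J C F G \<eta> \<Longrightarrow> f \<in> Hom J a b \<Longrightarrow> \<eta> b \<cdot>\<^bsub>C\<^esub> amap F f = amap G f \<cdot>\<^bsub>C\<^esub> \<eta> a"
  unfolding nat_trans_def by blast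

lemma fctr_comp_omap [simp]: "j \<in> Ob J \<Longrightarrow> omap (fctr_comp J G F) j = omap G (omap F j)"
  by (simp add: fctr_comp_def)

lemma fctr_comp_amap [simp]: "f \<in> Arr J \<Longrightarrow> amap (fctr_comp J G F) f = amap G (amap F f)"
  by (simp add: fctr_comp_def)

lemma const_fctr_omap [simp]: "j \<in> Ob J \<Longrightarrow> omap (const_fctr J C c) j = c"
  by (simp add: const_fctr_def)

lemma const_fctr_amap [simp]: "f \<in> Arr J \<Longrightarrow> amap (const_fctr J C c) f = Ident C c"
  by (simp add: const_fctr_def)

lemma fctr_comp_is_functor:
  assumes J: "is_category J" and F: "is_functor J C F" and G: "is_functor C D G"
  shows "is_functor J D (fctr_comp J G F)"
  unfolding is_functor_def
proof (intro conjI allI ballI impI)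
  show "omap (fctr_comp J G F) \<in> extensional (Ob J)" "amap (fctr_comp J G F) \<in> extensional (Arr J)"
    by (simp_all add: fctr_comp_def)
next
  fix j assume "j \<in> Ob J"
  then show "omap (fctr_comp J G F) j \<in> Ob D"
    and "amap (fctr_comp J G F) (Ident J j) = Ident D (omap (fctr_comp J G F) j)"
    using F G Ident_Hom[OF J, of j] by (auto simp: functor_Ob functor_Ident HomD)
next
  fix a b f assume f: "f \<in> Hom J a b"
  show "amap (fctr_comp J G F) f \<in> Hom D (omap (fctr_comp J G F) a) (omap (fctr_comp J G F) b)"
    using functor_Hom[OF G functor_Hom[OF F f]] Hom_Ob[OF J f] HomD[OF f] by simp
next
  fix a b c f g assume fg: "f \<in> Hom J a b \<and> g \<in> Hom J b c"
  then have "g \<cdot>\<^bsub>J\<^esub> f \<in> Hom J a c" using Comp_Hom[OF J] by metis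
  moreover have "amap G (amap F g \<cdot>\<^bsub>C\<^esub> amap F f) = amap G (amap F g) \<cdot>\<^bsub>D\<^esub> amap G (amap F f)"
    using fg F G by (meson functor_Hom functor_comp)
  ultimately show "amap (fctr_comp J G F) (g \<cdot>\<^bsub>J\<^esub> f) = amap (fctr_comp J G F) g \<cdot>\<^bsub>D\<^esub> amap (fctr_comp J G F) f"
    using HomD(1)[of "g \<cdot>\<^bsub>J\<^esub> f" J a c] HomD(1)[of f J a b] HomD(1)[of g J b c] fg
      functor_comp[OF F, of f a b g c] by simp
qed

lemma const_fctr_is_functor:
  assumes J: "is_category J" and C: "is_category C" and c: "c \<in> Ob C"
  shows "is_functor J C (const_fctr J C c)"
proof -
  have arr: "f \<in> Hom J a b \<Longrightarrow> f \<in> Arr J \<and> a \<in> Ob J \<and> b \<in> Ob J" for f a b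
    using Hom_Ob[OF J] HomD(1) by metis
  have comp: "g \<cdot>\<^bsub>J\<^esub> f \<in> Arr J" if "f \<in> Hom J a b" "g \<in> Hom J b d" for f g a b d
    using Comp_Hom[OF J that] HomD(1) by metis
  show ?thesis
    unfolding is_functor_def
  proof (intro conjI allI ballI impI)
    show "omap (const_fctr J C c) \<in> extensional (Ob J)" "amap (const_fctr J C c) \<in> extensional (Arr J)"
      by (simp_all add: const_fctr_def)
  next
    fix j assume "j \<in> Ob J"
    then show "omap (const_fctr J C c) j \<in> Ob C"
      and "amap (const_fctr J C c) (Ident J j) = Ident C (omap (const_fctr J C c) j)"
      using c HomD(1)[OF Ident_Hom[OF J]] by simp_all
  next
    fix a b f assume "f \<in> Hom J a b"
    then show "amap (const_fctr J C c) f \<in> Hom C (omap (const_fctr J C c) a) (omap (const_fctr J C c) b)"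
      using Ident_Hom[OF C c] arr[of f a b] by simp
  next
    fix a b d f g assume "f \<in> Hom J a b \<and> g \<in> Hom J b d"
    then show "amap (const_fctr J C c) (g \<cdot>\<^bsub>J\<^esub> f) = amap (const_fctr J C c) g \<cdot>\<^bsub>C\<^esub> amap (const_fctr J C c) f"
      using Comp_Ident(1)[OF C Ident_Hom[OF C c]] arr[of f a b] arr[of g b d] comp[of f a b g d] by simp
  qed
qed

lemma nat_trans_whisker:
  assumes J: "is_category J" and F: "is_functor J C F" and F': "is_functor J C F'"
    and G: "is_functor C D G" and n: "nat_trans J C F F' \<eta>"
  shows "nat_trans J D (fctr_comp J G F) (fctr_comp J G F') (\<lambda>j. amap G (\<eta> j))"
  unfolding nat_trans_def
proof (intro conjI allI ballI)
  fix j assume j: "j \<in> Ob J"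
  show "amap G (\<eta> j) \<in> Hom D (omap (fctr_comp J G F) j) (omap (fctr_comp J G F') j)"
    using functor_Hom[OF G nat_trans_Hom[OF n j]] j by simp
next
  fix a b f assume f: "f \<in> Hom J a b"
  then have ab: "a \<in> Ob J" "b \<in> Ob J" using Hom_Ob[OF J] by metis+
  show "amap G (\<eta> b) \<cdot>\<^bsub>D\<^esub> amap (fctr_comp J G F) f = amap (fctr_comp J G F') f \<cdot>\<^bsub>D\<^esub> amap G (\<eta> a)"
    using functor_comp[OF G functor_Hom[OF F f] nat_trans_Hom[OF n ab(2)]]
      functor_comp[OF G nat_trans_Hom[OF n ab(1)] functor_Hom[OF F' f]] nat_trans_eq[OF n f] HomD(1)[OF f]
    by simp
qed

lemma fctr_comp_const:
  assumes J: "is_category J" and G: "is_functor C D G" and c: "c \<in> Ob C"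
  shows "fctr_comp J G (const_fctr J C c) = const_fctr J D (omap G c)"
  using functor_Ident[OF G c] by (auto simp: fctr_comp_def const_fctr_def)

lemma nat_trans_comp:
  assumes C: "is_category C" and J: "is_category J"
    and F: "is_functor J C F" and G: "is_functor J C G" and H: "is_functor J C H"
    and n: "nat_trans J C F G \<eta>" and m: "nat_trans J C G H \<mu>"
  shows "nat_trans J C F H (\<lambda>j. \<mu> j \<cdot>\<^bsub>C\<^esub> \<eta> j)"
  unfolding nat_trans_def
proof (intro conjI allI ballI)
  fix j assume j: "j \<in> Ob J"
  show "\<mu> j \<cdot>\<^bsub>C\<^esub> \<eta> j \<in> Hom C (omap F j) (omap H j)"
    using Comp_Hom[OF C nat_trans_Hom[OF n j] nat_trans_Hom[OF m j]] .
next
  fix a b f assume f: "f \<in> Hom J a b"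
  then have ab: "a \<in> Ob J" "b \<in> Ob J" using Hom_Ob[OF J] by metis+
  note na = nat_trans_Hom[OF n ab(1)] and nb = nat_trans_Hom[OF n ab(2)]
    and ma = nat_trans_Hom[OF m ab(1)] and mb = nat_trans_Hom[OF m ab(2)]
    and Ff = functor_Hom[OF F f] and Gf = functor_Hom[OF G f] and Hf = functor_Hom[OF H f]
  show "\<mu> b \<cdot>\<^bsub>C\<^esub> \<eta> b \<cdot>\<^bsub>C\<^esub> amap F f = amap H f \<cdot>\<^bsub>C\<^esub> (\<mu> a \<cdot>\<^bsub>C\<^esub> \<eta> a)"
    by (simp add: Comp_assoc[OF C na ma Hf] Comp_assoc[OF C na Gf mb, symmetric]
        Comp_assoc[OF C Ff nb mb, symmetric] nat_trans_eq[OF n f] nat_trans_eq[OF m f, symmetric])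
qed

section \<open>Opposite categories and trivial model structures\<close>

lemma op_cat_simps [simp]:
  "Ob (op_cat C) = Ob C" "Arr (op_cat C) = Arr C" "Dom (op_cat C) = Cod C" "Cod (op_cat C) = Dom C"
  "Ident (op_cat C) = Ident C" "Comp (op_cat C) f g = g \<cdot>\<^bsub>C\<^esub> f"
  by (simp_all add: op_cat_def)

lemma Hom_op [simp]: "Hom (op_cat C) a b = Hom C b a"
  by (auto simp: Hom_def)

lemma is_category_op: "is_category C \<Longrightarrow> is_category (op_cat C)"
  unfolding is_category_def by auto

lemma op_model_simps [simp]:
  "Ob (op_model C) = Ob C" "Arr (op_model C) = Arr C" "Dom (op_model C) = Cod C" "Cod (op_model C) = Dom C"
  "Ident (op_model C) = Ident C" "Comp (op_model C) f g = g \<cdot>\<^bsub>C\<^esub> f"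
  "Weq (op_model C) = Weq C" "Fib (op_model C) = Cof C" "Cof (op_model C) = Fib C"
  by (simp_all add: op_model_def op_cat_def category.defs model.defs)

lemma Hom_op_model [simp]: "Hom (op_model C) a b = Hom C b a"
  by (auto simp: Hom_def)

lemma is_category_op_model: "is_category C \<Longrightarrow> is_category (op_model C)"
  unfolding is_category_def by auto

lemma trivial_model_simps [simp]:
  "Ob (trivial_model C) = Ob C" "Arr (trivial_model C) = Arr C" "Dom (trivial_model C) = Dom C"
  "Cod (trivial_model C) = Cod C" "Ident (trivial_model C) = Ident C"
  "Comp (trivial_model C) f g = f \<cdot>\<^bsub>C\<^esub> g"
  "Weq (trivial_model C) = {f. is_iso C f}" "Fib (trivial_model C) = Arr C" "Cof (trivial_model C) = Arr C"
  by (simp_all add: trivial_model_def category.defs model.defs)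

lemma Hom_trivial_model [simp]: "Hom (trivial_model C) a b = Hom C a b"
  by (auto simp: Hom_def)

lemma is_category_trivial: "is_category C \<Longrightarrow> is_category (trivial_model C)"
  unfolding is_category_def by simp

lemma is_functor_op_op: "is_functor C D F \<Longrightarrow> is_functor (op_model C) (op_model D) F"
  unfolding is_functor_def by simp blast

text \<open>A functor records only its values, so reversing source and target together leaves the
  datum alone. A cosimplicial algebra is thereby literally a simplicial object of the opposite
  category.\<close>

lemma is_functor_delta_op_model:
  "is_functor (op_cat J) (op_model C) F \<longleftrightarrow> is_functor J C F"
  unfolding is_functor_def by simp blast

text \<open>The components stay the same but point the other way, which exchanges \<open>F\<close>
  and \<open>G\<close>.\<close>

lemma nat_trans_op_model:
  "nat_trans (op_cat J) (op_model C) G F \<eta> \<longleftrightarrow> nat_trans J C F G \<eta>"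
  unfolding nat_trans_def by simp metis

section \<open>Isomorphisms and chosen inverses\<close>

lemma isoI:
  assumes "f \<in> Hom C a b" "g \<in> Hom C b a" "g \<cdot>\<^bsub>C\<^esub> f = Ident C a" "f \<cdot>\<^bsub>C\<^esub> g = Ident C b"
  shows "is_iso C f"
  using assms by (auto simp: is_iso_def Hom_def)

lemma isoE:
  assumes "is_iso C f" "f \<in> Hom C a b"
  obtains g where "g \<in> Hom C b a" "g \<cdot>\<^bsub>C\<^esub> f = Ident C a" "f \<cdot>\<^bsub>C\<^esub> g = Ident C b"
  using assms by (auto simp: is_iso_def Hom_def)

text \<open>A chosen inverse as a function of the arrow, so that the inverses of a family of
  isomorphisms again form a family.\<close>

definition inv_arr :: "('o, 'm, 'z) category_scheme \<Rightarrow> 'm \<Rightarrow> 'm" where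
  "inv_arr C f = (SOME g. g \<in> Hom C (Cod C f) (Dom C f) \<and> g \<cdot>\<^bsub>C\<^esub> f = Ident C (Dom C f) \<and> f \<cdot>\<^bsub>C\<^esub> g = Ident C (Cod C f))"

lemma inv_arr:
  assumes "is_iso C f" "f \<in> Hom C a b"
  shows "inv_arr C f \<in> Hom C b a" "inv_arr C f \<cdot>\<^bsub>C\<^esub> f = Ident C a" "f \<cdot>\<^bsub>C\<^esub> inv_arr C f = Ident C b"
proof -
  have "\<exists>g. g \<in> Hom C (Cod C f) (Dom C f) \<and> g \<cdot>\<^bsub>C\<^esub> f = Ident C (Dom C f) \<and> f \<cdot>\<^bsub>C\<^esub> g = Ident C (Cod C f)"
    using assms(1) unfolding is_iso_def by blast
  from someI_ex[OF this] show "inv_arr C f \<in> Hom C b a" "inv_arr C f \<cdot>\<^bsub>C\<^esub> f = Ident C a" "f \<cdot>\<^bsub>C\<^esub> inv_arr C f = Ident C b"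
    using HomD[OF assms(2)] by (simp_all add: inv_arr_def)
qed

lemma inv_arr_iso: "is_iso C f \<Longrightarrow> f \<in> Hom C a b \<Longrightarrow> is_iso C (inv_arr C f)"
  using inv_arr isoI by metis

lemma is_iso_comp:
  assumes C: "is_category C" and "is_iso C f" "f \<in> Hom C a b" "is_iso C g" "g \<in> Hom C b c"
  shows "is_iso C (g \<cdot>\<^bsub>C\<^esub> f)"
proof -
  obtain f' where f': "f' \<in> Hom C b a" "f' \<cdot>\<^bsub>C\<^esub> f = Ident C a" "f \<cdot>\<^bsub>C\<^esub> f' = Ident C b"
    using isoE assms(2,3) by metis
  obtain g' where g': "g' \<in> Hom C c b" "g' \<cdot>\<^bsub>C\<^esub> g = Ident C b" "g \<cdot>\<^bsub>C\<^esub> g' = Ident C c"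
    using isoE assms(4,5) by metis
  note f = assms(3) and g = assms(5)
  show ?thesis
  proof (rule isoI)
    show "g \<cdot>\<^bsub>C\<^esub> f \<in> Hom C a c" "f' \<cdot>\<^bsub>C\<^esub> g' \<in> Hom C c a"
      using C f g f' g' Comp_Hom by metis+
    show "f' \<cdot>\<^bsub>C\<^esub> g' \<cdot>\<^bsub>C\<^esub> (g \<cdot>\<^bsub>C\<^esub> f) = Ident C a"
      by (simp add: Comp_assoc[OF C f g Comp_Hom[OF C g'(1) f'(1)]] Comp_assoc[OF C g g'(1) f'(1), symmetric]
          g'(2) f'(2) Comp_Ident[OF C f'(1)])
    show "g \<cdot>\<^bsub>C\<^esub> f \<cdot>\<^bsub>C\<^esub> (f' \<cdot>\<^bsub>C\<^esub> g') = Ident C c"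
      by (simp add: Comp_assoc[OF C g'(1) f'(1) Comp_Hom[OF C f g]] Comp_assoc[OF C f'(1) f g, symmetric]
          f'(3) g'(3) Comp_Ident[OF C g])
  qed
qed

lemma functor_iso:
  assumes J: "is_category J" and F: "is_functor J C F" and f: "is_iso J f"
  shows "is_iso C (amap F f)"
proof -
  have fh: "f \<in> Hom J (Dom J f) (Cod J f)" using f by (simp add: is_iso_def Hom_def)
  obtain g where g: "g \<in> Hom J (Cod J f) (Dom J f)" "g \<cdot>\<^bsub>J\<^esub> f = Ident J (Dom J f)" "f \<cdot>\<^bsub>J\<^esub> g = Ident J (Cod J f)"
    using isoE[OF f fh] by metis
  show ?thesis
    by (rule isoI[OF functor_Hom[OF F fh] functor_Hom[OF F g(1)]])
      (metis F J fh g functor_comp functor_Ident Hom_Ob)+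
qed

lemma iso_cancel_left:
  assumes C: "is_category C" and "is_iso C i" "i \<in> Hom C b c" "f \<in> Hom C a b" "g \<in> Hom C a b"
    and "i \<cdot>\<^bsub>C\<^esub> f = i \<cdot>\<^bsub>C\<^esub> g"
  shows "f = g"
proof -
  note i = inv_arr[OF assms(2,3)]
  have "inv_arr C i \<cdot>\<^bsub>C\<^esub> i \<cdot>\<^bsub>C\<^esub> f = inv_arr C i \<cdot>\<^bsub>C\<^esub> i \<cdot>\<^bsub>C\<^esub> g"
    by (simp add: Comp_assoc[OF C assms(4,3) i(1), symmetric] Comp_assoc[OF C assms(5,3) i(1), symmetric] assms(6))
  then show ?thesis by (simp add: i Comp_Ident[OF C] assms(4,5) Comp_Ident(2)[OF C assms(4)] Comp_Ident(2)[OF C assms(5)])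
qed

lemma iso_cancel_right:
  assumes C: "is_category C" and "is_iso C i" "i \<in> Hom C a b" "f \<in> Hom C b c" "g \<in> Hom C b c"
    and "f \<cdot>\<^bsub>C\<^esub> i = g \<cdot>\<^bsub>C\<^esub> i"
  shows "f = g"
proof -
  note i = inv_arr[OF assms(2,3)]
  have "f \<cdot>\<^bsub>C\<^esub> (i \<cdot>\<^bsub>C\<^esub> inv_arr C i) = g \<cdot>\<^bsub>C\<^esub> (i \<cdot>\<^bsub>C\<^esub> inv_arr C i)"
    by (simp add: Comp_assoc[OF C i(1) assms(3,4)] Comp_assoc[OF C i(1) assms(3,5)] assms(6))
  then show ?thesis by (simp add: i Comp_Ident(1)[OF C assms(4)] Comp_Ident(1)[OF C assms(5)])
qed

lemma nat_trans_inv: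
  assumes C: "is_category C" and J: "is_category J" and F: "is_functor J C F" and G: "is_functor J C G"
    and n: "nat_trans J C F G \<eta>" and iso: "\<And>j. j \<in> Ob J \<Longrightarrow> is_iso C (\<eta> j)"
  shows "nat_trans J C G F (\<lambda>j. inv_arr C (\<eta> j))"
  unfolding nat_trans_def
proof (intro conjI allI ballI)
  fix j assume j: "j \<in> Ob J"
  show "inv_arr C (\<eta> j) \<in> Hom C (omap G j) (omap F j)"
    using inv_arr(1)[OF iso[OF j] nat_trans_Hom[OF n j]] .
next
  fix a b f assume f: "f \<in> Hom J a b"
  then have ab: "a \<in> Ob J" "b \<in> Ob J" using Hom_Ob[OF J] by metis+
  note ha = nat_trans_Hom[OF n ab(1)] and hb = nat_trans_Hom[OF n ab(2)]
  note ia = inv_arr[OF iso[OF ab(1)] ha] and ib = inv_arr[OF iso[OF ab(2)] hb]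
  note Ff = functor_Hom[OF F f] and Gf = functor_Hom[OF G f]
  show "inv_arr C (\<eta> b) \<cdot>\<^bsub>C\<^esub> amap G f = amap F f \<cdot>\<^bsub>C\<^esub> inv_arr C (\<eta> a)"
  \<comment> \<open>Naturality of the inverses is checked after composing with the isomorphism
    \<open>\<eta> b\<close>.\<close>
  proof (rule iso_cancel_left[OF C iso[OF ab(2)] hb])
    show "inv_arr C (\<eta> b) \<cdot>\<^bsub>C\<^esub> amap G f \<in> Hom C (omap G a) (omap F b)"
      "amap F f \<cdot>\<^bsub>C\<^esub> inv_arr C (\<eta> a) \<in> Hom C (omap G a) (omap F b)"
      using Comp_Hom[OF C Gf ib(1)] Comp_Hom[OF C ia(1) Ff] .
    have "\<eta> b \<cdot>\<^bsub>C\<^esub> (amap F f \<cdot>\<^bsub>C\<^esub> inv_arr C (\<eta> a)) = amap G f \<cdot>\<^bsub>C\<^esub> (\<eta> a \<cdot>\<^bsub>C\<^esub> inv_arr C (\<eta> a))"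
      by (simp add: Comp_assoc[OF C ia(1) Ff hb] nat_trans_eq[OF n f] Comp_assoc[OF C ia(1) ha Gf])
    then show "\<eta> b \<cdot>\<^bsub>C\<^esub> (inv_arr C (\<eta> b) \<cdot>\<^bsub>C\<^esub> amap G f) = \<eta> b \<cdot>\<^bsub>C\<^esub> (amap F f \<cdot>\<^bsub>C\<^esub> inv_arr C (\<eta> a))"
      by (simp add: Comp_assoc[OF C Gf ib(1) hb] ia(3) ib(3) Comp_Ident[OF C Gf])
  qed
qed

section \<open>Functor categories\<close>

lemma fun_cat_simps [simp]:
  "Ob (fun_cat J C) = {F. is_functor J C F}" "Dom (fun_cat J C) = fst" "Cod (fun_cat J C) = (\<lambda>t. snd (snd t))"
  "Ident (fun_cat J C) F = (F, \<lambda>j\<in>Ob J. Ident C (omap F j), F)"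
  "s \<cdot>\<^bsub>fun_cat J C\<^esub> t = (fst t, \<lambda>j\<in>Ob J. mid s j \<cdot>\<^bsub>C\<^esub> mid t j, snd (snd s))"
  by (simp_all add: fun_cat_def)

lemma Hom_fun_cat:
  "e \<in> Hom (fun_cat J C) F G \<longleftrightarrow> (\<exists>\<eta>. e = (F, \<eta>, G) \<and> is_functor J C F \<and> is_functor J C G \<and>
     nat_trans J C F G \<eta> \<and> \<eta> \<in> extensional (Ob J))"
  by (auto simp: Hom_def fun_cat_def)

lemma nat_trans_Ident:
  assumes "is_category C" "is_category J" "is_functor J C F"
  shows "nat_trans J C F F (\<lambda>j. Ident C (omap F j))"
  using assms Ident_Hom Comp_Ident functor_Hom functor_Ob unfolding nat_trans_def by metis

lemma nat_trans_cong:
  assumes "is_category J" "\<And>j. j \<in> Ob J \<Longrightarrow> \<eta> j = \<mu> j"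
  shows "nat_trans J C F G \<eta> = nat_trans J C F G \<mu>"
  using assms Hom_Ob[OF assms(1)] unfolding nat_trans_def by (metis (no_types, lifting))

text \<open>Arrows of \<open>fun_cat\<close> carry components made extensional by
  \<open>restrict\<close>; naturality evaluates them at objects only and does not see the
  difference.\<close>

lemma nat_trans_restrict [simp]:
  "is_category J \<Longrightarrow> nat_trans J C F G (restrict \<eta> (Ob J)) = nat_trans J C F G \<eta>"
  by (rule nat_trans_cong) auto

lemma is_category_fun_cat:
  assumes C: "is_category C" and J: "is_category J"
  shows "is_category (fun_cat J C)"
  unfolding is_category_def
proof (intro conjI allI ballI impI)
  fix f assume "f \<in> Arr (fun_cat J C)"
  then show "Dom (fun_cat J C) f \<in> Ob (fun_cat J C)" "Cod (fun_cat J C) f \<in> Ob (fun_cat J C)"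
    by (auto simp: fun_cat_def)
next
  fix F assume "F \<in> Ob (fun_cat J C)"
  then show "Ident (fun_cat J C) F \<in> Hom (fun_cat J C) F F"
    using nat_trans_Ident[OF C J] J by (simp add: Hom_fun_cat)
next
  fix F G H e d assume "e \<in> Hom (fun_cat J C) F G \<and> d \<in> Hom (fun_cat J C) G H"
  then show "d \<cdot>\<^bsub>fun_cat J C\<^esub> e \<in> Hom (fun_cat J C) F H"
    using nat_trans_comp[OF C J] J by (auto simp: Hom_fun_cat)
next
  fix F G e assume "e \<in> Hom (fun_cat J C) F G"
  then obtain \<eta> where e: "e = (F, \<eta>, G)" "nat_trans J C F G \<eta>" "\<eta> \<in> extensional (Ob J)"
    by (auto simp: Hom_fun_cat)
  show "e \<cdot>\<^bsub>fun_cat J C\<^esub> Ident (fun_cat J C) F = e"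
    using Comp_Ident(1)[OF C nat_trans_Hom[OF e(2)]] e by (auto simp: extensional_def fun_eq_iff)
  show "Ident (fun_cat J C) G \<cdot>\<^bsub>fun_cat J C\<^esub> e = e"
    using Comp_Ident(2)[OF C nat_trans_Hom[OF e(2)]] e by (auto simp: extensional_def fun_eq_iff)
next
  fix F G H K e d c
  assume "e \<in> Hom (fun_cat J C) F G \<and> d \<in> Hom (fun_cat J C) G H \<and> c \<in> Hom (fun_cat J C) H K"
  then obtain \<eta> \<mu> \<nu> where *: "e = (F, \<eta>, G)" "nat_trans J C F G \<eta>" "d = (G, \<mu>, H)" "nat_trans J C G H \<mu>"
    "c = (H, \<nu>, K)" "nat_trans J C H K \<nu>"
    by (auto simp: Hom_fun_cat)
  then show "c \<cdot>\<^bsub>fun_cat J C\<^esub> (d \<cdot>\<^bsub>fun_cat J C\<^esub> e) = c \<cdot>\<^bsub>fun_cat J C\<^esub> d \<cdot>\<^bsub>fun_cat J C\<^esub> e"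
    using Comp_assoc[OF C nat_trans_Hom[OF *(2)] nat_trans_Hom[OF *(4)] nat_trans_Hom[OF *(6)]]
    by (auto simp: fun_eq_iff)
qed

section \<open>The simplex category\<close>

lemma is_category_delta: "is_category delta"
proof -
  have H: "f \<in> Hom delta a b \<longleftrightarrow> (\<exists>h. f = (a, h, b) \<and> h \<in> {..a} \<rightarrow>\<^sub>E {..b} \<and> mono_on {..a} h)" for f a b
    by (auto simp: Hom_def delta_def)
  show ?thesis unfolding is_category_def
  proof (intro conjI allI ballI impI)
    fix a b c f g assume "f \<in> Hom delta a b \<and> g \<in> Hom delta b c"
    then show "g \<cdot>\<^bsub>delta\<^esub> f \<in> Hom delta a c"
      unfolding H by (auto simp: delta_def compose_def mono_on_def PiE_iff Pi_iff)
  next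
    fix a b f assume "f \<in> Hom delta a b"
    then show "f \<cdot>\<^bsub>delta\<^esub> Ident delta a = f" "Ident delta b \<cdot>\<^bsub>delta\<^esub> f = f"
      unfolding H by (auto simp: delta_def compose_def PiE_iff extensional_def fun_eq_iff)
  next
    fix a b c d f g h assume "f \<in> Hom delta a b \<and> g \<in> Hom delta b c \<and> h \<in> Hom delta c d"
    then show "h \<cdot>\<^bsub>delta\<^esub> (g \<cdot>\<^bsub>delta\<^esub> f) = h \<cdot>\<^bsub>delta\<^esub> g \<cdot>\<^bsub>delta\<^esub> f"
      unfolding H by (auto simp: delta_def compose_def PiE_iff extensional_def fun_eq_iff)
  qed (auto simp: delta_def Hom_def mono_on_def)
qed

lemma delta_Hom_iff:
  "f \<in> Hom delta a b \<longleftrightarrow> (\<exists>h. f = (a, h, b) \<and> h \<in> {..a} \<rightarrow>\<^sub>E {..b} \<and> mono_on {..a} h)"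
  by (auto simp: Hom_def delta_def)

lemma delta_simps [simp]:
  "Ob delta = UNIV" "Dom delta = fst" "Cod delta = (\<lambda>t. snd (snd t))"
  "Ident delta n = (n, \<lambda>i\<in>{..n}. i, n)"
  by (simp_all add: delta_def)

lemma delta_comp:
  "s \<cdot>\<^bsub>delta\<^esub> t = (fst t, compose {..fst t} (mid s) (mid t), snd (snd s))"
  by (simp add: delta_def)

definition vertex :: "nat \<Rightarrow> nat \<Rightarrow> darr" where
  "vertex n v = (0, \<lambda>i\<in>{..0}. v, n)"

definition collapse :: "nat \<Rightarrow> darr" where
  "collapse n = (n, \<lambda>i\<in>{..n}. 0, 0)"

text \<open>The injection whose image misses \<open>i\<close>, given by the same formula as the
  arrow in \<open>face\<close>.\<close>

definition coface :: "nat \<Rightarrow> nat \<Rightarrow> darr" where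
  "coface n i = (n, \<lambda>j\<in>{..n}. if j < i then j else Suc j, Suc n)"

lemma vertex_Hom: "v \<le> n \<Longrightarrow> vertex n v \<in> Hom delta 0 n"
  by (auto simp: vertex_def collapse_def coface_def delta_Hom_iff mono_on_def)

lemma collapse_Hom: "collapse n \<in> Hom delta n 0"
  by (auto simp: vertex_def collapse_def coface_def delta_Hom_iff mono_on_def)

lemma coface_Hom: "coface n i \<in> Hom delta n (Suc n)"
  by (auto simp: vertex_def collapse_def coface_def delta_Hom_iff mono_on_def)

lemma delta_comp_vertex:
  "\<theta> \<in> Hom delta m n \<Longrightarrow> v \<le> m \<Longrightarrow> \<theta> \<cdot>\<^bsub>delta\<^esub> vertex m v = vertex n (mid \<theta> v)"
  by (auto simp: vertex_def collapse_def coface_def delta_Hom_iff delta_comp compose_def fun_eq_iff)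

lemma delta_collapse_comp: "\<theta> \<in> Hom delta m n \<Longrightarrow> collapse n \<cdot>\<^bsub>delta\<^esub> \<theta> = collapse m"
  by (auto simp: vertex_def collapse_def coface_def delta_Hom_iff delta_comp compose_def fun_eq_iff)

lemma vertex_0_0: "vertex 0 0 = Ident delta 0"
  by (auto simp: vertex_def)

text \<open>The edge from \<open>v\<close> to \<open>w\<close>. It fixes the orientation used
  throughout: a coface omits the vertex it is indexed by, so \<open>coface 0 (Suc 0)\<close> picks
  the start and \<open>coface 0 0\<close> the end.\<close>

lemma delta_edge:
  assumes "v < w" "w \<le> n"
  obtains \<theta> where "\<theta> \<in> Hom delta (Suc 0) n" "\<theta> \<cdot>\<^bsub>delta\<^esub> coface 0 (Suc 0) = vertex n v" "\<theta> \<cdot>\<^bsub>delta\<^esub> coface 0 0 = vertex n w"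
proof
  show "(Suc 0, \<lambda>i\<in>{..Suc 0}. if i = 0 then v else w, n) \<in> Hom delta (Suc 0) n"
    using assms by (auto simp: vertex_def collapse_def coface_def delta_Hom_iff mono_on_def)
qed (auto simp: vertex_def coface_def delta_comp compose_def fun_eq_iff)

section \<open>Sets and simplicial sets\<close>

lemma set_cat_simps [simp]:
  "Ob set_cat = UNIV" "Dom set_cat = fst" "Cod set_cat = (\<lambda>t. snd (snd t))"
  "Ident set_cat A = (A, \<lambda>x\<in>A. x, A)"
  by (simp_all add: set_cat_def)

lemma set_cat_comp: "s \<cdot>\<^bsub>set_cat\<^esub> t = (fst t, compose (fst t) (mid s) (mid t), snd (snd s))"
  by (simp add: set_cat_def)

lemma Hom_set_cat: "e \<in> Hom set_cat A B \<longleftrightarrow> (\<exists>f. e = (A, f, B) \<and> f \<in> A \<rightarrow>\<^sub>E B)"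
  by (auto simp: Hom_def set_cat_def)

lemma Hom_set_cat_mid: "e \<in> Hom set_cat A B \<Longrightarrow> x \<in> A \<Longrightarrow> mid e x \<in> B"
  by (auto simp: Hom_set_cat)

lemma is_category_set_cat: "is_category set_cat"
  unfolding is_category_def
proof (intro conjI allI ballI impI)
  fix a b e assume "e \<in> Hom set_cat a b"
  then obtain f where e: "e = (a, f, b)" and f: "f \<in> a \<rightarrow>\<^sub>E b" by (auto simp: Hom_set_cat)
  have "f x = undefined" if "x \<notin> a" for x using f that by (rule PiE_arb)
  with PiE_mem[OF f] show "e \<cdot>\<^bsub>set_cat\<^esub> Ident set_cat a = e" "Ident set_cat b \<cdot>\<^bsub>set_cat\<^esub> e = e"
    by (simp_all add: e set_cat_comp compose_def fun_eq_iff)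
next
  fix a b c d f g h
  assume "f \<in> Hom set_cat a b \<and> g \<in> Hom set_cat b c \<and> h \<in> Hom set_cat c d"
  then show "h \<cdot>\<^bsub>set_cat\<^esub> (g \<cdot>\<^bsub>set_cat\<^esub> f) = h \<cdot>\<^bsub>set_cat\<^esub> g \<cdot>\<^bsub>set_cat\<^esub> f"
    unfolding Hom_set_cat
    by (auto simp: set_cat_comp compose_def PiE_iff extensional_def fun_eq_iff)
qed (auto simp: set_cat_def Hom_def compose_def PiE_iff)

lemma set_cat_comp_mid:
  "f \<in> Hom set_cat A B \<Longrightarrow> x \<in> A \<Longrightarrow> mid (g \<cdot>\<^bsub>set_cat\<^esub> f) x = mid g (mid f x)"
  by (auto simp: Hom_set_cat set_cat_comp compose_def)

lemma iso_set_cat_bij: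
  assumes "is_iso set_cat e" "e \<in> Hom set_cat A B"
  shows "bij_betw (mid e) A B"
proof -
  obtain g where g: "g \<in> Hom set_cat B A" "g \<cdot>\<^bsub>set_cat\<^esub> e = Ident set_cat A" "e \<cdot>\<^bsub>set_cat\<^esub> g = Ident set_cat B"
    using isoE[OF assms] by metis
  have "mid g (mid e x) = x" if "x \<in> A" for x
    using g(2) set_cat_comp_mid[OF assms(2) that, of g] that by simp
  moreover have "mid e (mid g x) = x" if "x \<in> B" for x
    using g(3) set_cat_comp_mid[OF g(1) that, of e] that by simp
  ultimately show ?thesis
    using Hom_set_cat_mid[OF assms(2)] Hom_set_cat_mid[OF g(1)]
    by (intro bij_betw_byWitness[where f' = "mid g"]) auto
qed

abbreviation is_sset :: "'a sset \<Rightarrow> bool" where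
  "is_sset X \<equiv> is_functor (op_cat delta) set_cat X"

lemma act_in: "is_sset X \<Longrightarrow> \<theta> \<in> Hom delta m n \<Longrightarrow> x \<in> omap X n \<Longrightarrow> act X \<theta> x \<in> omap X m"
  using functor_Hom[of "op_cat delta" set_cat X \<theta> n m] by (auto intro: Hom_set_cat_mid)

lemma act_comp:
  assumes "is_sset X" "\<theta> \<in> Hom delta m n" "\<phi> \<in> Hom delta l m" "x \<in> omap X n"
  shows "act X (\<theta> \<cdot>\<^bsub>delta\<^esub> \<phi>) x = act X \<phi> (act X \<theta> x)"
  using functor_comp[OF assms(1), of \<theta> n m \<phi> l] functor_Hom[OF assms(1), of \<theta> n m] assms(2-)
  by (auto simp: set_cat_comp_mid)

lemma act_Ident: "is_sset X \<Longrightarrow> x \<in> omap X n \<Longrightarrow> act X (Ident delta n) x = x"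
  using functor_Ident[of "op_cat delta" set_cat X n] by simp

lemma mk_sset_simps [simp]:
  "omap (mk_sset S r) n = S n"
  "\<theta> \<in> Hom delta m n \<Longrightarrow> x \<in> S n \<Longrightarrow> act (mk_sset S r) \<theta> x = r \<theta> x"
  by (auto simp: mk_sset_def Hom_def)

lemma mk_sset_is_sset:
  assumes "\<And>m n \<theta> x. \<theta> \<in> Hom delta m n \<Longrightarrow> x \<in> S n \<Longrightarrow> r \<theta> x \<in> S m"
    and "\<And>n x. x \<in> S n \<Longrightarrow> r (Ident delta n) x = x"
    and "\<And>l m n \<theta> \<phi> x. \<theta> \<in> Hom delta m n \<Longrightarrow> \<phi> \<in> Hom delta l m \<Longrightarrow> x \<in> S n \<Longrightarrow> r (\<theta> \<cdot>\<^bsub>delta\<^esub> \<phi>) x = r \<phi> (r \<theta> x)"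
  shows "is_sset (mk_sset S r)"
  unfolding is_functor_def
proof (intro conjI allI ballI impI)
  show "omap (mk_sset S r) \<in> extensional (Ob (op_cat delta))" "amap (mk_sset S r) \<in> extensional (Arr (op_cat delta))"
    by (simp_all add: mk_sset_def)
next
  fix n assume "n \<in> Ob (op_cat delta)"
  then show "omap (mk_sset S r) n \<in> Ob set_cat" by simp
  have "Ident delta n \<in> Hom delta n n" using Ident_Hom[OF is_category_delta] by simp
  then show "amap (mk_sset S r) (Ident (op_cat delta) n) = Ident set_cat (omap (mk_sset S r) n)"
    using assms(2)[of _ n] by (auto simp: mk_sset_def Hom_def fun_eq_iff)
next
  fix a b f assume "f \<in> Hom (op_cat delta) a b"
  then show "amap (mk_sset S r) f \<in> Hom set_cat (omap (mk_sset S r) a) (omap (mk_sset S r) b)"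
    using assms(1)[of f b a] by (auto simp: Hom_set_cat mk_sset_def HomD(1) HomD(2,3)[of f delta b a, simplified])
next
  fix a b c f g assume *: "f \<in> Hom (op_cat delta) a b \<and> g \<in> Hom (op_cat delta) b c"
  then have f: "f \<in> Hom delta b a" and g: "g \<in> Hom delta c b" by auto
  have "f \<cdot>\<^bsub>delta\<^esub> g \<in> Hom delta c a" using Comp_Hom[OF is_category_delta g f] .
  then show "amap (mk_sset S r) (g \<cdot>\<^bsub>op_cat delta\<^esub> f) = amap (mk_sset S r) g \<cdot>\<^bsub>set_cat\<^esub> amap (mk_sset S r) f"
    using assms(1)[OF f] assms(3)[OF f g] HomD[OF f] HomD[OF g] HomD[of "f \<cdot>\<^bsub>delta\<^esub> g" delta c a]
    by (auto simp: mk_sset_def set_cat_comp compose_def fun_eq_iff)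
qed


section \<open>Geometric realization\<close>

abbreviation cells :: "'a sset \<Rightarrow> (nat \<times> 'a \<times> (nat \<Rightarrow> real)) set" where
  "cells X \<equiv> {(n, x, t). x \<in> omap X n \<and> t \<in> standard_simplex n}"

lemma rcls_self [simp]: "p \<in> rcls X p"
  by (simp add: rcls_def)

lemma rcls_eqI: assumes "q \<in> rcls X p" shows "rcls X q = rcls X p"
proof -
  let ?R = "(glue X \<union> (glue X)\<inverse>)\<^sup>*"
  have "sym ?R" by (intro sym_rtrancl) (auto simp: sym_def)
  moreover have "(p, q) \<in> ?R" using assms by (simp add: rcls_def)
  ultimately show ?thesis unfolding rcls_def
    by (auto elim: symE intro: rtrancl_trans dest: symD)
qed

lemma rcls_glue:
  "\<theta> \<in> Hom delta m n \<Longrightarrow> x \<in> omap X n \<Longrightarrow> t \<in> standard_simplex m \<Longrightarrow>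
    rcls X (n, x, push \<theta> t) = rcls X (m, act X \<theta> x, t)"
  by (rule rcls_eqI[symmetric], unfold rcls_def glue_def) blast

text \<open>Induction along a chain of generating identifications, taken in either direction.
  Functions on cells descend to the realization in this way.\<close>

lemma rcls_invariant:
  assumes "\<And>p q. (p, q) \<in> glue X \<Longrightarrow> f p = f q" and "q \<in> rcls X p"
  shows "f q = f p"
proof -
  have "(p, q) \<in> (glue X \<union> (glue X)\<inverse>)\<^sup>*" using assms(2) by (simp add: rcls_def)
  then show ?thesis by (induction rule: rtrancl_induct) (use assms(1) in auto)
qed

text \<open>\<open>realization\<close> is obtained from a predicate through \<open>topology\<close>,
  and the predicate can be recovered once it is known to define a topology. It does, because traces
  on cells commute with intersections and unions.\<close>

lemma openin_realization:
  "openin (realization X) U \<longleftrightarrow> U \<subseteq> rcls X ` cells X \<and>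
     (\<forall>n. \<forall>x\<in>omap X n. openin (subtopology (powertop_real UNIV) (standard_simplex n))
        {t \<in> standard_simplex n. rcls X (n, x, t) \<in> U})"
proof -
  let ?T = "\<lambda>n. subtopology (powertop_real UNIV) (standard_simplex n)"
  let ?s = "\<lambda>n x U. {t \<in> standard_simplex n. rcls X (n, x, t) \<in> U}"
  let ?P = "\<lambda>U. U \<subseteq> rcls X ` cells X \<and> (\<forall>n. \<forall>x\<in>omap X n. openin (?T n) (?s n x U))"
  have "istopology ?P"
    unfolding istopology_def
  proof (rule conjI; intro allI impI)
    fix S T assume ST: "?P S" "?P T"
    have "?s n x (S \<inter> T) = ?s n x S \<inter> ?s n x T" for n x by auto
    with ST show "?P (S \<inter> T)" by (auto intro: openin_Int)
  next
    fix K assume K: "\<forall>S\<in>K. ?P S"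
    have "?s n x (\<Union>K) = (\<Union>S\<in>K. ?s n x S)" for n x by auto
    with K show "?P (\<Union>K)" by (auto intro: openin_Union)
  qed
  then show ?thesis unfolding realization_def by (simp add: topology_inverse')
qed

lemma openin_simplex: "openin (subtopology (powertop_real UNIV) (standard_simplex n)) (standard_simplex n)"
  using openin_topspace[of "subtopology (powertop_real UNIV) (standard_simplex n)"]
  by (simp add: topspace_standard_simplex)

lemma topspace_realization: "topspace (realization X) = rcls X ` cells X"
proof
  show "topspace (realization X) \<subseteq> rcls X ` cells X"
    using openin_topspace[of "realization X"] unfolding openin_realization by blast
  have *: "{t \<in> standard_simplex n. rcls X (n, x, t) \<in> rcls X ` cells X} = standard_simplex n"
    if "x \<in> omap X n" for n x using that by auto
  have "openin (realization X) (rcls X ` cells X)"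
    unfolding openin_realization by (simp add: * openin_simplex)
  then show "rcls X ` cells X \<subseteq> topspace (realization X)" by (rule openin_subset)
qed

text \<open>\<open>realization_map\<close> takes the union of the image classes of all
  representatives. By invariance under gluing these classes are all the same one.\<close>

lemma realization_map_rcls:
  assumes X: "is_sset X" and f: "sset_map X Y f" and p: "(n, x, t) \<in> cells X"
  shows "realization_map Y f (rcls X (n, x, t)) = rcls Y (n, f n x, t)"
proof -
  define g where "g = (\<lambda>(n, x, t). rcls Y (n, f n x, t))"
  have "g p = g q" if "(p, q) \<in> glue X" for p q
  proof -
    obtain m n \<theta> x t where *: "p = (n, x, push \<theta> t)" "q = (m, act X \<theta> x, t)"
      "\<theta> \<in> Hom delta m n" "x \<in> omap X n" "t \<in> standard_simplex m"
      using \<open>(p, q) \<in> glue X\<close> by (auto simp: glue_def)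
    then have "f m (act X \<theta> x) = act Y \<theta> (f n x)" "f n x \<in> omap Y n" using f by (auto simp: sset_map_def)
    then show ?thesis using rcls_glue[of \<theta> m n "f n x" Y t] * by (simp add: g_def)
  qed
  then have *: "g q = g (n, x, t)" if "q \<in> rcls X (n, x, t)" for q using that by (rule rcls_invariant)
  have "realization_map Y f (rcls X (n, x, t)) = (\<Union>q\<in>rcls X (n, x, t). g q)"
    unfolding realization_map_def g_def ..
  also have "\<dots> = (\<Union>q\<in>rcls X (n, x, t). g (n, x, t))" by (rule SUP_cong[OF refl *])
  also have "\<dots> = g (n, x, t)" using rcls_self[of "(n, x, t)" X] by blast
  finally show ?thesis by (simp add: g_def)
qed

text \<open>The quotient topology is tested cell by cell, and a preimage has the same trace on the
  cell of \<open>x\<close> as the original set has on the cell of \<open>f n x\<close>.\<close>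

lemma continuous_realization_map:
  assumes X: "is_sset X" and f: "sset_map X Y f"
  shows "continuous_map (realization X) (realization Y) (realization_map Y f)"
  unfolding continuous_map_def
proof (intro conjI allI impI)
  show "realization_map Y f \<in> topspace (realization X) \<rightarrow> topspace (realization Y)"
    using f by (auto simp: topspace_realization realization_map_rcls[OF X f] sset_map_def)
  fix U assume "openin (realization Y) U"
  then have U: "openin (subtopology (powertop_real UNIV) (standard_simplex n))
      {t \<in> standard_simplex n. rcls Y (n, f n x, t) \<in> U}" if "x \<in> omap X n" for n x
    using f that by (auto simp: openin_realization sset_map_def)
  have "{t \<in> standard_simplex n. rcls X (n, x, t) \<in> {c \<in> topspace (realization X). realization_map Y f c \<in> U}}
      = {t \<in> standard_simplex n. rcls Y (n, f n x, t) \<in> U}" if "x \<in> omap X n" for n x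
    using that by (auto simp: topspace_realization realization_map_rcls[OF X f])
  then show "openin (realization X) {c \<in> topspace (realization X). realization_map Y f c \<in> U}"
    using U unfolding openin_realization by (simp add: topspace_realization)
qed

lemma realization_map_comp:
  assumes X: "is_sset X" and Y: "is_sset Y" and f: "sset_map X Y f" and g: "sset_map Y Z g"
    and h: "sset_map X Z h" and gf: "\<And>n x. x \<in> omap X n \<Longrightarrow> h n x = g n (f n x)"
    and c: "c \<in> topspace (realization X)"
  shows "realization_map Z h c = realization_map Z g (realization_map Y f c)"
  using c f by (auto simp: topspace_realization realization_map_rcls[OF X f] realization_map_rcls[OF X h]
      realization_map_rcls[OF Y g] gf sset_map_def)

lemma sset_map_inverse:
  assumes X: "is_sset X" and f: "sset_map X Y f" and bij: "\<And>n. bij_betw (f n) (omap X n) (omap Y n)"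
  shows "sset_map Y X (\<lambda>n. inv_into (omap X n) (f n))"
  unfolding sset_map_def
proof (intro conjI allI ballI)
  fix n x assume x: "x \<in> omap Y n"
  then show "inv_into (omap X n) (f n) x \<in> omap X n"
    using bij[of n] by (metis bij_betw_def inv_into_into)
next
  fix m n \<theta> x assume \<theta>: "\<theta> \<in> Hom delta m n" and x: "x \<in> omap Y n"
  let ?y = "inv_into (omap X n) (f n) x"
  have y: "?y \<in> omap X n" "f n ?y = x" using bij[of n] x
    by (metis bij_betw_def inv_into_into, metis bij_betw_inv_into_right)
  then have "act Y \<theta> x = f m (act X \<theta> ?y)" using f \<theta> by (simp add: sset_map_def)
  then show "inv_into (omap X m) (f m) (act Y \<theta> x) = act X \<theta> ?y"
    using bij_betw_inv_into_left[OF bij act_in[OF X \<theta> y(1)]] by simp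
qed

lemma homeomorphic_realization_map:
  assumes X: "is_sset X" and Y: "is_sset Y" and f: "sset_map X Y f"
    and bij: "\<And>n. bij_betw (f n) (omap X n) (omap Y n)"
  shows "homeomorphic_maps (realization X) (realization Y) (realization_map Y f)
    (realization_map X (\<lambda>n. inv_into (omap X n) (f n)))"
proof -
  let ?g = "\<lambda>n. inv_into (omap X n) (f n)"
  have g: "sset_map Y X ?g" by (rule sset_map_inverse[OF X f bij])
  have fY: "f n x \<in> omap Y n" if "x \<in> omap X n" for n x using f that by (simp add: sset_map_def)
  have gX: "?g n x \<in> omap X n" if "x \<in> omap Y n" for n x using g that by (simp add: sset_map_def)
  show ?thesis
    unfolding homeomorphic_maps_def
    using continuous_realization_map[OF X f] continuous_realization_map[OF Y g]
      bij_betw_inv_into_left[OF bij] bij_betw_inv_into_right[OF bij]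
    by (auto simp: topspace_realization realization_map_rcls[OF X f] realization_map_rcls[OF Y g] fY gX)
qed

text \<open>Paths and spheroids travel from \<open>X'\<close> to \<open>X\<close> along
  \<open>h\<close> and back along \<open>k\<close>. The map \<open>f'\<close> is compared with the
  composite on points of \<open>X'\<close> only, because realization maps compose only on points of
  the realization.\<close>

lemma weak_homotopy_equiv_comp_homeomorphic:
  assumes hk: "homeomorphic_maps X' X h k" and f: "weak_homotopy_equiv X Y f"
    and f': "\<And>x. x \<in> topspace X' \<Longrightarrow> f' x = f (h x)"
  shows "weak_homotopy_equiv X' Y f'"
proof -
  have h: "continuous_map X' X h" and k: "continuous_map X X' k"
    and kh: "\<And>x. x \<in> topspace X' \<Longrightarrow> k (h x) = x" and hk': "\<And>x. x \<in> topspace X \<Longrightarrow> h (k x) = x"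
    using hk by (auto simp: homeomorphic_maps_def)
  have hX: "h x \<in> topspace X" if "x \<in> topspace X'" for x
    using h that by (auto simp: continuous_map_def)
  have kX: "k x \<in> topspace X'" if "x \<in> topspace X" for x
    using k that by (auto simp: continuous_map_def)
  have cf: "continuous_map X Y f"
    and s0: "\<And>y. y \<in> topspace Y \<Longrightarrow> \<exists>x\<in>topspace X. path_component_of Y (f x) y"
    and i0: "\<And>x x'. x \<in> topspace X \<Longrightarrow> x' \<in> topspace X \<Longrightarrow> path_component_of Y (f x) (f x') \<Longrightarrow> path_component_of X x x'"
    and sn: "\<And>n x q. n \<ge> 1 \<Longrightarrow> x \<in> topspace X \<Longrightarrow> q \<in> spheroids n Y (f x) \<Longrightarrow> \<exists>g\<in>spheroids n X x. homotopic_rel n Y (f x) (f \<circ> g) q"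
    and inj: "\<And>n x g g'. n \<ge> 1 \<Longrightarrow> x \<in> topspace X \<Longrightarrow> g \<in> spheroids n X x \<Longrightarrow> g' \<in> spheroids n X x \<Longrightarrow>
      homotopic_rel n Y (f x) (f \<circ> g) (f \<circ> g') \<Longrightarrow> homotopic_rel n X x g g'"
    using f unfolding weak_homotopy_equiv_def by blast+
  have path: "path_component_of B (m x) (m y)" if "continuous_map A B m" "path_component_of A x y"
    for A :: "'z topology" and B :: "'w topology" and m x y
    using that unfolding path_component_of_def by (metis comp_apply pathin_compose)
  have sph: "h \<circ> g \<in> spheroids n X (h x)" if "g \<in> spheroids n X' x" for n x g
    using that h by (force simp: spheroids_def intro: continuous_map_compose)
  have sphk: "k \<circ> g \<in> spheroids n X' x" if "g \<in> spheroids n X (h x)" "x \<in> topspace X'" for n x g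
    using that k kh[of x] by (force simp: spheroids_def intro: continuous_map_compose)
  have sph_in: "g u \<in> topspace X'" if "g \<in> spheroids n X' x" "u \<in> topspace (cube n)" for n x g u
    using that by (auto simp: spheroids_def continuous_map_def)
  have bdry: "cube_bdry n \<subseteq> topspace (cube n)" for n by (auto simp: cube_bdry_def)
  \<comment> \<open>Homotopy classes see only values on the cube, so maps may be replaced by maps
    equal there.\<close>
  have eqrel: "homotopic_rel n Y y a b" if "homotopic_rel n Y y a' b'"
    "\<And>u. u \<in> topspace (cube n) \<Longrightarrow> a u = a' u" "\<And>u. u \<in> topspace (cube n) \<Longrightarrow> b u = b' u"
    for n a b a' b' and Y :: "'z topology" and y
    using that bdry[of n] unfolding homotopic_rel_def
    by (elim homotopic_with_eq) (auto simp: image_subset_iff subset_iff)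
  have comp: "homotopic_rel n B (m y) (m \<circ> a) (m \<circ> b)" if "homotopic_rel n A y a b" "continuous_map A B m"
    for n y a b m and A :: "'z topology" and B :: "'w topology"
    using that unfolding homotopic_rel_def
    by (elim homotopic_with_compose_continuous_map_left) (auto simp: image_subset_iff)
  show ?thesis
    unfolding weak_homotopy_equiv_def
  proof (intro conjI ballI allI impI)
    show "continuous_map X' Y f'"
      using continuous_map_eq[OF continuous_map_compose[OF h cf], of f'] f' by simp
  next
    fix y assume "y \<in> topspace Y"
    then obtain x where x: "x \<in> topspace X" "path_component_of Y (f x) y" using s0 by blast
    then show "\<exists>x\<in>topspace X'. path_component_of Y (f' x) y"
      using kX f' hk' by (intro bexI[of _ "k x"]) auto
  next
    fix x x' assume x: "x \<in> topspace X'" "x' \<in> topspace X'" and p: "path_component_of Y (f' x) (f' x')"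
    then have "path_component_of X (h x) (h x')" using i0 f' hX by metis
    then show "path_component_of X' x x'" using path[OF k] kh x by metis
  next
    fix n :: nat and x q assume n: "n \<ge> 1" and x: "x \<in> topspace X'" and q: "q \<in> spheroids n Y (f' x)"
    then obtain g where g: "g \<in> spheroids n X (h x)" "homotopic_rel n Y (f (h x)) (f \<circ> g) q"
      using sn[OF n hX[OF x]] f' by metis
    \<comment> \<open>The spheroid found in \<open>X\<close> is brought back by \<open>k\<close>;
      composing with \<open>f'\<close> passes through \<open>X\<close> again and cancels
      \<open>k\<close>.\<close>
    have "homotopic_rel n Y (f' x) (f' \<circ> (k \<circ> g)) q"
      unfolding f'[OF x]
    proof (rule eqrel[OF g(2)])
      fix u assume "u \<in> topspace (cube n)"
      then have "g u \<in> topspace X" using g(1) by (auto simp: spheroids_def continuous_map_def)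
      then show "(f' \<circ> (k \<circ> g)) u = (f \<circ> g) u" using f' hk' kX by simp
    qed simp
    then show "\<exists>g\<in>spheroids n X' x. homotopic_rel n Y (f' x) (f' \<circ> g) q" using sphk[OF g(1) x] by blast
  next
    fix n :: nat and x g g' assume n: "n \<ge> 1" and x: "x \<in> topspace X'"
      and g: "g \<in> spheroids n X' x" and g': "g' \<in> spheroids n X' x"
      and hr: "homotopic_rel n Y (f' x) (f' \<circ> g) (f' \<circ> g')"
    have "homotopic_rel n Y (f (h x)) (f \<circ> (h \<circ> g)) (f \<circ> (h \<circ> g'))"
      unfolding f'[OF x, symmetric]
      by (rule eqrel[OF hr]) (simp_all add: f' sph_in[OF g] sph_in[OF g'])
    then have "homotopic_rel n X (h x) (h \<circ> g) (h \<circ> g')"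
      using inj[OF n hX[OF x] sph[OF g] sph[OF g']] by blast
    then have "homotopic_rel n X' (k (h x)) (k \<circ> (h \<circ> g)) (k \<circ> (h \<circ> g'))" by (rule comp[OF _ k])
    then show "homotopic_rel n X' x g g'"
      unfolding kh[OF x]
      by (rule eqrel) (simp_all add: sph_in[OF g] sph_in[OF g'] kh)
  qed
qed

lemma weak_homotopy_equiv_id: "weak_homotopy_equiv X X (\<lambda>x. x)"
proof -
  have "homotopic_rel n X x h h" if "h \<in> spheroids n X x" for n x h
    using that unfolding homotopic_rel_def spheroids_def by auto
  moreover have "(\<lambda>x. x) \<circ> g = g" for g :: "(nat \<Rightarrow> real) \<Rightarrow> 'a" by auto
  ultimately show ?thesis
    unfolding weak_homotopy_equiv_def by (auto simp: path_component_of_refl intro!: bexI)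
qed

lemma sset_map_comp:
  assumes X: "is_sset X" and f: "sset_map X Y f" and g: "sset_map Y Z g"
    and gf: "\<And>n x. x \<in> omap X n \<Longrightarrow> h n x = g n (f n x)"
  shows "sset_map X Z h"
  using f g act_in[OF X] unfolding sset_map_def by (simp add: gf)

text \<open>The three simplicial sets may have simplices in different types, so that
  \<open>Z\<close> can be a homotopy limit.\<close>

lemma sset_weq_comp_bij:
  assumes X: "is_sset X" and Y: "is_sset Y" and f: "sset_map X Y f"
    and bij: "\<And>n. bij_betw (f n) (omap X n) (omap Y n)"
    and g: "sset_weq Y Z g" and gf: "\<And>n x. x \<in> omap X n \<Longrightarrow> h n x = g n (f n x)"
  shows "sset_weq X Z h"
proof -
  have gm: "sset_map Y Z g" and gw: "weak_homotopy_equiv (realization Y) (realization Z) (realization_map Z g)"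
    using g by (auto simp: sset_weq_def)
  have h: "sset_map X Z h" by (rule sset_map_comp[OF X f gm gf])
  show ?thesis
    unfolding sset_weq_def
    using h weak_homotopy_equiv_comp_homeomorphic[OF homeomorphic_realization_map[OF X Y f bij] gw
        realization_map_comp[OF X Y f gm h gf]] by blast
qed

lemma bij_sset_weq:
  assumes X: "is_sset X" and Y: "is_sset Y" and f: "sset_map X Y f"
    and bij: "\<And>n. bij_betw (f n) (omap X n) (omap Y n)"
  shows "sset_weq X Y f"
  unfolding sset_weq_def
  using f weak_homotopy_equiv_comp_homeomorphic[OF homeomorphic_realization_map[OF X Y f bij] weak_homotopy_equiv_id, of "realization_map Y f"]
  by blast


section \<open>Path components of the realization\<close>

text \<open>Here \<open>c\<close> stands for a map out of the set of components: it agrees at the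
  two ends of each edge. Vertex 0 is joined to every other vertex of a simplex by one edge, that of
  \<open>delta_edge\<close>.\<close>

lemma vertices_equal:
  assumes X: "is_sset X" and c: "\<And>e. e \<in> omap X (Suc 0) \<Longrightarrow> c (act X (coface 0 0) e) = c (act X (coface 0 (Suc 0)) e)"
    and x: "x \<in> omap X n" and v: "v \<le> n"
  shows "c (act X (vertex n v) x) = c (act X (vertex n 0) x)"
proof (cases "v = 0")
  case False
  then obtain \<theta> where \<theta>: "\<theta> \<in> Hom delta (Suc 0) n" "\<theta> \<cdot>\<^bsub>delta\<^esub> coface 0 (Suc 0) = vertex n 0" "\<theta> \<cdot>\<^bsub>delta\<^esub> coface 0 0 = vertex n v"
    using delta_edge[of 0 v n] v by auto
  have co: "coface 0 i \<in> Hom delta 0 (Suc 0)" for i using coface_Hom[of 0 i] by simp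
  show ?thesis
    using c[OF act_in[OF X \<theta>(1) x]] act_comp[OF X \<theta>(1) co x, of 0] act_comp[OF X \<theta>(1) co x, of "Suc 0"]
    unfolding \<theta>(2,3) by simp
qed simp

text \<open>The value of \<open>c\<close> at the first vertex of a cell respects gluing and so is a
  function on the realization; being constant on each cell, it has open level sets. A path is
  connected and stays in one of them.\<close>

lemma component_invariant:
  assumes X: "is_sset X" and c: "\<And>e. e \<in> omap X (Suc 0) \<Longrightarrow> c (act X (coface 0 0) e) = c (act X (coface 0 (Suc 0)) e)"
    and p: "(n, x, t) \<in> cells X" and q: "(m, y, u) \<in> cells X"
    and path: "path_component_of (realization X) (rcls X (n, x, t)) (rcls X (m, y, u))"
  shows "c (act X (vertex n 0) x) = c (act X (vertex m 0) y)"
proof -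
  define C where "C = (\<lambda>(n, x, t :: nat \<Rightarrow> real). c (act X (vertex n 0) x))"
  have glue: "C p = C q" if pq: "(p, q) \<in> glue X" for p q
  proof -
    obtain m n \<theta> x t where *: "p = (n, x, push \<theta> t)" "q = (m, act X \<theta> x, t)"
      "\<theta> \<in> Hom delta m n" "x \<in> omap X n" "t \<in> standard_simplex m"
      using pq by (auto simp: glue_def)
    \<comment> \<open>Acting by \<open>\<theta>\<close> moves the first vertex to the vertex
      \<open>mid \<theta> 0\<close> of the same simplex.\<close>
    have "act X (vertex m 0) (act X \<theta> x) = act X (vertex n (mid \<theta> 0)) x"
      using act_comp[OF X *(3) vertex_Hom[of 0 m] *(4)] delta_comp_vertex[OF *(3), of 0] by simp
    moreover have "mid \<theta> 0 \<le> n" using *(3) by (auto simp: delta_Hom_iff)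
    ultimately show ?thesis using vertices_equal[OF X c *(4), of "mid \<theta> 0"]
      unfolding C_def *(1,2) by simp
  qed
  \<comment> \<open>So \<open>C\<close> depends only on the point of the realization.\<close>
  have rc: "C q = C p" if "rcls X p = rcls X q" for p q
    by (rule rcls_invariant[where f = C and X = X, OF glue]) (use that rcls_self[of q X] in simp_all)
  let ?V = "\<lambda>D. rcls X ` {p \<in> cells X. C p \<in> D}"
  have V: "rcls X p \<in> ?V D \<longleftrightarrow> C p \<in> D" if "p \<in> cells X" for p D
  proof
    assume "rcls X p \<in> ?V D"
    then obtain q where "rcls X p = rcls X q" "C q \<in> D" by blast
    then show "C p \<in> D" using rc by metis
  qed (use that in blast)
  have op: "openin (realization X) (?V D)" for D
    unfolding openin_realization
  proof (intro conjI allI ballI)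
    fix n x assume x: "x \<in> omap X n"
    \<comment> \<open>A cell lies entirely inside or entirely outside the set of points with value
      in \<open>D\<close>.\<close>
    have "{t \<in> standard_simplex n. rcls X (n, x, t) \<in> ?V D} =
        (if c (act X (vertex n 0) x) \<in> D then standard_simplex n else {})"
      using V[of "(n, x, _)" D] x by (auto simp: C_def)
    then show "openin (subtopology (powertop_real UNIV) (standard_simplex n)) {t \<in> standard_simplex n. rcls X (n, x, t) \<in> ?V D}"
      by (simp add: openin_simplex)
  qed auto
  \<comment> \<open>The level set through the starting point and its complement are disjoint open
    sets that cover the path.\<close>
  let ?U = "?V {C (n, x, t)}"
  let ?W = "?V (- {C (n, x, t)})"
  obtain g where g: "pathin (realization X) g" "g 0 = rcls X (n, x, t)" "g 1 = rcls X (m, y, u)"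
    using path by (auto simp: path_component_of_def)
  let ?S = "g ` {0..1}"
  have S: "connectedin (realization X) ?S" "rcls X (n, x, t) \<in> ?S" "rcls X (m, y, u) \<in> ?S"
    using connectedin_path_image[OF g(1)] g(2,3) by (auto simp: image_iff)
  have cover: "?S \<subseteq> ?U \<union> ?W"
    using connectedin_subset_topspace[OF S(1)] unfolding topspace_realization by blast
  have disj: "?U \<inter> ?W = {}"
  proof (rule equals0I)
    fix z assume z: "z \<in> ?U \<inter> ?W"
    then obtain p where "p \<in> cells X" "z = rcls X p" "C p \<in> {C (n, x, t)}" by blast
    then show False using z V[of p "- {C (n, x, t)}"] by blast
  qed
  have sep: "W \<inter> S = {}" if "connectedin T S" "openin T U" "openin T W" "S \<subseteq> U \<union> W" "U \<inter> W = {}" "U \<inter> S \<noteq> {}"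
    for T :: "'z topology" and U W S
    using that unfolding connectedin by blast
  have mem: "z \<in> U" if "z \<in> S" "S \<subseteq> U \<union> W" "W \<inter> S = {}" for z :: 'z and U W S
    using that by blast
  have meet: "U \<inter> S \<noteq> {}" if "z \<in> S" "z \<in> U" for z :: 'z and U S
    using that by blast
  have "rcls X (n, x, t) \<in> ?U" using V[OF p, of "{C (n, x, t)}"] by (metis singletonI)
  then have "?U \<inter> ?S \<noteq> {}" by (rule meet[OF S(2)])
  then have "?W \<inter> ?S = {}" by (rule sep[OF S(1) op op cover disj])
  then have "rcls X (m, y, u) \<in> ?U" by (rule mem[OF S(3) cover])
  then have "C (m, y, u) = C (n, x, t)" using V[OF q] by blast
  then show ?thesis by (simp add: C_def)
qed

text \<open>The only point of the standard 0-simplex, as a coordinate function on all of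
  \<open>nat\<close>.\<close>

abbreviation pt0 :: "nat \<Rightarrow> real" where
  "pt0 \<equiv> \<lambda>j. if j = 0 then 1 else 0"

text \<open>The characteristic map of \<open>e\<close> sends the segment between the two vertices of
  the standard 1-simplex to a path, whose ends gluing identifies with the two faces of
  \<open>e\<close>.\<close>

lemma edge_path:
  assumes X: "is_sset X" and e: "e \<in> omap X (Suc 0)"
  shows "path_component_of (realization X) (rcls X (0, act X (coface 0 (Suc 0)) e, pt0)) (rcls X (0, act X (coface 0 0) e, pt0))"
proof -
  \<comment> \<open>Barycentric coordinates \<open>(1 - s, s)\<close>, running from vertex 0 to
    vertex 1.\<close>
  define l where "l = (\<lambda>(s :: real) (j :: nat). if j = 0 then 1 - s else if j = 1 then s else 0)"
  have l: "l s \<in> standard_simplex (Suc 0)" if "s \<in> {0..1}" for s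
    using that by (auto simp: l_def standard_simplex_def)
  have ct: "continuous_map (top_of_set {0..1}) (subtopology (powertop_real UNIV) (standard_simplex (Suc 0))) l"
    unfolding continuous_map_in_subtopology continuous_map_componentwise_UNIV
  proof (intro conjI allI)
    fix k
    have "continuous_on {0..1} (\<lambda>s. l s k)"
      by (cases "k = 0"; cases "k = 1") (auto simp: l_def intro!: continuous_intros)
    then show "continuous_map (top_of_set {0..1}) euclideanreal (\<lambda>s. l s k)" by simp
  qed (use l in auto)
  \<comment> \<open>The characteristic map of a simplex is continuous by the very definition of the
    quotient topology.\<close>
  have "continuous_map (subtopology (powertop_real UNIV) (standard_simplex (Suc 0))) (realization X) (\<lambda>t. rcls X (Suc 0, e, t))"
    unfolding continuous_map_def using e
    by (auto simp: topspace_realization openin_realization topspace_standard_simplex)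
  then have "continuous_map (top_of_set {0..1}) (realization X) ((\<lambda>t. rcls X (Suc 0, e, t)) \<circ> l)"
    using ct continuous_map_compose by blast
  moreover have "push (coface 0 (Suc 0)) pt0 = l 0" "push (coface 0 0) pt0 = l 1"
  proof -
    have a: "{j. j \<le> (0::nat) \<and> (if j < Suc 0 then j else Suc j) = i} = (if i = 0 then {0} else {})"
     and b: "{j. j \<le> (0::nat) \<and> Suc j = i} = (if i = 1 then {0} else {})" for i by auto
    show "push (coface 0 (Suc 0)) pt0 = l 0" "push (coface 0 0) pt0 = l 1"
      by (rule ext, auto simp: push_def coface_def l_def cong: conj_cong)+
  qed
  moreover have "pt0 \<in> standard_simplex 0" by simp
  moreover have "coface 0 i \<in> Hom delta 0 (Suc 0)" for i using coface_Hom[of 0 i] by simp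
  ultimately show ?thesis
    unfolding path_component_of_def pathin_def
    using rcls_glue[of "coface 0 (Suc 0)" 0 "Suc 0" e X pt0] rcls_glue[of "coface 0 0" 0 "Suc 0" e X pt0] e
    by (intro exI[of _ "(\<lambda>t. rcls X (Suc 0, e, t)) \<circ> l"]) simp
qed


text \<open>Surjectivity on path components, read through an invariant \<open>c\<close> of the
  components of \<open>Y\<close>. The point found in the realization of \<open>X\<close> may lie
  inside a cell; the first vertex of that cell replaces it.\<close>

lemma sset_weq_surj_components:
  assumes X: "is_sset X" and Y: "is_sset Y" and f: "sset_weq X Y f" and y: "y \<in> omap Y 0"
    and c: "\<And>e. e \<in> omap Y (Suc 0) \<Longrightarrow> c (act Y (coface 0 0) e) = c (act Y (coface 0 (Suc 0)) e)"
  shows "\<exists>x\<in>omap X 0. c (f 0 x) = c y"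
proof -
  have fm: "sset_map X Y f" using f by (simp add: sset_weq_def)
  have pt: "pt0 \<in> standard_simplex 0" by simp
  have "rcls Y (0, y, pt0) \<in> topspace (realization Y)" using y pt by (auto simp: topspace_realization)
  then obtain z where z: "z \<in> topspace (realization X)"
    "path_component_of (realization Y) (realization_map Y f z) (rcls Y (0, y, pt0))"
    using f unfolding sset_weq_def weak_homotopy_equiv_def by blast
  then obtain n x t where nxt: "(n, x, t) \<in> cells X" "z = rcls X (n, x, t)"
    unfolding topspace_realization by blast
  then have x: "x \<in> omap X n" "t \<in> standard_simplex n" by auto
  then have fx: "f n x \<in> omap Y n" using fm by (simp add: sset_map_def)
  have v: "vertex n 0 \<in> Hom delta 0 n" by (simp add: vertex_Hom)
  have "path_component_of (realization Y) (rcls Y (n, f n x, t)) (rcls Y (0, y, pt0))"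
    using z(2) nxt by (simp add: realization_map_rcls[OF X fm])
  then have "c (act Y (vertex n 0) (f n x)) = c (act Y (vertex 0 0) y)"
    using fx x y pt by (intro component_invariant[OF Y c]) auto
  moreover have "act Y (vertex n 0) (f n x) = f 0 (act X (vertex n 0) x)"
    using fm v x unfolding sset_map_def by metis
  moreover have "act Y (vertex 0 0) y = y" using act_Ident[OF Y y] by (simp add: vertex_0_0)
  ultimately show ?thesis using act_in[OF X v x(1)] by auto
qed

text \<open>A single edge of \<open>Y\<close> yields a path between the two image points;
  injectivity on path components gives a path in the realization of \<open>X\<close>, along which
  \<open>c\<close> is constant.\<close>

lemma sset_weq_inj_components:
  assumes X: "is_sset X" and Y: "is_sset Y" and f: "sset_weq X Y f"
    and x: "x \<in> omap X 0" and x': "x' \<in> omap X 0" and e: "e \<in> omap Y (Suc 0)"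
    and ends: "act Y (coface 0 (Suc 0)) e = f 0 x" "act Y (coface 0 0) e = f 0 x'"
    and c: "\<And>e. e \<in> omap X (Suc 0) \<Longrightarrow> c (act X (coface 0 0) e) = c (act X (coface 0 (Suc 0)) e)"
  shows "c x = c x'"
proof -
  have fm: "sset_map X Y f" using f by (simp add: sset_weq_def)
  have pt: "pt0 \<in> standard_simplex 0" by simp
  have top: "rcls X (0, x, pt0) \<in> topspace (realization X)" "rcls X (0, x', pt0) \<in> topspace (realization X)"
    using x x' pt by (auto simp: topspace_realization)
  have "path_component_of (realization Y) (realization_map Y f (rcls X (0, x, pt0))) (realization_map Y f (rcls X (0, x', pt0)))"
    using edge_path[OF Y e] x x' pt by (simp add: realization_map_rcls[OF X fm] ends)
  then have "path_component_of (realization X) (rcls X (0, x, pt0)) (rcls X (0, x', pt0))"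
    using f top unfolding sset_weq_def weak_homotopy_equiv_def by blast
  then have "c (act X (vertex 0 0) x) = c (act X (vertex 0 0) x')"
    using x x' pt by (intro component_invariant[OF X c]) auto
  then show ?thesis using act_Ident[OF X x] act_Ident[OF X x'] by (simp add: vertex_0_0)
qed

section \<open>Discrete simplicial sets\<close>

definition discrete_sset :: "'a sset \<Rightarrow> bool" where
  "discrete_sset X \<longleftrightarrow> is_sset X \<and> (\<forall>n. \<forall>x\<in>omap X n. \<exists>y\<in>omap X 0. x = act X (collapse n) y)"

text \<open>The object 0 is terminal in the simplex category, so an arrow followed by a collapse is
  again a collapse.\<close>

lemma act_degenerate:
  assumes "is_sset X" "\<theta> \<in> Hom delta m n" "y \<in> omap X 0"
  shows "act X \<theta> (act X (collapse n) y) = act X (collapse m) y"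
  using act_comp[OF assms(1) collapse_Hom assms(2,3)] delta_collapse_comp[OF assms(2)] by simp

lemma collapse_0: "collapse 0 = Ident delta 0"
  by (auto simp: collapse_def)

text \<open>All edges are degenerate, so their two ends coincide and the identity can serve as the
  invariant \<open>c\<close> in the lemmas on components: \<open>f\<close> is bijective in degree 0.
  Higher degrees are copies of degree 0 through \<open>collapse\<close> and
  \<open>vertex\<close>.\<close>

lemma discrete_sset_weq_bij:
  assumes dX: "discrete_sset X" and dY: "discrete_sset Y" and f: "sset_weq X Y f"
  shows "bij_betw (f n) (omap X n) (omap Y n)"
proof -
  have X: "is_sset X" and Y: "is_sset Y" using dX dY by (auto simp: discrete_sset_def)
  have fm: "sset_map X Y f" using f by (simp add: sset_weq_def)
  have fin: "f n x \<in> omap Y n" if "x \<in> omap X n" for n x using fm that by (simp add: sset_map_def)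
  have fnat: "f m (act X \<theta> x) = act Y \<theta> (f n x)" if "\<theta> \<in> Hom delta m n" "x \<in> omap X n" for m n \<theta> x
    using fm that by (simp add: sset_map_def)
  have co: "coface 0 i \<in> Hom delta 0 (Suc 0)" for i by (rule coface_Hom)
  have inv: "act Z (coface 0 0) e = act Z (coface 0 (Suc 0)) e" if "discrete_sset Z" "e \<in> omap Z (Suc 0)" for Z :: "'z sset" and e
    using that act_degenerate[OF _ co] unfolding discrete_sset_def by metis
  have surj: "\<exists>x\<in>omap X 0. f 0 x = y" if "y \<in> omap Y 0" for y
    using sset_weq_surj_components[OF X Y f that, of "\<lambda>y. y"] inv[OF dY] by simp
  \<comment> \<open>The degenerate edge at \<open>f 0 x\<close> joins the image of \<open>x\<close>
    to that of \<open>x'\<close>, since the two images are equal.\<close>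
  have inj: "x = x'" if "x \<in> omap X 0" "x' \<in> omap X 0" "f 0 x = f 0 x'" for x x'
  proof (rule sset_weq_inj_components[OF X Y f that(1,2), of "act Y (collapse (Suc 0)) (f 0 x)" "\<lambda>y. y"])
    show "act Y (collapse (Suc 0)) (f 0 x) \<in> omap Y (Suc 0)"
      using act_in[OF Y collapse_Hom] fin that(1) by blast
    show "act Y (coface 0 (Suc 0)) (act Y (collapse (Suc 0)) (f 0 x)) = f 0 x"
      "act Y (coface 0 0) (act Y (collapse (Suc 0)) (f 0 x)) = f 0 x'"
      using act_degenerate[OF Y co fin[OF that(1)]] act_Ident[OF Y fin[OF that(1)]] that(3) collapse_0 by simp_all
  qed (use inv[OF dX] in simp)
  have v: "vertex n 0 \<in> Hom delta 0 n" by (simp add: vertex_Hom)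
  have cv: "act Z (vertex n 0) (act Z (collapse n) z) = z" if "is_sset Z" "z \<in> omap Z 0" for Z :: "'z sset" and z
    using act_degenerate[OF that(1) v that(2)] act_Ident[OF that] by (simp add: collapse_0)
  show ?thesis
    unfolding bij_betw_def
  proof
    show "inj_on (f n) (omap X n)"
    proof (rule inj_onI)
      fix x x' assume xx: "x \<in> omap X n" "x' \<in> omap X n" "f n x = f n x'"
      then obtain z z' where z: "z \<in> omap X 0" "x = act X (collapse n) z" "z' \<in> omap X 0" "x' = act X (collapse n) z'"
        using dX unfolding discrete_sset_def by metis
      have "f 0 z = f 0 z'"
        using fnat[OF v xx(1)] fnat[OF v xx(2)] xx(3) cv[OF X z(1)] cv[OF X z(3)] z by simp
      then show "x = x'" using inj[OF z(1,3)] z(2,4) by simp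
    qed
    show "f n ` omap X n = omap Y n"
    proof (intro equalityI subsetI)
      fix y assume "y \<in> omap Y n"
      then obtain z where z: "z \<in> omap Y 0" "y = act Y (collapse n) z"
        using dY unfolding discrete_sset_def by metis
      then obtain x where x: "x \<in> omap X 0" "f 0 x = z" using surj by blast
      have "f n (act X (collapse n) x) = y" using fnat[OF collapse_Hom x(1)] x z by simp
      then show "y \<in> f n ` omap X n" using act_in[OF X collapse_Hom x(1)] by blast
    qed (use fin in blast)
  qed
qed

text \<open>The property of an indexing object that \<open>tensor_map\<close> relies on: its
  equation for an arrow \<open>\<theta>\<close> evaluates the family at
  \<open>act K \<theta> x\<close>.\<close>

definition act_closed :: "'a sset \<Rightarrow> bool" where
  "act_closed K \<longleftrightarrow> (\<forall>m n. \<forall>\<theta>\<in>Hom delta m n. \<forall>x\<in>omap K n. act K \<theta> x \<in> omap K m)"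

lemma act_closedD: "act_closed K \<Longrightarrow> \<theta> \<in> Hom delta m n \<Longrightarrow> x \<in> omap K n \<Longrightarrow> act K \<theta> x \<in> omap K m"
  by (simp add: act_closed_def)

lemma act_closed_std: "act_closed (std l)"
  unfolding act_closed_def std_def
  by (auto simp: mk_sset_simps(2) mk_sset_simps(1) intro: Comp_Hom[OF is_category_delta])

lemma act_closed_bdry: "act_closed (bdry l)"
  unfolding act_closed_def bdry_def mk_sset_simps(1)
proof (intro allI ballI)
  fix m n \<theta> x assume \<theta>: "\<theta> \<in> Hom delta m n" and x: "x \<in> {\<tau> \<in> Hom delta n l. mid \<tau> ` {..n} \<noteq> {..l}}"
  \<comment> \<open>Precomposition can only shrink the image, so a simplex that misses a vertex
    keeps missing it.\<close>
  have "mid (x \<cdot>\<^bsub>delta\<^esub> \<theta>) ` {..m} \<subseteq> mid x ` {..n}" and "mid x ` {..n} \<subseteq> {..l}"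
    using \<theta> x by (auto simp: delta_comp delta_Hom_iff compose_def)
  then have "mid (x \<cdot>\<^bsub>delta\<^esub> \<theta>) ` {..m} \<noteq> {..l}" using x by blast
  then show "act (mk_sset (\<lambda>m. {\<tau> \<in> Hom delta m l. mid \<tau> ` {..m} \<noteq> {..l}}) (\<lambda>\<theta> \<tau>. \<tau> \<cdot>\<^bsub>delta\<^esub> \<theta>)) \<theta> x
      \<in> {\<tau> \<in> Hom delta m l. mid \<tau> ` {..m} \<noteq> {..l}}"
    using \<theta> x Comp_Hom[OF is_category_delta \<theta>, of x l] by (subst mk_sset_simps(2)[OF \<theta>]) auto
qed

lemma act_closed_sset_times: "act_closed K \<Longrightarrow> act_closed L \<Longrightarrow> act_closed (sset_times K L)"
  unfolding act_closed_def sset_times_def mk_sset_simps(1)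
  by (auto simp: mk_sset_simps(2))

section \<open>Right adjoints and hypercoverings\<close>

text \<open>An adjunction given by its counit \<open>eps\<close> and the universal property of the
  counit. In the application both categories are opposite categories, so \<open>eps\<close> is the
  map from a simplicial algebra to its components, read backwards.\<close>

locale right_adjoint =
  fixes M :: "('o, 'm, 'y) category_scheme" and D :: "('p, 'q, 'z) category_scheme"
    and U :: "('o, 'm, 'p, 'q) fctr" and c :: "('p, 'q, 'o, 'm) fctr" and eps :: "'o \<Rightarrow> 'm"
  assumes M: "is_category M" and D: "is_category D"
    and U: "is_functor M D U" and c: "is_functor D M c"
    and eps_Hom: "X \<in> Ob M \<Longrightarrow> eps X \<in> Hom M (omap c (omap U X)) X"
    and eps_nat: "f \<in> Hom M X Y \<Longrightarrow> f \<cdot>\<^bsub>M\<^esub> eps X = eps Y \<cdot>\<^bsub>M\<^esub> amap c (amap U f)"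
    and universal: "X \<in> Ob M \<Longrightarrow> W \<in> Ob D \<Longrightarrow> g \<in> Hom M (omap c W) X \<Longrightarrow>
      \<exists>!h. h \<in> Hom D W (omap U X) \<and> eps X \<cdot>\<^bsub>M\<^esub> amap c h = g"
begin

text \<open>Transposition across the adjunction, taking arrows of \<open>D\<close> into a value of
  \<open>U\<close> to arrows of \<open>M\<close>; \<open>lift\<close> is its inverse.\<close>

definition tr :: "'o \<Rightarrow> 'q \<Rightarrow> 'm" where
  "tr X h = eps X \<cdot>\<^bsub>M\<^esub> amap c h"

definition lift :: "'p \<Rightarrow> 'o \<Rightarrow> 'm \<Rightarrow> 'q" where
  "lift W X g = (THE h. h \<in> Hom D W (omap U X) \<and> eps X \<cdot>\<^bsub>M\<^esub> amap c h = g)"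

lemma tr_Hom: "X \<in> Ob M \<Longrightarrow> h \<in> Hom D W (omap U X) \<Longrightarrow> tr X h \<in> Hom M (omap c W) X"
  unfolding tr_def by (rule Comp_Hom[OF M functor_Hom[OF c] eps_Hom])

lemma lift_Hom: "X \<in> Ob M \<Longrightarrow> W \<in> Ob D \<Longrightarrow> g \<in> Hom M (omap c W) X \<Longrightarrow> lift W X g \<in> Hom D W (omap U X)"
  and tr_lift: "X \<in> Ob M \<Longrightarrow> W \<in> Ob D \<Longrightarrow> g \<in> Hom M (omap c W) X \<Longrightarrow> tr X (lift W X g) = g"
  unfolding lift_def tr_def using theI'[OF universal[of X W g]] by blast+

lemma tr_inj:
  assumes "X \<in> Ob M" "h \<in> Hom D W (omap U X)" "h' \<in> Hom D W (omap U X)" "tr X h = tr X h'"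
  shows "h = h'"
  using universal[OF assms(1) conjunct1[OF Hom_Ob[OF D assms(2)]] tr_Hom[OF assms(1,2)]] assms
  unfolding tr_def by metis

text \<open>Naturality of transposition in the target, as \<open>tr_comp_c\<close> is in the source.
  With \<open>tr_inj\<close> they turn an equation in \<open>D\<close> into one in \<open>M\<close>,
  which is how each universal property is transported.\<close>

lemma tr_comp_U:
  assumes f: "f \<in> Hom M X Y" and h: "h \<in> Hom D W (omap U X)"
  shows "tr Y (amap U f \<cdot>\<^bsub>D\<^esub> h) = f \<cdot>\<^bsub>M\<^esub> tr X h"
proof -
  have X: "X \<in> Ob M" and Y: "Y \<in> Ob M" using Hom_Ob[OF M f] by auto
  have Uf: "amap U f \<in> Hom D (omap U X) (omap U Y)" by (rule functor_Hom[OF U f])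
  show ?thesis
    unfolding tr_def functor_comp[OF c h Uf]
      Comp_assoc[OF M functor_Hom[OF c h] functor_Hom[OF c Uf] eps_Hom[OF Y]]
      Comp_assoc[OF M functor_Hom[OF c h] eps_Hom[OF X] f] eps_nat[OF f] ..
qed

lemma tr_comp_c:
  assumes X: "X \<in> Ob M" and g: "g \<in> Hom D V W" and h: "h \<in> Hom D W (omap U X)"
  shows "tr X (h \<cdot>\<^bsub>D\<^esub> g) = tr X h \<cdot>\<^bsub>M\<^esub> amap c g"
  unfolding tr_def functor_comp[OF c g h]
    Comp_assoc[OF M functor_Hom[OF c g] functor_Hom[OF c h] eps_Hom[OF X]] ..

section \<open>Limits, cotensors and matching objects under a right adjoint\<close>

lemma is_terminal_U:
  assumes "is_terminal M T"
  shows "is_terminal D (omap U T)"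
  unfolding is_terminal_def
proof (intro conjI ballI)
  have T: "T \<in> Ob M" using assms by (simp add: is_terminal_def)
  show "omap U T \<in> Ob D" using functor_Ob[OF U T] .
  fix W assume W: "W \<in> Ob D"
  then have cW: "omap c W \<in> Ob M" using functor_Ob[OF c] by blast
  then obtain g where g: "g \<in> Hom M (omap c W) T" and u: "\<And>g'. g' \<in> Hom M (omap c W) T \<Longrightarrow> g' = g"
    using assms unfolding is_terminal_def by blast
  show "\<exists>!h. h \<in> Hom D W (omap U T)"
  proof (rule ex1I[of _ "lift W T g"], rule lift_Hom[OF T W g])
    fix h assume h: "h \<in> Hom D W (omap U T)"
    have "tr T h = tr T (lift W T g)" unfolding tr_lift[OF T W g] by (rule u[OF tr_Hom[OF T h]])
    then show "h = lift W T g" by (rule tr_inj[OF T h lift_Hom[OF T W g]])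
  qed
qed

lemma is_pullback_U:
  assumes pb: "is_pullback M f g P p q" and f: "f \<in> Arr M" and g: "g \<in> Arr M" and cod: "Cod M f = Cod M g"
  shows "is_pullback D (amap U f) (amap U g) (omap U P) (amap U p) (amap U q)"
proof -
  obtain A B C where f: "f \<in> Hom M A C" and g: "g \<in> Hom M B C"
    using f g cod by (auto simp: Hom_def)
  have p: "p \<in> Hom M P A" and q: "q \<in> Hom M P B" and e: "f \<cdot>\<^bsub>M\<^esub> p = g \<cdot>\<^bsub>M\<^esub> q"
    and ex: "\<And>X a b. X \<in> Ob M \<Longrightarrow> a \<in> Hom M X A \<Longrightarrow> b \<in> Hom M X B \<Longrightarrow> f \<cdot>\<^bsub>M\<^esub> a = g \<cdot>\<^bsub>M\<^esub> b \<Longrightarrow>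
      \<exists>!h. h \<in> Hom M X P \<and> p \<cdot>\<^bsub>M\<^esub> h = a \<and> q \<cdot>\<^bsub>M\<^esub> h = b"
    using pb HomD[OF f] HomD[OF g] unfolding is_pullback_def by auto
  note Uf = functor_Hom[OF U f] and Ug = functor_Hom[OF U g] and Up = functor_Hom[OF U p] and Uq = functor_Hom[OF U q]
  have A: "A \<in> Ob M" and B: "B \<in> Ob M" and C: "C \<in> Ob M" and P: "P \<in> Ob M"
    using Hom_Ob[OF M f] Hom_Ob[OF M g] Hom_Ob[OF M p] by auto
  show ?thesis
    unfolding is_pullback_def HomD(2)[OF Uf] HomD(2)[OF Ug]
  proof (intro conjI ballI impI Up Uq)
    show "amap U f \<cdot>\<^bsub>D\<^esub> amap U p = amap U g \<cdot>\<^bsub>D\<^esub> amap U q"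
      using functor_comp[OF U p f] functor_comp[OF U q g] e by simp
    fix W a b assume W: "W \<in> Ob D" and a: "a \<in> Hom D W (omap U A)" and b: "b \<in> Hom D W (omap U B)"
      and ab: "amap U f \<cdot>\<^bsub>D\<^esub> a = amap U g \<cdot>\<^bsub>D\<^esub> b"
    have cW: "omap c W \<in> Ob M" using functor_Ob[OF c W] .
    \<comment> \<open>The competing cone in \<open>D\<close> is transposed to \<open>M\<close>,
      where the pullback property yields \<open>h\<close>; the lift of \<open>h\<close> is the
      required arrow.\<close>
    have "f \<cdot>\<^bsub>M\<^esub> tr A a = g \<cdot>\<^bsub>M\<^esub> tr B b"
      using tr_comp_U[OF f a] tr_comp_U[OF g b] ab by simp
    then obtain h where h: "h \<in> Hom M (omap c W) P" "p \<cdot>\<^bsub>M\<^esub> h = tr A a" "q \<cdot>\<^bsub>M\<^esub> h = tr B b"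
      and u: "\<And>h'. h' \<in> Hom M (omap c W) P \<Longrightarrow> p \<cdot>\<^bsub>M\<^esub> h' = tr A a \<Longrightarrow> q \<cdot>\<^bsub>M\<^esub> h' = tr B b \<Longrightarrow> h' = h"
      using ex[OF cW tr_Hom[OF A a] tr_Hom[OF B b]] by metis
    note l = lift_Hom[OF P W h(1)] and tl = tr_lift[OF P W h(1)]
    show "\<exists>!h. h \<in> Hom D W (omap U P) \<and> amap U p \<cdot>\<^bsub>D\<^esub> h = a \<and> amap U q \<cdot>\<^bsub>D\<^esub> h = b"
    proof (rule ex1I[of _ "lift W P h"], intro conjI l)
      show "amap U p \<cdot>\<^bsub>D\<^esub> lift W P h = a"
        by (rule tr_inj[OF A Comp_Hom[OF D l Up] a]) (simp add: tr_comp_U[OF p l] tl h)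
      show "amap U q \<cdot>\<^bsub>D\<^esub> lift W P h = b"
        by (rule tr_inj[OF B Comp_Hom[OF D l Uq] b]) (simp add: tr_comp_U[OF q l] tl h)
    next
      fix h' assume h': "h' \<in> Hom D W (omap U P) \<and> amap U p \<cdot>\<^bsub>D\<^esub> h' = a \<and> amap U q \<cdot>\<^bsub>D\<^esub> h' = b"
      then have "tr P h' = h"
        using u[OF tr_Hom[OF P]] tr_comp_U[OF p] tr_comp_U[OF q] by metis
      then show "h' = lift W P h" using tr_inj[OF P _ l] h' tl by metis
    qed
  qed
qed

lemma functor_simp_Ob: "F \<in> Ob (simp_cat M) \<Longrightarrow> fctr_comp (op_cat delta) U F \<in> Ob (simp_cat D)"
  using fctr_comp_is_functor[OF is_category_op[OF is_category_delta] _ U] by simp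

lemma functor_simp_Ob_c: "W \<in> Ob (simp_cat D) \<Longrightarrow> fctr_comp (op_cat delta) c W \<in> Ob (simp_cat M)"
  using fctr_comp_is_functor[OF is_category_op[OF is_category_delta] _ c] by simp

lemma simp_Hom: "F \<in> Ob (simp_cat C) \<Longrightarrow> \<theta> \<in> Hom delta m n \<Longrightarrow> amap F \<theta> \<in> Hom C (omap F n) (omap F m)"
  using functor_Hom[of "op_cat delta" C F \<theta> n m] by simp

lemma simp_Ob: "F \<in> Ob (simp_cat C) \<Longrightarrow> omap F n \<in> Ob C"
  using functor_Ob[of "op_cat delta" C F n] by simp

text \<open>The adjunction applied degreewise: the compatibility equations on the two sides are
  transposes of each other. Tensor maps are families of arrows, so no coproduct enters.\<close>

lemma tensor_map_tr:
  assumes X: "X \<in> Ob (simp_cat M)" and W: "W \<in> Ob (simp_cat D)"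
    and K: "act_closed K"
    and f: "\<And>n x. x \<in> omap K n \<Longrightarrow> f n x \<in> Hom D (omap W n) (omap U (omap X n))"
  shows "tensor_map D K W (fctr_comp (op_cat delta) U X) f \<longleftrightarrow>
    tensor_map M K (fctr_comp (op_cat delta) c W) X (\<lambda>n x. tr (omap X n) (f n x))"
proof -
  have "amap U (amap X \<theta>) \<cdot>\<^bsub>D\<^esub> f n x = f m (act K \<theta> x) \<cdot>\<^bsub>D\<^esub> amap W \<theta> \<longleftrightarrow>
      amap X \<theta> \<cdot>\<^bsub>M\<^esub> tr (omap X n) (f n x) = tr (omap X m) (f m (act K \<theta> x)) \<cdot>\<^bsub>M\<^esub> amap c (amap W \<theta>)"
    if \<theta>: "\<theta> \<in> Hom delta m n" and x: "x \<in> omap K n" for m n \<theta> x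
  proof -
    note Xt = simp_Hom[OF X \<theta>] and Wt = simp_Hom[OF W \<theta>] and fx = f[OF x] and ft = f[OF act_closedD[OF K \<theta> x]]
    have "tr (omap X m) (amap U (amap X \<theta>) \<cdot>\<^bsub>D\<^esub> f n x) = amap X \<theta> \<cdot>\<^bsub>M\<^esub> tr (omap X n) (f n x)"
      by (rule tr_comp_U[OF Xt fx])
    moreover have "tr (omap X m) (f m (act K \<theta> x) \<cdot>\<^bsub>D\<^esub> amap W \<theta>) = tr (omap X m) (f m (act K \<theta> x)) \<cdot>\<^bsub>M\<^esub> amap c (amap W \<theta>)"
      by (rule tr_comp_c[OF simp_Ob[OF X] Wt ft])
    ultimately show ?thesis
      using tr_inj[OF simp_Ob[OF X] Comp_Hom[OF D fx functor_Hom[OF U Xt]] Comp_Hom[OF D Wt ft]] by metis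
  qed
  moreover have "\<theta> \<in> Hom delta m n \<Longrightarrow> \<theta> \<in> Arr delta" for \<theta> m n by (rule HomD(1))
  ultimately show ?thesis
    unfolding tensor_map_def using f tr_Hom[OF simp_Ob[OF X] f] by simp
qed

lemma tensor_map_U:
  assumes X: "X \<in> Ob (simp_cat M)" and Z: "Z \<in> Ob (simp_cat M)" and f: "tensor_map M K Z X f"
    and K: "act_closed K"
  shows "tensor_map D K (fctr_comp (op_cat delta) U Z) (fctr_comp (op_cat delta) U X) (\<lambda>n x. amap U (f n x))"
proof -
  have fH: "f n x \<in> Hom M (omap Z n) (omap X n)" if "x \<in> omap K n" for n x
    using f that by (simp add: tensor_map_def)
  have "amap U (amap X \<theta>) \<cdot>\<^bsub>D\<^esub> amap U (f n x) = amap U (f m (act K \<theta> x)) \<cdot>\<^bsub>D\<^esub> amap U (amap Z \<theta>)"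
    if \<theta>: "\<theta> \<in> Hom delta m n" and x: "x \<in> omap K n" for m n \<theta> x
    unfolding functor_comp[OF U fH[OF x] simp_Hom[OF X \<theta>], symmetric]
      functor_comp[OF U simp_Hom[OF Z \<theta>] fH[OF act_closedD[OF K \<theta> x]], symmetric]
    using f \<theta> x by (simp add: tensor_map_def)
  then show ?thesis
    unfolding tensor_map_def using functor_Hom[OF U fH] HomD(1)[of _ delta] by simp
qed

text \<open>The universal property of \<open>Z\<close> is tested at \<open>c\<close> applied to an
  object \<open>W\<close> of \<open>D\<close>: degreewise transposition carries the test map from
  \<open>D\<close> to \<open>M\<close>, and the resulting map into \<open>Z\<close> back to
  \<open>D\<close>.\<close>

lemma is_cotensor_U:
  assumes co: "is_cotensor M K X Z ev" and X: "X \<in> Ob (simp_cat M)"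
    and K: "act_closed K"
  shows "is_cotensor D K (fctr_comp (op_cat delta) U X) (fctr_comp (op_cat delta) U Z) (\<lambda>n x. amap U (ev n x))"
  unfolding is_cotensor_def
proof (intro conjI ballI allI impI)
  have Z: "Z \<in> Ob (simp_cat M)" and ev: "tensor_map M K Z X ev"
    using co by (auto simp: is_cotensor_def)
  show "fctr_comp (op_cat delta) U Z \<in> Ob (simp_cat D)" by (rule functor_simp_Ob[OF Z])
  show "tensor_map D K (fctr_comp (op_cat delta) U Z) (fctr_comp (op_cat delta) U X) (\<lambda>n x. amap U (ev n x))"
    by (rule tensor_map_U[OF X Z ev K])
  have evH: "ev n x \<in> Hom M (omap Z n) (omap X n)" if "x \<in> omap K n" for n x
    using ev that by (simp add: tensor_map_def)
  fix W m f assume W: "W \<in> Ob (simp_cat D)"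
    and f: "tensor_map D (sset_times K (std m)) W (fctr_comp (op_cat delta) U X) f"
  let ?cW = "fctr_comp (op_cat delta) c W"
  have fH: "f n x \<in> Hom D (omap W n) (omap U (omap X n))" if "x \<in> omap (sset_times K (std m)) n" for n x
    using f that by (simp add: tensor_map_def)
  have KO: "(x, \<tau>) \<in> omap (sset_times K (std m)) n" if "x \<in> omap K n" "\<tau> \<in> omap (std m) n" for n x \<tau>
    using that by (simp add: sset_times_def mk_sset_def)
  let ?f = "\<lambda>n x. tr (omap X n) (f n x)"
  have tf: "tensor_map M (sset_times K (std m)) ?cW X ?f"
    by (rule iffD1[OF tensor_map_tr[OF X W act_closed_sset_times[OF K act_closed_std]] f]) (rule fH)
  obtain g where g: "tensor_map M (std m) ?cW Z g"
    and ge0: "\<forall>n. \<forall>x\<in>omap K n. \<forall>\<tau>\<in>omap (std m) n. ev n x \<cdot>\<^bsub>M\<^esub> g n \<tau> = ?f n (x, \<tau>)"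
    and gu0: "\<forall>g'. tensor_map M (std m) ?cW Z g' \<and>
        (\<forall>n. \<forall>x\<in>omap K n. \<forall>\<tau>\<in>omap (std m) n. ev n x \<cdot>\<^bsub>M\<^esub> g' n \<tau> = ?f n (x, \<tau>)) \<longrightarrow>
      (\<forall>n. \<forall>\<tau>\<in>omap (std m) n. g' n \<tau> = g n \<tau>)"
    using co[unfolded is_cotensor_def, THEN conjunct2, THEN conjunct2, THEN bspec, OF functor_simp_Ob_c[OF W],
        THEN spec, of m, THEN spec, of ?f, THEN mp, OF tf] by (elim exE conjE) (rule that)
  have ge: "\<And>n x \<tau>. x \<in> omap K n \<Longrightarrow> \<tau> \<in> omap (std m) n \<Longrightarrow> ev n x \<cdot>\<^bsub>M\<^esub> g n \<tau> = tr (omap X n) (f n (x, \<tau>))"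
    using ge0 by simp
  have gu: "g' n \<tau> = g n \<tau>" if "tensor_map M (std m) ?cW Z g'"
    "\<And>n x \<tau>. x \<in> omap K n \<Longrightarrow> \<tau> \<in> omap (std m) n \<Longrightarrow> ev n x \<cdot>\<^bsub>M\<^esub> g' n \<tau> = tr (omap X n) (f n (x, \<tau>))"
    "\<tau> \<in> omap (std m) n" for g' n \<tau>
    using gu0[THEN spec, of g', THEN mp] that by simp
  have gH: "g n \<tau> \<in> Hom M (omap c (omap W n)) (omap Z n)" if "\<tau> \<in> omap (std m) n" for n \<tau>
    using g that by (simp add: tensor_map_def)
  \<comment> \<open>The factorization through \<open>Z\<close>, transposed degree by degree.\<close>
  define G where "G n \<tau> = lift (omap W n) (omap Z n) (g n \<tau>)" for n \<tau>
  have GH: "G n \<tau> \<in> Hom D (omap W n) (omap U (omap Z n))" and trG: "tr (omap Z n) (G n \<tau>) = g n \<tau>"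
    if "\<tau> \<in> omap (std m) n" for n \<tau>
    unfolding G_def using lift_Hom[OF simp_Ob[OF Z] simp_Ob[OF W] gH[OF that]] tr_lift[OF simp_Ob[OF Z] simp_Ob[OF W] gH[OF that]] .
  show "\<exists>g. tensor_map D (std m) W (fctr_comp (op_cat delta) U Z) g \<and>
      (\<forall>n. \<forall>x\<in>omap K n. \<forall>\<tau>\<in>omap (std m) n. amap U (ev n x) \<cdot>\<^bsub>D\<^esub> g n \<tau> = f n (x, \<tau>)) \<and>
      (\<forall>g'. tensor_map D (std m) W (fctr_comp (op_cat delta) U Z) g' \<and>
        (\<forall>n. \<forall>x\<in>omap K n. \<forall>\<tau>\<in>omap (std m) n. amap U (ev n x) \<cdot>\<^bsub>D\<^esub> g' n \<tau> = f n (x, \<tau>)) \<longrightarrow>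
        (\<forall>n. \<forall>\<tau>\<in>omap (std m) n. g' n \<tau> = g n \<tau>))"
  proof (intro exI[of _ G] conjI allI ballI impI)
    have tG: "tensor_map M (std m) ?cW Z (\<lambda>n \<tau>. tr (omap Z n) (G n \<tau>))"
      using g act_closedD[OF act_closed_std] trG unfolding tensor_map_def by simp
    show "tensor_map D (std m) W (fctr_comp (op_cat delta) U Z) G"
      by (rule iffD2[OF tensor_map_tr[OF Z W act_closed_std] tG]) (rule GH)
  next
    fix n x \<tau> assume x: "x \<in> omap K n" and t: "\<tau> \<in> omap (std m) n"
    show "amap U (ev n x) \<cdot>\<^bsub>D\<^esub> G n \<tau> = f n (x, \<tau>)"
      by (rule tr_inj[OF simp_Ob[OF X] Comp_Hom[OF D GH[OF t] functor_Hom[OF U evH[OF x]]] fH[OF KO[OF x t]]])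
        (simp add: tr_comp_U[OF evH[OF x] GH[OF t]] trG[OF t] ge[OF x t])
  next
    fix g' n \<tau> assume t: "\<tau> \<in> omap (std m) n"
    assume g': "tensor_map D (std m) W (fctr_comp (op_cat delta) U Z) g' \<and>
        (\<forall>n. \<forall>x\<in>omap K n. \<forall>\<tau>\<in>omap (std m) n. amap U (ev n x) \<cdot>\<^bsub>D\<^esub> g' n \<tau> = f n (x, \<tau>))"
    then have g'H: "g' n \<tau> \<in> Hom D (omap W n) (omap U (omap Z n))" if "\<tau> \<in> omap (std m) n" for n \<tau>
      using that by (simp add: tensor_map_def)
    have "tensor_map M (std m) ?cW Z (\<lambda>n \<tau>. tr (omap Z n) (g' n \<tau>))"
      by (rule iffD1[OF tensor_map_tr[OF Z W act_closed_std] conjunct1[OF g']]) (rule g'H)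
    moreover have "ev n x \<cdot>\<^bsub>M\<^esub> tr (omap Z n) (g' n \<tau>) = tr (omap X n) (f n (x, \<tau>))"
      if "x \<in> omap K n" "\<tau> \<in> omap (std m) n" for n x \<tau>
      using tr_comp_U[OF evH[OF that(1)] g'H[OF that(2)]] g' that by simp
    ultimately have "tr (omap Z n) (g' n \<tau>) = g n \<tau>"
      using t by (rule gu)
    then show "g' n \<tau> = G n \<tau>"
      using tr_inj[OF simp_Ob[OF Z] g'H[OF t] GH[OF t]] trG[OF t] by simp
  qed
qed

text \<open>A cone over the boundary is a tensor map out of a constant object, and \<open>c\<close>
  takes the constant object on \<open>W\<close> to the one on \<open>omap c W\<close>. Hence cones
  over the image of \<open>X\<close> with apex \<open>W\<close> are cones over \<open>X\<close> with
  apex \<open>omap c W\<close>.\<close>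

lemma is_matching_U:
  assumes ma: "is_matching M X n N ev" and X: "X \<in> Ob (simp_cat M)"
  shows "is_matching D (fctr_comp (op_cat delta) U X) n (omap U N) (\<lambda>m \<tau>. amap U (ev m \<tau>))"
  unfolding is_matching_def
proof (intro conjI ballI allI impI)
  have dc: "is_category (op_cat delta)" by (rule is_category_op[OF is_category_delta])
  have N: "N \<in> Ob M" and ev: "tensor_map M (bdry n) (const_fctr (op_cat delta) M N) X ev"
    using ma by (auto simp: is_matching_def)
  have cN: "const_fctr (op_cat delta) M N \<in> Ob (simp_cat M)"
    using const_fctr_is_functor[OF dc M N] by simp
  show "omap U N \<in> Ob D" by (rule functor_Ob[OF U N])
  show "tensor_map D (bdry n) (const_fctr (op_cat delta) D (omap U N)) (fctr_comp (op_cat delta) U X) (\<lambda>m \<tau>. amap U (ev m \<tau>))"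
    using tensor_map_U[OF X cN ev act_closed_bdry] unfolding fctr_comp_const[OF dc U N] .
  have evH: "ev m x \<in> Hom M N (omap X m)" if "x \<in> omap (bdry n) m" for m x
    using ev that by (simp add: tensor_map_def)
  fix W f assume W: "W \<in> Ob D"
    and f: "tensor_map D (bdry n) (const_fctr (op_cat delta) D W) (fctr_comp (op_cat delta) U X) f"
  have cW: "const_fctr (op_cat delta) D W \<in> Ob (simp_cat D)"
    using const_fctr_is_functor[OF dc D W] by simp
  have fH: "f m x \<in> Hom D (omap (const_fctr (op_cat delta) D W) m) (omap U (omap X m))" if "x \<in> omap (bdry n) m" for m x
    using f that by (simp add: tensor_map_def)
  let ?f = "\<lambda>m x. tr (omap X m) (f m x)"
  have tf: "tensor_map M (bdry n) (const_fctr (op_cat delta) M (omap c W)) X ?f"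
    unfolding fctr_comp_const[OF dc c W, symmetric]
    by (rule iffD1[OF tensor_map_tr[OF X cW act_closed_bdry] f]) (rule fH)
  have "\<exists>!h. h \<in> Hom M (omap c W) N \<and> (\<forall>m. \<forall>\<tau>\<in>omap (bdry n) m. ev m \<tau> \<cdot>\<^bsub>M\<^esub> h = ?f m \<tau>)"
    using ma[unfolded is_matching_def, THEN conjunct2, THEN conjunct2, THEN bspec, OF functor_Ob[OF c W], THEN spec, THEN mp, OF tf] .
  then obtain h where h0: "h \<in> Hom M (omap c W) N \<and> (\<forall>m. \<forall>\<tau>\<in>omap (bdry n) m. ev m \<tau> \<cdot>\<^bsub>M\<^esub> h = ?f m \<tau>)"
    and u0: "\<forall>h'. h' \<in> Hom M (omap c W) N \<and> (\<forall>m. \<forall>\<tau>\<in>omap (bdry n) m. ev m \<tau> \<cdot>\<^bsub>M\<^esub> h' = ?f m \<tau>) \<longrightarrow> h' = h"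
    by (rule ex1E) (rule that)
  have h: "h \<in> Hom M (omap c W) N" "\<And>m \<tau>. \<tau> \<in> omap (bdry n) m \<Longrightarrow> ev m \<tau> \<cdot>\<^bsub>M\<^esub> h = tr (omap X m) (f m \<tau>)"
    using h0 by auto
  have u: "h' = h" if "h' \<in> Hom M (omap c W) N" "\<And>m \<tau>. \<tau> \<in> omap (bdry n) m \<Longrightarrow> ev m \<tau> \<cdot>\<^bsub>M\<^esub> h' = tr (omap X m) (f m \<tau>)" for h'
    using u0 that by simp
  note l = lift_Hom[OF N W h(1)] and tl = tr_lift[OF N W h(1)]
  show "\<exists>!h. h \<in> Hom D W (omap U N) \<and> (\<forall>m. \<forall>\<tau>\<in>omap (bdry n) m. amap U (ev m \<tau>) \<cdot>\<^bsub>D\<^esub> h = f m \<tau>)"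
  proof (rule ex1I[of _ "lift W N h"], intro conjI l allI ballI)
    fix m \<tau> assume t: "\<tau> \<in> omap (bdry n) m"
    have fH': "f m \<tau> \<in> Hom D W (omap U (omap X m))" using fH[OF t] by simp
    show "amap U (ev m \<tau>) \<cdot>\<^bsub>D\<^esub> lift W N h = f m \<tau>"
      by (rule tr_inj[OF simp_Ob[OF X] Comp_Hom[OF D l functor_Hom[OF U evH[OF t]]] fH'])
        (simp add: tr_comp_U[OF evH[OF t] l] tl h(2)[OF t])
  next
    fix h' assume h': "h' \<in> Hom D W (omap U N) \<and> (\<forall>m. \<forall>\<tau>\<in>omap (bdry n) m. amap U (ev m \<tau>) \<cdot>\<^bsub>D\<^esub> h' = f m \<tau>)"
    have "ev m \<tau> \<cdot>\<^bsub>M\<^esub> tr N h' = tr (omap X m) (f m \<tau>)" if "\<tau> \<in> omap (bdry n) m" for m \<tau>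
      using tr_comp_U[OF evH[OF that], of h' W] h' that by simp
    then have "tr N h' = h" using u[OF tr_Hom[OF N]] h' by blast
    then show "h' = lift W N h" using tr_inj[OF N _ l] h' tl by metis
  qed
qed

lemma nat_trans_simp_U:
  assumes "F \<in> Ob (simp_cat M)" "G \<in> Ob (simp_cat M)" "nat_trans (op_cat delta) M F G \<eta>"
  shows "nat_trans (op_cat delta) D (fctr_comp (op_cat delta) U F) (fctr_comp (op_cat delta) U G) (\<lambda>n. amap U (\<eta> n))"
  using nat_trans_whisker[OF is_category_op[OF is_category_delta] _ _ U assms(3)] assms(1,2) by simp

end

text \<open>The target carries a trivial structure: every arrow is a fibration and the weak
  equivalences are the isomorphisms. The homotopical conditions in \<open>D\<close> thus come down
  to invertibility, supplied by \<open>WeqM\<close>, and limits, supplied by the adjunction.\<close>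

locale homotopy_right_adjoint = right_adjoint M D U c eps
  for M :: "('o, 'm) model" and D :: "('p, 'q) model" and U c eps +
  assumes FibM: "Fib M \<subseteq> Arr M" and FibD: "Fib D = Arr D" and WeqD: "Weq D = {f. is_iso D f}"
    and WeqM: "f \<in> Weq M \<Longrightarrow> f \<in> Arr M \<and> is_iso D (amap U f)"
begin

lemma fibrant_U: "fibrant M X \<Longrightarrow> fibrant D (omap U X)"
  unfolding fibrant_def FibD using functor_Ob[OF U] is_terminal_U functor_Hom[OF U] HomD(1) by metis

text \<open>In \<open>D\<close> the matching map is automatically a fibration, so what has to be
  transported is the matching object with the map to it.\<close>

lemma reedy_fibrant_U:
  assumes "reedy_fibrant M X"
  shows "reedy_fibrant D (fctr_comp (op_cat delta) U X)"
  unfolding reedy_fibrant_def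
proof (intro conjI allI)
  have X: "X \<in> Ob (simp_cat M)" using assms by (simp add: reedy_fibrant_def)
  then show "fctr_comp (op_cat delta) U X \<in> Ob (simp_cat D)" by (rule functor_simp_Ob)
  fix n
  obtain N ev h where N: "is_matching M X n N ev" and h: "h \<in> Hom M (omap X n) N"
    and e: "\<And>m \<tau>. \<tau> \<in> omap (bdry n) m \<Longrightarrow> ev m \<tau> \<cdot>\<^bsub>M\<^esub> h = amap X \<tau>"
    using assms unfolding reedy_fibrant_def by metis
  have "amap U (ev m \<tau>) \<cdot>\<^bsub>D\<^esub> amap U h = amap (fctr_comp (op_cat delta) U X) \<tau>" if t: "\<tau> \<in> omap (bdry n) m" for m \<tau>
  proof -
    have "ev m \<tau> \<in> Hom M N (omap X m)"
      using N t by (simp add: is_matching_def tensor_map_def)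
    then have "amap U (ev m \<tau>) \<cdot>\<^bsub>D\<^esub> amap U h = amap U (amap X \<tau>)"
      using functor_comp[OF U h] e[OF t] by metis
    \<comment> \<open>Every simplex of \<open>bdry n\<close> is an arrow of \<open>delta\<close>,
      where \<open>fctr_comp\<close> takes its proper value rather than
      \<open>undefined\<close>.\<close>
    moreover have "\<tau> \<in> Arr delta" using t by (auto simp: bdry_def mk_sset_simps(1) Hom_def)
    ultimately show ?thesis by simp
  qed
  then show "\<exists>N ev. is_matching D (fctr_comp (op_cat delta) U X) n N ev \<and>
      (\<exists>h\<in>Hom D (omap (fctr_comp (op_cat delta) U X) n) N. h \<in> Fib D \<and>
        (\<forall>m. \<forall>\<tau>\<in>omap (bdry n) m. ev m \<tau> \<cdot>\<^bsub>D\<^esub> h = amap (fctr_comp (op_cat delta) U X) \<tau>))"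
    using is_matching_U[OF N X] functor_Hom[OF U h] HomD(1)[OF functor_Hom[OF U h]] unfolding FibD
    by (intro exI conjI bexI) auto
qed

text \<open>The replacement of the cospan chosen in \<open>M\<close> is carried over as it stands:
  its weak equivalences become isomorphisms, its fibre product stays a fibre product, and
  \<open>amap U h\<close> is again the induced map.\<close>

lemma hpullback_map_in_U:
  assumes hp: "hpullback_map_in M S a b f d"
    and a: "a \<in> Hom M W A" and b: "b \<in> Hom M W B" and cA: "f \<in> Hom M A C" and d: "d \<in> Hom M B C"
    and S: "\<And>h. h \<in> S \<Longrightarrow> h \<in> Arr M \<Longrightarrow> amap U h \<in> S'"
  shows "hpullback_map_in D S' (amap U a) (amap U b) (amap U f) (amap U d)"
proof -
  obtain f' g' x y z P p q h where *: "f' \<in> Fib M" "g' \<in> Fib M" "Cod M f' = Cod M g'" "fibrant M (Cod M f')"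
    "x \<in> Hom M A (Dom M f')" "y \<in> Hom M B (Dom M g')"
    "z \<in> Hom M C (Cod M f')" "x \<in> Weq M" "y \<in> Weq M" "z \<in> Weq M"
    "f' \<cdot>\<^bsub>M\<^esub> x = z \<cdot>\<^bsub>M\<^esub> f" "g' \<cdot>\<^bsub>M\<^esub> y = z \<cdot>\<^bsub>M\<^esub> d" "is_pullback M f' g' P p q"
    "h \<in> Hom M W P" "p \<cdot>\<^bsub>M\<^esub> h = x \<cdot>\<^bsub>M\<^esub> a" "q \<cdot>\<^bsub>M\<^esub> h = y \<cdot>\<^bsub>M\<^esub> b" "h \<in> S"
    using hp unfolding hpullback_map_in_def HomD[OF a] HomD[OF b] HomD[OF cA] HomD[OF d] by blast
  obtain A' B' C' where f': "f' \<in> Hom M A' C'" and g': "g' \<in> Hom M B' C'"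
    using *(1-3) FibM by (auto simp: Hom_def)
  note x = *(5)[unfolded HomD[OF f']] and y = *(6)[unfolded HomD[OF g']] and z = *(7)[unfolded HomD[OF f']]
  have p: "p \<in> Hom M P A'" and q: "q \<in> Hom M P B'"
    using *(13) HomD[OF f'] HomD[OF g'] by (auto simp: is_pullback_def)
  note U' = functor_Hom[OF U]
  note Uc = functor_comp[OF U]
  have sq: "f \<cdot>\<^bsub>M\<^esub> a = d \<cdot>\<^bsub>M\<^esub> b" using hp by (simp add: hpullback_map_in_def)
  show ?thesis
    unfolding hpullback_map_in_def HomD[OF U'[OF a]] HomD[OF U'[OF b]] HomD[OF U'[OF cA]] HomD[OF U'[OF d]]
  proof (intro conjI exI)
    show "amap U f \<cdot>\<^bsub>D\<^esub> amap U a = amap U d \<cdot>\<^bsub>D\<^esub> amap U b"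
      using Uc[OF a cA] Uc[OF b d] sq by simp
    show "amap U f' \<in> Fib D" "amap U g' \<in> Fib D" "Cod D (amap U f') = Cod D (amap U g')"
      using HomD[OF U'[OF f']] HomD[OF U'[OF g']] by (auto simp: FibD)
    show "fibrant D (Cod D (amap U f'))" using fibrant_U[OF *(4)] HomD[OF U'[OF f']] HomD[OF f'] by simp
    show "amap U x \<in> Hom D (omap U A) (Dom D (amap U f'))" using U'[OF x] HomD[OF U'[OF f']] by simp
    show "amap U y \<in> Hom D (omap U B) (Dom D (amap U g'))" using U'[OF y] HomD[OF U'[OF g']] by simp
    show "amap U z \<in> Hom D (omap U C) (Cod D (amap U f'))" using U'[OF z] HomD[OF U'[OF f']] by simp
    show "amap U x \<in> Weq D" "amap U y \<in> Weq D" "amap U z \<in> Weq D" using WeqM *(8-10) by (auto simp: WeqD)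
    show "amap U f' \<cdot>\<^bsub>D\<^esub> amap U x = amap U z \<cdot>\<^bsub>D\<^esub> amap U f" using Uc[OF x f'] Uc[OF cA z] *(11) by simp
    show "amap U g' \<cdot>\<^bsub>D\<^esub> amap U y = amap U z \<cdot>\<^bsub>D\<^esub> amap U d" using Uc[OF y g'] Uc[OF d z] *(12) by simp
    show "is_pullback D (amap U f') (amap U g') (omap U P) (amap U p) (amap U q)"
      using is_pullback_U[OF *(13)] *(1-3) FibM by blast
    show "amap U h \<in> Hom D (omap U W) (omap U P)" using U'[OF *(14)] .
    show "amap U p \<cdot>\<^bsub>D\<^esub> amap U h = amap U x \<cdot>\<^bsub>D\<^esub> amap U a" using Uc[OF *(14) p] Uc[OF a x] *(15) by simp
    show "amap U q \<cdot>\<^bsub>D\<^esub> amap U h = amap U y \<cdot>\<^bsub>D\<^esub> amap U b" using Uc[OF *(14) q] Uc[OF b y] *(16) by simp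
    show "amap U h \<in> S'" using S[OF *(17) HomD(1)[OF *(14)]] .
  qed
qed

text \<open>All witnesses are images under \<open>U\<close> of those in \<open>M\<close>, and the
  equations relating them are preserved by functoriality.\<close>

lemma comparison_map_in_U:
  assumes cm: "comparison_map_in M S X Y e n" and X: "X \<in> Ob (simp_cat M)" and Y: "Y \<in> Ob (simp_cat M)"
    and e: "nat_trans (op_cat delta) M X Y e"
    and S: "\<And>h. h \<in> S \<Longrightarrow> h \<in> Arr M \<Longrightarrow> amap U h \<in> S'"
  shows "comparison_map_in D S' (fctr_comp (op_cat delta) U X) (fctr_comp (op_cat delta) U Y) (\<lambda>n. amap U (e n)) n"
proof -
  obtain XD xD XB xB YD yD YB yB rX rY eD eB where *:
    "is_cotensor M (std n) X XD xD" "is_cotensor M (bdry n) X XB xB"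
    "is_cotensor M (std n) Y YD yD" "is_cotensor M (bdry n) Y YB yB"
    "nat_trans (op_cat delta) M XD XB rX" "\<And>m \<tau>. \<tau> \<in> omap (bdry n) m \<Longrightarrow> xB m \<tau> \<cdot>\<^bsub>M\<^esub> rX m = xD m \<tau>"
    "nat_trans (op_cat delta) M YD YB rY" "\<And>m \<tau>. \<tau> \<in> omap (bdry n) m \<Longrightarrow> yB m \<tau> \<cdot>\<^bsub>M\<^esub> rY m = yD m \<tau>"
    "nat_trans (op_cat delta) M XD YD eD" "\<And>m \<tau>. \<tau> \<in> omap (std n) m \<Longrightarrow> yD m \<tau> \<cdot>\<^bsub>M\<^esub> eD m = e m \<cdot>\<^bsub>M\<^esub> xD m \<tau>"
    "nat_trans (op_cat delta) M XB YB eB" "\<And>m \<tau>. \<tau> \<in> omap (bdry n) m \<Longrightarrow> yB m \<tau> \<cdot>\<^bsub>M\<^esub> eB m = e m \<cdot>\<^bsub>M\<^esub> xB m \<tau>"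
    "hpullback_map_in M S (rX 0) (eD 0) (eB 0) (rY 0)"
    using cm unfolding comparison_map_in_def by auto
  have ob: "XD \<in> Ob (simp_cat M)" "XB \<in> Ob (simp_cat M)" "YD \<in> Ob (simp_cat M)" "YB \<in> Ob (simp_cat M)"
    and tm: "tensor_map M (std n) XD X xD" "tensor_map M (bdry n) XB X xB"
      "tensor_map M (std n) YD Y yD" "tensor_map M (bdry n) YB Y yB"
    using *(1-4) by (auto simp: is_cotensor_def)
  have tmH: "x \<in> omap K m \<Longrightarrow> f m x \<in> Hom M (omap Z m) (omap V m)" if "tensor_map M K Z V f"
    for K :: "darr sset" and Z V f m x
    using that by (simp add: tensor_map_def)
  have nH: "\<eta> m \<in> Hom M (omap F m) (omap G m)" if "nat_trans (op_cat delta) M F G \<eta>" for F G \<eta> m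
    using nat_trans_Hom[OF that, of m] by simp
  have bs: "\<tau> \<in> omap (bdry n) m \<Longrightarrow> \<tau> \<in> omap (std n) m" for \<tau> m
    by (simp add: bdry_def std_def mk_sset_simps(1))
  note Uc = functor_comp[OF U, symmetric]
  show ?thesis
    unfolding comparison_map_in_def
  proof (intro exI conjI allI ballI)
    show "is_cotensor D (std n) (fctr_comp (op_cat delta) U X) (fctr_comp (op_cat delta) U XD) (\<lambda>n x. amap U (xD n x))"
      "is_cotensor D (bdry n) (fctr_comp (op_cat delta) U X) (fctr_comp (op_cat delta) U XB) (\<lambda>n x. amap U (xB n x))"
      "is_cotensor D (std n) (fctr_comp (op_cat delta) U Y) (fctr_comp (op_cat delta) U YD) (\<lambda>n x. amap U (yD n x))"
      "is_cotensor D (bdry n) (fctr_comp (op_cat delta) U Y) (fctr_comp (op_cat delta) U YB) (\<lambda>n x. amap U (yB n x))"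
      using is_cotensor_U[OF *(1) X act_closed_std] is_cotensor_U[OF *(2) X act_closed_bdry]
        is_cotensor_U[OF *(3) Y act_closed_std] is_cotensor_U[OF *(4) Y act_closed_bdry] .
    show "nat_trans (op_cat delta) D (fctr_comp (op_cat delta) U XD) (fctr_comp (op_cat delta) U XB) (\<lambda>n. amap U (rX n))"
      "nat_trans (op_cat delta) D (fctr_comp (op_cat delta) U YD) (fctr_comp (op_cat delta) U YB) (\<lambda>n. amap U (rY n))"
      "nat_trans (op_cat delta) D (fctr_comp (op_cat delta) U XD) (fctr_comp (op_cat delta) U YD) (\<lambda>n. amap U (eD n))"
      "nat_trans (op_cat delta) D (fctr_comp (op_cat delta) U XB) (fctr_comp (op_cat delta) U YB) (\<lambda>n. amap U (eB n))"
      using nat_trans_simp_U[OF ob(1,2) *(5)] nat_trans_simp_U[OF ob(3,4) *(7)]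
        nat_trans_simp_U[OF ob(1,3) *(9)] nat_trans_simp_U[OF ob(2,4) *(11)] .
    show "hpullback_map_in D S' (amap U (rX 0)) (amap U (eD 0)) (amap U (eB 0)) (amap U (rY 0))"
      by (rule hpullback_map_in_U[OF *(13) nH[OF *(5)] nH[OF *(9)] nH[OF *(11)] nH[OF *(7)] S])
  next
    fix m \<tau> assume t: "\<tau> \<in> omap (bdry n) m"
    show "amap U (xB m \<tau>) \<cdot>\<^bsub>D\<^esub> amap U (rX m) = amap U (xD m \<tau>)"
      using Uc[OF nH[OF *(5)] tmH[OF tm(2) t]] *(6)[OF t] by simp
    show "amap U (yB m \<tau>) \<cdot>\<^bsub>D\<^esub> amap U (rY m) = amap U (yD m \<tau>)"
      using Uc[OF nH[OF *(7)] tmH[OF tm(4) t]] *(8)[OF t] by simp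
    show "amap U (yB m \<tau>) \<cdot>\<^bsub>D\<^esub> amap U (eB m) = amap U (e m) \<cdot>\<^bsub>D\<^esub> amap U (xB m \<tau>)"
      using Uc[OF nH[OF *(11)] tmH[OF tm(4) t]] Uc[OF tmH[OF tm(2) t] nH[OF e]] *(12)[OF t] by simp
  next
    fix m \<tau> assume t: "\<tau> \<in> omap (std n) m"
    show "amap U (yD m \<tau>) \<cdot>\<^bsub>D\<^esub> amap U (eD m) = amap U (e m) \<cdot>\<^bsub>D\<^esub> amap U (xD m \<tau>)"
      using Uc[OF nH[OF *(9)] tmH[OF tm(3) t]] Uc[OF tmH[OF tm(1) t] nH[OF e]] *(10)[OF t] by simp
  qed
qed

text \<open>The augmented object over \<open>A\<close> is only isomorphic, through
  \<open>\<alpha>\<close> and \<open>\<beta>\<close>, to the image of \<open>e\<close>. These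
  isomorphisms are composed into the replacement maps, so that the fibrant objects, their matching
  objects and their cotensors are exactly images under \<open>U\<close>.\<close>

lemma hypercovering_U:
  assumes hyp: "hypercovering M S X Y e"
    and S: "\<And>h. h \<in> S \<Longrightarrow> h \<in> Arr M \<Longrightarrow> amap U h \<in> S'"
    and B: "B \<in> Ob (simp_cat D)" and A: "A \<in> Ob D"
    and e0: "nat_trans (op_cat delta) D B (const_fctr (op_cat delta) D A) e0"
    and \<alpha>: "nat_trans (op_cat delta) D B (fctr_comp (op_cat delta) U X) \<alpha>" and \<alpha>_iso: "\<And>n. is_iso D (\<alpha> n)"
    and \<beta>: "\<beta> \<in> Hom D A (omap U Y)" and \<beta>_iso: "is_iso D \<beta>"
    and sq: "\<And>n. \<beta> \<cdot>\<^bsub>D\<^esub> e0 n = amap U (e n) \<cdot>\<^bsub>D\<^esub> \<alpha> n"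
  shows "hypercovering D S' B A e0"
proof -
  let ?U = "fctr_comp (op_cat delta) U"
  let ?k = "const_fctr (op_cat delta)"
  have dc: "is_category (op_cat delta)" by (rule is_category_op[OF is_category_delta])
  obtain X' Y' i j e' where *:
    "reedy_weq M X X' i" "reedy_fibrant M X'" "reedy_weq M (?k M Y) Y' j" "reedy_fibrant M Y'"
    "nat_trans (op_cat delta) M X' Y' e'" "\<And>n. e' n \<cdot>\<^bsub>M\<^esub> i n = j n \<cdot>\<^bsub>M\<^esub> e n"
    "\<And>n. comparison_map_in M S X' Y' e' n"
    using hyp unfolding hypercovering_def by auto
  have Y: "Y \<in> Ob M" and X: "X \<in> Ob (simp_cat M)" and e: "nat_trans (op_cat delta) M X (?k M Y) e"
    using hyp unfolding hypercovering_def by auto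
  have X': "X' \<in> Ob (simp_cat M)" and Y': "Y' \<in> Ob (simp_cat M)" and kY: "?k M Y \<in> Ob (simp_cat M)"
    using *(1,3) by (auto simp: reedy_weq_def)
  have i: "nat_trans (op_cat delta) M X X' i" and j: "nat_trans (op_cat delta) M (?k M Y) Y' j"
    and iw: "i n \<in> Weq M" and jw: "j n \<in> Weq M" for n
    using *(1,3) by (auto simp: reedy_weq_def)
  have kA: "?k D A \<in> Ob (simp_cat D)" using const_fctr_is_functor[OF dc D A] by simp
  have kUY: "?U (?k M Y) = ?k D (omap U Y)" by (rule fctr_comp_const[OF dc U Y])
  have \<beta>n: "nat_trans (op_cat delta) D (?k D A) (?k D (omap U Y)) (\<lambda>_. \<beta>)"
    using \<beta> Comp_Ident[OF D \<beta>] HomD(1)[of _ delta] by (simp add: nat_trans_def)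
  note Ui = nat_trans_simp_U[OF X X' i] and Uj = nat_trans_simp_U[OF kY Y' j, unfolded kUY]
  have ob: "?U X \<in> Ob (simp_cat D)" "?U X' \<in> Ob (simp_cat D)" "?U Y' \<in> Ob (simp_cat D)" "?k D (omap U Y) \<in> Ob (simp_cat D)"
    using functor_simp_Ob[OF X] functor_simp_Ob[OF X'] functor_simp_Ob[OF Y'] functor_simp_Ob[OF kY] kUY by simp_all
  have nH: "\<eta> n \<in> Hom C (omap F n) (omap G n)" if "nat_trans (op_cat delta) C F G \<eta>" for C :: "('x, 'w) model" and F G \<eta> n
    using nat_trans_Hom[OF that, of n] by simp
  show ?thesis
    unfolding hypercovering_def
  proof (intro conjI exI allI)
    show "reedy_weq D B (?U X') (\<lambda>n. amap U (i n) \<cdot>\<^bsub>D\<^esub> \<alpha> n)"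
      unfolding reedy_weq_def WeqD
      using nat_trans_comp[OF D dc _ _ _ \<alpha> Ui] is_iso_comp[OF D \<alpha>_iso nH[OF \<alpha>] _ nH[OF Ui]] WeqM[OF iw] B ob by simp
    show "reedy_weq D (?k D A) (?U Y') (\<lambda>n. amap U (j n) \<cdot>\<^bsub>D\<^esub> \<beta>)"
      unfolding reedy_weq_def WeqD
      using nat_trans_comp[OF D dc _ _ _ \<beta>n Uj] is_iso_comp[OF D \<beta>_iso \<beta> conjunct2[OF WeqM[OF jw]]] nH[OF Uj] \<beta>n kA ob
      by (simp, metis)
    show "reedy_fibrant D (?U X')" "reedy_fibrant D (?U Y')" using reedy_fibrant_U *(2,4) by auto
    show "nat_trans (op_cat delta) D (?U X') (?U Y') (\<lambda>n. amap U (e' n))" by (rule nat_trans_simp_U[OF X' Y' *(5)])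
    fix n
    show "comparison_map_in D S' (?U X') (?U Y') (\<lambda>n. amap U (e' n)) n"
      by (rule comparison_map_in_U[OF *(7) X' Y' *(5) S])
    have en: "e n \<in> Hom M (omap X n) Y" and jn: "j n \<in> Hom M Y (omap Y' n)" using nH[OF e, of n] nH[OF j, of n] by simp_all
    have e0n: "e0 n \<in> Hom D (omap B n) A" and \<alpha>n: "\<alpha> n \<in> Hom D (omap B n) (omap U (omap X n))"
      using nH[OF e0, of n] nH[OF \<alpha>, of n] by simp_all
    note Uin = functor_Hom[OF U nH[OF i, of n]] and Ue'n = functor_Hom[OF U nH[OF *(5), of n]]
      and Ujn = functor_Hom[OF U jn] and Uen = functor_Hom[OF U en]
    \<comment> \<open>Both sides are rewritten to the image of \<open>j n\<close> after
      \<open>e n\<close>, preceded by \<open>\<alpha> n\<close>.\<close>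
    show "amap U (e' n) \<cdot>\<^bsub>D\<^esub> (amap U (i n) \<cdot>\<^bsub>D\<^esub> \<alpha> n) = amap U (j n) \<cdot>\<^bsub>D\<^esub> \<beta> \<cdot>\<^bsub>D\<^esub> e0 n"
      unfolding Comp_assoc[OF D \<alpha>n Uin Ue'n] Comp_assoc[OF D e0n \<beta> Ujn, symmetric] sq
        Comp_assoc[OF D \<alpha>n Uen Ujn]
        functor_comp[OF U nH[OF i] nH[OF *(5)], symmetric] functor_comp[OF U en jn, symmetric] *(6) ..
  qed (use A B e0 in auto)
qed

end

section \<open>Invariance of etale maps under isomorphism\<close>

definition frag_map :: "('a \<Rightarrow> 'b) \<Rightarrow> ('a \<Rightarrow>\<^sub>0 int) \<Rightarrow> ('b \<Rightarrow>\<^sub>0 int)" where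
  "frag_map h = frag_extend (frag_of \<circ> h)"

lemma frag_map_simps [simp]:
  "frag_map h 0 = 0" "frag_map h (frag_of x) = frag_of (h x)" "frag_map h (- a) = - frag_map h a"
  "frag_map h (a + b) = frag_map h a + frag_map h b" "frag_map h (a - b) = frag_map h a - frag_map h b"
  by (simp_all add: frag_map_def frag_extend_minus frag_extend_add frag_extend_diff)

lemma frag_map_comp: "frag_map g (frag_map h t) = frag_map (g \<circ> h) t"
  unfolding frag_map_def frag_extend_compose by (simp add: comp_assoc)

lemma frag_map_cong: "(\<And>x. x \<in> Poly_Mapping.keys t \<Longrightarrow> h x = g x) \<Longrightarrow> frag_map h t = frag_map g t"
  unfolding frag_map_def by (rule frag_extend_eq) simp

lemma frag_map_id: "(\<And>x. x \<in> Poly_Mapping.keys t \<Longrightarrow> h x = x) \<Longrightarrow> frag_map h t = t"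
  using frag_map_cong[of t h id] frag_expansion[of t] by (simp add: frag_map_def)

lemma keys_frag_map: "Poly_Mapping.keys (frag_map h t) \<subseteq> h ` Poly_Mapping.keys t"
  unfolding frag_map_def using keys_frag_extend[of "frag_of \<circ> h" t] by fastforce

text \<open>Induction on the generation of \<open>t\<close>: it suffices that generators go to
  generators. The carrier conditions identify the group inverse of a generator with its
  negative.\<close>

lemma frag_map_generate:
  assumes G: "G \<subseteq> carrier (free_Abelian_group A)" and G': "G' \<subseteq> carrier (free_Abelian_group B)"
    and h: "\<And>g. g \<in> G \<Longrightarrow> frag_map h g \<in> G'"
    and t: "t \<in> generate (free_Abelian_group A) G"
  shows "frag_map h t \<in> generate (free_Abelian_group B) G'"
  using t
proof (induction rule: generate.induct)
  case one
  show ?case using generate.one[of "free_Abelian_group B" G'] by simp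
next
  case (incl g)
  then show ?case using h by (blast intro: generate.incl)
next
  case (inv g)
  have "inv\<^bsub>free_Abelian_group A\<^esub> g = - g" using G inv by auto
  moreover have "inv\<^bsub>free_Abelian_group B\<^esub> (frag_map h g) = - frag_map h g"
    using G' h[OF inv] by auto
  ultimately show ?case using generate.inv[OF h[OF inv], of "free_Abelian_group B"] by simp
next
  case (eng a b)
  then show ?case using generate.eng[of "frag_map h a" "free_Abelian_group B" G' "frag_map h b"] by simp
qed

lemma frag_of_carrier: "x \<in> A \<Longrightarrow> frag_of x \<in> carrier (free_Abelian_group A)"
  by (simp add: free_Abelian_group_def)

lemma frag_diff_carrier:
  assumes "a \<in> carrier (free_Abelian_group A)" "b \<in> carrier (free_Abelian_group A)"
  shows "a - b \<in> carrier (free_Abelian_group A)"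
  using assms keys_diff[of a b] by (auto simp: free_Abelian_group_def)

text \<open>An isomorphism kept together with its inverse, between rings that may live in different
  types. The notion is symmetric, so a fact proved for one direction is available for the
  other.\<close>

definition iso_pair :: "('a, 'b) ring_scheme \<Rightarrow> ('c, 'd) ring_scheme \<Rightarrow> ('a \<Rightarrow> 'c) \<Rightarrow> ('c \<Rightarrow> 'a) \<Rightarrow> bool" where
  "iso_pair R R' \<phi> \<phi>' \<longleftrightarrow> cring R \<and> cring R' \<and> \<phi> \<in> ring_hom R R' \<and> \<phi>' \<in> ring_hom R' R \<and>
     (\<forall>x\<in>carrier R. \<phi>' (\<phi> x) = x) \<and> (\<forall>x\<in>carrier R'. \<phi> (\<phi>' x) = x)"

lemma iso_pair_sym: "iso_pair R R' \<phi> \<phi>' \<Longrightarrow> iso_pair R' R \<phi>' \<phi>"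
  by (simp add: iso_pair_def)

lemma iso_pairD:
  assumes "iso_pair R R' \<phi> \<phi>'"
  shows "cring R" "cring R'" "\<And>x. x \<in> carrier R \<Longrightarrow> \<phi> x \<in> carrier R'"
    "\<And>x y. x \<in> carrier R \<Longrightarrow> y \<in> carrier R \<Longrightarrow> \<phi> (x \<otimes>\<^bsub>R\<^esub> y) = \<phi> x \<otimes>\<^bsub>R'\<^esub> \<phi> y"
    "\<And>x y. x \<in> carrier R \<Longrightarrow> y \<in> carrier R \<Longrightarrow> \<phi> (x \<oplus>\<^bsub>R\<^esub> y) = \<phi> x \<oplus>\<^bsub>R'\<^esub> \<phi> y"
    "\<phi> \<one>\<^bsub>R\<^esub> = \<one>\<^bsub>R'\<^esub>" "\<phi> \<zero>\<^bsub>R\<^esub> = \<zero>\<^bsub>R'\<^esub>"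
    "\<And>x. x \<in> carrier R \<Longrightarrow> \<phi>' (\<phi> x) = x" "\<phi> \<in> ring_hom R R'"
proof -
  show cr: "cring R" "cring R'" and h: "\<phi> \<in> ring_hom R R'" and "\<And>x. x \<in> carrier R \<Longrightarrow> \<phi>' (\<phi> x) = x"
    using assms by (auto simp: iso_pair_def)
  show "\<And>x. x \<in> carrier R \<Longrightarrow> \<phi> x \<in> carrier R'"
    "\<And>x y. x \<in> carrier R \<Longrightarrow> y \<in> carrier R \<Longrightarrow> \<phi> (x \<otimes>\<^bsub>R\<^esub> y) = \<phi> x \<otimes>\<^bsub>R'\<^esub> \<phi> y"
    "\<And>x y. x \<in> carrier R \<Longrightarrow> y \<in> carrier R \<Longrightarrow> \<phi> (x \<oplus>\<^bsub>R\<^esub> y) = \<phi> x \<oplus>\<^bsub>R'\<^esub> \<phi> y"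
    "\<phi> \<one>\<^bsub>R\<^esub> = \<one>\<^bsub>R'\<^esub>"
    using h by (auto simp: ring_hom_def)
  show "\<phi> \<zero>\<^bsub>R\<^esub> = \<zero>\<^bsub>R'\<^esub>" using ring_hom_zero[OF h] cr by (simp add: cring.axioms(1))
qed

section \<open>Tensor relations and flatness\<close>

definition tensor_gens ::
  "('a, 'b) ring_scheme \<Rightarrow> ('a, 'm) module \<Rightarrow> ('s, 'c) ring_scheme \<Rightarrow> ('a \<Rightarrow> 's) \<Rightarrow> (('m \<times> 's) \<Rightarrow>\<^sub>0 int) set" where
  "tensor_gens R M S f =
      {frag_of (x \<oplus>\<^bsub>M\<^esub> y, s) - frag_of (x, s) - frag_of (y, s) | x y s.
         x \<in> carrier M \<and> y \<in> carrier M \<and> s \<in> carrier S} \<union>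
      {frag_of (x, s \<oplus>\<^bsub>S\<^esub> t) - frag_of (x, s) - frag_of (x, t) | x s t.
         x \<in> carrier M \<and> s \<in> carrier S \<and> t \<in> carrier S} \<union>
      {frag_of (r \<odot>\<^bsub>M\<^esub> x, s) - frag_of (x, f r \<otimes>\<^bsub>S\<^esub> s) | r x s.
         r \<in> carrier R \<and> x \<in> carrier M \<and> s \<in> carrier S}"

lemma tensor_relations_gens:
  "tensor_relations R M S f = generate (free_Abelian_group (carrier M \<times> carrier S)) (tensor_gens R M S f)"
  by (simp add: tensor_relations_def tensor_gens_def)

lemma tensor_gens_cases [consumes 1, case_names add_left add_right smult]:
  assumes "g \<in> tensor_gens R M S f"
  obtains x y s where "g = frag_of (x \<oplus>\<^bsub>M\<^esub> y, s) - frag_of (x, s) - frag_of (y, s)"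
      "x \<in> carrier M" "y \<in> carrier M" "s \<in> carrier S"
    | x s t where "g = frag_of (x, s \<oplus>\<^bsub>S\<^esub> t) - frag_of (x, s) - frag_of (x, t)"
      "x \<in> carrier M" "s \<in> carrier S" "t \<in> carrier S"
    | r x s where "g = frag_of (r \<odot>\<^bsub>M\<^esub> x, s) - frag_of (x, f r \<otimes>\<^bsub>S\<^esub> s)"
      "r \<in> carrier R" "x \<in> carrier M" "s \<in> carrier S"
  using assms unfolding tensor_gens_def by blast

lemma tensor_gens_carrier:
  assumes M: "Module.module R M" and S: "cring S" and f: "\<And>r. r \<in> carrier R \<Longrightarrow> f r \<in> carrier S"
  shows "tensor_gens R M S f \<subseteq> carrier (free_Abelian_group (carrier M \<times> carrier S))"
proof -
  interpret M: Module.module R M by fact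
  interpret S: cring S by fact
  show ?thesis
    unfolding tensor_gens_def
    by (auto intro!: frag_diff_carrier frag_of_carrier simp: f simp del: carrier_free_Abelian_group_iff)
qed

text \<open>A map semilinear over \<open>\<phi>\<close>, paired with \<open>\<psi>\<close>, sends
  each defining relation to one of the same kind; \<open>ff\<close> takes care of the scalars that
  cross the tensor sign.\<close>

lemma tensor_relations_map:
  assumes M: "Module.module R M" and M': "Module.module R' M'" and S: "cring S" and S': "cring S'"
    and \<phi>: "\<And>r. r \<in> carrier R \<Longrightarrow> \<phi> r \<in> carrier R'"
    and m: "\<And>x. x \<in> carrier M \<Longrightarrow> m x \<in> carrier M'"
      "\<And>x y. x \<in> carrier M \<Longrightarrow> y \<in> carrier M \<Longrightarrow> m (x \<oplus>\<^bsub>M\<^esub> y) = m x \<oplus>\<^bsub>M'\<^esub> m y"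
      "\<And>r x. r \<in> carrier R \<Longrightarrow> x \<in> carrier M \<Longrightarrow> m (r \<odot>\<^bsub>M\<^esub> x) = \<phi> r \<odot>\<^bsub>M'\<^esub> m x"
    and \<psi>: "\<psi> \<in> ring_hom S S'"
    and f: "\<And>r. r \<in> carrier R \<Longrightarrow> f r \<in> carrier S" and f': "\<And>r. r \<in> carrier R' \<Longrightarrow> f' r \<in> carrier S'"
    and ff: "\<And>r. r \<in> carrier R \<Longrightarrow> f' (\<phi> r) = \<psi> (f r)"
    and t: "t \<in> tensor_relations R M S f"
  shows "frag_map (\<lambda>(x, s). (m x, \<psi> s)) t \<in> tensor_relations R' M' S' f'"
  using t unfolding tensor_relations_gens
proof (rule frag_map_generate[OF tensor_gens_carrier[OF M S f] tensor_gens_carrier[OF M' S' f'], rotated -1])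
  interpret S: cring S by fact
  note \<psi>' = ring_hom_closed[OF \<psi>] ring_hom_add[OF \<psi>] ring_hom_mult[OF \<psi>]
  let ?m = "\<lambda>(x, s). (m x, \<psi> s)"
  fix g assume "g \<in> tensor_gens R M S f"
  then show "frag_map ?m g \<in> tensor_gens R' M' S' f'"
  proof (cases rule: tensor_gens_cases)
    case (add_left x y s)
    then have "frag_map ?m g = frag_of (m x \<oplus>\<^bsub>M'\<^esub> m y, \<psi> s) - frag_of (m x, \<psi> s) - frag_of (m y, \<psi> s)"
      by (simp add: m)
    then show ?thesis unfolding tensor_gens_def using add_left m(1) \<psi>'(1) by blast
  next
    case (add_right x s t)
    then have "frag_map ?m g = frag_of (m x, \<psi> s \<oplus>\<^bsub>S'\<^esub> \<psi> t) - frag_of (m x, \<psi> s) - frag_of (m x, \<psi> t)"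
      by (simp add: \<psi>')
    then show ?thesis unfolding tensor_gens_def using add_right m(1) \<psi>'(1) by blast
  next
    case (smult r x s)
    then have "frag_map ?m g = frag_of (\<phi> r \<odot>\<^bsub>M'\<^esub> m x, \<psi> s) - frag_of (m x, f' (\<phi> r) \<otimes>\<^bsub>S'\<^esub> \<psi> s)"
      by (simp add: \<psi>' m f ff)
    then show ?thesis unfolding tensor_gens_def using smult m(1) \<psi>'(1) \<phi> by blast
  qed
qed

text \<open>Only the scalar action changes, so the carrier stays in the universe over which
  \<open>flat\<close> quantifies.\<close>

definition restrict_scalars :: "('c \<Rightarrow> 'a) \<Rightarrow> ('a, 'm) module \<Rightarrow> ('c, 'm) module" where
  "restrict_scalars \<phi> M = \<lparr>carrier = carrier M, mult = mult M, one = one M, zero = zero M, add = add M,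
     smult = (\<lambda>r x. \<phi> r \<odot>\<^bsub>M\<^esub> x)\<rparr>"

lemma restrict_scalars_simps [simp]:
  "carrier (restrict_scalars \<phi> M) = carrier M" "add (restrict_scalars \<phi> M) = add M"
  "zero (restrict_scalars \<phi> M) = zero M" "smult (restrict_scalars \<phi> M) r x = \<phi> r \<odot>\<^bsub>M\<^esub> x"
  by (simp_all add: restrict_scalars_def)

lemma module_restrict_scalars:
  assumes M: "Module.module R' M" and R: "cring R" and \<phi>: "\<phi> \<in> ring_hom R R'"
  shows "Module.module R (restrict_scalars \<phi> M)"
proof -
  interpret M: Module.module R' M by fact
  have \<phi>': "\<And>r. r \<in> carrier R \<Longrightarrow> \<phi> r \<in> carrier R'"
    "\<And>r t. r \<in> carrier R \<Longrightarrow> t \<in> carrier R \<Longrightarrow> \<phi> (r \<oplus>\<^bsub>R\<^esub> t) = \<phi> r \<oplus>\<^bsub>R'\<^esub> \<phi> t"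
    "\<And>r t. r \<in> carrier R \<Longrightarrow> t \<in> carrier R \<Longrightarrow> \<phi> (r \<otimes>\<^bsub>R\<^esub> t) = \<phi> r \<otimes>\<^bsub>R'\<^esub> \<phi> t"
    "\<phi> \<one>\<^bsub>R\<^esub> = \<one>\<^bsub>R'\<^esub>"
    using \<phi> by (auto simp: ring_hom_def)
  have ab: "abelian_group (restrict_scalars \<phi> M)"
  proof (rule abelian_groupI)
    fix x assume "x \<in> carrier (restrict_scalars \<phi> M)"
    then show "\<exists>y\<in>carrier (restrict_scalars \<phi> M). y \<oplus>\<^bsub>restrict_scalars \<phi> M\<^esub> x = \<zero>\<^bsub>restrict_scalars \<phi> M\<^esub>"
      using M.M.l_neg M.M.a_inv_closed by (intro bexI[of _ "\<ominus>\<^bsub>M\<^esub> x"]) simp_all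
  qed (simp_all add: M.M.a_assoc M.M.a_comm M.M.a_lcomm)
  show ?thesis
    by (rule moduleI[OF R ab]) (simp_all add: \<phi>' M.smult_l_distr M.smult_r_distr M.smult_assoc1)
qed

text \<open>A module over \<open>R'\<close> is one over \<open>R\<close> by restriction along
  \<open>\<phi>\<close>, so flatness over \<open>R\<close> applies to it. Elements are moved from
  \<open>S'\<close> to \<open>S\<close> by \<open>\<psi>'\<close>, and the conclusion is moved back
  by \<open>\<psi>\<close>.\<close>

lemma flat_iso:
  fixes R :: "('a, 'b) ring_scheme" and R' :: "('c, 'd) ring_scheme" and U :: "'e itself"
  assumes R: "iso_pair R R' \<phi> \<phi>'" and S: "iso_pair S S' \<psi> \<psi>'"
    and f: "\<And>r. r \<in> carrier R \<Longrightarrow> f r \<in> carrier S" and f': "\<And>r. r \<in> carrier R' \<Longrightarrow> f' r \<in> carrier S'"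
    and ff: "\<And>r. r \<in> carrier R \<Longrightarrow> f' (\<phi> r) = \<psi> (f r)"
    and flat: "flat U R S f"
  shows "flat U R' S' f'"
  unfolding flat_def
proof (intro allI impI ballI)
  fix M :: "('c, 'e) module" and M2 :: "('c, 'e) module" and g t
  assume *: "Module.module R' M \<and> Module.module R' M2 \<and> g \<in> carrier M \<rightarrow> carrier M2 \<and> inj_on g (carrier M) \<and>
      (\<forall>x\<in>carrier M. \<forall>y\<in>carrier M. g (x \<oplus>\<^bsub>M\<^esub> y) = g x \<oplus>\<^bsub>M2\<^esub> g y) \<and>
      (\<forall>r\<in>carrier R'. \<forall>x\<in>carrier M. g (r \<odot>\<^bsub>M\<^esub> x) = r \<odot>\<^bsub>M2\<^esub> g x)"
    and t: "t \<in> carrier (free_Abelian_group (carrier M \<times> carrier S'))"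
    and gt: "frag_extend (\<lambda>(x, s). frag_of (g x, s)) t \<in> tensor_relations R' M2 S' f'"
  note Rd = iso_pairD[OF R] and Rd' = iso_pairD[OF iso_pair_sym[OF R]]
  note Sd = iso_pairD[OF S] and Sd' = iso_pairD[OF iso_pair_sym[OF S]]
  let ?N = "restrict_scalars \<phi> M" and ?N2 = "restrict_scalars \<phi> M2"
  have M: "Module.module R' M" and M2: "Module.module R' M2" using * by auto
  have N: "Module.module R ?N" and N2: "Module.module R ?N2"
    using module_restrict_scalars[OF M Rd(1,9)] module_restrict_scalars[OF M2 Rd(1,9)] .
  have ff': "f (\<phi>' r) = \<psi>' (f' r)" if "r \<in> carrier R'" for r
    using ff[of "\<phi>' r"] that Rd' Sd f by (metis iso_pairD(3,8) iso_pair_sym[OF R])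
  have fr: "frag_extend (\<lambda>(x, s). frag_of (h x, s)) = frag_map (\<lambda>(x, s). (h x, s))" for h :: "'e \<Rightarrow> 'e"
    unfolding frag_map_def by (rule arg_cong[of _ _ frag_extend]) auto
  \<comment> \<open>The given element with its second factors moved to \<open>S\<close>; the module
    factor is untouched.\<close>
  define u where "u = frag_map (\<lambda>(x, s). (x, \<psi>' s)) t"
  have kt: "Poly_Mapping.keys t \<subseteq> carrier M \<times> carrier S'" using t by (simp add: free_Abelian_group_def)
  have "frag_map (\<lambda>(x, s). (x, \<psi>' s)) (frag_map (\<lambda>(x, s). (g x, s)) t) \<in> tensor_relations R ?N2 S f"
    by (rule tensor_relations_map[where \<phi> = \<phi>' and m = "\<lambda>x. x" and \<psi> = \<psi>' and f = f' and f' = f, OF M2 N2 Sd(2,1) Rd'(3) _ _ _ Sd'(9) f' f ff' gt[unfolded fr]])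
      (simp_all add: Rd'(8))
  also have "frag_map (\<lambda>(x, s). (x, \<psi>' s)) (frag_map (\<lambda>(x, s). (g x, s)) t) = frag_extend (\<lambda>(x, s). frag_of (g x, s)) u"
    unfolding fr u_def frag_map_comp by (rule frag_map_cong) auto
  finally have gu: "frag_extend (\<lambda>(x, s). frag_of (g x, s)) u \<in> tensor_relations R ?N2 S f" .
  have "Poly_Mapping.keys u \<subseteq> carrier ?N \<times> carrier S"
    unfolding u_def by (rule order_trans[OF keys_frag_map]) (use kt Sd'(3) in auto)
  then have uc: "u \<in> carrier (free_Abelian_group (carrier ?N \<times> carrier S))" by (simp add: free_Abelian_group_def)
  have uN: "u \<in> tensor_relations R ?N S f"
    using flat[unfolded flat_def, THEN spec, of ?N, THEN spec, of ?N2, THEN spec, of g, THEN mp, THEN bspec, OF _ uc, THEN mp, OF _ gu]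
      * N N2 Rd(3) by simp
  have "frag_map (\<lambda>(x, s). (x, \<psi> s)) u \<in> tensor_relations R' M S' f'"
    by (rule tensor_relations_map[where \<phi> = \<phi> and m = "\<lambda>x. x" and \<psi> = \<psi> and f = f and f' = f', OF N M Sd(1,2) Rd(3) _ _ _ Sd(9) f f' ff uN]) simp_all
  also have "frag_map (\<lambda>(x, s). (x, \<psi> s)) u = t"
    unfolding u_def frag_map_comp by (rule frag_map_id) (use kt Sd'(8) in auto)
  finally show "t \<in> tensor_relations R' M S' f'" .
qed


section \<open>Kaehler differentials\<close>

definition kaehler_gens ::
  "('a, 'b) ring_scheme \<Rightarrow> ('s, 'c) ring_scheme \<Rightarrow> ('a \<Rightarrow> 's) \<Rightarrow> (('s \<times> 's) \<Rightarrow>\<^sub>0 int) set" where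
  "kaehler_gens R S f =
      {frag_of (s \<oplus>\<^bsub>S\<^esub> s', t) - frag_of (s, t) - frag_of (s', t) | s s' t.
         s \<in> carrier S \<and> s' \<in> carrier S \<and> t \<in> carrier S} \<union>
      {frag_of (s, t \<oplus>\<^bsub>S\<^esub> t') - frag_of (s, t) - frag_of (s, t') | s t t'.
         s \<in> carrier S \<and> t \<in> carrier S \<and> t' \<in> carrier S} \<union>
      {frag_of (s, t \<otimes>\<^bsub>S\<^esub> t') - frag_of (s \<otimes>\<^bsub>S\<^esub> t, t') - frag_of (s \<otimes>\<^bsub>S\<^esub> t', t) | s t t'.
         s \<in> carrier S \<and> t \<in> carrier S \<and> t' \<in> carrier S} \<union>
      {frag_of (s, f r) | s r. s \<in> carrier S \<and> r \<in> carrier R}"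

lemma kaehler_relations_gens:
  "kaehler_relations R S f = generate (free_Abelian_group (carrier S \<times> carrier S)) (kaehler_gens R S f)"
  by (simp add: kaehler_relations_def kaehler_gens_def)

lemma kaehler_gens_carrier:
  assumes S: "cring S" and f: "\<And>r. r \<in> carrier R \<Longrightarrow> f r \<in> carrier S"
  shows "kaehler_gens R S f \<subseteq> carrier (free_Abelian_group (carrier S \<times> carrier S))"
proof -
  interpret S: cring S by fact
  show ?thesis
    unfolding kaehler_gens_def
    by (auto intro!: frag_diff_carrier frag_of_carrier simp: f simp del: carrier_free_Abelian_group_iff)
qed

text \<open>Each element is pulled back to \<open>S\<close>, where it is generated by the relations,
  and pushed forward again; \<open>ff\<close> takes differentials of constants to differentials of
  constants.\<close>

lemma unramified_iso:
  assumes R: "iso_pair R R' \<phi> \<phi>'" and S: "iso_pair S S' \<psi> \<psi>'"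
    and f: "\<And>r. r \<in> carrier R \<Longrightarrow> f r \<in> carrier S" and f': "\<And>r. r \<in> carrier R' \<Longrightarrow> f' r \<in> carrier S'"
    and ff: "\<And>r. r \<in> carrier R \<Longrightarrow> f' (\<phi> r) = \<psi> (f r)"
    and unr: "unramified R S f"
  shows "unramified R' S' f'"
proof -
  note Rd = iso_pairD[OF R] and Rd' = iso_pairD[OF iso_pair_sym[OF R]]
  note Sd = iso_pairD[OF S] and Sd' = iso_pairD[OF iso_pair_sym[OF S]]
  interpret S: cring S by (rule Sd(1))
  let ?F = "free_Abelian_group (carrier S' \<times> carrier S')"
  have Gc: "kaehler_gens R S f \<subseteq> carrier (free_Abelian_group (carrier S \<times> carrier S))"
    and G'c: "kaehler_gens R' S' f' \<subseteq> carrier ?F"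
    by (rule kaehler_gens_carrier[OF Sd(1)], erule f) (rule kaehler_gens_carrier[OF Sd(2)], erule f')
  let ?m = "\<lambda>(x, y). (\<psi> x, \<psi> y)" and ?m' = "\<lambda>(x, y). (\<psi>' x, \<psi>' y)"
  have GG: "frag_map ?m g \<in> kaehler_gens R' S' f'" if "g \<in> kaehler_gens R S f" for g
  proof -
    from that consider s s' t where "g = frag_of (s \<oplus>\<^bsub>S\<^esub> s', t) - frag_of (s, t) - frag_of (s', t)"
      "s \<in> carrier S" "s' \<in> carrier S" "t \<in> carrier S"
      | s t t' where "g = frag_of (s, t \<oplus>\<^bsub>S\<^esub> t') - frag_of (s, t) - frag_of (s, t')"
        "s \<in> carrier S" "t \<in> carrier S" "t' \<in> carrier S"
      | s t t' where "g = frag_of (s, t \<otimes>\<^bsub>S\<^esub> t') - frag_of (s \<otimes>\<^bsub>S\<^esub> t, t') - frag_of (s \<otimes>\<^bsub>S\<^esub> t', t)"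
        "s \<in> carrier S" "t \<in> carrier S" "t' \<in> carrier S"
      | s r where "g = frag_of (s, f r)" "s \<in> carrier S" "r \<in> carrier R"
      unfolding kaehler_gens_def by blast
    then show ?thesis
    proof cases
      case 1
      then have "frag_map ?m g = frag_of (\<psi> s \<oplus>\<^bsub>S'\<^esub> \<psi> s', \<psi> t) - frag_of (\<psi> s, \<psi> t) - frag_of (\<psi> s', \<psi> t)"
        by (simp add: Sd)
      then show ?thesis unfolding kaehler_gens_def using 1 Sd(3) by blast
    next
      case 2
      then have "frag_map ?m g = frag_of (\<psi> s, \<psi> t \<oplus>\<^bsub>S'\<^esub> \<psi> t') - frag_of (\<psi> s, \<psi> t) - frag_of (\<psi> s, \<psi> t')"
        by (simp add: Sd)
      then show ?thesis unfolding kaehler_gens_def using 2 Sd(3) by blast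
    next
      case 3
      then have "frag_map ?m g = frag_of (\<psi> s, \<psi> t \<otimes>\<^bsub>S'\<^esub> \<psi> t') - frag_of (\<psi> s \<otimes>\<^bsub>S'\<^esub> \<psi> t, \<psi> t') - frag_of (\<psi> s \<otimes>\<^bsub>S'\<^esub> \<psi> t', \<psi> t)"
        by (simp add: Sd)
      then show ?thesis unfolding kaehler_gens_def using 3 Sd(3) by blast
    next
      case 4
      then have "frag_map ?m g = frag_of (\<psi> s, f' (\<phi> r))" by (simp add: ff)
      then show ?thesis unfolding kaehler_gens_def using 4 Sd(3) Rd(3) by blast
    qed
  qed
  have "t \<in> generate ?F (kaehler_gens R' S' f')"
    if t: "t \<in> carrier ?F" for t
  proof -
    have kt: "Poly_Mapping.keys t \<subseteq> carrier S' \<times> carrier S'" using t by simp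
    have "Poly_Mapping.keys (frag_map ?m' t) \<subseteq> carrier S \<times> carrier S"
      by (rule order_trans[OF keys_frag_map]) (use kt Sd'(3) in auto)
    then have "frag_map ?m' t \<in> generate (free_Abelian_group (carrier S \<times> carrier S)) (kaehler_gens R S f)"
      using unr unfolding unramified_def kaehler_relations_gens by simp
    then have "frag_map ?m (frag_map ?m' t) \<in> generate ?F (kaehler_gens R' S' f')"
      by (rule frag_map_generate[OF Gc G'c GG, rotated])
    moreover have "frag_map ?m (frag_map ?m' t) = t"
      unfolding frag_map_comp by (rule frag_map_id) (use kt Sd'(8) in auto)
    ultimately show ?thesis by simp
  qed
  then show ?thesis
    unfolding unramified_def kaehler_relations_gens using group.generate_incl[OF group_free_Abelian_group G'c] by blast
qed

section \<open>Prime spectra and generated ideals\<close>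

lemma primeideal_vimage:
  assumes "cring R" "cring S" "h \<in> ring_hom R S" "primeideal P S"
  shows "primeideal {r \<in> carrier R. h r \<in> P} R"
proof -
  interpret h: ring_hom_cring R S h using assms by (intro ring_hom_cring.intro ring_hom_cring_axioms.intro)
  interpret P: primeideal P S by fact
  show ?thesis
  proof (rule primeidealI[OF h.ring.ideal_vimage[OF P.is_ideal] assms(1)])
    have "\<one>\<^bsub>S\<^esub> \<notin> P" using P.one_imp_carrier P.I_notcarr by blast
    then have "\<one>\<^bsub>R\<^esub> \<notin> {r \<in> carrier R. h r \<in> P}" by simp
    then show "carrier R \<noteq> {r \<in> carrier R. h r \<in> P}" using h.R.one_closed by blast
  next
    fix a b assume "a \<in> carrier R" "b \<in> carrier R" "a \<otimes>\<^bsub>R\<^esub> b \<in> {r \<in> carrier R. h r \<in> P}"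
    then show "a \<in> {r \<in> carrier R. h r \<in> P} \<or> b \<in> {r \<in> carrier R. h r \<in> P}"
      using P.I_prime[of "h a" "h b"] by auto
  qed
qed

text \<open>A prime of \<open>R'\<close> is pulled back along \<open>\<phi>\<close>, lifted to a
  prime \<open>Q\<close> of some \<open>S j\<close>, and \<open>Q\<close> is pulled back along the
  inverse \<open>\<psi>' j\<close>.\<close>

lemma spec_surjective_iso:
  assumes R: "iso_pair R R' \<phi> \<phi>'" and S: "\<And>j. j \<in> J \<Longrightarrow> iso_pair (S j) (S' j) (\<psi> j) (\<psi>' j)"
    and f: "\<And>j r. j \<in> J \<Longrightarrow> r \<in> carrier R \<Longrightarrow> f j r \<in> carrier (S j)"
    and ff: "\<And>j r. j \<in> J \<Longrightarrow> r \<in> carrier R \<Longrightarrow> f' j (\<phi> r) = \<psi> j (f j r)"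
    and sur: "spec_surjective R J S f"
  shows "spec_surjective R' J S' f'"
  unfolding spec_surjective_def
proof (intro allI impI)
  note Rd = iso_pairD[OF R] and Rd' = iso_pairD[OF iso_pair_sym[OF R]]
  fix P assume P: "primeideal P R'"
  obtain j Q where j: "j \<in> J" and Q: "primeideal Q (S j)" "{a \<in> carrier R. f j a \<in> Q} = {r \<in> carrier R. \<phi> r \<in> P}"
    using sur[unfolded spec_surjective_def] primeideal_vimage[OF Rd(1,2,9) P] by blast
  note Sd = iso_pairD[OF S[OF j]] and Sd' = iso_pairD[OF iso_pair_sym[OF S[OF j]]]
  have Pc: "P \<subseteq> carrier R'"
    using P by (simp add: additive_subgroup.a_subset ideal.axioms(1) primeideal.axioms(1))
  have "f' j a \<in> {s \<in> carrier (S' j). \<psi>' j s \<in> Q} \<longleftrightarrow> a \<in> P" if a: "a \<in> carrier R'" for a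
  proof -
    have b: "\<phi>' a \<in> carrier R" "\<phi> (\<phi>' a) = a" using a Rd' by auto
    then have "f' j a = \<psi> j (f j (\<phi>' a))" using ff[OF j b(1)] by simp
    moreover have "\<phi>' a \<in> {a \<in> carrier R. f j a \<in> Q} \<longleftrightarrow> \<phi>' a \<in> {r \<in> carrier R. \<phi> r \<in> P}"
      using Q(2) by simp
    ultimately show ?thesis using b f[OF j b(1)] Sd(3,8) by simp
  qed
  then have "{a \<in> carrier R'. f' j a \<in> {s \<in> carrier (S' j). \<psi>' j s \<in> Q}} = P" using Pc by blast
  then show "\<exists>j\<in>J. \<exists>Q. primeideal Q (S' j) \<and> {a \<in> carrier R'. f' j a \<in> Q} = P"
    using primeideal_vimage[OF Sd'(1,2,9) Q(1)] j by blast
qed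

text \<open>Preimages of ideals are ideals, so minimality of the generated ideal gives one inclusion
  along \<open>h'\<close> and the other along \<open>h\<close>.\<close>

lemma genideal_iso:
  assumes P: "ring P" and P': "ring P'" and h: "h \<in> ring_hom P P'" and h': "h' \<in> ring_hom P' P"
    and inv: "\<And>x. x \<in> carrier P \<Longrightarrow> h' (h x) = x" and inv': "\<And>x. x \<in> carrier P' \<Longrightarrow> h (h' x) = x"
    and F: "F \<subseteq> carrier P"
  shows "Idl\<^bsub>P'\<^esub> (h ` F) = h ` (Idl\<^bsub>P\<^esub> F)"
proof -
  interpret h: ring_hom_ring P P' h using P P' h by (intro ring_hom_ring.intro ring_hom_ring_axioms.intro)
  interpret h': ring_hom_ring P' P h' using P P' h' by (intro ring_hom_ring.intro ring_hom_ring_axioms.intro)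
  have hc: "h x \<in> carrier P'" if "x \<in> carrier P" for x using h that by (simp add: ring_hom_def Pi_iff)
  have hc': "h' x \<in> carrier P" if "x \<in> carrier P'" for x using h' that by (simp add: ring_hom_def Pi_iff)
  have hF: "h ` F \<subseteq> carrier P'" using F hc by blast
  have I: "ideal (Idl\<^bsub>P\<^esub> F) P" and I': "ideal (Idl\<^bsub>P'\<^esub> (h ` F)) P'"
    using h.R.genideal_ideal[OF F] h.S.genideal_ideal[OF hF] .
  have sub: "Idl\<^bsub>P\<^esub> F \<subseteq> carrier P" "Idl\<^bsub>P'\<^esub> (h ` F) \<subseteq> carrier P'"
    using I I' by (simp_all add: additive_subgroup.a_subset ideal.axioms(1))
  show ?thesis
  proof
    have "h ` F \<subseteq> {y \<in> carrier P'. h' y \<in> Idl\<^bsub>P\<^esub> F}"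
    proof (rule image_subsetI)
      fix x assume "x \<in> F"
      then show "h x \<in> {y \<in> carrier P'. h' y \<in> Idl\<^bsub>P\<^esub> F}"
        using hF inv[of x] F h.R.genideal_self[OF F] by (auto simp: subset_iff)
    qed
    then have "Idl\<^bsub>P'\<^esub> (h ` F) \<subseteq> {y \<in> carrier P'. h' y \<in> Idl\<^bsub>P\<^esub> F}"
      by (rule h.S.genideal_minimal[OF h'.ideal_vimage[OF I]])
    then show "Idl\<^bsub>P'\<^esub> (h ` F) \<subseteq> h ` (Idl\<^bsub>P\<^esub> F)" using inv' by (force simp: image_iff)
    have "F \<subseteq> {y \<in> carrier P. h y \<in> Idl\<^bsub>P'\<^esub> (h ` F)}"
      using F h.S.genideal_self[OF hF] by auto
    then have "Idl\<^bsub>P\<^esub> F \<subseteq> {y \<in> carrier P. h y \<in> Idl\<^bsub>P'\<^esub> (h ` F)}"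
      by (rule h.R.genideal_minimal[OF h.ideal_vimage[OF I']])
    then show "h ` (Idl\<^bsub>P\<^esub> F) \<subseteq> Idl\<^bsub>P'\<^esub> (h ` F)" by auto
  qed
qed


section \<open>Polynomial rings and finite presentation\<close>

lemma mpoly_simps [simp]:
  "carrier (mpoly R n) = {p. (\<forall>e. p e \<in> carrier R) \<and> finite {e. p e \<noteq> \<zero>\<^bsub>R\<^esub>} \<and>
     (\<forall>e. p e \<noteq> \<zero>\<^bsub>R\<^esub> \<longrightarrow> (\<forall>i\<ge>n. e i = 0))}"
  "p \<otimes>\<^bsub>mpoly R n\<^esub> q = (\<lambda>e. finsum R (\<lambda>(a, b). p a \<otimes>\<^bsub>R\<^esub> q b) {(a, b). \<forall>i. a i + b i = e i})"
  "\<one>\<^bsub>mpoly R n\<^esub> = (\<lambda>e. if \<forall>i. e i = 0 then \<one>\<^bsub>R\<^esub> else \<zero>\<^bsub>R\<^esub>)"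
  "\<zero>\<^bsub>mpoly R n\<^esub> = (\<lambda>_. \<zero>\<^bsub>R\<^esub>)"
  "p \<oplus>\<^bsub>mpoly R n\<^esub> q = (\<lambda>e. p e \<oplus>\<^bsub>R\<^esub> q e)"
  by (simp_all add: mpoly_def)

text \<open>Acting on coefficients preserves supports, because only zero goes to zero. The predicate
  \<open>ring_hom\<close> states compatibility with the operations alone, so this is available
  before the polynomials are known to form a ring.\<close>

lemma mpoly_map_hom:
  assumes R: "iso_pair R R' \<phi> \<phi>'"
  shows "(\<lambda>p. \<phi> \<circ> p) \<in> ring_hom (mpoly R n) (mpoly R' n)"
proof (rule ring_hom_memI)
  note Rd = iso_pairD[OF R]
  interpret h: ring_hom_cring R R' \<phi>
    using Rd by (intro ring_hom_cring.intro ring_hom_cring_axioms.intro)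
  have z: "\<phi> x = \<zero>\<^bsub>R'\<^esub> \<longleftrightarrow> x = \<zero>\<^bsub>R\<^esub>" if "x \<in> carrier R" for x
    using Rd(7) Rd(8)[OF that] Rd(8)[OF h.R.zero_closed] by metis
  fix p q assume p: "p \<in> carrier (mpoly R n)"
  then have pc: "p e \<in> carrier R" for e by simp
  have "(\<phi> (p e) \<noteq> \<zero>\<^bsub>R'\<^esub>) = (p e \<noteq> \<zero>\<^bsub>R\<^esub>)" for e using z[OF pc] by simp
  then show "\<phi> \<circ> p \<in> carrier (mpoly R' n)" using p by simp
  assume q: "q \<in> carrier (mpoly R n)"
  then have qc: "q e \<in> carrier R" for e by simp
  show "\<phi> \<circ> (p \<oplus>\<^bsub>mpoly R n\<^esub> q) = (\<phi> \<circ> p) \<oplus>\<^bsub>mpoly R' n\<^esub> (\<phi> \<circ> q)"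
    by (simp add: fun_eq_iff pc qc)
  show "\<phi> \<circ> (p \<otimes>\<^bsub>mpoly R n\<^esub> q) = (\<phi> \<circ> p) \<otimes>\<^bsub>mpoly R' n\<^esub> (\<phi> \<circ> q)"
  proof
    fix e
    let ?A = "{(a, b). \<forall>i. a i + b i = e i} :: ((nat \<Rightarrow> nat) \<times> (nat \<Rightarrow> nat)) set"
    have "\<phi> (finsum R (\<lambda>(a, b). p a \<otimes>\<^bsub>R\<^esub> q b) ?A) = finsum R' (\<phi> \<circ> (\<lambda>(a, b). p a \<otimes>\<^bsub>R\<^esub> q b)) ?A"
      by (rule h.hom_finsum) (auto simp: pc qc)
    also have "\<phi> \<circ> (\<lambda>(a, b). p a \<otimes>\<^bsub>R\<^esub> q b) = (\<lambda>(a, b). \<phi> (p a) \<otimes>\<^bsub>R'\<^esub> \<phi> (q b))"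
      by (auto simp: pc qc)
    finally show "(\<phi> \<circ> (p \<otimes>\<^bsub>mpoly R n\<^esub> q)) e = ((\<phi> \<circ> p) \<otimes>\<^bsub>mpoly R' n\<^esub> (\<phi> \<circ> q)) e"
      by simp
  qed
next
  show "\<phi> \<circ> \<one>\<^bsub>mpoly R n\<^esub> = \<one>\<^bsub>mpoly R' n\<^esub>"
    using iso_pairD(6,7)[OF R] by (simp add: fun_eq_iff)
qed

lemma mpoly_eval_closed:
  assumes R: "cring R" and S: "cring S" and f: "f \<in> carrier R \<rightarrow> carrier S" and x: "x \<in> {..<n} \<rightarrow> carrier S"
    and p: "p \<in> carrier (mpoly R n)"
  shows "mpoly_eval R S f n x p \<in> carrier S"
proof -
  interpret S: cring S by fact
  have "p e \<in> carrier R" for e using p by simp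
  then have "f (p e) \<in> carrier S" for e using f by blast
  moreover have "(\<Otimes>\<^bsub>S\<^esub>i\<in>{..<n}. x i [^]\<^bsub>S\<^esub> (e i :: nat)) \<in> carrier S" for e
    using x by (intro S.finprod_closed) auto
  ultimately show ?thesis unfolding mpoly_eval_def by (intro S.finsum_closed) auto
qed

text \<open>Both evaluations sum over the same support, since \<open>\<phi>\<close> kills no nonzero
  coefficient; moreover \<open>\<psi>\<close> commutes with finite sums, products and
  powers.\<close>

lemma mpoly_eval_iso:
  assumes R: "iso_pair R R' \<phi> \<phi>'" and S: "iso_pair S S' \<psi> \<psi>'"
    and f: "\<And>r. r \<in> carrier R \<Longrightarrow> f r \<in> carrier S"
    and ff: "\<And>r. r \<in> carrier R \<Longrightarrow> f' (\<phi> r) = \<psi> (f r)"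
    and x: "x \<in> {..<n} \<rightarrow> carrier S" and p: "p \<in> carrier (mpoly R n)"
  shows "mpoly_eval R' S' f' n (\<psi> \<circ> x) (\<phi> \<circ> p) = \<psi> (mpoly_eval R S f n x p)"
proof -
  note Rd = iso_pairD[OF R] and Sd = iso_pairD[OF S]
  interpret R: cring R by (rule Rd(1))
  interpret h: ring_hom_cring S S' \<psi>
    using Sd by (intro ring_hom_cring.intro ring_hom_cring_axioms.intro)
  have pc: "p e \<in> carrier R" for e using p by simp
  have "\<phi> y = \<zero>\<^bsub>R'\<^esub> \<longleftrightarrow> y = \<zero>\<^bsub>R\<^esub>" if "y \<in> carrier R" for y
    using Rd(7) Rd(8)[OF that] Rd(8)[OF R.zero_closed] by metis
  then have supp: "{e. (\<phi> \<circ> p) e \<noteq> \<zero>\<^bsub>R'\<^esub>} = {e. p e \<noteq> \<zero>\<^bsub>R\<^esub>}" using pc by simp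
  have xc: "x i [^]\<^bsub>S\<^esub> (m :: nat) \<in> carrier S" if "i < n" for i m using x that by auto
  have prc: "(\<Otimes>\<^bsub>S\<^esub>i\<in>{..<n}. x i [^]\<^bsub>S\<^esub> (e i :: nat)) \<in> carrier S" for e
    using xc by (intro h.R.finprod_closed) auto
  have pw: "\<psi> (a [^]\<^bsub>S\<^esub> (m :: nat)) = \<psi> a [^]\<^bsub>S'\<^esub> m" if "a \<in> carrier S" for a m
    using that by (induction m) auto
  have pr: "\<psi> (\<Otimes>\<^bsub>S\<^esub>i\<in>{..<n}. x i [^]\<^bsub>S\<^esub> (e i :: nat)) = (\<Otimes>\<^bsub>S'\<^esub>i\<in>{..<n}. \<psi> (x i) [^]\<^bsub>S'\<^esub> e i)" for e
  proof -
    have "\<psi> (\<Otimes>\<^bsub>S\<^esub>i\<in>{..<n}. x i [^]\<^bsub>S\<^esub> (e i :: nat)) = (\<Otimes>\<^bsub>S'\<^esub>i\<in>{..<n}. (\<psi> \<circ> (\<lambda>i. x i [^]\<^bsub>S\<^esub> e i)) i)"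
      by (rule h.hom_finprod) (use xc in auto)
    also have "\<dots> = (\<Otimes>\<^bsub>S'\<^esub>i\<in>{..<n}. \<psi> (x i) [^]\<^bsub>S'\<^esub> e i)"
      by (rule h.S.finprod_cong') (use x pw in auto)
    finally show ?thesis .
  qed
  have "\<psi> (mpoly_eval R S f n x p) =
      (\<Oplus>\<^bsub>S'\<^esub>e\<in>{e. p e \<noteq> \<zero>\<^bsub>R\<^esub>}. (\<psi> \<circ> (\<lambda>e. f (p e) \<otimes>\<^bsub>S\<^esub> (\<Otimes>\<^bsub>S\<^esub>i\<in>{..<n}. x i [^]\<^bsub>S\<^esub> e i))) e)"
    unfolding mpoly_eval_def by (rule h.hom_finsum) (use f pc prc in auto)
  also have "\<dots> = (\<Oplus>\<^bsub>S'\<^esub>e\<in>{e. p e \<noteq> \<zero>\<^bsub>R\<^esub>}. f' ((\<phi> \<circ> p) e) \<otimes>\<^bsub>S'\<^esub> (\<Otimes>\<^bsub>S'\<^esub>i\<in>{..<n}. (\<psi> \<circ> x) i [^]\<^bsub>S'\<^esub> e i))"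
    by (simp add: ff[OF pc] f[OF pc] prc pr)
  finally show ?thesis unfolding mpoly_eval_def supp by simp
qed

text \<open>The same presentation serves, with generators moved by \<open>\<psi>\<close> and
  relations by \<open>\<phi>\<close>. The hypothesis \<open>nontriv\<close> speaks of the type
  rather than the carrier, because an empty intersection of ideals is the whole function
  type.\<close>

lemma finitely_presented_iso:
  fixes R :: "('a, 'b) ring_scheme"
  assumes R: "iso_pair R R' \<phi> \<phi>'" and S: "iso_pair S S' \<psi> \<psi>'"
    and f: "\<And>r. r \<in> carrier R \<Longrightarrow> f r \<in> carrier S"
    and ff: "\<And>r. r \<in> carrier R \<Longrightarrow> f' (\<phi> r) = \<psi> (f r)"
    and nontriv: "\<exists>x :: 'a. x \<noteq> \<zero>\<^bsub>R\<^esub>"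
    and fp: "finitely_presented R S f"
  shows "finitely_presented R' S' f'"
proof -
  note Rd = iso_pairD[OF R] and Rd' = iso_pairD[OF iso_pair_sym[OF R]]
  note Sd = iso_pairD[OF S] and Sd' = iso_pairD[OF iso_pair_sym[OF S]]
  obtain n x F where x: "x \<in> {..<n} \<rightarrow> carrier S" and sur: "mpoly_eval R S f n x ` carrier (mpoly R n) = carrier S"
    and F: "finite F" "F \<subseteq> carrier (mpoly R n)"
    and ker: "{p \<in> carrier (mpoly R n). mpoly_eval R S f n x p = \<zero>\<^bsub>S\<^esub>} = Idl\<^bsub>mpoly R n\<^esub> F"
    using fp unfolding finitely_presented_def by blast
  let ?P = "mpoly R n" and ?P' = "mpoly R' n" and ?h = "\<lambda>p. \<phi> \<circ> p" and ?h' = "\<lambda>p. \<phi>' \<circ> p"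
  have h: "?h \<in> ring_hom ?P ?P'" and h': "?h' \<in> ring_hom ?P' ?P"
    using mpoly_map_hom[OF R] mpoly_map_hom[OF iso_pair_sym[OF R]] .
  have hc: "\<phi> \<circ> p \<in> carrier ?P'" if "p \<in> carrier ?P" for p by (rule ring_hom_closed[OF h that])
  have hc': "\<phi>' \<circ> p \<in> carrier ?P" if "p \<in> carrier ?P'" for p by (rule ring_hom_closed[OF h' that])
  have inv: "\<phi>' \<circ> (\<phi> \<circ> p) = p" if "p \<in> carrier ?P" for p using that Rd(8) by (simp add: fun_eq_iff)
  have inv': "\<phi> \<circ> (\<phi>' \<circ> p) = p" if "p \<in> carrier ?P'" for p using that Rd'(8) by (simp add: fun_eq_iff)
  have himg: "?h ` carrier ?P = carrier ?P'"
  proof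
    show "?h ` carrier ?P \<subseteq> carrier ?P'" by (rule image_subsetI) (rule hc)
    show "carrier ?P' \<subseteq> ?h ` carrier ?P"
    proof
      fix q assume q: "q \<in> carrier ?P'"
      show "q \<in> ?h ` carrier ?P" by (rule image_eqI[where f = ?h, OF inv'[OF q, symmetric] hc'[OF q]])
    qed
  qed
  (* If the polynomial ring were not a ring, the ideal generated by F would be an empty
     intersection, that is, the whole type. *)
  have P: "ring ?P"
  proof (rule ccontr)
    assume "\<not> ring ?P"
    then have "\<not> ideal I ?P" for I using ideal.axioms(2) by blast
    then have "Idl\<^bsub>?P\<^esub> F = UNIV" by (simp add: genideal_def)
    then have all: "p \<in> carrier ?P" for p using ker by blast
    \<comment> \<open>The constant function at \<open>a\<close> would be a polynomial, although each
      of the infinitely many exponents lies in its support.\<close>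
    obtain a :: 'a where a: "a \<noteq> \<zero>\<^bsub>R\<^esub>" using nontriv by blast
    have "finite {e :: nat \<Rightarrow> nat. (\<lambda>_. a) e \<noteq> \<zero>\<^bsub>R\<^esub>}" using all[of "\<lambda>_. a"] by simp
    then have fin: "finite (UNIV :: (nat \<Rightarrow> nat) set)" using a by simp
    have "inj (\<lambda>(m :: nat) (_ :: nat). m)" by (auto simp: inj_def fun_eq_iff)
    then show False using fin finite_imageD[of "\<lambda>(m :: nat) (_ :: nat). m" UNIV] finite_subset[of _ UNIV] by auto
  qed
  have P': "ring ?P'"
  proof -
    have "bij_betw ?h (carrier ?P) (carrier ?P')"
      using himg inv by (intro bij_betw_imageI inj_on_inverseI[of _ ?h'])
    then have "?h \<in> ring_iso ?P ?P'" using h by (simp add: ring_iso_def)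
    \<comment> \<open>Transport along a ring isomorphism resets the zero to the image of the zero,
      which is the zero already in place.\<close>
    then have "ring (?P'\<lparr>zero := ?h \<zero>\<^bsub>?P\<^esub>\<rparr>)" by (rule ring.ring_iso_imp_img_ring[OF P])
    moreover have "?h \<zero>\<^bsub>?P\<^esub> = \<zero>\<^bsub>?P'\<^esub>" using Rd(7) by (simp add: fun_eq_iff)
    ultimately show ?thesis by (simp add: mpoly_def)
  qed
  have z: "\<psi> y = \<zero>\<^bsub>S'\<^esub> \<longleftrightarrow> y = \<zero>\<^bsub>S\<^esub>" if "y \<in> carrier S" for y
    using Sd(7) Sd(8)[OF that] Sd(8)[OF ring.ring_simprules(2)[OF cring.axioms(1)[OF Sd(1)]]] by metis
  have ev: "mpoly_eval R' S' f' n (\<psi> \<circ> x) (\<phi> \<circ> p) = \<psi> (mpoly_eval R S f n x p)" if "p \<in> carrier ?P" for p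
    by (rule mpoly_eval_iso[where f = f and f' = f', OF R S f ff x that])
  have evc: "mpoly_eval R S f n x p \<in> carrier S" if "p \<in> carrier ?P" for p
    using mpoly_eval_closed[OF Rd(1) Sd(1) _ x that] f by blast
  show ?thesis
    unfolding finitely_presented_def
  proof (intro exI conjI)
    show "\<psi> \<circ> x \<in> {..<n} \<rightarrow> carrier S'"
      using Sd(3)[OF funcset_mem[OF x]] by (intro Pi_I) simp
    show "finite (?h ` F)" "?h ` F \<subseteq> carrier ?P'" using F hc by blast+
    have "mpoly_eval R' S' f' n (\<psi> \<circ> x) ` carrier ?P' = \<psi> ` mpoly_eval R S f n x ` carrier ?P"
      unfolding himg[symmetric] image_image by (rule image_cong[OF refl ev])
    also note sur
    also have "\<psi> ` carrier S = carrier S'"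
    proof
      show "carrier S' \<subseteq> \<psi> ` carrier S"
      proof
        fix y assume "y \<in> carrier S'"
        then show "y \<in> \<psi> ` carrier S" using Sd'(3,8) by (metis imageI)
      qed
    qed (use Sd(3) in blast)
    finally show "mpoly_eval R' S' f' n (\<psi> \<circ> x) ` carrier ?P' = carrier S'" .
    have gi: "Idl\<^bsub>?P'\<^esub> (?h ` F) = ?h ` (Idl\<^bsub>?P\<^esub> F)"
      by (rule genideal_iso[OF P P' h h' inv inv' F(2)])
    have "{p \<in> carrier ?P'. mpoly_eval R' S' f' n (\<psi> \<circ> x) p = \<zero>\<^bsub>S'\<^esub>} =
        ?h ` {p \<in> carrier ?P. mpoly_eval R S f n x p = \<zero>\<^bsub>S\<^esub>}"
    proof (intro equalityI subsetI)
      fix q assume "q \<in> {p \<in> carrier ?P'. mpoly_eval R' S' f' n (\<psi> \<circ> x) p = \<zero>\<^bsub>S'\<^esub>}"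
      then have q: "q \<in> carrier ?P'" "mpoly_eval R' S' f' n (\<psi> \<circ> x) q = \<zero>\<^bsub>S'\<^esub>" by blast+
      have "mpoly_eval R S f n x (\<phi>' \<circ> q) = \<zero>\<^bsub>S\<^esub>"
        using ev[OF hc'[OF q(1)]] z[OF evc[OF hc'[OF q(1)]]] q(2) inv'[OF q(1)] by metis
      then have "\<phi>' \<circ> q \<in> {p \<in> carrier ?P. mpoly_eval R S f n x p = \<zero>\<^bsub>S\<^esub>}" using hc'[OF q(1)] by blast
      then show "q \<in> ?h ` {p \<in> carrier ?P. mpoly_eval R S f n x p = \<zero>\<^bsub>S\<^esub>}"
        using inv'[OF q(1)] by (intro image_eqI[of q ?h "\<phi>' \<circ> q"]) simp_all
    next
      fix q assume "q \<in> ?h ` {p \<in> carrier ?P. mpoly_eval R S f n x p = \<zero>\<^bsub>S\<^esub>}"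
      then obtain p where p: "q = \<phi> \<circ> p" "p \<in> carrier ?P" "mpoly_eval R S f n x p = \<zero>\<^bsub>S\<^esub>" by blast
      have "mpoly_eval R' S' f' n (\<psi> \<circ> x) q = \<zero>\<^bsub>S'\<^esub>" using ev[OF p(2)] p(1,3) Sd(7) by simp
      then show "q \<in> {p \<in> carrier ?P'. mpoly_eval R' S' f' n (\<psi> \<circ> x) p = \<zero>\<^bsub>S'\<^esub>}"
        using hc[OF p(2)] p(1) by blast
    qed
    then show "{p \<in> carrier ?P'. mpoly_eval R' S' f' n (\<psi> \<circ> x) p = \<zero>\<^bsub>S'\<^esub>} = Idl\<^bsub>?P'\<^esub> (?h ` F)"
      by (simp only: gi ker)
  qed
qed

lemma etale_iso:
  fixes R :: "('a, 'b) ring_scheme"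
  assumes R: "iso_pair R R' \<phi> \<phi>'" and S: "iso_pair S S' \<psi> \<psi>'" and f': "f' \<in> ring_hom R' S'"
    and ff: "\<And>r. r \<in> carrier R \<Longrightarrow> f' (\<phi> r) = \<psi> (f r)"
    and nontriv: "\<exists>x :: 'a. x \<noteq> \<zero>\<^bsub>R\<^esub>" and et: "etale U R S f"
  shows "etale U R' S' f'"
proof -
  have f: "f r \<in> carrier S" if "r \<in> carrier R" for r
    using et that by (auto simp: etale_def intro: ring_hom_closed)
  have f'c: "f' r \<in> carrier S'" if "r \<in> carrier R'" for r
    using f' that by (rule ring_hom_closed)
  show ?thesis
    using et f' finitely_presented_iso[where f = f and f' = f', OF R S f ff nontriv]
      flat_iso[where f = f and f' = f', OF R S f f'c ff] unramified_iso[where f = f and f' = f', OF R S f f'c ff]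
    unfolding etale_def by blast
qed

section \<open>Commutative algebras\<close>

text \<open>Homomorphisms without the extensionality that arrows of \<open>calg_cat\<close> carry,
  so that composites and induced maps can be treated as plain functions.\<close>

definition calg_hom :: "'u ring \<Rightarrow> 'u calg \<Rightarrow> 'u calg \<Rightarrow> ('u \<Rightarrow> 'u) \<Rightarrow> bool" where
  "calg_hom k A B f \<longleftrightarrow> f \<in> ring_hom A B \<and> (\<forall>c\<in>carrier k. \<forall>x\<in>carrier A. f (c \<odot>\<^bsub>A\<^esub> x) = c \<odot>\<^bsub>B\<^esub> f x)"

lemma algebra_cring: "Module.algebra k A \<Longrightarrow> cring A"
  by (rule algebra.axioms(2))

lemma calg_cat_simps [simp]:
  "Ob (calg_cat k) = {A. Module.algebra k A}" "Dom (calg_cat k) = fst" "Cod (calg_cat k) = (\<lambda>t. snd (snd t))"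
  "Ident (calg_cat k) A = (A, \<lambda>x\<in>carrier A. x, A)"
  by (simp_all add: calg_cat_def)

lemma calg_comp: "s \<cdot>\<^bsub>calg_cat k\<^esub> t = (fst t, compose (carrier (fst t)) (mid s) (mid t), snd (snd s))"
  by (simp_all add: calg_cat_def)

lemma Hom_calg: "e \<in> Hom (calg_cat k) A B \<longleftrightarrow> (\<exists>f. e = (A, f, B) \<and> Module.algebra k A \<and> Module.algebra k B \<and>
    calg_hom k A B f \<and> f \<in> extensional (carrier A))"
  by (auto simp: Hom_def calg_cat_def calg_hom_def)

lemma calg_hom_closed: "calg_hom k A B f \<Longrightarrow> x \<in> carrier A \<Longrightarrow> f x \<in> carrier B"
  by (auto simp: calg_hom_def ring_hom_def)

lemma calg_hom_comp: "calg_hom k A B f \<Longrightarrow> calg_hom k B C g \<Longrightarrow> calg_hom k A C (\<lambda>x. g (f x))"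
  by (auto simp: calg_hom_def ring_hom_def Pi_iff)

lemma calg_hom_cong:
  assumes "Module.algebra k A" "\<And>x. x \<in> carrier A \<Longrightarrow> f x = g x"
  shows "calg_hom k A B f \<longleftrightarrow> calg_hom k A B g"
proof -
  interpret algebra k A by fact
  show ?thesis using assms(2) by (simp add: calg_hom_def ring_hom_def Pi_iff)
qed

lemma calg_arrI:
  assumes "Module.algebra k A" "Module.algebra k B" "calg_hom k A B f"
  shows "(A, \<lambda>x\<in>carrier A. f x, B) \<in> Hom (calg_cat k) A B"
  using assms calg_hom_cong[OF assms(1), of f "\<lambda>x\<in>carrier A. f x" B] by (simp add: Hom_calg)

lemma calg_mid:
  assumes "e \<in> Hom (calg_cat k) A B"
  shows "calg_hom k A B (mid e)" "x \<in> carrier A \<Longrightarrow> mid e x \<in> carrier B" "Module.algebra k A" "Module.algebra k B"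
  using assms by (auto simp: Hom_calg intro: calg_hom_closed)

lemma calg_comp_mid: "f \<in> Hom (calg_cat k) A B \<Longrightarrow> x \<in> carrier A \<Longrightarrow> mid (g \<cdot>\<^bsub>calg_cat k\<^esub> f) x = mid g (mid f x)"
  by (auto simp: Hom_calg calg_comp compose_def)

lemma calg_arr_eqI:
  assumes "e \<in> Hom (calg_cat k) A B" "e' \<in> Hom (calg_cat k) A B" "\<And>x. x \<in> carrier A \<Longrightarrow> mid e x = mid e' x"
  shows "e = e'"
  using assms by (auto simp: Hom_calg intro: extensionalityI)

lemma is_category_calg: "is_category (calg_cat k)"
proof -
  have comp: "g \<cdot>\<^bsub>calg_cat k\<^esub> f \<in> Hom (calg_cat k) a c"
    if f: "f \<in> Hom (calg_cat k) a b" and g: "g \<in> Hom (calg_cat k) b c" for f g a b c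
  proof -
    have *: "g \<cdot>\<^bsub>calg_cat k\<^esub> f = (a, \<lambda>x\<in>carrier a. mid g (mid f x), c)"
      using f g by (auto simp: Hom_calg calg_comp compose_def)
    show ?thesis
      unfolding *
      by (rule calg_arrI[OF calg_mid(3)[OF f] calg_mid(4)[OF g] calg_hom_comp[OF calg_mid(1)[OF f] calg_mid(1)[OF g]]])
  qed
  have ident: "Ident (calg_cat k) a \<in> Hom (calg_cat k) a a" if "Module.algebra k a" for a
    using calg_arrI[OF that that, of "\<lambda>x. x"] by (simp add: calg_hom_def ring_hom_def)
  show ?thesis
    unfolding is_category_def
  proof (intro conjI allI ballI impI)
    fix f assume "f \<in> Arr (calg_cat k)"
    then show "Dom (calg_cat k) f \<in> Ob (calg_cat k)" "Cod (calg_cat k) f \<in> Ob (calg_cat k)"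
      by (auto simp: calg_cat_def)
  next
    fix a b f assume f: "f \<in> Hom (calg_cat k) a b"
    note ob = calg_mid(3,4)[OF f]
    show "f \<cdot>\<^bsub>calg_cat k\<^esub> Ident (calg_cat k) a = f"
    proof (rule calg_arr_eqI[OF comp[OF ident[OF ob(1)] f] f])
      fix x assume "x \<in> carrier a"
      then show "mid (f \<cdot>\<^bsub>calg_cat k\<^esub> Ident (calg_cat k) a) x = mid f x"
        unfolding calg_comp_mid[OF ident[OF ob(1)] \<open>x \<in> carrier a\<close>] by simp
    qed
    show "Ident (calg_cat k) b \<cdot>\<^bsub>calg_cat k\<^esub> f = f"
    proof (rule calg_arr_eqI[OF comp[OF f ident[OF ob(2)]] f])
      fix x assume "x \<in> carrier a"
      then show "mid (Ident (calg_cat k) b \<cdot>\<^bsub>calg_cat k\<^esub> f) x = mid f x"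
        unfolding calg_comp_mid[OF f \<open>x \<in> carrier a\<close>] using calg_mid(2)[OF f] by simp
    qed
  next
    fix a b c d f g h
    assume *: "f \<in> Hom (calg_cat k) a b \<and> g \<in> Hom (calg_cat k) b c \<and> h \<in> Hom (calg_cat k) c d"
    then have f: "f \<in> Hom (calg_cat k) a b" and g: "g \<in> Hom (calg_cat k) b c" and h: "h \<in> Hom (calg_cat k) c d" by auto
    show "h \<cdot>\<^bsub>calg_cat k\<^esub> (g \<cdot>\<^bsub>calg_cat k\<^esub> f) = h \<cdot>\<^bsub>calg_cat k\<^esub> g \<cdot>\<^bsub>calg_cat k\<^esub> f"
    proof (rule calg_arr_eqI[OF comp[OF comp[OF f g] h] comp[OF f comp[OF g h]]])
      fix x assume x: "x \<in> carrier a"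
      show "mid (h \<cdot>\<^bsub>calg_cat k\<^esub> (g \<cdot>\<^bsub>calg_cat k\<^esub> f)) x = mid (h \<cdot>\<^bsub>calg_cat k\<^esub> g \<cdot>\<^bsub>calg_cat k\<^esub> f) x"
        unfolding calg_comp_mid[OF comp[OF f g] x] calg_comp_mid[OF f x] calg_comp_mid[OF g calg_mid(2)[OF f x]] ..
    qed
  qed (use comp ident in auto)
qed

lemma calg_hom_inverse:
  assumes A: "Module.algebra k A" and B: "Module.algebra k B" and f: "calg_hom k A B f"
    and bij: "bij_betw f (carrier A) (carrier B)"
  shows "calg_hom k B A (inv_into (carrier A) f)"
proof -
  interpret A: algebra k A by fact
  let ?g = "inv_into (carrier A) f"
  have g: "?g y \<in> carrier A" "f (?g y) = y" if "y \<in> carrier B" for y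
    using that bij by (auto simp: bij_betw_def inv_into_into f_inv_into_f)
  have gf: "?g (f x) = x" if "x \<in> carrier A" for x
    using that bij by (simp add: bij_betw_inv_into_left)
  have f': "f (x \<otimes>\<^bsub>A\<^esub> y) = f x \<otimes>\<^bsub>B\<^esub> f y" "f (x \<oplus>\<^bsub>A\<^esub> y) = f x \<oplus>\<^bsub>B\<^esub> f y" "f \<one>\<^bsub>A\<^esub> = \<one>\<^bsub>B\<^esub>"
    if "x \<in> carrier A" "y \<in> carrier A" for x y
    using f that by (auto simp: calg_hom_def ring_hom_def)
  have "?g (x \<otimes>\<^bsub>B\<^esub> y) = ?g x \<otimes>\<^bsub>A\<^esub> ?g y" "?g (x \<oplus>\<^bsub>B\<^esub> y) = ?g x \<oplus>\<^bsub>A\<^esub> ?g y"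
    if "x \<in> carrier B" "y \<in> carrier B" for x y
    using gf[of "?g x \<otimes>\<^bsub>A\<^esub> ?g y"] gf[of "?g x \<oplus>\<^bsub>A\<^esub> ?g y"] f'[of "?g x" "?g y"] g that by simp_all
  moreover have "?g \<one>\<^bsub>B\<^esub> = \<one>\<^bsub>A\<^esub>" using gf[of "\<one>\<^bsub>A\<^esub>"] f'(3)[of "\<one>\<^bsub>A\<^esub>" "\<one>\<^bsub>A\<^esub>"] by simp
  moreover have "?g (c \<odot>\<^bsub>B\<^esub> x) = c \<odot>\<^bsub>A\<^esub> ?g x" if "c \<in> carrier k" "x \<in> carrier B" for c x
    using gf[of "c \<odot>\<^bsub>A\<^esub> ?g x"] f g[OF that(2)] that(1) by (simp add: calg_hom_def)
  ultimately show ?thesis using g by (auto simp: calg_hom_def ring_hom_def)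
qed

lemma calg_bij_iso:
  assumes e: "e \<in> Hom (calg_cat k) A B" and bij: "bij_betw (mid e) (carrier A) (carrier B)"
  shows "is_iso (calg_cat k) e"
proof -
  let ?g = "inv_into (carrier A) (mid e)"
  note ob = calg_mid(3,4)[OF e]
  have g: "(B, \<lambda>x\<in>carrier B. ?g x, A) \<in> Hom (calg_cat k) B A"
    by (rule calg_arrI[OF ob(2,1) calg_hom_inverse[OF ob calg_mid(1)[OF e] bij]])
  have gf: "?g (mid e x) = x" if "x \<in> carrier A" for x
    using that bij by (simp add: bij_betw_inv_into_left)
  have fg: "mid e (?g y) = y" "?g y \<in> carrier A" if "y \<in> carrier B" for y
    using that bij by (auto simp: bij_betw_inv_into_right bij_betw_def inv_into_into)
  have id: "Ident (calg_cat k) X \<in> Hom (calg_cat k) X X" if "Module.algebra k X" for X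
    using Ident_Hom[OF is_category_calg] that by simp
  show ?thesis
  proof (rule isoI[OF e g])
    show "(B, \<lambda>x\<in>carrier B. ?g x, A) \<cdot>\<^bsub>calg_cat k\<^esub> e = Ident (calg_cat k) A"
    proof (rule calg_arr_eqI[OF Comp_Hom[OF is_category_calg e g] id[OF ob(1)]])
      fix x assume x: "x \<in> carrier A"
      show "mid ((B, \<lambda>x\<in>carrier B. ?g x, A) \<cdot>\<^bsub>calg_cat k\<^esub> e) x = mid (Ident (calg_cat k) A) x"
        unfolding calg_comp_mid[OF e x] using x gf calg_mid(2)[OF e x] by simp
    qed
    show "e \<cdot>\<^bsub>calg_cat k\<^esub> (B, \<lambda>x\<in>carrier B. ?g x, A) = Ident (calg_cat k) B"
    proof (rule calg_arr_eqI[OF Comp_Hom[OF is_category_calg g e] id[OF ob(2)]])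
      fix x assume x: "x \<in> carrier B"
      show "mid (e \<cdot>\<^bsub>calg_cat k\<^esub> (B, \<lambda>x\<in>carrier B. ?g x, A)) x = mid (Ident (calg_cat k) B) x"
        unfolding calg_comp_mid[OF g x] using x fg by simp
    qed
  qed
qed

lemma calg_iso_bij:
  assumes "is_iso (calg_cat k) e" "e \<in> Hom (calg_cat k) A B"
  shows "bij_betw (mid e) (carrier A) (carrier B)"
proof -
  obtain g where g: "g \<in> Hom (calg_cat k) B A" "g \<cdot>\<^bsub>calg_cat k\<^esub> e = Ident (calg_cat k) A" "e \<cdot>\<^bsub>calg_cat k\<^esub> g = Ident (calg_cat k) B"
    using isoE[OF assms] by metis
  have "mid g (mid e x) = x" if "x \<in> carrier A" for x
    using calg_comp_mid[OF assms(2) that, of g] that unfolding g(2) by simp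
  moreover have "mid e (mid g x) = x" if "x \<in> carrier B" for x
    using calg_comp_mid[OF g(1) that, of e] that unfolding g(3) by simp
  ultimately show ?thesis
    using calg_mid(2)[OF assms(2)] calg_mid(2)[OF g(1)]
    by (intro bij_betw_byWitness[where f' = "mid g"]) auto
qed


section \<open>Quotients of algebras\<close>

text \<open>The quotient by an ideal is realized on a set of coset representatives, so that its elements
  remain in the universe.\<close>

definition coset_rep :: "('u, 'b) ring_scheme \<Rightarrow> 'u set \<Rightarrow> 'u \<Rightarrow> 'u" where
  "coset_rep R I x = (SOME y. y \<in> I +>\<^bsub>R\<^esub> x)"

definition quot_alg :: "'u calg \<Rightarrow> 'u set \<Rightarrow> 'u calg" where
  "quot_alg R I = \<lparr>carrier = coset_rep R I ` carrier R, mult = (\<lambda>a b. coset_rep R I (a \<otimes>\<^bsub>R\<^esub> b)),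
     one = coset_rep R I \<one>\<^bsub>R\<^esub>, zero = coset_rep R I \<zero>\<^bsub>R\<^esub>, add = (\<lambda>a b. coset_rep R I (a \<oplus>\<^bsub>R\<^esub> b)),
     smult = (\<lambda>c a. coset_rep R I (c \<odot>\<^bsub>R\<^esub> a))\<rparr>"

lemma quot_alg_simps [simp]:
  "carrier (quot_alg R I) = coset_rep R I ` carrier R" "a \<otimes>\<^bsub>quot_alg R I\<^esub> b = coset_rep R I (a \<otimes>\<^bsub>R\<^esub> b)"
  "\<one>\<^bsub>quot_alg R I\<^esub> = coset_rep R I \<one>\<^bsub>R\<^esub>" "\<zero>\<^bsub>quot_alg R I\<^esub> = coset_rep R I \<zero>\<^bsub>R\<^esub>"
  "a \<oplus>\<^bsub>quot_alg R I\<^esub> b = coset_rep R I (a \<oplus>\<^bsub>R\<^esub> b)" "c \<odot>\<^bsub>quot_alg R I\<^esub> a = coset_rep R I (c \<odot>\<^bsub>R\<^esub> a)"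
  by (simp_all add: quot_alg_def)

locale alg_ideal =
  fixes k :: "'u ring" and R :: "'u calg" and I :: "'u set"
  assumes alg: "Module.algebra k R" and ide: "ideal I R"
begin

sublocale A: cring R by (rule algebra_cring[OF alg])
sublocale R: algebra k R by (rule alg)
sublocale I: ideal I R by (rule ide)

abbreviation q :: "'u \<Rightarrow> 'u" where "q \<equiv> coset_rep R I"
abbreviation coset :: "'u \<Rightarrow> 'u set" where "coset x \<equiv> I +>\<^bsub>R\<^esub> x"

lemma q_in: "x \<in> carrier R \<Longrightarrow> q x \<in> coset x"
  unfolding coset_rep_def by (rule someI) (rule I.a_rcos_self)

lemma q_closed: "x \<in> carrier R \<Longrightarrow> q x \<in> carrier R"
  using q_in A.a_r_coset_subset_G[OF I.a_subset] by blast

lemma coset_q [simp]: "x \<in> carrier R \<Longrightarrow> coset (q x) = coset x"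
  using A.a_repr_independence[OF q_in _ I.a_subgroup] by simp

lemma q_cong: "coset x = coset y \<Longrightarrow> q x = q y"
  by (simp add: coset_rep_def)

lemma q_q [simp]: "x \<in> carrier R \<Longrightarrow> q (q x) = q x"
  by (rule q_cong) simp

lemma q_eq_coset: "x \<in> carrier R \<Longrightarrow> y \<in> carrier R \<Longrightarrow> q x = q y \<longleftrightarrow> coset x = coset y"
  using q_cong coset_q by metis

lemma coset_eq: "x \<in> carrier R \<Longrightarrow> y \<in> carrier R \<Longrightarrow> coset x = coset y \<longleftrightarrow> x \<ominus>\<^bsub>R\<^esub> y \<in> I"
  using A.quotient_eq_iff_same_a_r_cos[OF ide] by (simp add: A.minus_eq)

lemma q_eq: "x \<in> carrier R \<Longrightarrow> y \<in> carrier R \<Longrightarrow> q x = q y \<longleftrightarrow> x \<ominus>\<^bsub>R\<^esub> y \<in> I"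
  using q_eq_coset coset_eq by simp

lemma coset_mult: "x \<in> carrier R \<Longrightarrow> y \<in> carrier R \<Longrightarrow> coset x \<otimes>\<^bsub>R Quot I\<^esub> coset y = coset (x \<otimes>\<^bsub>R\<^esub> y)"
  using I.rcoset_mult_add by (simp add: FactRing_def)

lemma coset_add: "x \<in> carrier R \<Longrightarrow> y \<in> carrier R \<Longrightarrow> coset x \<oplus>\<^bsub>R Quot I\<^esub> coset y = coset (x \<oplus>\<^bsub>R\<^esub> y)"
  using I.a_rcos_sum by (simp add: FactRing_def)

lemma carrier_Quot: "carrier (R Quot I) = coset ` carrier R"
  by (auto simp: FactRing_def A_RCOSETS_def')

lemma Quot_cring: "cring (R Quot I)"
  by (rule I.quotient_is_cring[OF A.is_cring])

lemma coset_zero: "\<zero>\<^bsub>R Quot I\<^esub> = coset \<zero>\<^bsub>R\<^esub>"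
  using A.a_coset_add_zero[OF I.a_subset] by (simp add: FactRing_def)

lemma coset_one: "\<one>\<^bsub>R Quot I\<^esub> = coset \<one>\<^bsub>R\<^esub>"
  by (simp add: FactRing_def)

text \<open>On a coset it returns the same representative as \<open>coset_rep\<close>, both being
  chosen from the same set; this makes it inverse to forming cosets of representatives.\<close>

definition sec :: "'u set \<Rightarrow> 'u" where "sec c = (SOME y. y \<in> c)"

lemma sec_coset: "sec (coset x) = q x"
  by (simp add: sec_def coset_rep_def)

lemma q_mult: "x \<in> carrier R \<Longrightarrow> y \<in> carrier R \<Longrightarrow> q (q x \<otimes>\<^bsub>R\<^esub> q y) = q (x \<otimes>\<^bsub>R\<^esub> y)"
  by (rule q_cong) (simp add: coset_mult[symmetric] q_closed)

lemma q_add: "x \<in> carrier R \<Longrightarrow> y \<in> carrier R \<Longrightarrow> q (q x \<oplus>\<^bsub>R\<^esub> q y) = q (x \<oplus>\<^bsub>R\<^esub> y)"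
  by (rule q_cong) (simp add: coset_add[symmetric] q_closed)

text \<open>Scalars act as multiplication by an element of \<open>R\<close>, which reduces their
  compatibility with cosets to that of multiplication.\<close>

lemma smult_eq: "c \<in> carrier k \<Longrightarrow> x \<in> carrier R \<Longrightarrow> c \<odot>\<^bsub>R\<^esub> x = (c \<odot>\<^bsub>R\<^esub> \<one>\<^bsub>R\<^esub>) \<otimes>\<^bsub>R\<^esub> x"
  by (simp add: R.smult_assoc2)

lemma q_smult:
  assumes "c \<in> carrier k" "x \<in> carrier R"
  shows "q (c \<odot>\<^bsub>R\<^esub> q x) = q (c \<odot>\<^bsub>R\<^esub> x)"
proof (rule q_cong)
  have "c \<odot>\<^bsub>R\<^esub> q x = (c \<odot>\<^bsub>R\<^esub> \<one>\<^bsub>R\<^esub>) \<otimes>\<^bsub>R\<^esub> q x" "c \<odot>\<^bsub>R\<^esub> x = (c \<odot>\<^bsub>R\<^esub> \<one>\<^bsub>R\<^esub>) \<otimes>\<^bsub>R\<^esub> x"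
    using smult_eq[of c x] smult_eq[of c "q x"] assms q_closed by simp_all
  then show "coset (c \<odot>\<^bsub>R\<^esub> q x) = coset (c \<odot>\<^bsub>R\<^esub> x)"
    using assms by (simp add: coset_mult[symmetric] q_closed)
qed

lemma sec_hom: "sec \<in> ring_hom (R Quot I) (quot_alg R I)"
  by (rule ring_hom_memI) (auto simp: carrier_Quot sec_coset coset_mult coset_add coset_one q_mult q_add)

lemma quot_alg_cring: "cring (quot_alg R I)"
proof -
  have "bij_betw sec (carrier (R Quot I)) (carrier (quot_alg R I))"
    by (rule bij_betw_byWitness[where f' = coset]) (auto simp: carrier_Quot sec_coset)
  then have "sec \<in> ring_iso (R Quot I) (quot_alg R I)" using sec_hom by (simp add: ring_iso_def)
  \<comment> \<open>Transport resets the zero to the representative of the zero coset, which is how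
    \<open>quot_alg\<close> defines its zero.\<close>
  then have "cring ((quot_alg R I)\<lparr>zero := sec \<zero>\<^bsub>R Quot I\<^esub>\<rparr>)"
    by (rule cring.ring_iso_imp_img_cring[OF Quot_cring])
  then show ?thesis by (simp add: coset_zero sec_coset quot_alg_def)
qed

lemma coset_hom: "coset \<in> ring_hom (quot_alg R I) (R Quot I)"
proof (rule ring_hom_memI)
  fix x y assume "x \<in> carrier (quot_alg R I)" "y \<in> carrier (quot_alg R I)"
  then obtain x' y' where *: "x' \<in> carrier R" "x = q x'" "y' \<in> carrier R" "y = q y'" by auto
  then have "q x' \<otimes>\<^bsub>R\<^esub> q y' \<in> carrier R" "q x' \<oplus>\<^bsub>R\<^esub> q y' \<in> carrier R" using q_closed by auto
  then show "coset (x \<otimes>\<^bsub>quot_alg R I\<^esub> y) = coset x \<otimes>\<^bsub>R Quot I\<^esub> coset y"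
    "coset (x \<oplus>\<^bsub>quot_alg R I\<^esub> y) = coset x \<oplus>\<^bsub>R Quot I\<^esub> coset y"
    using * coset_mult[of "q x'" "q y'"] coset_add[of "q x'" "q y'"] q_closed by simp_all
qed (auto simp: carrier_Quot coset_one)

text \<open>The bridge between the ring of cosets, in which \<open>pi0\<close> and its etaleness are
  expressed, and the ring of representatives, which underlies an object of
  \<open>calg_cat k\<close>.\<close>

lemma Quot_iso_pair: "iso_pair (R Quot I) (quot_alg R I) sec coset"
  unfolding iso_pair_def using Quot_cring quot_alg_cring sec_hom coset_hom
  by (auto simp: carrier_Quot sec_coset)

lemma quot_alg_algebra: "Module.algebra k (quot_alg R I)"
proof -
  interpret Q: cring "quot_alg R I" by (rule quot_alg_cring)
  show ?thesis
  proof (rule algebraI[OF R.R.is_cring quot_alg_cring])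
    fix c x y assume c: "c \<in> carrier k" and x: "x \<in> carrier (quot_alg R I)" and y: "y \<in> carrier (quot_alg R I)"
    then obtain x' y' where *: "x' \<in> carrier R" "x = q x'" "y' \<in> carrier R" "y = q y'" by auto
    show "c \<odot>\<^bsub>quot_alg R I\<^esub> (x \<oplus>\<^bsub>quot_alg R I\<^esub> y) = c \<odot>\<^bsub>quot_alg R I\<^esub> x \<oplus>\<^bsub>quot_alg R I\<^esub> c \<odot>\<^bsub>quot_alg R I\<^esub> y"
      using c * by (simp add: q_smult q_add R.smult_r_distr)
    show "c \<odot>\<^bsub>quot_alg R I\<^esub> x \<otimes>\<^bsub>quot_alg R I\<^esub> y = c \<odot>\<^bsub>quot_alg R I\<^esub> (x \<otimes>\<^bsub>quot_alg R I\<^esub> y)"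
      using c * by (simp add: q_smult q_mult R.smult_assoc2)
  next
    fix c d x assume c: "c \<in> carrier k" and d: "d \<in> carrier k" and x: "x \<in> carrier (quot_alg R I)"
    then obtain x' where *: "x' \<in> carrier R" "x = q x'" by auto
    show "(c \<oplus>\<^bsub>k\<^esub> d) \<odot>\<^bsub>quot_alg R I\<^esub> x = c \<odot>\<^bsub>quot_alg R I\<^esub> x \<oplus>\<^bsub>quot_alg R I\<^esub> d \<odot>\<^bsub>quot_alg R I\<^esub> x"
      using c d * by (simp add: q_smult q_add R.smult_l_distr)
    show "(c \<otimes>\<^bsub>k\<^esub> d) \<odot>\<^bsub>quot_alg R I\<^esub> x = c \<odot>\<^bsub>quot_alg R I\<^esub> (d \<odot>\<^bsub>quot_alg R I\<^esub> x)"
      using c d * by (simp add: q_smult R.smult_assoc1)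
  next
    fix c x assume c: "c \<in> carrier k" and x: "x \<in> carrier (quot_alg R I)"
    then show "c \<odot>\<^bsub>quot_alg R I\<^esub> x \<in> carrier (quot_alg R I)" using q_closed by auto
  next
    fix x assume "x \<in> carrier (quot_alg R I)"
    then show "\<one>\<^bsub>k\<^esub> \<odot>\<^bsub>quot_alg R I\<^esub> x = x" by (auto simp: q_closed)
  qed
qed

lemma q_hom: "calg_hom k R (quot_alg R I) q"
  unfolding calg_hom_def by (auto intro!: ring_hom_memI simp: q_mult q_add q_smult)

text \<open>Elements of the quotient are themselves elements of \<open>R\<close>, so the induced map
  is \<open>g\<close> unchanged; it does not depend on the representative because \<open>q x\<close>
  and \<open>x\<close> differ by an element of \<open>I\<close>.\<close>

lemma quot_lift:
  assumes S: "Module.algebra k S" and g: "calg_hom k R S g" and ker: "\<And>x. x \<in> I \<Longrightarrow> g x = \<zero>\<^bsub>S\<^esub>"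
  shows "calg_hom k (quot_alg R I) S g" and "x \<in> carrier R \<Longrightarrow> g (q x) = g x"
proof -
  interpret S: algebra k S by fact
  have gh: "g \<in> ring_hom R S" using g by (simp add: calg_hom_def)
  interpret g: ring_hom_cring R S g
    using gh A.is_cring algebra_cring[OF S] by (intro ring_hom_cring.intro ring_hom_cring_axioms.intro)
  have ab: "abelian_group S" by (rule ring.is_abelian_group[OF cring.axioms(1)[OF algebra_cring[OF S]]])
  have gq: "g (q x) = g x" if x: "x \<in> carrier R" for x
  proof -
    have "q x \<ominus>\<^bsub>R\<^esub> x \<in> I" using coset_eq[OF q_closed[OF x] x] coset_q[OF x] by simp
    then have "g (q x \<ominus>\<^bsub>R\<^esub> x) = \<zero>\<^bsub>S\<^esub>" by (rule ker)
    then have "g (q x) \<ominus>\<^bsub>S\<^esub> g x = \<zero>\<^bsub>S\<^esub>" using x q_closed[OF x] by (simp add: a_minus_def)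
    then have "\<ominus>\<^bsub>S\<^esub> (\<ominus>\<^bsub>S\<^esub> g x) = g (q x)"
      using x q_closed[OF x] by (intro abelian_group.minus_equality[OF ab]) (simp_all add: a_minus_def)
    then show ?thesis using x abelian_group.minus_minus[OF ab, of "g x"] by simp
  qed
  then show "x \<in> carrier R \<Longrightarrow> g (q x) = g x" .
  show "calg_hom k (quot_alg R I) S g"
    using g unfolding calg_hom_def by (auto intro!: ring_hom_memI simp: gq q_closed)
qed

end

section \<open>Connected components of simplicial algebras\<close>

lemma skCAlg_simps [simp]:
  "Ob (skCAlg k) = {A. is_functor (op_cat delta) (calg_cat k) A}"
  "Arr (skCAlg k) = Arr (simp_cat (calg_cat k))" "Dom (skCAlg k) = fst" "Cod (skCAlg k) = (\<lambda>t. snd (snd t))"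
  "Ident (skCAlg k) A = Ident (simp_cat (calg_cat k)) A"
  "s \<cdot>\<^bsub>skCAlg k\<^esub> t = s \<cdot>\<^bsub>simp_cat (calg_cat k)\<^esub> t"
  "Weq (skCAlg k) = scalg_equivs k" "Fib (skCAlg k) = scalg_fibs k"
  "Cof (skCAlg k) = {i. has_llp (simp_cat (calg_cat k)) (scalg_fibs k \<inter> scalg_equivs k) i}"
  by (simp_all add: skCAlg_def category.defs model.defs fun_cat_def)

lemma Hom_skCAlg: "Hom (skCAlg k) A B = Hom (simp_cat (calg_cat k)) A B"
  by (auto simp: Hom_def)

lemma is_category_skCAlg: "is_category (skCAlg k)"
  using is_category_fun_cat[OF is_category_calg[of k] is_category_op[OF is_category_delta]]
  unfolding is_category_def Hom_skCAlg by (simp add: skCAlg_def category.defs model.defs fun_cat_def)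

lemma dcat: "is_category (op_cat delta)"
  by (rule is_category_op[OF is_category_delta])

locale simp_calg =
  fixes k :: "'u ring" and A :: "'u scalg"
  assumes A: "is_functor (op_cat delta) (calg_cat k) A"
begin

abbreviation sact :: "darr \<Rightarrow> 'u \<Rightarrow> 'u" where "sact \<theta> \<equiv> mid (amap A \<theta>)"

lemma alg: "Module.algebra k (omap A n)"
  using functor_Ob[OF A, of n] by simp

lemma A_Hom: "\<theta> \<in> Hom delta m n \<Longrightarrow> amap A \<theta> \<in> Hom (calg_cat k) (omap A n) (omap A m)"
  using functor_Hom[OF A, of \<theta> n m] by simp

lemma sact_hom: "\<theta> \<in> Hom delta m n \<Longrightarrow> calg_hom k (omap A n) (omap A m) (sact \<theta>)"
  by (rule calg_mid(1)[OF A_Hom])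

lemma sact_closed: "\<theta> \<in> Hom delta m n \<Longrightarrow> x \<in> carrier (omap A n) \<Longrightarrow> sact \<theta> x \<in> carrier (omap A m)"
  by (rule calg_hom_closed[OF sact_hom])

lemma sact_comp:
  assumes "\<theta> \<in> Hom delta m n" "\<phi> \<in> Hom delta l m" "x \<in> carrier (omap A n)"
  shows "sact (\<theta> \<cdot>\<^bsub>delta\<^esub> \<phi>) x = sact \<phi> (sact \<theta> x)"
proof -
  have *: "amap A (\<theta> \<cdot>\<^bsub>delta\<^esub> \<phi>) = amap A \<phi> \<cdot>\<^bsub>calg_cat k\<^esub> amap A \<theta>"
    using functor_comp[OF A, of \<theta> n m \<phi> l] assms(1,2) by (simp del: calg_cat_simps)
  show ?thesis unfolding * by (rule calg_comp_mid[OF A_Hom[OF assms(1)] assms(3)])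
qed

lemma sact_Ident: "x \<in> carrier (omap A n) \<Longrightarrow> sact (Ident delta n) x = x"
  using functor_Ident[OF A, of n] by simp

lemma underlying_omap [simp]: "omap (underlying A) n = carrier (omap A n)"
  by (simp add: underlying_def mk_sset_def)

lemma underlying_act: "\<theta> \<in> Hom delta m n \<Longrightarrow> x \<in> carrier (omap A n) \<Longrightarrow> act (underlying A) \<theta> x = sact \<theta> x"
  unfolding underlying_def by (rule mk_sset_simps(2))

lemma underlying_sset: "is_sset (underlying A)"
  unfolding underlying_def
  by (rule mk_sset_is_sset) (simp_all only: sact_closed sact_comp sact_Ident)

text \<open>\<open>d 0\<close> takes an edge to its end and \<open>d (Suc 0)\<close> to its start;
  \<open>s\<close> gives the degenerate edge on an element.\<close>

abbreviation d :: "nat \<Rightarrow> 'u \<Rightarrow> 'u" where "d i \<equiv> sact (coface 0 i)"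
abbreviation s :: "'u \<Rightarrow> 'u" where "s \<equiv> sact (collapse (Suc 0))"

lemma d_hom: "calg_hom k (omap A (Suc 0)) (omap A 0) (d i)"
  by (rule sact_hom[OF coface_Hom])

lemma s_hom: "calg_hom k (omap A 0) (omap A (Suc 0)) s"
  by (rule sact_hom[OF collapse_Hom])

lemma d_s: "x \<in> carrier (omap A 0) \<Longrightarrow> d i (s x) = x"
  unfolding sact_comp[OF collapse_Hom coface_Hom, symmetric] delta_collapse_comp[OF coface_Hom] collapse_0
  by (rule sact_Ident)

sublocale A0: algebra k "omap A 0" by (rule alg)
sublocale A1: algebra k "omap A (Suc 0)" by (rule alg)

sublocale d: ring_hom_cring "omap A (Suc 0)" "omap A 0" "d i" for i
  using d_hom[of i] algebra_cring[OF alg]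
  by (intro ring_hom_cring.intro ring_hom_cring_axioms.intro) (simp_all add: calg_hom_def)

sublocale s: ring_hom_cring "omap A 0" "omap A (Suc 0)" s
  using s_hom algebra_cring[OF alg]
  by (intro ring_hom_cring.intro ring_hom_cring_axioms.intro) (simp_all add: calg_hom_def)

lemma boundaries_eq:
  "boundaries A 0 = d 0 ` {y \<in> carrier (omap A (Suc 0)). d (Suc 0) y = \<zero>\<^bsub>omap A 0\<^esub>}"
  by (simp add: boundaries_def face_def coface_def)

text \<open>The degenerate edge \<open>s x\<close> has both faces equal to \<open>x\<close>:
  multiplying a witness \<open>y\<close> by it keeps the start zero and multiplies the end by
  \<open>x\<close>.\<close>

lemma boundaries_ideal: "ideal (boundaries A 0) (omap A 0)"
proof -
  let ?Z = "{y \<in> carrier (omap A (Suc 0)). d (Suc 0) y = \<zero>\<^bsub>omap A 0\<^esub>}"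
  have mult: "x \<otimes>\<^bsub>omap A 0\<^esub> a \<in> boundaries A 0 \<and> a \<otimes>\<^bsub>omap A 0\<^esub> x \<in> boundaries A 0"
    if a: "a \<in> boundaries A 0" and x: "x \<in> carrier (omap A 0)" for a x
  proof -
    obtain y where y: "y \<in> ?Z" "a = d 0 y" using a boundaries_eq by auto
    have yc: "y \<in> carrier (omap A (Suc 0))" "d (Suc 0) y = \<zero>\<^bsub>omap A 0\<^esub>" using y(1) by auto
    have sx: "s x \<in> carrier (omap A (Suc 0))" using x by simp
    have "s x \<otimes>\<^bsub>omap A (Suc 0)\<^esub> y \<in> ?Z" "d 0 (s x \<otimes>\<^bsub>omap A (Suc 0)\<^esub> y) = x \<otimes>\<^bsub>omap A 0\<^esub> a"
      "y \<otimes>\<^bsub>omap A (Suc 0)\<^esub> s x \<in> ?Z" "d 0 (y \<otimes>\<^bsub>omap A (Suc 0)\<^esub> s x) = a \<otimes>\<^bsub>omap A 0\<^esub> x"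
      using yc x sx y(2) by (simp_all add: d_s)
    then show ?thesis unfolding boundaries_eq by (intro conjI image_eqI) (erule sym, assumption)+
  qed
  have sub: "boundaries A 0 \<subseteq> carrier (omap A 0)" using boundaries_eq by auto
  show ?thesis
  proof (rule idealI[OF cring.axioms(1)[OF algebra_cring[OF alg]]])
    show "subgroup (boundaries A 0) (add_monoid (omap A 0))"
    proof (rule A0.M.add.subgroupI)
      have "\<zero>\<^bsub>omap A (Suc 0)\<^esub> \<in> ?Z" by simp
      then show "boundaries A 0 \<noteq> {}" unfolding boundaries_eq by blast
    next
      fix a assume "a \<in> boundaries A 0"
      then obtain y where y: "y \<in> ?Z" "a = d 0 y" using boundaries_eq by auto
      then have "\<ominus>\<^bsub>omap A (Suc 0)\<^esub> y \<in> ?Z" "d 0 (\<ominus>\<^bsub>omap A (Suc 0)\<^esub> y) = \<ominus>\<^bsub>omap A 0\<^esub> a" by simp_all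
      then show "\<ominus>\<^bsub>omap A 0\<^esub> a \<in> boundaries A 0" unfolding boundaries_eq by (intro image_eqI) (erule sym)
    next
      fix a b assume "a \<in> boundaries A 0" "b \<in> boundaries A 0"
      then obtain y z where y: "y \<in> ?Z" "a = d 0 y" "z \<in> ?Z" "b = d 0 z" using boundaries_eq by auto
      then have "y \<oplus>\<^bsub>omap A (Suc 0)\<^esub> z \<in> ?Z" "d 0 (y \<oplus>\<^bsub>omap A (Suc 0)\<^esub> z) = a \<oplus>\<^bsub>omap A 0\<^esub> b" by simp_all
      then show "a \<oplus>\<^bsub>omap A 0\<^esub> b \<in> boundaries A 0" unfolding boundaries_eq by (intro image_eqI) (erule sym)
    qed (use sub in auto)
  qed (use mult in auto)
qed

sublocale alg_ideal k "omap A 0" "boundaries A 0"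
  by (intro alg_ideal.intro alg boundaries_ideal)

text \<open>Subtracting the degenerate edge on the start of \<open>y\<close> gives an edge that
  starts at zero, so the difference of the two ends of \<open>y\<close> is a boundary.\<close>

lemma q_d: "y \<in> carrier (omap A (Suc 0)) \<Longrightarrow> q (d 0 y) = q (d (Suc 0) y)"
proof -
  assume y: "y \<in> carrier (omap A (Suc 0))"
  let ?z = "y \<ominus>\<^bsub>omap A (Suc 0)\<^esub> s (d (Suc 0) y)"
  have z: "?z \<in> carrier (omap A (Suc 0))" "d 0 ?z = d 0 y \<ominus>\<^bsub>omap A 0\<^esub> d (Suc 0) y" "d (Suc 0) ?z = \<zero>\<^bsub>omap A 0\<^esub>"
    using y d_s by (simp_all add: a_minus_def A0.M.r_neg)
  have "d 0 y \<ominus>\<^bsub>omap A 0\<^esub> d (Suc 0) y \<in> boundaries A 0"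
    unfolding boundaries_eq by (rule image_eqI[where f = "d 0", OF z(2)[symmetric]]) (simp add: z)
  then show ?thesis using q_eq y by simp
qed

text \<open>This makes the projection to pi_0 admissible as the function \<open>c\<close> of
  \<open>component_invariant\<close>.\<close>

lemma q_underlying:
  "e \<in> omap (underlying A) (Suc 0) \<Longrightarrow>
    q (act (underlying A) (coface 0 0) e) = q (act (underlying A) (coface 0 (Suc 0)) e)"
  by (simp add: underlying_act[OF coface_Hom] q_d)

lemma q_vertex:
  assumes x: "x \<in> carrier (omap A n)" and v: "v \<le> n"
  shows "q (sact (vertex n v) x) = q (sact (vertex n 0) x)"
proof -
  have xu: "x \<in> omap (underlying A) n" using x by simp
  have "q (act (underlying A) (vertex n v) x) = q (act (underlying A) (vertex n 0) x)"
    by (rule vertices_equal[OF underlying_sset _ xu v]) (rule q_underlying)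
  then show ?thesis using underlying_act[OF vertex_Hom[OF v] x] underlying_act[OF vertex_Hom[of 0 n] x] by simp
qed

end

section \<open>The functor pi_0 and its adjunction with constant objects\<close>

abbreviation pi0_alg :: "'u scalg \<Rightarrow> 'u calg" where
  "pi0_alg A \<equiv> quot_alg (omap A 0) (boundaries A 0)"

abbreviation pi0_proj :: "'u scalg \<Rightarrow> 'u \<Rightarrow> 'u" where
  "pi0_proj A \<equiv> coset_rep (omap A 0) (boundaries A 0)"

lemma scalg_arr:
  assumes "e \<in> Hom (simp_cat (calg_cat k)) A B"
  shows "simp_calg k A" "simp_calg k B" "fst e = A" "snd (snd e) = B"
    "mid e n \<in> Hom (calg_cat k) (omap A n) (omap B n)"
    "\<theta> \<in> Hom delta m n \<Longrightarrow> x \<in> carrier (omap A n) \<Longrightarrow>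
       mid (mid e m) (mid (amap A \<theta>) x) = mid (amap B \<theta>) (mid (mid e n) x)"
proof -
  obtain \<eta> where e: "e = (A, \<eta>, B)" and A: "is_functor (op_cat delta) (calg_cat k) A"
    and B: "is_functor (op_cat delta) (calg_cat k) B" and n: "nat_trans (op_cat delta) (calg_cat k) A B \<eta>"
    using assms by (auto simp: Hom_fun_cat)
  show sA: "simp_calg k A" and sB: "simp_calg k B" using A B by (simp_all add: simp_calg_def)
  show "fst e = A" "snd (snd e) = B" using e by simp_all
  have \<eta>: "\<eta> n \<in> Hom (calg_cat k) (omap A n) (omap B n)" for n using nat_trans_Hom[OF n, of n] by simp
  show "mid e n \<in> Hom (calg_cat k) (omap A n) (omap B n)" using \<eta> e by simp
  assume t: "\<theta> \<in> Hom delta m n" and x: "x \<in> carrier (omap A n)"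
  have "\<eta> m \<cdot>\<^bsub>calg_cat k\<^esub> amap A \<theta> = amap B \<theta> \<cdot>\<^bsub>calg_cat k\<^esub> \<eta> n"
    using nat_trans_eq[OF n, of \<theta> n m] t by simp
  then show "mid (mid e m) (mid (amap A \<theta>) x) = mid (amap B \<theta>) (mid (mid e n) x)"
    using calg_comp_mid[OF simp_calg.A_Hom[OF sA t] x, of "\<eta> m"] calg_comp_mid[OF \<eta> x, of "amap B \<theta>"] e by (metis fst_conv snd_conv)
qed

definition pi0_fctr :: "'u ring \<Rightarrow> ('u scalg, 'u scalg_arr, 'u calg, 'u calg_arr) fctr" where
  "pi0_fctr k = \<lparr>omap = (\<lambda>A\<in>Ob (skCAlg k). pi0_alg A),
     amap = (\<lambda>e\<in>Arr (skCAlg k). (pi0_alg (fst e),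
       \<lambda>a\<in>carrier (pi0_alg (fst e)). pi0_proj (snd (snd e)) (mid (mid e 0) a), pi0_alg (snd (snd e))))\<rparr>"

lemma pi0_fctr_omap: "simp_calg k A \<Longrightarrow> omap (pi0_fctr k) A = pi0_alg A"
  by (simp add: pi0_fctr_def simp_calg_def)

text \<open>The induced map exists since \<open>e\<close> commutes with faces: a boundary goes to
  the end of an edge that starts at zero, and such an end has class zero by
  \<open>q_d\<close>.\<close>

lemma pi0_fctr_amap:
  assumes e: "e \<in> Hom (simp_cat (calg_cat k)) A B"
  shows "amap (pi0_fctr k) e \<in> Hom (calg_cat k) (pi0_alg A) (pi0_alg B)"
    and "x \<in> carrier (omap A 0) \<Longrightarrow> mid (amap (pi0_fctr k) e) (pi0_proj A x) = pi0_proj B (mid (mid e 0) x)"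
proof -
  interpret A: simp_calg k A by (rule scalg_arr(1)[OF e])
  interpret B: simp_calg k B by (rule scalg_arr(2)[OF e])
  let ?f = "\<lambda>x. pi0_proj B (mid (mid e 0) x)"
  have eq: "amap (pi0_fctr k) e = (pi0_alg A, \<lambda>a\<in>carrier (pi0_alg A). ?f a, pi0_alg B)"
    using HomD(1)[OF e] scalg_arr(3,4)[OF e] by (simp add: pi0_fctr_def)
  note e0 = calg_mid(1,2)[OF scalg_arr(5)[OF e]]
  have f: "calg_hom k (omap A 0) (pi0_alg B) ?f" by (rule calg_hom_comp[OF e0(1) B.q_hom])
  have ker: "?f x = \<zero>\<^bsub>pi0_alg B\<^esub>" if x: "x \<in> boundaries A 0" for x
  proof -
    obtain y where y: "y \<in> carrier (omap A (Suc 0))" "A.d (Suc 0) y = \<zero>\<^bsub>omap A 0\<^esub>" "x = A.d 0 y"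
      using x A.boundaries_eq by auto
    have "mid (mid e 0) x = B.d 0 (mid (mid e (Suc 0)) y)"
      using scalg_arr(6)[OF e coface_Hom y(1)] y(3) by simp
    moreover have "B.d (Suc 0) (mid (mid e (Suc 0)) y) = mid (mid e 0) \<zero>\<^bsub>omap A 0\<^esub>"
      using scalg_arr(6)[OF e coface_Hom y(1), of "Suc 0"] y(2) by simp
    moreover have "mid (mid e 0) \<zero>\<^bsub>omap A 0\<^esub> = \<zero>\<^bsub>omap B 0\<^esub>"
      using e0(1) ring_hom_zero[of _ "omap A 0" "omap B 0"] cring.axioms(1)[OF algebra_cring[OF A.alg]]
        cring.axioms(1)[OF algebra_cring[OF B.alg]] by (simp add: calg_hom_def)
    moreover note B.q_d[OF calg_mid(2)[OF scalg_arr(5)[OF e] y(1)]]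
    ultimately show ?thesis by simp
  qed
  show "amap (pi0_fctr k) e \<in> Hom (calg_cat k) (pi0_alg A) (pi0_alg B)"
    unfolding eq by (rule calg_arrI[OF A.quot_alg_algebra B.quot_alg_algebra A.quot_lift(1)[OF B.quot_alg_algebra f ker]])
  show "x \<in> carrier (omap A 0) \<Longrightarrow> mid (amap (pi0_fctr k) e) (pi0_proj A x) = ?f x"
    using A.quot_lift(2)[OF B.quot_alg_algebra f ker] by (simp add: eq)
qed

lemma pi0_arr_eqI:
  assumes A: "simp_calg k A" and h: "h \<in> Hom (calg_cat k) (pi0_alg A) R" "h' \<in> Hom (calg_cat k) (pi0_alg A) R"
    and "\<And>x. x \<in> carrier (omap A 0) \<Longrightarrow> mid h (pi0_proj A x) = mid h' (pi0_proj A x)"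
  shows "h = h'"
  by (rule calg_arr_eqI[OF h]) (use assms(4) in auto)

lemma pi0_fctr_is_functor: "is_functor (skCAlg k) (calg_cat k) (pi0_fctr k)"
  unfolding is_functor_def
proof (intro conjI allI ballI impI)
  show "omap (pi0_fctr k) \<in> extensional (Ob (skCAlg k))" "amap (pi0_fctr k) \<in> extensional (Arr (skCAlg k))"
    by (simp_all add: pi0_fctr_def)
next
  fix A assume "A \<in> Ob (skCAlg k)"
  then interpret A: simp_calg k A by (simp add: simp_calg_def)
  have sA: "simp_calg k A" ..
  show ob: "omap (pi0_fctr k) A \<in> Ob (calg_cat k)" using A.quot_alg_algebra by (simp add: pi0_fctr_omap[OF sA])
  have id: "Ident (skCAlg k) A \<in> Hom (simp_cat (calg_cat k)) A A"
    using Ident_Hom[OF is_category_skCAlg, of A k] A.A unfolding Hom_skCAlg by simp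
  have mid0: "mid (mid (Ident (skCAlg k) A) 0) x = x" if "x \<in> carrier (omap A 0)" for x using that by simp
  show "amap (pi0_fctr k) (Ident (skCAlg k) A) = Ident (calg_cat k) (omap (pi0_fctr k) A)"
  proof (rule pi0_arr_eqI[OF sA])
    show "amap (pi0_fctr k) (Ident (skCAlg k) A) \<in> Hom (calg_cat k) (pi0_alg A) (pi0_alg A)"
      by (rule pi0_fctr_amap(1)[OF id])
    show "Ident (calg_cat k) (omap (pi0_fctr k) A) \<in> Hom (calg_cat k) (pi0_alg A) (pi0_alg A)"
      using Ident_Hom[OF is_category_calg ob] by (simp add: pi0_fctr_omap[OF sA])
  next
    fix x assume x: "x \<in> carrier (omap A 0)"
    then show "mid (amap (pi0_fctr k) (Ident (skCAlg k) A)) (pi0_proj A x) = mid (Ident (calg_cat k) (omap (pi0_fctr k) A)) (pi0_proj A x)"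
      unfolding pi0_fctr_amap(2)[OF id x] mid0[OF x] by (simp add: pi0_fctr_omap[OF sA])
  qed
next
  fix A B e assume "e \<in> Hom (skCAlg k) A B"
  then have e: "e \<in> Hom (simp_cat (calg_cat k)) A B" by (simp only: Hom_skCAlg)
  show "amap (pi0_fctr k) e \<in> Hom (calg_cat k) (omap (pi0_fctr k) A) (omap (pi0_fctr k) B)"
    using pi0_fctr_amap(1)[OF e] scalg_arr(1,2)[OF e] by (simp add: pi0_fctr_omap)
next
  fix A B C e f assume "e \<in> Hom (skCAlg k) A B \<and> f \<in> Hom (skCAlg k) B C"
  then have e: "e \<in> Hom (simp_cat (calg_cat k)) A B" and f: "f \<in> Hom (simp_cat (calg_cat k)) B C"
    by (simp_all only: Hom_skCAlg)
  have fe: "f \<cdot>\<^bsub>skCAlg k\<^esub> e \<in> Hom (simp_cat (calg_cat k)) A C"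
    using Comp_Hom[OF is_category_skCAlg, of e k A B f C] e f unfolding Hom_skCAlg by simp
  note sA = scalg_arr(1)[OF e]
  show "amap (pi0_fctr k) (f \<cdot>\<^bsub>skCAlg k\<^esub> e) = amap (pi0_fctr k) f \<cdot>\<^bsub>calg_cat k\<^esub> amap (pi0_fctr k) e"
  proof (rule pi0_arr_eqI[OF sA pi0_fctr_amap(1)[OF fe] Comp_Hom[OF is_category_calg pi0_fctr_amap(1)[OF e] pi0_fctr_amap(1)[OF f]]])
    fix x assume x: "x \<in> carrier (omap A 0)"
    have qx: "pi0_proj A x \<in> carrier (pi0_alg A)" using x by simp
    have "mid (f \<cdot>\<^bsub>skCAlg k\<^esub> e) 0 = mid f 0 \<cdot>\<^bsub>calg_cat k\<^esub> mid e 0" by simp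
    then have m: "mid (mid (f \<cdot>\<^bsub>skCAlg k\<^esub> e) 0) x = mid (mid f 0) (mid (mid e 0) x)"
      using calg_comp_mid[OF scalg_arr(5)[OF e] x, of "mid f 0"] by metis
    show "mid (amap (pi0_fctr k) (f \<cdot>\<^bsub>skCAlg k\<^esub> e)) (pi0_proj A x)
        = mid (amap (pi0_fctr k) f \<cdot>\<^bsub>calg_cat k\<^esub> amap (pi0_fctr k) e) (pi0_proj A x)"
      unfolding calg_comp_mid[OF pi0_fctr_amap(1)[OF e] qx] pi0_fctr_amap(2)[OF e x] pi0_fctr_amap(2)[OF fe x] m
        pi0_fctr_amap(2)[OF f calg_mid(2)[OF scalg_arr(5)[OF e] x]] ..
  qed
qed

text \<open>Restricting to another vertex gives the same map, because the vertices of a simplex are joined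
  by edges.\<close>

definition pi0_unit :: "'u ring \<Rightarrow> 'u scalg \<Rightarrow> 'u scalg_arr" where
  "pi0_unit k A = (A, \<lambda>n. (omap A n, \<lambda>x\<in>carrier (omap A n). pi0_proj A (mid (amap A (vertex n 0)) x), pi0_alg A),
     const_fctr (op_cat delta) (calg_cat k) (pi0_alg A))"

lemma const_scalg:
  "Module.algebra k R \<Longrightarrow> is_functor (op_cat delta) (calg_cat k) (const_fctr (op_cat delta) (calg_cat k) R)"
  using const_fctr_is_functor[OF dcat is_category_calg] by simp

lemma pi0_unit_mid:
  "x \<in> carrier (omap A n) \<Longrightarrow> mid (mid (pi0_unit k A) n) x = pi0_proj A (mid (amap A (vertex n 0)) x)"
  by (simp add: pi0_unit_def)

lemma simp_arr_eqI:
  assumes "e \<in> Hom (simp_cat (calg_cat k)) A B" "e' \<in> Hom (simp_cat (calg_cat k)) A B"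
    and "\<And>n x. x \<in> carrier (omap A n) \<Longrightarrow> mid (mid e n) x = mid (mid e' n) x"
  shows "e = e'"
proof -
  have "mid e n = mid e' n" for n
    by (rule calg_arr_eqI[OF scalg_arr(5)[OF assms(1)] scalg_arr(5)[OF assms(2)] assms(3)])
  then show ?thesis using assms(1,2) by (auto simp: Hom_fun_cat)
qed

lemma simp_comp_mid:
  assumes "e \<in> Hom (simp_cat (calg_cat k)) A B" "x \<in> carrier (omap A n)"
  shows "mid (mid (f \<cdot>\<^bsub>simp_cat (calg_cat k)\<^esub> e) n) x = mid (mid f n) (mid (mid e n) x)"
proof -
  have "mid (f \<cdot>\<^bsub>simp_cat (calg_cat k)\<^esub> e) n = mid f n \<cdot>\<^bsub>calg_cat k\<^esub> mid e n" by simp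
  then show ?thesis using calg_comp_mid[OF scalg_arr(5)[OF assms(1)] assms(2), of "mid f n"] by metis
qed

lemma pi0_unit_Hom:
  assumes "simp_calg k A"
  shows "pi0_unit k A \<in> Hom (simp_cat (calg_cat k)) A (const_fctr (op_cat delta) (calg_cat k) (pi0_alg A))"
proof -
  interpret A: simp_calg k A by fact
  let ?u = "\<lambda>n. (omap A n, \<lambda>x\<in>carrier (omap A n). pi0_proj A (mid (amap A (vertex n 0)) x), pi0_alg A)"
  have u: "?u n \<in> Hom (calg_cat k) (omap A n) (pi0_alg A)" for n
    by (rule calg_arrI[OF A.alg A.quot_alg_algebra calg_hom_comp[OF A.sact_hom[OF vertex_Hom] A.q_hom]]) simp
  have um: "mid (?u n) x = pi0_proj A (mid (amap A (vertex n 0)) x)" if "x \<in> carrier (omap A n)" for n x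
    using that by simp
  have "?u m \<cdot>\<^bsub>calg_cat k\<^esub> amap A \<theta> = Ident (calg_cat k) (pi0_alg A) \<cdot>\<^bsub>calg_cat k\<^esub> ?u n"
    if t: "\<theta> \<in> Hom delta m n" for m n \<theta>
    unfolding Comp_Ident(2)[OF is_category_calg u]
  proof (rule calg_arr_eqI[OF Comp_Hom[OF is_category_calg A.A_Hom[OF t] u] u])
    fix x assume x: "x \<in> carrier (omap A n)"
    have "mid \<theta> 0 \<le> n" using t by (auto simp: delta_Hom_iff)
    then show "mid (?u m \<cdot>\<^bsub>calg_cat k\<^esub> amap A \<theta>) x = mid (?u n) x"
      unfolding calg_comp_mid[OF A.A_Hom[OF t] x] um[OF x] um[OF A.sact_closed[OF t x]]
        A.sact_comp[OF t vertex_Hom[of 0 m] x, symmetric, OF le0] delta_comp_vertex[OF t le0]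
      by (rule A.q_vertex[OF x])
  qed
  then show ?thesis
    using u A.A const_scalg[OF A.quot_alg_algebra] HomD(1)[of _ delta]
    by (simp add: Hom_fun_cat pi0_unit_def nat_trans_def extensional_def)
qed

lemma cs_omap: "R \<in> Ob C \<Longrightarrow> omap (cs C) R = const_fctr (op_cat delta) C R"
  by (simp add: cs_def)

lemma cs_amap: "h \<in> Hom C R S \<Longrightarrow>
    amap (cs C) h = (const_fctr (op_cat delta) C R, \<lambda>n\<in>UNIV. h, const_fctr (op_cat delta) C S)"
  by (auto simp: cs_def Hom_def)

lemma cs_is_functor:
  assumes C: "is_category C"
  shows "is_functor C (simp_cat C) (cs C)"
  unfolding is_functor_def
proof (intro conjI allI ballI impI)
  show "omap (cs C) \<in> extensional (Ob C)" "amap (cs C) \<in> extensional (Arr C)" by (simp_all add: cs_def)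
next
  fix R assume R: "R \<in> Ob C"
  show "omap (cs C) R \<in> Ob (simp_cat C)" using const_fctr_is_functor[OF dcat C R] R by (simp add: cs_omap)
  show "amap (cs C) (Ident C R) = Ident (simp_cat C) (omap (cs C) R)"
    using R by (simp add: cs_omap cs_amap[OF Ident_Hom[OF C R]])
next
  fix R S h assume h: "h \<in> Hom C R S"
  then have ob: "R \<in> Ob C" "S \<in> Ob C" using Hom_Ob[OF C] by auto
  show "amap (cs C) h \<in> Hom (simp_cat C) (omap (cs C) R) (omap (cs C) S)"
    using const_fctr_is_functor[OF dcat C ob(1)] const_fctr_is_functor[OF dcat C ob(2)] h Comp_Ident[OF C h] HomD(1)[of _ delta]
    by (simp add: cs_omap ob cs_amap[OF h] Hom_fun_cat nat_trans_def)
next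
  fix R S T h g assume "h \<in> Hom C R S \<and> g \<in> Hom C S T"
  then have h: "h \<in> Hom C R S" and g: "g \<in> Hom C S T" by auto
  show "amap (cs C) (g \<cdot>\<^bsub>C\<^esub> h) = amap (cs C) g \<cdot>\<^bsub>simp_cat C\<^esub> amap (cs C) h"
    by (simp add: cs_amap[OF h] cs_amap[OF g] cs_amap[OF Comp_Hom[OF C h g]])
qed

lemma pi0_unit_nat:
  assumes e: "e \<in> Hom (simp_cat (calg_cat k)) A B"
  shows "pi0_unit k B \<cdot>\<^bsub>simp_cat (calg_cat k)\<^esub> e = amap (cs (calg_cat k)) (amap (pi0_fctr k) e) \<cdot>\<^bsub>simp_cat (calg_cat k)\<^esub> pi0_unit k A"
proof -
  interpret A: simp_calg k A by (rule scalg_arr(1)[OF e])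
  note sA = scalg_arr(1)[OF e] and sB = scalg_arr(2)[OF e]
  note pe = pi0_fctr_amap[OF e]
  have cat: "is_category (simp_cat (calg_cat k))" by (rule is_category_fun_cat[OF is_category_calg dcat])
  have c: "amap (cs (calg_cat k)) (amap (pi0_fctr k) e) \<in> Hom (simp_cat (calg_cat k))
      (const_fctr (op_cat delta) (calg_cat k) (pi0_alg A)) (const_fctr (op_cat delta) (calg_cat k) (pi0_alg B))"
    using functor_Hom[OF cs_is_functor[OF is_category_calg] pe(1)] calg_mid(3,4)[OF pe(1)]
    by (simp add: cs_omap)
  show ?thesis
  proof (rule simp_arr_eqI[OF Comp_Hom[OF cat e pi0_unit_Hom[OF sB]] Comp_Hom[OF cat pi0_unit_Hom[OF sA] c]])
    fix n x assume x: "x \<in> carrier (omap A n)"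
    have v: "vertex n 0 \<in> Hom delta 0 n" by (simp add: vertex_Hom)
    have "mid (amap (cs (calg_cat k)) (amap (pi0_fctr k) e)) n = amap (pi0_fctr k) e"
      by (simp add: cs_amap[OF pe(1)])
    then show "mid (mid (pi0_unit k B \<cdot>\<^bsub>simp_cat (calg_cat k)\<^esub> e) n) x =
        mid (mid (amap (cs (calg_cat k)) (amap (pi0_fctr k) e) \<cdot>\<^bsub>simp_cat (calg_cat k)\<^esub> pi0_unit k A) n) x"
      unfolding simp_comp_mid[OF e x] simp_comp_mid[OF pi0_unit_Hom[OF sA] x] pi0_unit_mid[OF x]
        pi0_unit_mid[OF calg_mid(2)[OF scalg_arr(5)[OF e] x]] scalg_arr(6)[OF e v x, symmetric]
      using pe(2)[OF A.sact_closed[OF v x]] by simp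
  qed
qed

text \<open>Naturality over a constant object makes degree 0 of \<open>g\<close> agree at both ends
  of every edge, hence factor through pi_0. Restriction to vertex 0 recovers the other degrees from
  degree 0.\<close>

lemma pi0_universal:
  assumes A: "simp_calg k A" and R: "Module.algebra k R"
    and g: "g \<in> Hom (simp_cat (calg_cat k)) A (const_fctr (op_cat delta) (calg_cat k) R)"
  shows "\<exists>!h. h \<in> Hom (calg_cat k) (pi0_alg A) R \<and> amap (cs (calg_cat k)) h \<cdot>\<^bsub>simp_cat (calg_cat k)\<^esub> pi0_unit k A = g"
proof -
  interpret A: simp_calg k A by fact
  let ?K = "const_fctr (op_cat delta) (calg_cat k)"
  have cat: "is_category (simp_cat (calg_cat k))" by (rule is_category_fun_cat[OF is_category_calg dcat])
  have gn: "mid g n \<in> Hom (calg_cat k) (omap A n) R" for n using scalg_arr(5)[OF g, of n] by simp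
  have gnat: "mid (mid g m) (mid (amap A \<theta>) x) = mid (mid g n) x" if "\<theta> \<in> Hom delta m n" "x \<in> carrier (omap A n)" for m n \<theta> x
    using scalg_arr(6)[OF g that] HomD(1)[OF that(1)] calg_mid(2)[OF gn that(2)] by simp
  have ker: "mid (mid g 0) x = \<zero>\<^bsub>R\<^esub>" if x: "x \<in> boundaries A 0" for x
  proof -
    obtain y where y: "y \<in> carrier (omap A (Suc 0))" "A.d (Suc 0) y = \<zero>\<^bsub>omap A 0\<^esub>" "x = A.d 0 y"
      using x A.boundaries_eq by auto
    have "mid (mid g 0) x = mid (mid g 0) \<zero>\<^bsub>omap A 0\<^esub>"
      using gnat[OF coface_Hom y(1), of 0] gnat[OF coface_Hom y(1), of "Suc 0"] y(2,3) by simp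
    also have "\<dots> = \<zero>\<^bsub>R\<^esub>"
      using calg_mid(1)[OF gn[of 0]] ring_hom_zero[of _ "omap A 0" R] cring.axioms(1)[OF algebra_cring[OF A.alg]]
        cring.axioms(1)[OF algebra_cring[OF R]] by (simp add: calg_hom_def)
    finally show ?thesis .
  qed
  note lift = A.quot_lift[OF R calg_mid(1)[OF gn[of 0]] ker]
  define h where "h = (pi0_alg A, \<lambda>a\<in>carrier (pi0_alg A). mid (mid g 0) a, R)"
  have h: "h \<in> Hom (calg_cat k) (pi0_alg A) R" unfolding h_def by (rule calg_arrI[OF A.quot_alg_algebra R lift(1)])
  have hq: "mid h (pi0_proj A x) = mid (mid g 0) x" if "x \<in> carrier (omap A 0)" for x
    using that A.quot_lift(2)[OF R calg_mid(1)[OF gn[of 0]] ker, of x] by (simp add: h_def)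
  have c: "amap (cs (calg_cat k)) h' \<in> Hom (simp_cat (calg_cat k)) (?K (pi0_alg A)) (?K R)"
    and cm: "mid (amap (cs (calg_cat k)) h') n = h'" if h': "h' \<in> Hom (calg_cat k) (pi0_alg A) R" for h' n
    using functor_Hom[OF cs_is_functor[OF is_category_calg] h'] calg_mid(3,4)[OF h']
    by (simp_all add: cs_omap cs_amap[OF h'])
  note uH = pi0_unit_Hom[OF A]
  have val: "mid (mid (amap (cs (calg_cat k)) h' \<cdot>\<^bsub>simp_cat (calg_cat k)\<^esub> pi0_unit k A) n) x =
      mid h' (pi0_proj A (mid (amap A (vertex n 0)) x))"
    if h': "h' \<in> Hom (calg_cat k) (pi0_alg A) R" and x: "x \<in> carrier (omap A n)" for h' n x
    unfolding simp_comp_mid[OF uH x] pi0_unit_mid[OF x] cm[OF h'] ..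
  have v: "vertex n 0 \<in> Hom delta 0 n" for n by (simp add: vertex_Hom)
  show ?thesis
  proof (rule ex1I[of _ h], intro conjI h)
    show "amap (cs (calg_cat k)) h \<cdot>\<^bsub>simp_cat (calg_cat k)\<^esub> pi0_unit k A = g"
    proof (rule simp_arr_eqI[OF Comp_Hom[OF cat uH c[OF h]] g])
      fix n x assume x: "x \<in> carrier (omap A n)"
      show "mid (mid (amap (cs (calg_cat k)) h \<cdot>\<^bsub>simp_cat (calg_cat k)\<^esub> pi0_unit k A) n) x = mid (mid g n) x"
        unfolding val[OF h x] hq[OF A.sact_closed[OF v x]] gnat[OF v x] ..
    qed
  next
    fix h' assume *: "h' \<in> Hom (calg_cat k) (pi0_alg A) R \<and> amap (cs (calg_cat k)) h' \<cdot>\<^bsub>simp_cat (calg_cat k)\<^esub> pi0_unit k A = g"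
    then have h': "h' \<in> Hom (calg_cat k) (pi0_alg A) R" by blast
    show "h' = h"
    proof (rule pi0_arr_eqI[OF A h' h])
      fix x assume x: "x \<in> carrier (omap A 0)"
      have "mid (mid g 0) x = mid h' (pi0_proj A (mid (amap A (vertex 0 0)) x))" using val[OF h' x] unfolding conjunct2[OF *] .
      then show "mid h' (pi0_proj A x) = mid h (pi0_proj A x)"
        using hq[OF x] A.sact_Ident[OF x] by (simp add: vertex_0_0)
    qed
  qed
qed

text \<open>Bijectivity on pi_0 comes from the two lemmas on components, with the projections to
  pi_0 as invariants. For injectivity an equality of classes has to be realized by an edge.\<close>

lemma pi0_weq_iso:
  assumes w: "e \<in> scalg_equivs k"
  shows "is_iso (calg_cat k) (amap (pi0_fctr k) e)"
proof -
  have "e \<in> Arr (simp_cat (calg_cat k))" using w unfolding scalg_equivs_def mem_Collect_eq by (rule conjunct1)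
  then obtain A B where e: "e \<in> Hom (simp_cat (calg_cat k)) A B"
    by (rule that[OF Arr_Hom])
  have w: "sset_weq (underlying A) (underlying B) (\<lambda>n. mid (mid e n))"
    using w scalg_arr(3,4)[OF e] by (simp add: scalg_equivs_def)
  interpret A: simp_calg k A by (rule scalg_arr(1)[OF e])
  interpret B: simp_calg k B by (rule scalg_arr(2)[OF e])
  note pe = pi0_fctr_amap[OF e] and e0 = calg_mid(2)[OF scalg_arr(5)[OF e]]
  have inj: "pi0_proj A x = pi0_proj A x'"
    if x: "x \<in> carrier (omap A 0)" "x' \<in> carrier (omap A 0)"
      and eq: "pi0_proj B (mid (mid e 0) x') = pi0_proj B (mid (mid e 0) x)" for x x'
  proof -
    have "mid (mid e 0) x' \<ominus>\<^bsub>omap B 0\<^esub> mid (mid e 0) x \<in> boundaries B 0"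
      using eq B.q_eq[OF e0 e0] x by simp
    then obtain y where y: "y \<in> carrier (omap B (Suc 0))" "B.d (Suc 0) y = \<zero>\<^bsub>omap B 0\<^esub>"
      "mid (mid e 0) x' \<ominus>\<^bsub>omap B 0\<^esub> mid (mid e 0) x = B.d 0 y"
      using B.boundaries_eq by auto
    \<comment> \<open>The witness of the boundary runs from zero to the difference of the images;
      adding the degenerate edge at the image of \<open>x\<close> translates it to an edge between
      the two images.\<close>
    let ?z = "y \<oplus>\<^bsub>omap B (Suc 0)\<^esub> B.s (mid (mid e 0) x)"
    have z: "?z \<in> carrier (omap B (Suc 0))" "B.d (Suc 0) ?z = mid (mid e 0) x" "B.d 0 ?z = mid (mid e 0) x'"
      using y e0[OF x(1)] e0[OF x(2)] B.d_s y(3)[symmetric]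
      by (simp_all add: a_minus_def B.A0.M.a_assoc B.A0.M.l_neg)
    show ?thesis
      by (rule sset_weq_inj_components[OF A.underlying_sset B.underlying_sset w, of x x' ?z "pi0_proj A"])
        (simp_all only: A.underlying_omap B.underlying_omap x z A.q_underlying B.underlying_act[OF coface_Hom z(1)])
  qed
  have surj: "\<exists>x\<in>carrier (omap A 0). pi0_proj B (mid (mid e 0) x) = pi0_proj B y" if y: "y \<in> carrier (omap B 0)" for y
    using sset_weq_surj_components[OF A.underlying_sset B.underlying_sset w, of y "pi0_proj B"] y B.q_underlying by simp
  show ?thesis
  proof (rule calg_bij_iso[OF pe(1)])
    show "bij_betw (mid (amap (pi0_fctr k) e)) (carrier (pi0_alg A)) (carrier (pi0_alg B))"
      unfolding bij_betw_def
    proof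
      show "inj_on (mid (amap (pi0_fctr k) e)) (carrier (pi0_alg A))"
      proof (rule inj_onI)
        fix a b assume ab: "a \<in> carrier (pi0_alg A)" "b \<in> carrier (pi0_alg A)"
          "mid (amap (pi0_fctr k) e) a = mid (amap (pi0_fctr k) e) b"
        then obtain x y where x: "x \<in> carrier (omap A 0)" "a = pi0_proj A x"
          and y: "y \<in> carrier (omap A 0)" "b = pi0_proj A y"
          by auto
        show "a = b" unfolding x(2) y(2)
          by (rule inj[OF x(1) y(1)]) (use ab(3) pe(2)[OF x(1)] pe(2)[OF y(1)] in \<open>simp only: x(2) y(2)\<close>)
      qed
      show "mid (amap (pi0_fctr k) e) ` carrier (pi0_alg A) = carrier (pi0_alg B)"
      proof (intro equalityI subsetI)
        fix y assume "y \<in> carrier (pi0_alg B)"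
        then obtain y' where "y' \<in> carrier (omap B 0)" "y = pi0_proj B y'" by auto
        then obtain x where x: "x \<in> carrier (omap A 0)" "y = pi0_proj B (mid (mid e 0) x)" using surj by metis
        show "y \<in> mid (amap (pi0_fctr k) e) ` carrier (pi0_alg A)"
          by (rule image_eqI[of _ _ "pi0_proj A x"]) (simp_all only: x(2) pe(2)[OF x(1)] quot_alg_simps imageI[OF x(1)])
      qed (use calg_mid(2)[OF pe(1)] in auto)
    qed
  qed
qed

section \<open>Independence of functors and transformations from the model structure\<close>

lemma is_functor_trivial_dom [simp]: "is_functor (trivial_model J) C F = is_functor J C F"
  by (simp add: is_functor_def)

lemma is_functor_trivial_cod [simp]: "is_functor J (trivial_model C) F = is_functor J C F"
  by (simp add: is_functor_def)

lemma nat_trans_trivial_dom [simp]: "nat_trans (trivial_model J) C F G \<eta> = nat_trans J C F G \<eta>"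
  by (simp add: nat_trans_def)

lemma nat_trans_trivial_cod [simp]: "nat_trans J (trivial_model C) F G \<eta> = nat_trans J C F G \<eta>"
  by (simp add: nat_trans_def)

lemma is_iso_trivial [simp]: "is_iso (trivial_model C) f = is_iso C f"
  by (simp add: is_iso_def)

lemma is_iso_op_model: "is_iso (op_model C) f = is_iso C f"
  by (auto simp: is_iso_def)

lemma fun_cat_trivial [simp]: "fun_cat J (trivial_model C) = fun_cat J C"
  by (simp add: fun_cat_def)

lemma const_fctr_trivial [simp]: "const_fctr J (trivial_model C) c = const_fctr J C c"
  by (simp add: const_fctr_def)

lemma fctr_comp_trivial [simp]: "fctr_comp (trivial_model J) G F = fctr_comp J G F"
  by (simp add: fctr_comp_def)

lemma cs_trivial [simp]: "cs (trivial_model C) = cs C"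
  by (simp add: cs_def)

lemma is_functor_skCAlg_dom: "is_functor (skCAlg k) C F = is_functor (simp_cat (calg_cat k)) C F"
proof -
  have Ob: "Ob (skCAlg k) = Ob (simp_cat (calg_cat k))" by simp
  show ?thesis unfolding is_functor_def Hom_skCAlg Ob skCAlg_simps(2,5,6) ..
qed

lemma is_functor_skCAlg_cod: "is_functor C (skCAlg k) F = is_functor C (simp_cat (calg_cat k)) F"
proof -
  have Ob: "Ob (skCAlg k) = Ob (simp_cat (calg_cat k))" by simp
  show ?thesis unfolding is_functor_def Hom_skCAlg Ob skCAlg_simps(2,5,6) ..
qed

lemma nat_trans_skCAlg: "nat_trans J (skCAlg k) F G \<eta> = nat_trans J (simp_cat (calg_cat k)) F G \<eta>"
  unfolding nat_trans_def Hom_skCAlg skCAlg_simps(6) ..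

lemma const_fctr_skCAlg: "const_fctr J (skCAlg k) X = const_fctr J (simp_cat (calg_cat k)) X"
  by (simp only: const_fctr_def skCAlg_simps(5))

lemma pi0_right_adjoint:
  "homotopy_right_adjoint (dkAff k) (kAff k) (pi0_fctr k) (cs (calg_cat k)) (pi0_unit k)"
proof (intro homotopy_right_adjoint.intro right_adjoint.intro homotopy_right_adjoint_axioms.intro)
  let ?C = "calg_cat k"
  have Ob: "X \<in> Ob (dkAff k) \<longleftrightarrow> simp_calg k X" for X by (simp add: simp_calg_def)
  show "is_category (dkAff k)" "is_category (kAff k)"
    by (intro is_category_op_model is_category_skCAlg is_category_trivial is_category_calg)+
  show "is_functor (dkAff k) (kAff k) (pi0_fctr k)"
    by (rule is_functor_op_op) (simp add: pi0_fctr_is_functor)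
  show "is_functor (kAff k) (dkAff k) (cs ?C)"
    by (rule is_functor_op_op) (simp add: is_functor_skCAlg_cod cs_is_functor[OF is_category_calg])
  show "pi0_unit k X \<in> Hom (dkAff k) (omap (cs ?C) (omap (pi0_fctr k) X)) X" if "X \<in> Ob (dkAff k)" for X
    using pi0_unit_Hom[of k X] that simp_calg.boundaries_ideal[of k X] alg_ideal.quot_alg_algebra[of k "omap X 0" "boundaries X 0"]
      simp_calg.alg[of k X 0]
    unfolding Ob by (simp add: Hom_skCAlg pi0_fctr_omap cs_omap alg_ideal_def)
  \<comment> \<open>An arrow from \<open>X\<close> to \<open>Y\<close> here is a map of simplicial
    algebras from \<open>Y\<close> to \<open>X\<close>, hence the exchanged arguments.\<close>
  show "f \<cdot>\<^bsub>dkAff k\<^esub> pi0_unit k X = pi0_unit k Y \<cdot>\<^bsub>dkAff k\<^esub> amap (cs ?C) (amap (pi0_fctr k) f)"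
    if "f \<in> Hom (dkAff k) X Y" for f X Y
    using pi0_unit_nat[of f k Y X] that unfolding Hom_op_model Hom_skCAlg op_model_simps(6) skCAlg_simps(6) .
  show "\<exists>!h. h \<in> Hom (kAff k) W (omap (pi0_fctr k) X) \<and> pi0_unit k X \<cdot>\<^bsub>dkAff k\<^esub> amap (cs ?C) h = g"
    if X: "X \<in> Ob (dkAff k)" and W: "W \<in> Ob (kAff k)" and g: "g \<in> Hom (dkAff k) (omap (cs ?C) W) X" for X W g
  proof -
    have W': "Module.algebra k W" using W by simp
    then have "g \<in> Hom (simp_cat ?C) X (const_fctr (op_cat delta) ?C W)"
      using g unfolding Hom_op_model Hom_skCAlg by (simp add: cs_omap)
    from pi0_universal[OF X[unfolded Ob] W' this] show ?thesis
      unfolding Hom_op_model op_model_simps(6) skCAlg_simps(6) Hom_trivial_model pi0_fctr_omap[OF X[unfolded Ob]] .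
  qed
  \<comment> \<open>Fibrations of \<open>dkAff k\<close> are the cofibrations of simplicial
    algebras, which \<open>has_llp\<close> requires to be arrows.\<close>
  show "Fib (dkAff k) \<subseteq> Arr (dkAff k)" by (auto simp: has_llp_def)
  show "Fib (kAff k) = Arr (kAff k)" by simp
  show "Weq (kAff k) = {f. is_iso (kAff k) f}" by (simp add: is_iso_op_model)
  show "f \<in> Arr (dkAff k) \<and> is_iso (kAff k) (amap (pi0_fctr k) f)" if "f \<in> Weq (dkAff k)" for f
    using that pi0_weq_iso[of f k] by (simp add: is_iso_op_model scalg_equivs_def)
qed

text \<open>The condition on pi_0 is stated for coset rings. \<open>Quot_iso_pair\<close> moves it
  to the algebras of representatives, where \<open>pi_map e 0\<close> corresponds to
  \<open>amap (pi0_fctr k) e\<close>.\<close>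

lemma etale_covering_pi0:
  fixes e :: "'u::infinite scalg_arr"
  assumes e: "e \<in> Hom (simp_cat (calg_cat k)) A B" and et: "etale_covering_daff k A {()} (\<lambda>_. e)"
  shows "etale_covering_aff k (pi0_alg A) {()} (\<lambda>_. amap (pi0_fctr k) e)"
proof -
  interpret A: simp_calg k A by (rule scalg_arr(1)[OF e])
  interpret B: simp_calg k B by (rule scalg_arr(2)[OF e])
  let ?f = "amap (pi0_fctr k) e"
  note pe = pi0_fctr_amap[OF e] and e0 = calg_mid(2)[OF scalg_arr(5)[OF e]]
  have ob: "fst e = A" "snd (snd e) = B" using scalg_arr(3,4)[OF e] .
  have fob: "fst ?f = pi0_alg A" "snd (snd ?f) = pi0_alg B" using pe(1) by (auto simp: Hom_calg)
  obtain J where J: "J \<subseteq> {()}" and etJ: "\<And>j. j \<in> J \<Longrightarrow> etale TYPE('u) (pi0 A) (pi0 B) (pi_map e 0)"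
    and sur: "spec_surjective (pi0 A) J (\<lambda>_. pi0 B) (\<lambda>_. pi_map e 0)"
    using et unfolding etale_covering_daff_def ob by blast
  have isoA: "iso_pair (pi0 A) (pi0_alg A) A.sec A.coset" and isoB: "iso_pair (pi0 B) (pi0_alg B) B.sec B.coset"
    using A.Quot_iso_pair B.Quot_iso_pair by (simp_all add: pi0_def)
  have fhom: "mid ?f \<in> ring_hom (pi0_alg A) (pi0_alg B)"
    using calg_mid(1)[OF pe(1)] by (simp add: calg_hom_def)
  have cA: "carrier (pi0 A) = A.coset ` carrier (omap A 0)" using A.carrier_Quot by (simp add: pi0_def)
  \<comment> \<open>\<open>pi_map\<close> is a union over all representatives; the cosets united
    coincide because \<open>amap (pi0_fctr k) e\<close> depends on the class only.\<close>
  have pm: "pi_map e 0 (A.coset x) = B.coset (mid (mid e 0) x)" if x: "x \<in> carrier (omap A 0)" for x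
  proof -
    have "B.coset (mid (mid e 0) y) = B.coset (mid (mid e 0) x)" if y: "y \<in> A.coset x" for y
    proof -
      have yc: "y \<in> carrier (omap A 0)" using y A.A0.M.a_r_coset_subset_G[OF A.I.a_subset x] by blast
      have "A.coset y = A.coset x" using A.A0.M.a_repr_independence[OF y x A.I.a_subgroup] by simp
      then have "pi0_proj A y = pi0_proj A x" by (rule A.q_cong)
      then have "pi0_proj B (mid (mid e 0) y) = pi0_proj B (mid (mid e 0) x)"
        using pe(2)[OF yc] pe(2)[OF x] by simp
      then show ?thesis using B.q_eq_coset[OF e0[OF yc] e0[OF x]] by simp
    qed
    moreover have "x \<in> A.coset x" by (rule A.I.a_rcos_self[OF x])
    ultimately show ?thesis unfolding pi_map_def pi_class_def ob by blast
  qed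
  have ff: "mid ?f (A.sec z) = B.sec (pi_map e 0 z)" if "z \<in> carrier (pi0 A)" for z
    using that unfolding cA by (auto simp: A.sec_coset B.sec_coset pe(2) pm simp del: quot_alg_simps)
  have fc: "pi_map e 0 z \<in> carrier (pi0 B)" if "z \<in> carrier (pi0 A)" for z
    using that e0 B.carrier_Quot unfolding cA by (auto simp: pm pi0_def)
  \<comment> \<open>A type of sets has at least two elements, the empty set and \<open>UNIV\<close>,
    so one of them differs from zero.\<close>
  have nontriv: "\<exists>x :: 'u set. x \<noteq> \<zero>\<^bsub>pi0 A\<^esub>"
    by (metis UNIV_not_empty)
  have "etale TYPE('u) (pi0_alg A) (pi0_alg B) (mid ?f)" if "j \<in> J" for j
    by (rule etale_iso[where f = "pi_map e 0" and f' = "mid ?f", OF isoA isoB fhom ff nontriv etJ[OF that]])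
  moreover have "spec_surjective (pi0_alg A) J (\<lambda>_. pi0_alg B) (\<lambda>_. mid ?f)"
    by (rule spec_surjective_iso[where f = "\<lambda>_. pi_map e 0" and S = "\<lambda>_. pi0 B", OF isoA isoB fc ff sur])
  moreover have "finite J" using J finite_subset by blast
  \<comment> \<open>Flatness, listed separately in \<open>etale_covering_aff\<close>, is one of the
    clauses of \<open>etale\<close>.\<close>
  ultimately show ?thesis
    unfolding etale_covering_aff_def fob using J HomD(1)[OF pe(1)] by (auto simp: etale_def)
qed


section \<open>Isomorphisms of simplicial objects and simplicial frames\<close>

lemma simp_cat_category: "is_category C \<Longrightarrow> is_category (simp_cat C)"
  by (rule is_category_fun_cat[OF _ dcat])

lemma fun_cat_arr:
  assumes "e \<in> Hom (fun_cat J C) F G"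
  shows "e = (F, mid e, G)" "is_functor J C F" "is_functor J C G" "nat_trans J C F G (mid e)"
  using assms by (auto simp: Hom_fun_cat)

lemma fun_cat_arr_eqI:
  assumes "e \<in> Hom (fun_cat J C) F G" "e' \<in> Hom (fun_cat J C) F G" "\<And>j. j \<in> Ob J \<Longrightarrow> mid e j = mid e' j"
  shows "e = e'"
  using assms by (auto simp: Hom_fun_cat intro: extensionalityI)

text \<open>The inverse is assembled from the chosen inverses of the components.\<close>

lemma fun_cat_iso:
  assumes C: "is_category C" and J: "is_category J" and e: "e \<in> Hom (fun_cat J C) F G"
    and iso: "\<And>j. j \<in> Ob J \<Longrightarrow> is_iso C (mid e j)"
  shows "is_iso (fun_cat J C) e"
proof -
  note ea = fun_cat_arr[OF e]
  let ?i = "(G, \<lambda>j\<in>Ob J. inv_arr C (mid e j), F)"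
  have i: "?i \<in> Hom (fun_cat J C) G F"
    using nat_trans_inv[OF C J ea(2,3,4) iso] ea(2,3) J by (simp add: Hom_fun_cat)
  note inv = inv_arr[OF iso nat_trans_Hom[OF ea(4)]]
  have ident: "Ident (fun_cat J C) F \<in> Hom (fun_cat J C) F F" "Ident (fun_cat J C) G \<in> Hom (fun_cat J C) G G"
    using Ident_Hom[OF is_category_fun_cat[OF C J]] ea(2,3) by (metis fun_cat_simps(1) mem_Collect_eq)+
  note Ch = Comp_Hom[OF is_category_fun_cat[OF C J]]
  show ?thesis
    by (rule isoI[OF e i]; rule fun_cat_arr_eqI[OF Ch ident(1)] fun_cat_arr_eqI[OF Ch ident(2)], (rule e i)+)
      (simp_all add: inv)
qed

lemma iso_level:
  assumes C: "is_category C" and J: "is_category J" and iso: "is_iso (fun_cat J C) e"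
    and e: "e \<in> Hom (fun_cat J C) F G" and j: "j \<in> Ob J"
  shows "is_iso C (mid e j)"
proof -
  obtain g where g: "g \<in> Hom (fun_cat J C) G F" "g \<cdot>\<^bsub>fun_cat J C\<^esub> e = Ident (fun_cat J C) F" "e \<cdot>\<^bsub>fun_cat J C\<^esub> g = Ident (fun_cat J C) G"
    using isoE[OF iso e] by metis
  have "mid (g \<cdot>\<^bsub>fun_cat J C\<^esub> e) j = mid (Ident (fun_cat J C) F) j" "mid (e \<cdot>\<^bsub>fun_cat J C\<^esub> g) j = mid (Ident (fun_cat J C) G) j"
    using g by simp_all
  then show ?thesis
    using j by (intro isoI[OF nat_trans_Hom[OF fun_cat_arr(4)[OF e] j] nat_trans_Hom[OF fun_cat_arr(4)[OF g(1)] j]]) simp_all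
qed

lemma sset_arr_map:
  assumes "e \<in> Hom sset_cat X Y"
  shows "sset_map X Y (\<lambda>n. mid (mid e n))" "is_sset X" "is_sset Y"
proof -
  note ea = fun_cat_arr[OF assms]
  show X: "is_sset X" and Y: "is_sset Y" using ea by auto
  have en: "mid e n \<in> Hom set_cat (omap X n) (omap Y n)" for n using nat_trans_Hom[OF ea(4), of n] by simp
  have "mid (mid e m) (act X \<theta> x) = act Y \<theta> (mid (mid e n) x)" if t: "\<theta> \<in> Hom delta m n" and x: "x \<in> omap X n" for m n \<theta> x
  proof -
    have *: "mid e m \<cdot>\<^bsub>set_cat\<^esub> amap X \<theta> = amap Y \<theta> \<cdot>\<^bsub>set_cat\<^esub> mid e n"
      using nat_trans_eq[OF ea(4), of \<theta> n m] t by simp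
    have "amap X \<theta> \<in> Hom set_cat (omap X n) (omap X m)" using functor_Hom[OF X, of \<theta> n m] t by simp
    from set_cat_comp_mid[OF this x, of "mid e m"] set_cat_comp_mid[OF en x, of "amap Y \<theta>"]
    show ?thesis unfolding * by simp
  qed
  then show "sset_map X Y (\<lambda>n. mid (mid e n))"
    unfolding sset_map_def using Hom_set_cat_mid[OF en] by blast
qed

lemma sset_comp_mid:
  assumes "e \<in> Hom sset_cat X Y" "x \<in> omap X n"
  shows "mid (mid (f \<cdot>\<^bsub>sset_cat\<^esub> e) n) x = mid (mid f n) (mid (mid e n) x)"
proof -
  have en: "mid e n \<in> Hom set_cat (omap X n) (omap Y n)" using nat_trans_Hom[OF fun_cat_arr(4)[OF assms(1)], of n] by simp
  have "mid (f \<cdot>\<^bsub>sset_cat\<^esub> e) n = mid f n \<cdot>\<^bsub>set_cat\<^esub> mid e n" by simp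
  then show ?thesis using set_cat_comp_mid[OF en assms(2), of "mid f n"] by metis
qed

lemma sset_iso_bij:
  assumes "is_iso sset_cat e" "e \<in> Hom sset_cat X Y"
  shows "bij_betw (mid (mid e n)) (omap X n) (omap Y n)"
proof -
  have en: "mid e n \<in> Hom set_cat (omap X n) (omap Y n)" using nat_trans_Hom[OF fun_cat_arr(4)[OF assms(2)], of n] by simp
  show ?thesis
    by (rule iso_set_cat_bij[OF iso_level[OF is_category_set_cat dcat assms] en]) simp
qed

lemma sset_iso_equiv:
  assumes "is_iso sset_cat e" "e \<in> Hom sset_cat X Y"
  shows "e \<in> sset_equivs"
proof -
  have "sset_weq X Y (\<lambda>n. mid (mid e n))"
    using bij_sset_weq[OF sset_arr_map(2,3,1)[OF assms(2)] sset_iso_bij[OF assms]] .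
  then show ?thesis
    using HomD[OF assms(2)] by (simp add: sset_equivs_def)
qed

text \<open>A fibrant replacement of \<open>Y\<close> preceded by \<open>\<kappa>\<close> is one of
  \<open>Y2\<close>, so the homotopy limit is literally the same simplicial set; only the source of
  the canonical map changes, along \<open>h\<close>.\<close>

lemma holim_equiv_iso:
  fixes X :: "'x sset"
  assumes J: "is_category J" and hol: "holim_equiv J X Y c" and Y: "is_functor J sset_cat Y"
    and Y2: "is_functor J sset_cat Y2" and c2: "is_cone J sset_cat Y2 X2 c2"
    and \<kappa>: "nat_trans J sset_cat Y2 Y \<kappa>" and \<kappa>_iso: "\<And>j. j \<in> Ob J \<Longrightarrow> is_iso sset_cat (\<kappa> j)"
    and h: "h \<in> Hom sset_cat X2 X" and h_iso: "is_iso sset_cat h"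
    and sq: "\<And>j. j \<in> Ob J \<Longrightarrow> \<kappa> j \<cdot>\<^bsub>sset_cat\<^esub> c2 j = c j \<cdot>\<^bsub>sset_cat\<^esub> h"
  shows "holim_equiv J X2 Y2 c2"
proof -
  let ?S = "sset_cat :: ('x sset, 'x sset_arr) category"
  have S: "is_category ?S" by (rule simp_cat_category[OF is_category_set_cat])
  obtain Y' q where Y': "is_functor J ?S Y'" and q: "nat_trans J ?S Y Y' q"
    and qw: "\<And>j. j \<in> Ob J \<Longrightarrow> q j \<in> sset_equivs" and kan: "\<And>j. j \<in> Ob J \<Longrightarrow> kan_complex (omap Y' j)"
    and w: "sset_weq X (bk_holim J Y') (bk_coaug J X (\<lambda>j. q j \<cdot>\<^bsub>?S\<^esub> c j))"
    and cone: "is_cone J ?S Y X c"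
    using hol unfolding holim_equiv_def by blast
  have cH: "c j \<in> Hom ?S X (omap Y j)" if "j \<in> Ob J" for j
    using nat_trans_Hom[OF conjunct2[OF cone[unfolded is_cone_def]] that] that by simp
  have c2H: "c2 j \<in> Hom ?S X2 (omap Y2 j)" if "j \<in> Ob J" for j
    using nat_trans_Hom[OF conjunct2[OF c2[unfolded is_cone_def]] that] that by simp
  note hm = sset_arr_map[OF h]
  have "sset_weq X2 (bk_holim J Y') (bk_coaug J X2 (\<lambda>j. (q j \<cdot>\<^bsub>?S\<^esub> \<kappa> j) \<cdot>\<^bsub>?S\<^esub> c2 j))"
  proof (rule sset_weq_comp_bij[OF hm(2,3,1) sset_iso_bij[OF h_iso h] w])
    fix n x assume x: "x \<in> omap X2 n"
    \<comment> \<open>Both canonical maps are given by the same formula, and naturality of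
      \<open>h\<close> lets the action of \<open>\<tau>\<close> pass through it.\<close>
    have "mid (mid ((q j \<cdot>\<^bsub>?S\<^esub> \<kappa> j) \<cdot>\<^bsub>?S\<^esub> c2 j) p) (act X2 \<tau> x) = mid (mid (q j \<cdot>\<^bsub>?S\<^esub> c j) p) (act X \<tau> (mid (mid h n) x))"
      if j: "j \<in> Ob J" and t: "\<tau> \<in> Hom delta p n" for j p \<tau>
    proof -
      have ax: "act X2 \<tau> x \<in> omap X2 p" by (rule act_in[OF hm(2) t x])
      have "(q j \<cdot>\<^bsub>?S\<^esub> \<kappa> j) \<cdot>\<^bsub>?S\<^esub> c2 j = (q j \<cdot>\<^bsub>?S\<^esub> c j) \<cdot>\<^bsub>?S\<^esub> h"
        unfolding Comp_assoc[OF S c2H[OF j] nat_trans_Hom[OF \<kappa> j] nat_trans_Hom[OF q j], symmetric] sq[OF j]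
        by (rule Comp_assoc[OF S h cH[OF j] nat_trans_Hom[OF q j]])
      then have "mid (mid ((q j \<cdot>\<^bsub>?S\<^esub> \<kappa> j) \<cdot>\<^bsub>?S\<^esub> c2 j) p) (act X2 \<tau> x) = mid (mid (q j \<cdot>\<^bsub>?S\<^esub> c j) p) (mid (mid h p) (act X2 \<tau> x))"
        using sset_comp_mid[OF h ax, of "q j \<cdot>\<^bsub>?S\<^esub> c j"] by metis
      also have "mid (mid h p) (act X2 \<tau> x) = act X \<tau> (mid (mid h n) x)"
        using hm(1) t x by (simp add: sset_map_def)
      finally show ?thesis .
    qed
    then show "bk_coaug J X2 (\<lambda>j. (q j \<cdot>\<^bsub>?S\<^esub> \<kappa> j) \<cdot>\<^bsub>?S\<^esub> c2 j) n x = bk_coaug J X (\<lambda>j. q j \<cdot>\<^bsub>?S\<^esub> c j) n (mid (mid h n) x)"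
      unfolding bk_coaug_def
      by (intro restrict_ext ext) (auto simp: sset_times_def mk_sset_simps(1) std_def simp del: fun_cat_simps)
  qed
  moreover have "q j \<cdot>\<^bsub>?S\<^esub> \<kappa> j \<in> sset_equivs" if j: "j \<in> Ob J" for j
  proof -
    note \<kappa>j = nat_trans_Hom[OF \<kappa> j] and qj = nat_trans_Hom[OF q j]
    note km = sset_arr_map[OF \<kappa>j]
    have qe: "sset_weq (omap Y j) (omap Y' j) (\<lambda>n. mid (mid (q j) n))"
      using qw[OF j] HomD[OF qj] by (simp add: sset_equivs_def)
    have "sset_weq (omap Y2 j) (omap Y' j) (\<lambda>n. mid (mid (q j \<cdot>\<^bsub>?S\<^esub> \<kappa> j) n))"
      by (rule sset_weq_comp_bij[OF km(2,3,1) sset_iso_bij[OF \<kappa>_iso[OF j] \<kappa>j] qe sset_comp_mid[OF \<kappa>j]])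
    then show ?thesis
      using HomD[OF Comp_Hom[OF S \<kappa>j qj]] unfolding sset_equivs_def by simp
  qed
  moreover have "nat_trans J ?S Y2 Y' (\<lambda>j. q j \<cdot>\<^bsub>?S\<^esub> \<kappa> j)"
    by (rule nat_trans_comp[OF S J Y2 Y Y' \<kappa> q])
  ultimately show ?thesis
    unfolding holim_equiv_def using c2 Y' kan by blast
qed

text \<open>Naturality along \<open>collapse n\<close> has identities as structure maps on both
  sides, which forces all components to equal the one in degree 0.\<close>

lemma cs_full:
  assumes C: "is_category C" and e: "e \<in> Hom (simp_cat C) (const_fctr (op_cat delta) C A) (const_fctr (op_cat delta) C B)"
  shows "mid e 0 \<in> Hom C A B" "e = amap (cs C) (mid e 0)"
proof -
  note ea = fun_cat_arr[OF e]
  have en: "mid e n \<in> Hom C A B" for n using nat_trans_Hom[OF ea(4), of n] by simp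
  show e0: "mid e 0 \<in> Hom C A B" by (rule en)
  have ob: "A \<in> Ob C" "B \<in> Ob C" using Hom_Ob[OF C e0] by auto
  have "mid e n = mid e 0" for n
    using nat_trans_eq[OF ea(4), of "collapse n" 0 n] collapse_Hom[of n] HomD(1)[OF collapse_Hom[of n]]
      Comp_Ident[OF C en] by simp
  moreover have "amap (cs C) (mid e 0) \<in> Hom (simp_cat C) (const_fctr (op_cat delta) C A) (const_fctr (op_cat delta) C B)"
    using functor_Hom[OF cs_is_functor[OF C] e0] ob by (simp add: cs_omap)
  ultimately show "e = amap (cs C) (mid e 0)"
    by (intro fun_cat_arr_eqI[OF e]) (simp_all add: cs_amap[OF e0])
qed

section \<open>Frames over a trivial model structure\<close>

locale frame =
  fixes C :: "('o, 'm) category" and G :: "('o, 'm, ('o, 'm) sobj, ('o, 'm) sarr) fctr" and j :: "'o \<Rightarrow> ('o, 'm) sarr"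
  assumes C: "is_category C" and frame: "functorial_simplicial_frame (trivial_model C) G j"
begin

lemma G: "is_functor C (simp_cat C) G" and j: "nat_trans C (simp_cat C) (cs C) G j"
  and j_level: "A \<in> Ob C \<Longrightarrow> is_iso C (mid (j A) n)"
  using frame by (auto simp: functorial_simplicial_frame_def reedy_weq_def)

lemma j_Hom: "A \<in> Ob C \<Longrightarrow> j A \<in> Hom (simp_cat C) (const_fctr (op_cat delta) C A) (omap G A)"
  using nat_trans_Hom[OF j] by (simp add: cs_omap)

lemma j_iso: "A \<in> Ob C \<Longrightarrow> is_iso (simp_cat C) (j A)"
  by (rule fun_cat_iso[OF C dcat j_Hom j_level])

lemma j_n: "A \<in> Ob C \<Longrightarrow> mid (j A) n \<in> Hom C A (omap (omap G A) n)"
  using nat_trans_Hom[OF fun_cat_arr(4)[OF j_Hom], of A n] by simp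

lemma j_act:
  assumes A: "A \<in> Ob C" and t: "\<theta> \<in> Hom delta m n"
  shows "amap (omap G A) \<theta> \<cdot>\<^bsub>C\<^esub> mid (j A) n = mid (j A) m"
  using nat_trans_eq[OF fun_cat_arr(4)[OF j_Hom[OF A]], of \<theta> n m] t HomD(1)[OF t] Comp_Ident(1)[OF C j_n[OF A]]
  by simp

lemma j_nat: "f \<in> Hom C A B \<Longrightarrow> j B \<cdot>\<^bsub>simp_cat C\<^esub> amap (cs C) f = amap G f \<cdot>\<^bsub>simp_cat C\<^esub> j A"
  by (rule nat_trans_eq[OF j])

lemma G_Ob: "A \<in> Ob C \<Longrightarrow> is_functor (op_cat delta) C (omap G A)"
  using functor_Ob[OF G] by simp

text \<open>An arrow out of \<open>omap G A\<close> is determined by its composite with the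
  isomorphism \<open>j A\<close>, which is how \<open>G\<close> is compared with
  \<open>cs\<close>.\<close>

lemma G_eqI:
  assumes f0: "f0 \<in> Hom C A B" and f: "f \<in> Hom (simp_cat C) (omap G A) (omap G B)"
    and eq: "f \<cdot>\<^bsub>simp_cat C\<^esub> j A = j B \<cdot>\<^bsub>simp_cat C\<^esub> amap (cs C) f0"
  shows "amap G f0 = f"
proof -
  have A: "A \<in> Ob C" using Hom_Ob[OF C f0] by simp
  show ?thesis
    by (rule iso_cancel_right[OF simp_cat_category[OF C] j_iso[OF A] j_Hom[OF A] functor_Hom[OF G f0] f])
      (simp only: eq j_nat[OF f0])
qed

lemma G_full:
  assumes A: "A \<in> Ob C" and B: "B \<in> Ob C" and f: "f \<in> Hom (simp_cat C) (omap G A) (omap G B)"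
  obtains f0 where "f0 \<in> Hom C A B" "amap G f0 = f"
proof -
  note cat = simp_cat_category[OF C]
  note iB = inv_arr[OF j_iso[OF B] j_Hom[OF B]]
  \<comment> \<open>Conjugating \<open>f\<close> by the frame isomorphisms gives a map between
    constant objects.\<close>
  define e where "e = inv_arr (simp_cat C) (j B) \<cdot>\<^bsub>simp_cat C\<^esub> (f \<cdot>\<^bsub>simp_cat C\<^esub> j A)"
  have fj: "f \<cdot>\<^bsub>simp_cat C\<^esub> j A \<in> Hom (simp_cat C) (const_fctr (op_cat delta) C A) (omap G B)"
    by (rule Comp_Hom[OF cat j_Hom[OF A] f])
  have e: "e \<in> Hom (simp_cat C) (const_fctr (op_cat delta) C A) (const_fctr (op_cat delta) C B)"
    unfolding e_def by (rule Comp_Hom[OF cat fj iB(1)])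
  note full = cs_full[OF C e]
  have eq: "f \<cdot>\<^bsub>simp_cat C\<^esub> j A = j B \<cdot>\<^bsub>simp_cat C\<^esub> amap (cs C) (mid e 0)"
    unfolding full(2)[symmetric] unfolding e_def Comp_assoc[OF cat fj iB(1) j_Hom[OF B]] iB(3) Comp_Ident(2)[OF cat fj] ..
  show ?thesis by (rule that[OF full(1) G_eqI[OF full(1) f eq]])
qed

end

section \<open>Products of frames\<close>

lemma product_ex1:
  assumes "is_product C I A P p" "X \<in> Ob C" "\<And>i. i \<in> I \<Longrightarrow> f i \<in> Hom C X (A i)"
  shows "\<exists>!h. h \<in> Hom C X P \<and> (\<forall>i\<in>I. p i \<cdot>\<^bsub>C\<^esub> h = f i)"
  using assms unfolding is_product_def by simp

lemma product_eqI:
  assumes C: "is_category C" and P: "is_product C I A P p" and h: "h \<in> Hom C X P" "h' \<in> Hom C X P"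
    and eq: "\<And>i. i \<in> I \<Longrightarrow> p i \<cdot>\<^bsub>C\<^esub> h = p i \<cdot>\<^bsub>C\<^esub> h'"
  shows "h = h'"
proof -
  have p: "p i \<in> Hom C P (A i)" if "i \<in> I" for i using P that by (simp add: is_product_def)
  have X: "X \<in> Ob C" using Hom_Ob[OF C h(1)] by simp
  have "\<exists>!g. g \<in> Hom C X P \<and> (\<forall>i\<in>I. p i \<cdot>\<^bsub>C\<^esub> g = p i \<cdot>\<^bsub>C\<^esub> h)"
    by (rule product_ex1[OF P X Comp_Hom[OF C h(1) p]])
  then show ?thesis using h eq by (elim ex1E) (metis (no_types, lifting))
qed

context frame
begin

text \<open>In degree 0 the naturality square of \<open>j\<close> recovers \<open>f\<close> up to
  the isomorphism \<open>mid (j B) 0\<close>.\<close>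

lemma G_faithful:
  assumes f: "f \<in> Hom C A B" and g: "g \<in> Hom C A B" and eq: "amap G f = amap G g"
  shows "f = g"
proof -
  have B: "B \<in> Ob C" using Hom_Ob[OF C f] by simp
  have "mid (j B \<cdot>\<^bsub>simp_cat C\<^esub> amap (cs C) f) 0 = mid (j B \<cdot>\<^bsub>simp_cat C\<^esub> amap (cs C) g) 0"
    unfolding j_nat[OF f] j_nat[OF g] eq ..
  then have "mid (j B) 0 \<cdot>\<^bsub>C\<^esub> f = mid (j B) 0 \<cdot>\<^bsub>C\<^esub> g" by (simp add: cs_amap[OF f] cs_amap[OF g])
  then show ?thesis by (rule iso_cancel_left[OF C j_level[OF B] j_n[OF B] f g])
qed

text \<open>Since \<open>0\<close> is terminal in the simplex category, maps from a constant object to \<open>P\<close> are maps to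
  \<open>P\<^sub>0\<close>; so \<open>P\<^sub>0\<close> is a product in \<open>C\<close> whenever \<open>P\<close> is a product of frames, and the constant object
  on \<open>P\<^sub>0\<close> is isomorphic to \<open>P\<close>.\<close>

lemma product_of_frames:
  assumes A: "\<And>i. i \<in> I \<Longrightarrow> A i \<in> Ob C" and prod: "is_product (simp_cat C) I (\<lambda>i. omap G (A i)) P p"
  obtains Q p0 \<theta> where "is_product C I A Q p0" "\<theta> \<in> Hom (simp_cat C) (omap G Q) P" "is_iso (simp_cat C) \<theta>"
    "\<And>i. i \<in> I \<Longrightarrow> p i \<cdot>\<^bsub>simp_cat C\<^esub> \<theta> = amap G (p0 i)"
proof -
  note cat = simp_cat_category[OF C]
  let ?K = "const_fctr (op_cat delta) C"
  have P: "is_functor (op_cat delta) C P" using prod by (simp add: is_product_def)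
  have p: "p i \<in> Hom (simp_cat C) P (omap G (A i))" if "i \<in> I" for i
    using prod that by (simp add: is_product_def)
  have pn: "mid (p i) n \<in> Hom C (omap P n) (omap (omap G (A i)) n)" if "i \<in> I" for i n
    using nat_trans_Hom[OF fun_cat_arr(4)[OF p[OF that]], of n] by simp
  have pnat: "mid (p i) m \<cdot>\<^bsub>C\<^esub> amap P \<theta> = amap (omap G (A i)) \<theta> \<cdot>\<^bsub>C\<^esub> mid (p i) n"
    if "i \<in> I" "\<theta> \<in> Hom delta m n" for i m n \<theta>
    using nat_trans_eq[OF fun_cat_arr(4)[OF p[OF that(1)]], of \<theta> n m] that(2) by simp
  have PH: "amap P \<theta> \<in> Hom C (omap P n) (omap P m)" if "\<theta> \<in> Hom delta m n" for m n \<theta>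
    using functor_Hom[OF P, of \<theta> n m] that by simp
  have Pc: "amap P (\<theta> \<cdot>\<^bsub>delta\<^esub> \<phi>) = amap P \<phi> \<cdot>\<^bsub>C\<^esub> amap P \<theta>" if "\<theta> \<in> Hom delta m n" "\<phi> \<in> Hom delta l m" for l m n \<theta> \<phi>
    using functor_comp[OF P, of \<theta> n m \<phi> l] that by simp
  have GH: "amap (omap G (A i)) \<theta> \<in> Hom C (omap (omap G (A i)) n) (omap (omap G (A i)) m)" if "i \<in> I" "\<theta> \<in> Hom delta m n" for i m n \<theta>
    using functor_Hom[OF G_Ob[OF A[OF that(1)]], of \<theta> n m] that(2) by simp
  \<comment> \<open>\<open>col\<close> is the total degeneracy out of degree 0, and
    \<open>ver\<close> the restriction to a vertex.\<close>
  define col where "col n = amap P (collapse n)" for n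
  define ver where "ver n v = amap P (vertex n v)" for n v
  have col: "col n \<in> Hom C (omap P 0) (omap P n)" for n unfolding col_def by (rule PH[OF collapse_Hom])
  have ver: "ver n v \<in> Hom C (omap P n) (omap P 0)" if "v \<le> n" for n v unfolding ver_def by (rule PH[OF vertex_Hom[OF that]])
  have P0: "omap P 0 \<in> Ob C" using functor_Ob[OF P, of 0] by simp
  have Pid: "amap P (Ident delta n) = Ident C (omap P n)" for n
    using functor_Ident[OF P, of n] by simp
  have col0: "col 0 = Ident C (omap P 0)" unfolding col_def collapse_0 by (rule Pid)
  have vercol: "ver n 0 \<cdot>\<^bsub>C\<^esub> col n = Ident C (omap P 0)" for n
    unfolding ver_def col_def Pc[OF collapse_Hom vertex_Hom[OF le0], symmetric]
      delta_collapse_comp[OF vertex_Hom[OF le0]] collapse_0 by (rule Pid)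
  \<comment> \<open>The projection in degree 0, corrected by the frame isomorphism so that its
    target is \<open>A i\<close> itself.\<close>
  define p0 where "p0 i = inv_arr C (mid (j (A i)) 0) \<cdot>\<^bsub>C\<^esub> mid (p i) 0" for i
  note ji = inv_arr[OF j_level[OF A] j_n[OF A]]
  have p0: "p0 i \<in> Hom C (omap P 0) (A i)" if "i \<in> I" for i
    unfolding p0_def by (rule Comp_Hom[OF C pn ji(1)]) (rule that)+
  have jp0: "mid (j (A i)) 0 \<cdot>\<^bsub>C\<^esub> p0 i = mid (p i) 0" if i: "i \<in> I" for i
    unfolding p0_def Comp_assoc[OF C pn[OF i] ji(1)[OF i i] j_n[OF A[OF i]]] ji(3)[OF i i] by (rule Comp_Ident(2)[OF C pn[OF i]])
  have pcol: "mid (p i) n \<cdot>\<^bsub>C\<^esub> col n = mid (j (A i)) n \<cdot>\<^bsub>C\<^esub> p0 i" if i: "i \<in> I" for i n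
    unfolding col_def pnat[OF i collapse_Hom] jp0[OF i, symmetric]
      Comp_assoc[OF C p0[OF i] j_n[OF A[OF i]] GH[OF i collapse_Hom]] j_act[OF A[OF i] collapse_Hom] ..
  \<comment> \<open>Restricting to any vertex loses nothing of the projection in degree
    \<open>n\<close>, since the factor is constant up to isomorphism.\<close>
  have p0ver: "mid (j (A i)) n \<cdot>\<^bsub>C\<^esub> (p0 i \<cdot>\<^bsub>C\<^esub> ver n v) = mid (p i) n" if i: "i \<in> I" and v: "v \<le> n" for i n v
  proof -
    note V = vertex_Hom[OF v]
    note jn = j_n[OF A[OF i]] and jin = ji[OF i i]
    have e: "inv_arr C (mid (j (A i)) n) \<cdot>\<^bsub>C\<^esub> mid (p i) n \<in> Hom C (omap P n) (A i)"
      by (rule Comp_Hom[OF C pn[OF i] jin(1)])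
    have je: "mid (j (A i)) n \<cdot>\<^bsub>C\<^esub> (inv_arr C (mid (j (A i)) n) \<cdot>\<^bsub>C\<^esub> mid (p i) n) = mid (p i) n"
      unfolding Comp_assoc[OF C pn[OF i] jin(1) jn] jin(3) by (rule Comp_Ident(2)[OF C pn[OF i]])
    have "mid (j (A i)) 0 \<cdot>\<^bsub>C\<^esub> (p0 i \<cdot>\<^bsub>C\<^esub> ver n v) = amap (omap G (A i)) (vertex n v) \<cdot>\<^bsub>C\<^esub> mid (p i) n"
      unfolding Comp_assoc[OF C ver[OF v] p0[OF i] jn] jp0[OF i] unfolding ver_def by (rule pnat[OF i V])
    also have "\<dots> = amap (omap G (A i)) (vertex n v) \<cdot>\<^bsub>C\<^esub> (mid (j (A i)) n \<cdot>\<^bsub>C\<^esub> (inv_arr C (mid (j (A i)) n) \<cdot>\<^bsub>C\<^esub> mid (p i) n))"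
      unfolding je ..
    also have "\<dots> = mid (j (A i)) 0 \<cdot>\<^bsub>C\<^esub> (inv_arr C (mid (j (A i)) n) \<cdot>\<^bsub>C\<^esub> mid (p i) n)"
      unfolding Comp_assoc[OF C e jn GH[OF i V]] j_act[OF A[OF i] V] ..
    finally have "p0 i \<cdot>\<^bsub>C\<^esub> ver n v = inv_arr C (mid (j (A i)) n) \<cdot>\<^bsub>C\<^esub> mid (p i) n"
      by (rule iso_cancel_left[OF C j_level[OF A[OF i]] jn Comp_Hom[OF C ver[OF v] p0[OF i]] e])
    then show ?thesis using je by simp
  qed
  \<comment> \<open>A map into degree 0 of \<open>P\<close> extends by degeneracies to a map out of
    the constant object.\<close>
  define ext where "ext X h = (?K X, \<lambda>n. col n \<cdot>\<^bsub>C\<^esub> h, P)" for X h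
  have ext: "ext X h \<in> Hom (simp_cat C) (?K X) P" if h: "h \<in> Hom C X (omap P 0)" for X h
  proof -
    have X: "X \<in> Ob C" using Hom_Ob[OF C h] by simp
    note ch = Comp_Hom[OF C h col]
    have "(col m \<cdot>\<^bsub>C\<^esub> h) \<cdot>\<^bsub>C\<^esub> Ident C X = amap P \<theta> \<cdot>\<^bsub>C\<^esub> (col n \<cdot>\<^bsub>C\<^esub> h)" if t: "\<theta> \<in> Hom delta m n" for m n \<theta>
      unfolding Comp_Ident(1)[OF C ch] Comp_assoc[OF C h col PH[OF t]]
      unfolding col_def Pc[OF collapse_Hom t, symmetric] delta_collapse_comp[OF t] ..
    then show ?thesis
      using ch const_fctr_is_functor[OF dcat C X] P HomD(1)[of _ delta]
      by (simp add: ext_def Hom_fun_cat nat_trans_def extensional_def)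
  qed
  have pext: "p i \<cdot>\<^bsub>simp_cat C\<^esub> ext X h = j (A i) \<cdot>\<^bsub>simp_cat C\<^esub> amap (cs C) (p0 i \<cdot>\<^bsub>C\<^esub> h)"
    if i: "i \<in> I" and h: "h \<in> Hom C X (omap P 0)" for i X h
  proof (rule fun_cat_arr_eqI[OF Comp_Hom[OF cat ext[OF h] p[OF i]]])
    have X: "X \<in> Ob C" using Hom_Ob[OF C h] by simp
    note ph = Comp_Hom[OF C h p0[OF i]]
    have "amap (cs C) (p0 i \<cdot>\<^bsub>C\<^esub> h) \<in> Hom (simp_cat C) (?K X) (?K (A i))"
      using functor_Hom[OF cs_is_functor[OF C] ph] X A[OF i] by (simp add: cs_omap)
    then show "j (A i) \<cdot>\<^bsub>simp_cat C\<^esub> amap (cs C) (p0 i \<cdot>\<^bsub>C\<^esub> h) \<in> Hom (simp_cat C) (?K X) (omap G (A i))"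
      by (rule Comp_Hom[OF cat _ j_Hom[OF A[OF i]]])
    fix n :: nat
    have "mid (p i) n \<cdot>\<^bsub>C\<^esub> (col n \<cdot>\<^bsub>C\<^esub> h) = mid (j (A i)) n \<cdot>\<^bsub>C\<^esub> (p0 i \<cdot>\<^bsub>C\<^esub> h)"
      unfolding Comp_assoc[OF C h col pn[OF i]] pcol[OF i] Comp_assoc[OF C h p0[OF i] j_n[OF A[OF i]]] ..
    then show "mid (p i \<cdot>\<^bsub>simp_cat C\<^esub> ext X h) n = mid (j (A i) \<cdot>\<^bsub>simp_cat C\<^esub> amap (cs C) (p0 i \<cdot>\<^bsub>C\<^esub> h)) n"
      by (simp add: ext_def cs_amap[OF ph])
  qed
  have prod0: "is_product C I A (omap P 0) p0"
    unfolding is_product_def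
  proof (intro conjI ballI allI impI P0 p0)
    fix X f assume X: "X \<in> Ob C" and f: "\<forall>i\<in>I. f i \<in> Hom C X (A i)"
    have fi: "f i \<in> Hom C X (A i)" if "i \<in> I" for i using f that by blast
    have KX: "?K X \<in> Ob (simp_cat C)" using const_fctr_is_functor[OF dcat C X] by simp
    have jf: "j (A i) \<cdot>\<^bsub>simp_cat C\<^esub> amap (cs C) (f i) \<in> Hom (simp_cat C) (?K X) (omap G (A i))" if i: "i \<in> I" for i
      using Comp_Hom[OF cat functor_Hom[OF cs_is_functor[OF C] fi[OF i]]] j_Hom[OF A[OF i]] X A[OF i] by (simp only: cs_omap)
    have "\<exists>!h. h \<in> Hom (simp_cat C) (?K X) P \<and> (\<forall>i\<in>I. p i \<cdot>\<^bsub>simp_cat C\<^esub> h = j (A i) \<cdot>\<^bsub>simp_cat C\<^esub> amap (cs C) (f i))"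
      by (rule product_ex1[OF prod KX jf])
    then obtain h where h: "h \<in> Hom (simp_cat C) (?K X) P"
      and hp: "\<And>i. i \<in> I \<Longrightarrow> p i \<cdot>\<^bsub>simp_cat C\<^esub> h = j (A i) \<cdot>\<^bsub>simp_cat C\<^esub> amap (cs C) (f i)"
      by (elim ex1E) blast
    have h0: "mid h 0 \<in> Hom C X (omap P 0)" using nat_trans_Hom[OF fun_cat_arr(4)[OF h], of 0] by simp
    show "\<exists>!h. h \<in> Hom C X (omap P 0) \<and> (\<forall>i\<in>I. p0 i \<cdot>\<^bsub>C\<^esub> h = f i)"
    proof (rule ex1I[of _ "mid h 0"], intro conjI h0 ballI)
      fix i assume i: "i \<in> I"
      have "mid (p i \<cdot>\<^bsub>simp_cat C\<^esub> h) 0 = mid (j (A i) \<cdot>\<^bsub>simp_cat C\<^esub> amap (cs C) (f i)) 0" unfolding hp[OF i] ..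
      then have "mid (j (A i)) 0 \<cdot>\<^bsub>C\<^esub> (p0 i \<cdot>\<^bsub>C\<^esub> mid h 0) = mid (j (A i)) 0 \<cdot>\<^bsub>C\<^esub> f i"
        unfolding Comp_assoc[OF C h0 p0[OF i] j_n[OF A[OF i]]] jp0[OF i] by (simp add: cs_amap[OF fi[OF i]])
      then show "p0 i \<cdot>\<^bsub>C\<^esub> mid h 0 = f i"
        by (rule iso_cancel_left[OF C j_level[OF A[OF i]] j_n[OF A[OF i]] Comp_Hom[OF C h0 p0[OF i]] fi[OF i]])
    next
      fix h' assume h': "h' \<in> Hom C X (omap P 0) \<and> (\<forall>i\<in>I. p0 i \<cdot>\<^bsub>C\<^esub> h' = f i)"
      then have "ext X h' = h"
        by (intro product_eqI[OF cat prod ext h]) (simp_all only: pext hp)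
      then have "mid (ext X h') 0 = mid h 0" by simp
      then show "h' = mid h 0"
        using Comp_Ident(2)[OF C conjunct1[OF h']] by (simp add: ext_def col0)
    qed
  qed
  \<comment> \<open>The projections \<open>p0\<close> are jointly monic and do not see which vertex
    was taken.\<close>
  have ver_eq: "ver n v = ver n 0" if v: "v \<le> n" for n v
  proof (rule product_eqI[OF C prod0 ver[OF v] ver[OF le0]])
    fix i assume i: "i \<in> I"
    show "p0 i \<cdot>\<^bsub>C\<^esub> ver n v = p0 i \<cdot>\<^bsub>C\<^esub> ver n 0"
      by (rule iso_cancel_left[OF C j_level[OF A[OF i], of n] j_n[OF A[OF i]] Comp_Hom[OF C ver[OF v] p0[OF i]] Comp_Hom[OF C ver[OF le0] p0[OF i]]])
        (simp only: p0ver[OF i v] p0ver[OF i le0])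
  qed
  define \<kappa> where "\<kappa> = ext (omap P 0) (Ident C (omap P 0))"
  have id0: "Ident C (omap P 0) \<in> Hom C (omap P 0) (omap P 0)" by (rule Ident_Hom[OF C P0])
  have \<kappa>: "\<kappa> \<in> Hom (simp_cat C) (?K (omap P 0)) P" unfolding \<kappa>_def by (rule ext[OF id0])
  have \<kappa>n: "mid \<kappa> n = col n" for n using Comp_Ident(1)[OF C col] by (simp add: \<kappa>_def ext_def)
  \<comment> \<open>The candidate inverse of \<open>\<kappa>\<close>; it is natural because all
    vertex maps of a degree agree.\<close>
  define w where "w = (P, \<lambda>n. ver n 0, ?K (omap P 0))"
  have w: "w \<in> Hom (simp_cat C) P (?K (omap P 0))"
  proof -
    have "ver m 0 \<cdot>\<^bsub>C\<^esub> amap P \<theta> = Ident C (omap P 0) \<cdot>\<^bsub>C\<^esub> ver n 0" if t: "\<theta> \<in> Hom delta m n" for m n \<theta>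
    proof -
      have le: "mid \<theta> 0 \<le> n" using t by (auto simp: delta_Hom_iff)
      have "ver m 0 \<cdot>\<^bsub>C\<^esub> amap P \<theta> = ver n (mid \<theta> 0)"
        unfolding ver_def Pc[OF t vertex_Hom[OF le0], symmetric] delta_comp_vertex[OF t le0] ..
      then show ?thesis unfolding Comp_Ident(2)[OF C ver[OF le0]] using ver_eq[OF le] by simp
    qed
    then show ?thesis
      using ver[OF le0] const_fctr_is_functor[OF dcat C P0] P HomD(1)[of _ delta]
      by (simp add: w_def Hom_fun_cat nat_trans_def extensional_def)
  qed
  have idP: "Ident (simp_cat C) P \<in> Hom (simp_cat C) P P" by (rule Ident_Hom[OF cat]) (simp add: P)
  \<comment> \<open>The composite on the side of \<open>P\<close> is compared with the identity
    after each projection, by uniqueness for the product \<open>P\<close>.\<close>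
  have "\<kappa> \<cdot>\<^bsub>simp_cat C\<^esub> w = Ident (simp_cat C) P"
  proof (rule product_eqI[OF cat prod Comp_Hom[OF cat w \<kappa>] idP])
    fix i assume i: "i \<in> I"
    have "p i \<cdot>\<^bsub>simp_cat C\<^esub> (\<kappa> \<cdot>\<^bsub>simp_cat C\<^esub> w) = p i"
    proof (rule fun_cat_arr_eqI[OF Comp_Hom[OF cat Comp_Hom[OF cat w \<kappa>] p[OF i]] p[OF i]])
      fix n :: nat
      have "mid (p i) n \<cdot>\<^bsub>C\<^esub> (col n \<cdot>\<^bsub>C\<^esub> ver n 0) = mid (p i) n"
        unfolding Comp_assoc[OF C ver[OF le0] col pn[OF i]] pcol[OF i]
          Comp_assoc[OF C ver[OF le0] p0[OF i] j_n[OF A[OF i]], symmetric] by (rule p0ver[OF i le0])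
      then show "mid (p i \<cdot>\<^bsub>simp_cat C\<^esub> (\<kappa> \<cdot>\<^bsub>simp_cat C\<^esub> w)) n = mid (p i) n"
        by (simp add: \<kappa>n) (simp add: w_def)
    qed
    then show "p i \<cdot>\<^bsub>simp_cat C\<^esub> (\<kappa> \<cdot>\<^bsub>simp_cat C\<^esub> w) = p i \<cdot>\<^bsub>simp_cat C\<^esub> Ident (simp_cat C) P"
      unfolding Comp_Ident(1)[OF cat p[OF i]] .
  qed
  then have colver: "col n \<cdot>\<^bsub>C\<^esub> ver n 0 = Ident C (omap P n)" for n
  proof -
    assume "\<kappa> \<cdot>\<^bsub>simp_cat C\<^esub> w = Ident (simp_cat C) P"
    then have "mid (\<kappa> \<cdot>\<^bsub>simp_cat C\<^esub> w) n = mid (Ident (simp_cat C) P) n" by simp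
    then show ?thesis by (simp add: \<kappa>n) (simp add: w_def)
  qed
  have \<kappa>_iso: "is_iso (simp_cat C) \<kappa>"
    by (rule fun_cat_iso[OF C dcat \<kappa>]) (simp only: \<kappa>n isoI[OF col ver[OF le0] vercol colver])
  note jQ = inv_arr[OF j_iso[OF P0] j_Hom[OF P0]]
  \<comment> \<open>Replaces the constant object on \<open>omap P 0\<close> by its frame, through
    the inverse of \<open>j\<close>.\<close>
  define \<theta> where "\<theta> = \<kappa> \<cdot>\<^bsub>simp_cat C\<^esub> inv_arr (simp_cat C) (j (omap P 0))"
  have \<theta>: "\<theta> \<in> Hom (simp_cat C) (omap G (omap P 0)) P" unfolding \<theta>_def by (rule Comp_Hom[OF cat jQ(1) \<kappa>])
  have \<theta>_iso: "is_iso (simp_cat C) \<theta>"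
    unfolding \<theta>_def by (rule is_iso_comp[OF cat inv_arr_iso[OF j_iso[OF P0] j_Hom[OF P0]] jQ(1) \<kappa>_iso \<kappa>])
  have \<theta>j: "\<theta> \<cdot>\<^bsub>simp_cat C\<^esub> j (omap P 0) = \<kappa>"
    unfolding \<theta>_def Comp_assoc[OF cat j_Hom[OF P0] jQ(1) \<kappa>, symmetric] jQ(2) by (rule Comp_Ident(1)[OF cat \<kappa>])
  have "p i \<cdot>\<^bsub>simp_cat C\<^esub> \<theta> = amap G (p0 i)" if i: "i \<in> I" for i
  proof (rule G_eqI[OF p0[OF i] Comp_Hom[OF cat \<theta> p[OF i]], symmetric])
    show "(p i \<cdot>\<^bsub>simp_cat C\<^esub> \<theta>) \<cdot>\<^bsub>simp_cat C\<^esub> j (omap P 0) = j (A i) \<cdot>\<^bsub>simp_cat C\<^esub> amap (cs C) (p0 i)"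
      unfolding Comp_assoc[OF cat j_Hom[OF P0] \<theta> p[OF i], symmetric] \<theta>j
      unfolding \<kappa>_def pext[OF i id0] Comp_Ident(1)[OF C p0[OF i]] ..
  qed
  then show ?thesis by (rule that[OF prod0 \<theta> \<theta>_iso])
qed

end

section \<open>Constant simplicial sets and their products\<close>

lemma discrete_ssetI:
  assumes X: "is_sset X" and f: "\<And>n. f n ` S = omap X n"
    and act: "\<And>n x. x \<in> S \<Longrightarrow> act X (collapse n) (f 0 x) = f n x"
  shows "discrete_sset X"
  unfolding discrete_sset_def
proof (intro conjI allI ballI X)
  fix n x assume "x \<in> omap X n"
  then obtain y where y: "y \<in> S" "x = f n y" using f by blast
  then show "\<exists>y\<in>omap X 0. x = act X (collapse n) y" using act[OF y(1), of n] f[of 0] by (intro bexI[of _ "f 0 y"]) auto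
qed

lemma const_sset: "is_sset (const_fctr (op_cat delta) set_cat S)"
  by (rule const_fctr_is_functor[OF dcat is_category_set_cat]) simp

lemma const_act: "\<theta> \<in> Hom delta m n \<Longrightarrow> x \<in> S \<Longrightarrow> act (const_fctr (op_cat delta) set_cat S) \<theta> x = x"
  using HomD(1)[of \<theta> delta m n] by simp

lemma discrete_const: "discrete_sset (const_fctr (op_cat delta) set_cat S)"
  by (rule discrete_ssetI[OF const_sset, of "\<lambda>_ x. x" S]) (simp_all add: const_act[OF collapse_Hom])

lemma sset_prod_sset:
  assumes "\<And>i. i \<in> I \<Longrightarrow> is_sset (Y i)"
  shows "is_sset (sset_prod I Y)"
  unfolding sset_prod_def
proof (rule mk_sset_is_sset)
  fix m n \<theta> x assume "\<theta> \<in> Hom delta m n" "x \<in> (\<Pi>\<^sub>E i\<in>I. omap (Y i) n)"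
  then show "(\<lambda>i\<in>I. act (Y i) \<theta> (x i)) \<in> (\<Pi>\<^sub>E i\<in>I. omap (Y i) m)"
    using act_in[OF assms] by (simp add: PiE_iff)
next
  fix n x assume "x \<in> (\<Pi>\<^sub>E i\<in>I. omap (Y i) n)"
  then show "(\<lambda>i\<in>I. act (Y i) (Ident delta n) (x i)) = x"
    using act_Ident[OF assms] by (intro extensionalityI[of _ I]) (auto simp: PiE_iff)
next
  fix l m n \<theta> \<phi> x assume "\<theta> \<in> Hom delta m n" "\<phi> \<in> Hom delta l m" "x \<in> (\<Pi>\<^sub>E i\<in>I. omap (Y i) n)"
  then show "(\<lambda>i\<in>I. act (Y i) (\<theta> \<cdot>\<^bsub>delta\<^esub> \<phi>) (x i)) = (\<lambda>i\<in>I. act (Y i) \<phi> ((\<lambda>i\<in>I. act (Y i) \<theta> (x i)) i))"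
    using act_comp[OF assms] by (intro restrict_ext) (auto simp: PiE_iff)
qed

lemma discrete_sset_prod_const: "discrete_sset (sset_prod I (\<lambda>i. const_fctr (op_cat delta) set_cat (S i)))"
proof (rule discrete_ssetI[OF sset_prod_sset[OF const_sset], of "\<lambda>_ x. x" "\<Pi>\<^sub>E i\<in>I. S i"])
  fix n x assume x: "x \<in> (\<Pi>\<^sub>E i\<in>I. S i)"
  then have "act (sset_prod I (\<lambda>i. const_fctr (op_cat delta) set_cat (S i))) (collapse n) x =
      (\<lambda>i\<in>I. act (const_fctr (op_cat delta) set_cat (S i)) (collapse n) (x i))"
    unfolding sset_prod_def by (subst mk_sset_simps(2)[OF collapse_Hom]) simp_all
  also have "\<dots> = x" using x by (intro extensionalityI[of _ I]) (auto simp: PiE_iff const_act[OF collapse_Hom])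
  finally show "act (sset_prod I (\<lambda>i. const_fctr (op_cat delta) set_cat (S i))) (collapse n) x = x" .
qed (simp add: sset_prod_def mk_sset_simps(1))

lemma bij_betw_PiE:
  assumes "\<And>i. i \<in> I \<Longrightarrow> bij_betw (g i) (S i) (T i)"
  shows "bij_betw (\<lambda>x. \<lambda>i\<in>I. g i (x i)) (\<Pi>\<^sub>E i\<in>I. S i) (\<Pi>\<^sub>E i\<in>I. T i)"
proof (rule bij_betw_byWitness[where f' = "\<lambda>y. \<lambda>i\<in>I. inv_into (S i) (g i) (y i)"])
  show "\<forall>x\<in>\<Pi>\<^sub>E i\<in>I. S i. (\<lambda>i\<in>I. inv_into (S i) (g i) ((\<lambda>i\<in>I. g i (x i)) i)) = x"
    using bij_betw_inv_into_left[OF assms] by (auto intro!: extensionalityI[of _ I] simp: PiE_iff)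
  show "\<forall>y\<in>\<Pi>\<^sub>E i\<in>I. T i. (\<lambda>i\<in>I. g i ((\<lambda>i\<in>I. inv_into (S i) (g i) (y i)) i)) = y"
    using bij_betw_inv_into_right[OF assms] by (auto intro!: extensionalityI[of _ I] simp: PiE_iff)
  show "(\<lambda>x. \<lambda>i\<in>I. g i (x i)) ` (\<Pi>\<^sub>E i\<in>I. S i) \<subseteq> (\<Pi>\<^sub>E i\<in>I. T i)"
    using bij_betwE[OF assms] by (auto simp: PiE_iff)
  show "(\<lambda>y. \<lambda>i\<in>I. inv_into (S i) (g i) (y i)) ` (\<Pi>\<^sub>E i\<in>I. T i) \<subseteq> (\<Pi>\<^sub>E i\<in>I. S i)"
    using bij_betwE[OF bij_betw_inv_into[OF assms]] by (auto simp: PiE_iff)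
qed

section \<open>Frames on algebras and on sets linked by a sheaf\<close>

locale frame_square =
  s: frame "calg_cat k" s j + s': frame set_cat s' j'
  for k :: "'u::infinite ring" and s j and s' :: "('v set, 'v set_arr, 'v sset, 'v sset_arr) fctr" and j' +
  fixes Sh :: "('u calg, 'u calg_arr, 'v set, 'v set_arr) fctr"
    and dSt :: "('u scalg, 'u scalg_arr, 'v sset, 'v sset_arr) fctr"
  assumes Sh: "is_sheaf k Sh" and dSt: "is_functor (simp_cat (calg_cat k)) sset_cat dSt"
    and square: "fctr_comp (calg_cat k) dSt s = fctr_comp (calg_cat k) s' Sh"
begin

abbreviation C :: "('u calg, 'u calg_arr) category" where "C \<equiv> calg_cat k"

lemma C: "is_category C" by (rule is_category_calg)
lemma S: "is_category sset_cat" by (rule simp_cat_category[OF is_category_set_cat])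

lemma Sh_functor: "is_functor C set_cat Sh"
  using Sh by (simp add: is_sheaf_def)

lemma square_Ob: "A \<in> Ob C \<Longrightarrow> omap dSt (omap s A) = omap s' (omap Sh A)"
  using arg_cong[OF square, of "\<lambda>F. omap F A"] by simp

lemma square_Hom: "f \<in> Hom C A B \<Longrightarrow> amap dSt (amap s f) = amap s' (amap Sh f)"
  using arg_cong[OF square, of "\<lambda>F. amap F f"] HomD(1)[of f C A B] by simp

text \<open>The frame isomorphism parametrizes every degree by \<open>carrier A\<close>, compatibly
  with degeneracies.\<close>

lemma discrete_underlying:
  assumes A: "A \<in> Ob C"
  shows "discrete_sset (underlying (omap s A))"
proof -
  interpret sA: simp_calg k "omap s A" by (rule simp_calg.intro[OF s.G_Ob[OF A]])
  show ?thesis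
  proof (rule discrete_ssetI[OF sA.underlying_sset, of "\<lambda>n. mid (mid (j A) n)" "carrier A"])
    show im: "mid (mid (j A) n) ` carrier A = omap (underlying (omap s A)) n" for n
      using calg_iso_bij[OF s.j_level[OF A] s.j_n[OF A], of n] by (simp add: bij_betw_def)
    fix n x assume x: "x \<in> carrier A"
    have "act (underlying (omap s A)) (collapse n) (mid (mid (j A) 0) x) = sA.sact (collapse n) (mid (mid (j A) 0) x)"
      by (rule sA.underlying_act[OF collapse_Hom calg_mid(2)[OF s.j_n[OF A] x]])
    also have "\<dots> = mid (amap (omap s A) (collapse n) \<cdot>\<^bsub>C\<^esub> mid (j A) 0) x"
      by (rule calg_comp_mid[OF s.j_n[OF A] x, symmetric])
    also have "\<dots> = mid (mid (j A) n) x" unfolding s.j_act[OF A collapse_Hom] ..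
    finally show "act (underlying (omap s A)) (collapse n) (mid (mid (j A) 0) x) = mid (mid (j A) n) x" .
  qed
qed

lemma dSt_equivalence:
  assumes A: "A \<in> Ob C" and B: "B \<in> Ob C" and f: "f \<in> Hom (simp_cat C) (omap s A) (omap s B)" and w: "f \<in> scalg_equivs k"
  shows "amap dSt f \<in> sset_equivs"
proof -
  have "sset_weq (underlying (omap s A)) (underlying (omap s B)) (\<lambda>n. mid (mid f n))"
    using w HomD(2,3)[OF f] by (simp add: scalg_equivs_def)
  then have "bij_betw (mid (mid f n)) (carrier (omap (omap s A) n)) (carrier (omap (omap s B) n))" for n
    using discrete_sset_weq_bij[OF discrete_underlying[OF A] discrete_underlying[OF B], of _ n]
    by (simp add: underlying_def)
  then have "is_iso C (mid f n)" for n by (rule calg_bij_iso[OF scalg_arr(5)[OF f]])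
  then have "is_iso (simp_cat C) f" by (intro fun_cat_iso[OF C dcat f])
  then show ?thesis
    by (rule sset_iso_equiv[OF functor_iso[OF simp_cat_category[OF C] dSt] functor_Hom[OF dSt f]])
qed

text \<open>The functor in terms of which \<open>is_sheaf\<close> states its conditions: sets viewed
  as constant simplicial sets.\<close>

abbreviation cSh :: "('u calg, 'u calg_arr, 'v sset, 'v sset_arr) fctr" where
  "cSh \<equiv> fctr_comp C (cs set_cat) Sh"

lemma cSh: "is_functor C sset_cat cSh"
  by (rule fctr_comp_is_functor[OF C Sh_functor cs_is_functor[OF is_category_set_cat]])

lemma cSh_omap: "A \<in> Ob C \<Longrightarrow> omap cSh A = const_fctr (op_cat delta) set_cat (omap Sh A)"
  by (simp add: cs_omap)

lemma cSh_amap: "f \<in> Hom C A B \<Longrightarrow> amap cSh f = amap (cs set_cat) (amap Sh f)"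
  using HomD(1) by fastforce

lemma cSh_mid: "f \<in> Hom C A B \<Longrightarrow> mid (amap cSh f) n = amap Sh f"
  using cs_amap[OF functor_Hom[OF Sh_functor]] by (simp add: cSh_amap)

text \<open>The commutative square identifies the target of \<open>j'\<close> with
  \<open>dSt\<close> after \<open>s\<close>, so \<open>j'\<close> is a natural isomorphism along
  which the sheaf conditions on \<open>Sh\<close> reach \<open>dSt\<close>.\<close>

lemma j'_nat: "f \<in> Hom C A B \<Longrightarrow> j' (omap Sh B) \<cdot>\<^bsub>sset_cat\<^esub> amap cSh f = amap dSt (amap s f) \<cdot>\<^bsub>sset_cat\<^esub> j' (omap Sh A)"
  using s'.j_nat[OF functor_Hom[OF Sh_functor]] by (simp only: square_Hom cSh_amap)

lemma j'_Hom: "A \<in> Ob C \<Longrightarrow> j' (omap Sh A) \<in> Hom sset_cat (omap cSh A) (omap dSt (omap s A))"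
  using s'.j_Hom[of "omap Sh A"] by (simp only: square_Ob cSh_omap set_cat_simps UNIV_I)

lemma j'_iso: "is_iso sset_cat (j' (omap Sh A))"
  by (rule s'.j_iso) simp

lemma dSt_product:
  fixes I :: "nat set"
  assumes I: "finite I" and A: "\<And>i. i \<in> I \<Longrightarrow> A i \<in> Ob C"
    and prod: "is_product (simp_cat C) I (\<lambda>i. omap s (A i)) P p"
  shows "prod_equiv I (omap dSt P) (\<lambda>i. omap dSt (omap s (A i))) (\<lambda>i. amap dSt (p i))"
proof -
  note cat = simp_cat_category[OF C]
  obtain Q p0 \<theta> where Q: "is_product C I A Q p0" and \<theta>: "\<theta> \<in> Hom (simp_cat C) (omap s Q) P"
    and \<theta>_iso: "is_iso (simp_cat C) \<theta>" and p\<theta>: "\<And>i. i \<in> I \<Longrightarrow> p i \<cdot>\<^bsub>simp_cat C\<^esub> \<theta> = amap s (p0 i)"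
    using s.product_of_frames[OF A prod] by blast
  have p0: "p0 i \<in> Hom C Q (A i)" if "i \<in> I" for i using Q that by (simp add: is_product_def)
  have QO: "Q \<in> Ob C" using Q by (simp add: is_product_def)
  have p: "p i \<in> Hom (simp_cat C) P (omap s (A i))" if "i \<in> I" for i using prod that by (simp add: is_product_def)
  have "prod_equiv I (omap cSh Q) (\<lambda>i. omap cSh (A i)) (\<lambda>i. amap cSh (p0 i))"
    using Sh Q I A unfolding is_sheaf_def Let_def by (simp add: is_product_def)
  then have "sset_weq (omap cSh Q) (sset_prod I (\<lambda>i. omap cSh (A i))) (\<lambda>n x. \<lambda>i\<in>I. mid (mid (amap cSh (p0 i)) n) x)"
    by (simp only: prod_equiv_def)
  moreover have "sset_prod I (\<lambda>i. omap cSh (A i)) = sset_prod I (\<lambda>i. const_fctr (op_cat delta) set_cat (omap Sh (A i)))"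
    using cSh_omap[OF A] unfolding sset_prod_def by (intro arg_cong2[of _ _ _ _ mk_sset] ext PiE_cong restrict_ext) (simp_all only:)
  \<comment> \<open>Both simplicial sets are discrete, so the sheaf condition yields a bijection of
    sets in degree 0.\<close>
  ultimately have b: "bij_betw (\<lambda>x. \<lambda>i\<in>I. mid (amap Sh (p0 i)) x) (omap Sh Q) (\<Pi>\<^sub>E i\<in>I. omap Sh (A i))"
    using discrete_sset_weq_bij[OF discrete_const discrete_sset_prod_const, of "omap Sh Q" I "\<lambda>i. omap Sh (A i)" _ 0]
      cSh_mid[OF p0] unfolding cSh_omap[OF QO]
    by (simp add: sset_prod_def mk_sset_simps(1) cong: restrict_cong)
  let ?c = "\<lambda>n x. \<lambda>i\<in>I. mid (mid (amap dSt (p i)) n) x"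
  note dp = functor_Hom[OF dSt p] and d\<theta> = functor_Hom[OF dSt \<theta>]
  have P: "is_sset (omap dSt P)" using sset_arr_map(3)[OF d\<theta>] .
  have Y: "is_sset (omap dSt (omap s (A i)))" if "i \<in> I" for i using sset_arr_map(3)[OF dp[OF that]] .
  have map: "sset_map (omap dSt P) (sset_prod I (\<lambda>i. omap dSt (omap s (A i)))) ?c"
    unfolding sset_map_def
  proof (intro conjI allI ballI)
    have pm: "sset_map (omap dSt P) (omap dSt (omap s (A i))) (\<lambda>n. mid (mid (amap dSt (p i)) n))" if "i \<in> I" for i
      by (rule sset_arr_map(1)[OF dp[OF that]])
    fix n x assume x: "x \<in> omap (omap dSt P) n"
    then show cx: "?c n x \<in> omap (sset_prod I (\<lambda>i. omap dSt (omap s (A i)))) n"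
      using pm by (auto simp: sset_prod_def mk_sset_simps(1) sset_map_def)
    fix m \<tau> assume t: "\<tau> \<in> Hom delta m n"
    have "act (sset_prod I (\<lambda>i. omap dSt (omap s (A i)))) \<tau> (?c n x) = (\<lambda>i\<in>I. act (omap dSt (omap s (A i))) \<tau> (?c n x i))"
      using cx unfolding sset_prod_def mk_sset_simps(1) by (rule mk_sset_simps(2)[OF t])
    also have "\<dots> = ?c m (act (omap dSt P) \<tau> x)"
      using pm t x by (auto simp: sset_map_def intro!: restrict_ext)
    finally show "?c m (act (omap dSt P) \<tau> x) = act (sset_prod I (\<lambda>i. omap dSt (omap s (A i)))) \<tau> (?c n x)" by simp
  qed
  have "bij_betw (?c n) (omap (omap dSt P) n) (omap (sset_prod I (\<lambda>i. omap dSt (omap s (A i)))) n)" for n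
  proof -
    let ?j = "\<lambda>A. mid (mid (j' (omap Sh A)) n)"
    have jb: "bij_betw (?j B) (omap Sh B) (omap (omap dSt (omap s B)) n)" if "B \<in> Ob C" for B
      using sset_iso_bij[OF j'_iso j'_Hom[OF that], of n] unfolding cSh_omap[OF that] by simp
    \<comment> \<open>A parametrization of degree \<open>n\<close> of \<open>omap dSt P\<close> by
      the set \<open>omap Sh Q\<close>.\<close>
    let ?a = "\<lambda>x. mid (mid (amap dSt \<theta>) n) (?j Q x)"
    have a: "bij_betw ?a (omap Sh Q) (omap (omap dSt P) n)"
      using bij_betw_trans[OF jb[OF QO] sset_iso_bij[OF functor_iso[OF cat dSt \<theta>_iso] d\<theta>, of n]] by (simp add: comp_def)
    \<comment> \<open>In these parameters the canonical map becomes the comparison map of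
      \<open>Sh\<close>, by naturality of \<open>j'\<close>.\<close>
    have ca: "?c n (?a x) = (\<lambda>i\<in>I. ?j (A i) ((\<lambda>i\<in>I. mid (amap Sh (p0 i)) x) i))" if x: "x \<in> omap Sh Q" for x
    proof (rule restrict_ext)
      fix i assume i: "i \<in> I"
      have xc: "x \<in> omap (omap cSh Q) n" using x cSh_omap[OF QO] by simp
      have jx: "?j Q x \<in> omap (omap dSt (omap s Q)) n" using jb[OF QO] x by (auto simp: bij_betw_def)
      have "mid (mid (amap dSt (p i)) n) (?a x) = mid (mid (amap dSt (p i) \<cdot>\<^bsub>sset_cat\<^esub> amap dSt \<theta>) n) (?j Q x)"
        by (rule sset_comp_mid[OF d\<theta> jx, symmetric])
      also have "\<dots> = mid (mid (amap dSt (amap s (p0 i))) n) (?j Q x)"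
        unfolding functor_comp[OF dSt \<theta> p[OF i], symmetric] p\<theta>[OF i] ..
      also have "\<dots> = mid (mid (amap dSt (amap s (p0 i)) \<cdot>\<^bsub>sset_cat\<^esub> j' (omap Sh Q)) n) x"
        by (rule sset_comp_mid[OF j'_Hom[OF QO] xc, symmetric])
      also have "\<dots> = mid (mid (j' (omap Sh (A i)) \<cdot>\<^bsub>sset_cat\<^esub> amap cSh (p0 i)) n) x"
        unfolding j'_nat[OF p0[OF i]] ..
      also have "\<dots> = ?j (A i) (mid (amap Sh (p0 i)) x)"
        unfolding sset_comp_mid[OF functor_Hom[OF cSh p0[OF i]] xc] cSh_mid[OF p0[OF i]] ..
      finally show "mid (mid (amap dSt (p i)) n) (?a x) = ?j (A i) ((\<lambda>i\<in>I. mid (amap Sh (p0 i)) x) i)" using i by simp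
    qed
    have "bij_betw ((\<lambda>y. \<lambda>i\<in>I. ?j (A i) (y i)) \<circ> (\<lambda>x. \<lambda>i\<in>I. mid (amap Sh (p0 i)) x)) (omap Sh Q) (\<Pi>\<^sub>E i\<in>I. omap (omap dSt (omap s (A i))) n)"
      by (rule bij_betw_trans[OF b bij_betw_PiE[OF jb[OF A]]])
    then have "bij_betw (?c n \<circ> ?a) (omap Sh Q) (\<Pi>\<^sub>E i\<in>I. omap (omap dSt (omap s (A i))) n)"
      using ca by (subst bij_betw_cong[of "omap Sh Q" "?c n \<circ> ?a"]) (simp_all add: comp_def)
    \<comment> \<open>The parametrization \<open>?a\<close> is a bijection and can be
      cancelled.\<close>
    then have "bij_betw (?c n) (omap (omap dSt P) n) (\<Pi>\<^sub>E i\<in>I. omap (omap dSt (omap s (A i))) n)"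
      using bij_betw_comp_iff[OF a, of "?c n"] by blast
    then show ?thesis by (simp add: sset_prod_def mk_sset_simps(1))
  qed
  then show ?thesis
    unfolding prod_equiv_def by (intro bij_sset_weq[OF P sset_prod_sset[OF Y] map])
qed

end

section \<open>Hypercoverings and descent\<close>

context frame_square
begin

text \<open>Identifies \<open>A\<close> with pi_0 of its frame, so that pi_0 undoes \<open>s\<close>
  up to natural isomorphism.\<close>

definition iota :: "'u calg \<Rightarrow> 'u calg_arr" where
  "iota A = (A, \<lambda>x\<in>carrier A. pi0_proj (omap s A) (mid (mid (j A) 0) x), pi0_alg (omap s A))"

lemma iota_mid: "x \<in> carrier A \<Longrightarrow> mid (iota A) x = pi0_proj (omap s A) (mid (mid (j A) 0) x)"
  by (simp add: iota_def)

lemma simp_calg_s: "A \<in> Ob C \<Longrightarrow> simp_calg k (omap s A)"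
  by (rule simp_calg.intro[OF s.G_Ob])

lemma iota_Hom:
  assumes A: "A \<in> Ob C"
  shows "iota A \<in> Hom C A (pi0_alg (omap s A))"
proof -
  interpret sA: simp_calg k "omap s A" by (rule simp_calg_s[OF A])
  have "Module.algebra k A" using A by simp
  then show ?thesis
    unfolding iota_def
    by (rule calg_arrI[OF _ sA.quot_alg_algebra calg_hom_comp[OF calg_mid(1)[OF s.j_n[OF A]] sA.q_hom]])
qed

text \<open>Every edge of a frame is degenerate, so its two ends agree. An edge that starts at zero
  then ends at zero, the boundaries vanish, and the projection to pi_0 is injective.\<close>

lemma iota_iso:
  assumes A: "A \<in> Ob C"
  shows "is_iso C (iota A)"
proof (rule calg_bij_iso[OF iota_Hom[OF A]])
  interpret sA: simp_calg k "omap s A" by (rule simp_calg_s[OF A])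
  have bij: "bij_betw (mid (mid (j A) 0)) (carrier A) (carrier (omap (omap s A) 0))"
    by (rule calg_iso_bij[OF s.j_level[OF A] s.j_n[OF A]])
  have dd: "sA.d i y = sA.d i' y" if y: "y \<in> carrier (omap (omap s A) (Suc 0))" for y i i'
  proof -
    obtain z where "z \<in> carrier (omap (omap s A) 0)" "y = act (underlying (omap s A)) (collapse (Suc 0)) z"
      using discrete_underlying[OF A] y unfolding discrete_sset_def by (metis sA.underlying_omap)
    then have z: "z \<in> carrier (omap (omap s A) 0)" "y = sA.s z" using sA.underlying_act[OF collapse_Hom] by simp_all
    then show ?thesis by (simp add: sA.d_s)
  qed
  have "inj_on (pi0_proj (omap s A)) (carrier (omap (omap s A) 0))"
  proof (rule inj_onI)
    fix x y assume x: "x \<in> carrier (omap (omap s A) 0)" and y: "y \<in> carrier (omap (omap s A) 0)" and eq: "sA.q x = sA.q y"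
    then have "x \<ominus>\<^bsub>omap (omap s A) 0\<^esub> y \<in> boundaries (omap s A) 0" using sA.q_eq by simp
    then have "x \<ominus>\<^bsub>omap (omap s A) 0\<^esub> y = \<zero>\<^bsub>omap (omap s A) 0\<^esub>"
      unfolding sA.boundaries_eq using dd[of _ 0 "Suc 0"] by auto
    moreover have "x = (x \<ominus>\<^bsub>omap (omap s A) 0\<^esub> y) \<oplus>\<^bsub>omap (omap s A) 0\<^esub> y"
      using x y by (simp add: a_minus_def sA.A0.M.a_assoc sA.A0.M.l_neg)
    ultimately show "x = y" using y by simp
  qed
  then have "bij_betw (pi0_proj (omap s A)) (carrier (omap (omap s A) 0)) (carrier (pi0_alg (omap s A)))"
    by (simp add: bij_betw_def)
  from bij_betw_trans[OF bij this] show "bij_betw (mid (iota A)) (carrier A) (carrier (pi0_alg (omap s A)))"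
    by (subst bij_betw_cong[where g = "pi0_proj (omap s A) \<circ> mid (mid (j A) 0)"]) (simp_all add: iota_mid)
qed

lemma iota_nat:
  assumes f: "f \<in> Hom C A B"
  shows "iota B \<cdot>\<^bsub>C\<^esub> f = amap (pi0_fctr k) (amap s f) \<cdot>\<^bsub>C\<^esub> iota A"
proof -
  have A: "A \<in> Ob C" and B: "B \<in> Ob C" using Hom_Ob[OF C f] by auto
  note sf = functor_Hom[OF s.G f]
  note pf = pi0_fctr_amap[OF sf]
  show ?thesis
  proof (rule calg_arr_eqI[OF Comp_Hom[OF C f iota_Hom[OF B]] Comp_Hom[OF C iota_Hom[OF A] pf(1)]])
    fix x assume x: "x \<in> carrier A"
    have fx: "mid f x \<in> carrier B" by (rule calg_mid(2)[OF f x])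
    have "mid (j B \<cdot>\<^bsub>simp_cat C\<^esub> amap (cs C) f) 0 = mid (amap s f \<cdot>\<^bsub>simp_cat C\<^esub> j A) 0" unfolding s.j_nat[OF f] ..
    then have "mid (j B) 0 \<cdot>\<^bsub>C\<^esub> f = mid (amap s f) 0 \<cdot>\<^bsub>C\<^esub> mid (j A) 0" by (simp add: cs_amap[OF f])
    then have "mid (mid (j B) 0) (mid f x) = mid (mid (amap s f) 0) (mid (mid (j A) 0) x)"
      using calg_comp_mid[OF f x, of "mid (j B) 0"] calg_comp_mid[OF s.j_n[OF A] x, of "mid (amap s f) 0"] by simp
    then show "mid (iota B \<cdot>\<^bsub>C\<^esub> f) x = mid (amap (pi0_fctr k) (amap s f) \<cdot>\<^bsub>C\<^esub> iota A) x"
      unfolding calg_comp_mid[OF f x] calg_comp_mid[OF iota_Hom[OF A] x] iota_mid[OF x] iota_mid[OF fx]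
        pf(2)[OF calg_mid(2)[OF s.j_n[OF A] x]] by simp
  qed
qed

text \<open>Applies \<open>hypercovering_U\<close>. Since pi_0 of the frames gives back the original
  algebras only up to isomorphism, the inverses of the maps \<open>iota\<close> serve as its
  \<open>\<alpha>\<close> and \<open>\<beta>\<close>.\<close>

lemma etale_hypercovering_descends:
  assumes A: "A \<in> Ob C" and B: "is_functor delta C B"
    and u0: "nat_trans delta C (const_fctr delta C A) B u0"
    and hyp: "etale_hypercovering_daff k (omap s A) (fctr_comp delta s B) (\<lambda>n. amap s (u0 n))"
  shows "etale_hypercovering_aff k A B u0"
proof -
  interpret hra: homotopy_right_adjoint "dkAff k" "kAff k" "pi0_fctr k" "cs C" "pi0_unit k"
    by (rule pi0_right_adjoint)
  have BO: "omap B n \<in> Ob C" for n using functor_Ob[OF B, of n] by simp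
  have u0H: "u0 n \<in> Hom C A (omap B n)" for n using nat_trans_Hom[OF u0, of n] by simp
  \<comment> \<open>Functors record only values, and \<open>delta\<close> and its opposite have the
    same objects and arrows.\<close>
  have const: "const_fctr (op_cat delta) (kAff k) A = const_fctr delta C A" by (simp add: const_fctr_def)
  have comp: "fctr_comp (op_cat delta) G F = fctr_comp delta G F" for G F by (simp add: fctr_comp_def)
  have LsB: "is_functor delta C (fctr_comp delta (pi0_fctr k) (fctr_comp delta s B))"
    using fctr_comp_is_functor[OF is_category_delta fctr_comp_is_functor[OF is_category_delta B s.G]
        pi0_fctr_is_functor[unfolded is_functor_skCAlg_dom]] .
  have om: "omap (fctr_comp delta (pi0_fctr k) (fctr_comp delta s B)) n = pi0_alg (omap s (omap B n))" for n
    using pi0_fctr_omap[OF simp_calg_s[OF BO]] by simp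
  have iota_nt: "nat_trans delta C B (fctr_comp delta (pi0_fctr k) (fctr_comp delta s B)) (\<lambda>n. iota (omap B n))"
    unfolding nat_trans_def
  proof (intro conjI ballI allI)
    fix n show "iota (omap B n) \<in> Hom C (omap B n) (omap (fctr_comp delta (pi0_fctr k) (fctr_comp delta s B)) n)"
      unfolding om by (rule iota_Hom[OF BO])
  next
    fix a b \<theta> assume t: "\<theta> \<in> Hom delta a b"
    show "iota (omap B b) \<cdot>\<^bsub>C\<^esub> amap B \<theta> = amap (fctr_comp delta (pi0_fctr k) (fctr_comp delta s B)) \<theta> \<cdot>\<^bsub>C\<^esub> iota (omap B a)"
      using iota_nat[OF functor_Hom[OF B t]] HomD(1)[OF t] by simp
  qed
  \<comment> \<open>In the opposite category the comparison has to run from \<open>B\<close> to pi_0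
    of its frames; as a map of algebras it is therefore the inverse of \<open>iota\<close>.\<close>
  have \<alpha>: "nat_trans delta C (fctr_comp delta (pi0_fctr k) (fctr_comp delta s B)) B (\<lambda>n. inv_arr C (iota (omap B n)))"
    by (rule nat_trans_inv[OF C is_category_delta B LsB iota_nt iota_iso[OF BO]])
  note iA = inv_arr[OF iota_iso[OF A] iota_Hom[OF A]]
  have S: "amap (pi0_fctr k) h \<in> {e. etale_covering_aff k (fst e) {()} (\<lambda>_. e)}"
    if h: "h \<in> {e. etale_covering_daff k (fst e) {()} (\<lambda>_. e)}" "h \<in> Arr (dkAff k)" for h
  proof -
    have hH: "h \<in> Hom (simp_cat C) (fst h) (snd (snd h))"
      using h(2) Arr_Hom[of h "simp_cat C"] by simp
    have "fst (amap (pi0_fctr k) h) = pi0_alg (fst h)" using pi0_fctr_amap(1)[OF hH] by (auto simp: Hom_calg)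
    then show ?thesis using etale_covering_pi0[OF hH] h(1) by simp
  qed
  show ?thesis
    unfolding etale_hypercovering_aff_def
  proof (rule hra.hypercovering_U[OF hyp[unfolded etale_hypercovering_daff_def] S])
    show "B \<in> Ob (simp_cat (kAff k))" using B by (simp add: is_functor_delta_op_model)
    show "A \<in> Ob (kAff k)" using A by simp
    show "nat_trans (op_cat delta) (kAff k) B (const_fctr (op_cat delta) (kAff k) A) u0"
      unfolding nat_trans_op_model const using u0 by simp
    show "nat_trans (op_cat delta) (kAff k) B (fctr_comp (op_cat delta) (pi0_fctr k) (fctr_comp delta s B)) (\<lambda>n. inv_arr C (iota (omap B n)))"
      unfolding nat_trans_op_model comp using \<alpha> by simp
    show "is_iso (kAff k) (inv_arr C (iota (omap B n)))" for n
      unfolding is_iso_op_model using inv_arr_iso[OF iota_iso[OF BO] iota_Hom[OF BO]] by simp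
    show "inv_arr C (iota A) \<in> Hom (kAff k) A (omap (pi0_fctr k) (omap s A))"
      using iA(1) by (simp add: pi0_fctr_omap[OF simp_calg_s[OF A]])
    show "is_iso (kAff k) (inv_arr C (iota A))"
      unfolding is_iso_op_model using inv_arr_iso[OF iota_iso[OF A] iota_Hom[OF A]] by simp
    fix n
    note iB = inv_arr[OF iota_iso[OF BO] iota_Hom[OF BO], of n]
    note Lu = pi0_fctr_amap(1)[OF functor_Hom[OF s.G u0H[of n]]]
    have "u0 n \<cdot>\<^bsub>C\<^esub> inv_arr C (iota A) = inv_arr C (iota (omap B n)) \<cdot>\<^bsub>C\<^esub> amap (pi0_fctr k) (amap s (u0 n))"
    proof (rule iso_cancel_left[OF C iota_iso[OF BO] iota_Hom[OF BO] Comp_Hom[OF C iA(1) u0H] Comp_Hom[OF C Lu iB(1)]])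
      show "iota (omap B n) \<cdot>\<^bsub>C\<^esub> (u0 n \<cdot>\<^bsub>C\<^esub> inv_arr C (iota A))
          = iota (omap B n) \<cdot>\<^bsub>C\<^esub> (inv_arr C (iota (omap B n)) \<cdot>\<^bsub>C\<^esub> amap (pi0_fctr k) (amap s (u0 n)))"
        unfolding Comp_assoc[OF C iA(1) u0H iota_Hom[OF BO]] iota_nat[OF u0H]
          Comp_assoc[OF C iA(1) iota_Hom[OF A] Lu, symmetric] iA(3) Comp_assoc[OF C Lu iB(1) iota_Hom[OF BO]] iB(3)
        by (simp only: Comp_Ident[OF C Lu])
    qed
    then show "inv_arr C (iota A) \<cdot>\<^bsub>kAff k\<^esub> u0 n = amap (pi0_fctr k) (amap s (u0 n)) \<cdot>\<^bsub>kAff k\<^esub> inv_arr C (iota (omap B n))"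
      by simp
  qed
qed

text \<open>Since \<open>s\<close> is full, each component of \<open>u\<close> comes from an algebra
  map, and faithfulness makes these maps natural. Descent for \<open>Sh\<close> along the resulting
  hypercovering is then moved to \<open>dSt\<close> by the natural isomorphism
  \<open>j'\<close>.\<close>

lemma dSt_descent:
  assumes A: "A \<in> Ob C" and B: "is_functor delta C B"
    and u: "nat_trans delta (simp_cat C) (const_fctr delta (simp_cat C) (omap s A)) (fctr_comp delta s B) u"
    and hyp: "etale_hypercovering_daff k (omap s A) (fctr_comp delta s B) u"
  shows "holim_equiv delta (omap dSt (omap s A)) (fctr_comp delta dSt (fctr_comp delta s B)) (\<lambda>n. amap dSt (u n))"
proof -
  note cat = simp_cat_category[OF C]
  let ?sB = "fctr_comp delta s B" and ?Y2 = "fctr_comp delta dSt (fctr_comp delta s B)"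
  have BO: "omap B n \<in> Ob C" for n using functor_Ob[OF B, of n] by simp
  have uH: "u n \<in> Hom (simp_cat C) (omap s A) (omap s (omap B n))" for n
    using nat_trans_Hom[OF u, of n] by simp
  have "\<exists>f0. f0 \<in> Hom C A (omap B n) \<and> amap s f0 = u n" for n
    using s.G_full[OF A BO uH] by blast
  then obtain u0 where u0: "\<And>n. u0 n \<in> Hom C A (omap B n)" "\<And>n. amap s (u0 n) = u n" by metis
  have u_eq: "u = (\<lambda>n. amap s (u0 n))" using u0(2) by auto
  have sA: "omap s A \<in> Ob (simp_cat C)" by (rule functor_Ob[OF s.G A])
  have nt: "nat_trans delta C (const_fctr delta C A) B u0"
    unfolding nat_trans_def
  proof (intro conjI ballI allI)
    fix n show "u0 n \<in> Hom C (omap (const_fctr delta C A) n) (omap B n)" using u0(1) by simp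
  next
    fix a b \<theta> assume t: "\<theta> \<in> Hom delta a b"
    have "u b \<cdot>\<^bsub>simp_cat C\<^esub> Ident (simp_cat C) (omap s A) = amap s (amap B \<theta>) \<cdot>\<^bsub>simp_cat C\<^esub> u a"
      using nat_trans_eq[OF u t] HomD(1)[OF t] by (simp del: fun_cat_simps)
    then have "amap s (u0 b) = amap s (amap B \<theta> \<cdot>\<^bsub>C\<^esub> u0 a)"
      unfolding Comp_Ident(1)[OF cat uH] functor_comp[OF s.G u0(1) functor_Hom[OF B t]] u0(2) .
    then have "u0 b = amap B \<theta> \<cdot>\<^bsub>C\<^esub> u0 a"
      by (rule s.G_faithful[OF u0(1) Comp_Hom[OF C u0(1) functor_Hom[OF B t]]])
    then show "u0 b \<cdot>\<^bsub>C\<^esub> amap (const_fctr delta C A) \<theta> = amap B \<theta> \<cdot>\<^bsub>C\<^esub> u0 a"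
      unfolding const_fctr_amap[OF HomD(1)[OF t]] Comp_Ident(1)[OF C u0(1)] .
  qed
  have "etale_hypercovering_aff k A B u0"
    by (rule etale_hypercovering_descends[OF A B nt hyp[unfolded u_eq]])
  moreover have "nat_trans delta (kCAlg k) (const_fctr delta (kCAlg k) A) B u0" "is_functor delta (kCAlg k) B" "A \<in> Ob (kCAlg k)"
    using nt B A by simp_all
  ultimately have hol: "holim_equiv delta (omap cSh A) (fctr_comp delta cSh B) (\<lambda>n. amap cSh (u0 n))"
    using Sh unfolding is_sheaf_def Let_def fctr_comp_trivial by blast
  have sB: "is_functor delta (simp_cat C) ?sB" by (rule fctr_comp_is_functor[OF is_category_delta B s.G])
  have Y2: "is_functor delta sset_cat ?Y2" by (rule fctr_comp_is_functor[OF is_category_delta sB dSt])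
  have Y: "is_functor delta sset_cat (fctr_comp delta cSh B)" by (rule fctr_comp_is_functor[OF is_category_delta B cSh])
  have jn: "nat_trans delta sset_cat (fctr_comp delta cSh B) ?Y2 (\<lambda>n. j' (omap Sh (omap B n)))"
    unfolding nat_trans_def
  proof (intro conjI ballI allI)
    fix n show "j' (omap Sh (omap B n)) \<in> Hom sset_cat (omap (fctr_comp delta cSh B) n) (omap ?Y2 n)"
      using j'_Hom[OF BO] by (simp only: fctr_comp_omap delta_simps UNIV_I)
  next
    fix a b \<theta> assume t: "\<theta> \<in> Hom delta a b"
    show "j' (omap Sh (omap B b)) \<cdot>\<^bsub>sset_cat\<^esub> amap (fctr_comp delta cSh B) \<theta> = amap ?Y2 \<theta> \<cdot>\<^bsub>sset_cat\<^esub> j' (omap Sh (omap B a))"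
      using j'_nat[OF functor_Hom[OF B t]] HomD(1)[OF t] by (simp only: fctr_comp_amap)
  qed
  \<comment> \<open>\<open>holim_equiv_iso\<close> expects the comparison to run towards the diagram
    whose descent is known, hence the inverses of \<open>j'\<close>.\<close>
  have \<kappa>: "nat_trans delta sset_cat ?Y2 (fctr_comp delta cSh B) (\<lambda>n. inv_arr sset_cat (j' (omap Sh (omap B n))))"
    by (rule nat_trans_inv[OF S is_category_delta Y Y2 jn j'_iso])
  have cone: "is_cone delta sset_cat ?Y2 (omap dSt (omap s A)) (\<lambda>n. amap dSt (u n))"
    unfolding is_cone_def
    using functor_Ob[OF dSt sA]
      nat_trans_whisker[OF is_category_delta const_fctr_is_functor[OF is_category_delta cat sA] sB dSt u]
    unfolding fctr_comp_const[OF is_category_delta dSt sA] by blast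
  note jA = inv_arr[OF j'_iso j'_Hom[OF A]]
  show ?thesis
  proof (rule holim_equiv_iso[OF is_category_delta hol Y Y2 cone \<kappa> _ jA(1) inv_arr_iso[OF j'_iso j'_Hom[OF A]]])
    fix n
    show "is_iso sset_cat (inv_arr sset_cat (j' (omap Sh (omap B n))))" by (rule inv_arr_iso[OF j'_iso j'_Hom[OF BO]])
    note jB = inv_arr[OF j'_iso j'_Hom[OF BO], of n]
    note du = functor_Hom[OF dSt uH[of n]] and cu = functor_Hom[OF cSh u0(1)[of n]]
    show "inv_arr sset_cat (j' (omap Sh (omap B n))) \<cdot>\<^bsub>sset_cat\<^esub> amap dSt (u n) = amap cSh (u0 n) \<cdot>\<^bsub>sset_cat\<^esub> inv_arr sset_cat (j' (omap Sh A))"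
    proof (rule iso_cancel_left[OF S j'_iso j'_Hom[OF BO] Comp_Hom[OF S du jB(1)] Comp_Hom[OF S jA(1) cu]])
      show "j' (omap Sh (omap B n)) \<cdot>\<^bsub>sset_cat\<^esub> (inv_arr sset_cat (j' (omap Sh (omap B n))) \<cdot>\<^bsub>sset_cat\<^esub> amap dSt (u n))
          = j' (omap Sh (omap B n)) \<cdot>\<^bsub>sset_cat\<^esub> (amap cSh (u0 n) \<cdot>\<^bsub>sset_cat\<^esub> inv_arr sset_cat (j' (omap Sh A)))"
        unfolding Comp_assoc[OF S du jB(1) j'_Hom[OF BO]] jB(3) Comp_assoc[OF S jA(1) cu j'_Hom[OF BO]] j'_nat[OF u0(1)] u0(2)
          Comp_assoc[OF S jA(1) j'_Hom[OF A] du, symmetric] jA(3)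
        by (simp only: Comp_Ident[OF S du])
    qed
  qed
qed

end

theorem theorem3p1:
  fixes k :: "'u::infinite ring"
    and Sh :: "('u calg, 'u calg_arr, 'v::infinite set, 'v set_arr) fctr"
    and s :: "('u calg, 'u calg_arr, 'u scalg, 'u scalg_arr) fctr"
    and j :: "'u calg \<Rightarrow> 'u scalg_arr"
    and s' :: "('v set, 'v set_arr, 'v sset, 'v sset_arr) fctr"
    and j' :: "'v set \<Rightarrow> 'v sset_arr"
    and dSt :: "('u scalg, 'u scalg_arr, 'v sset, 'v sset_arr) fctr"
  assumes "cring k"
    and "is_sheaf k Sh"
    and "functorial_simplicial_frame (kCAlg k) s j"
    and "preserves_finite_limits (kCAlg k) (skCAlg k) s"
    and "functorial_simplicial_frame set_model s' j'"
    and "preserves_finite_limits set_model sset_cat s'"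
    and "is_functor (skCAlg k) sset_cat dSt"
    and "fctr_comp (kCAlg k) dSt s = fctr_comp (kCAlg k) s' Sh"
  shows
    "(\<forall>A\<in>Ob (kCAlg k). \<forall>B\<in>Ob (kCAlg k). \<forall>f\<in>Hom (skCAlg k) (omap s A) (omap s B).
        f \<in> Weq (skCAlg k) \<longrightarrow> amap dSt f \<in> sset_equivs) \<and>
     (\<forall>A\<in>Ob (kCAlg k). \<forall>B u.
        is_functor delta (kCAlg k) B \<and>
        nat_trans delta (skCAlg k) (const_fctr delta (skCAlg k) (omap s A)) (fctr_comp delta s B) u \<and>
        etale_hypercovering_daff k (omap s A) (fctr_comp delta s B) u \<longrightarrow>
        holim_equiv delta (omap dSt (omap s A)) (fctr_comp delta dSt (fctr_comp delta s B)) (\<lambda>n. amap dSt (u n))) \<and>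
     (\<forall>(I :: nat set) A P p.
        finite I \<and> (\<forall>i\<in>I. A i \<in> Ob (kCAlg k)) \<and> is_product (skCAlg k) I (\<lambda>i. omap s (A i)) P p \<longrightarrow>
        prod_equiv I (omap dSt P) (\<lambda>i. omap dSt (omap s (A i))) (\<lambda>i. amap dSt (p i)))"
proof -
  interpret frame_square k s j s' j' Sh dSt
  proof (intro frame_square.intro frame.intro frame_square_axioms.intro)
    show "is_category (calg_cat k)" "is_category set_cat" by (rule is_category_calg is_category_set_cat)+
    show "functorial_simplicial_frame (kCAlg k) s j" "is_sheaf k Sh" by fact+
    show "functorial_simplicial_frame (trivial_model set_cat) s' j'" using assms(5) by (simp only: set_model_def)
    show "is_functor (simp_cat (calg_cat k)) sset_cat dSt" using assms(7) by (simp only: is_functor_skCAlg_dom)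
    show "fctr_comp (calg_cat k) dSt s = fctr_comp (calg_cat k) s' Sh" using assms(8) by (simp only: fctr_comp_trivial)
  qed
  \<comment> \<open>\<open>is_product\<close> sees only objects, arrows and composition, which
    \<open>skCAlg k\<close> shares with the category it extends.\<close>
  have prod: "is_product (simp_cat C) I X P p" if "is_product (skCAlg k) I X P p" for I :: "nat set" and X P p
    using that unfolding is_product_def Hom_skCAlg skCAlg_simps(6) by (simp del: fun_cat_simps(5))
  show ?thesis
  proof (intro conjI ballI allI impI)
    fix A B f assume "A \<in> Ob (kCAlg k)" "B \<in> Ob (kCAlg k)" "f \<in> Hom (skCAlg k) (omap s A) (omap s B)" "f \<in> Weq (skCAlg k)"
    then show "amap dSt f \<in> sset_equivs"
      by (intro dSt_equivalence) (simp_all only: trivial_model_simps Hom_skCAlg skCAlg_simps(7))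
  next
    fix A B u assume "A \<in> Ob (kCAlg k)"
      and "is_functor delta (kCAlg k) B \<and>
        nat_trans delta (skCAlg k) (const_fctr delta (skCAlg k) (omap s A)) (fctr_comp delta s B) u \<and>
        etale_hypercovering_daff k (omap s A) (fctr_comp delta s B) u"
    then show "holim_equiv delta (omap dSt (omap s A)) (fctr_comp delta dSt (fctr_comp delta s B)) (\<lambda>n. amap dSt (u n))"
      by (intro dSt_descent) (simp_all only: trivial_model_simps is_functor_trivial_cod nat_trans_skCAlg const_fctr_skCAlg)
  next
    fix I :: "nat set" and A P p
    assume *: "finite I \<and> (\<forall>i\<in>I. A i \<in> Ob (kCAlg k)) \<and> is_product (skCAlg k) I (\<lambda>i. omap s (A i)) P p"
    show "prod_equiv I (omap dSt P) (\<lambda>i. omap dSt (omap s (A i))) (\<lambda>i. amap dSt (p i))"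
      by (rule dSt_product) (use * prod in simp_all)
  qed
qed

end
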